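(* Consider the equation (CR): $-i\partial_tg=\mathcal{T}(g,g,g)$, $g=g(t,\xi)$, $\xi\in\mathbb{R}^2$. (1) (CR) is locally well-posed in $\dot X^1(\mathbb{R}^2)$, and globally well-posed in $L^2(\mathbb{R}^2)$. (2) (CR) is globally well-posed in $H^s(\mathbb{R}^2)$ and in $L^{2,s}(\mathbb{R}^2)$ for any $s\ge0$. (3) (CR) is globally well-posed in $X^\sigma(\mathbb{R}^2)$ for any $\sigma>2$. Moreover, if $\nabla g(0)\in X^\sigma$ (in addition to $g(0)\in X^\sigma$), then $g,\nabla g\in C_{\mathrm{loc}}(\mathbb{R};X^\sigma)$.
   Context: Here $$\mathcal{T}(f,g,h)(\xi)=\int_{-1}^1\int_{\mathbb{R}^2}f(\xi+x)\,\overline{g(\xi+x+\lambda x^\perp)}\,h(\xi+\lambda x^\perp)\,dx\,d\lambda,$$ with $x^\perp$ the rotation of $x$ by $+\pi/2$. Write $\langle x\rangle=\sqrt{1+|x|^2}$. Spaces on $\mathbb{R}^2$: $\dot X^1$ has norm $\||x|f\|_{L^\infty}$; $X^\sigma$ has norm $\|\langle x\rangle^\sigma f\|_{L^\infty}$; $L^{2,s}$ has norm $\|\langle x\rangle^sf\|_{L^2}$; $H^s$ is the usual Sobolev space. Locally well-posed in $X$: for any $f_0\in X$ there is $T>0$ and a solution in $C^\infty([0,T],X)$ with initial data $f_0$ (i.e. $f(t)=f_0+i\int_0^t\mathcal{T}(f,f,f)(s)\,ds$), unique in $L^\infty([0,T],X)$ and depending continuously on $f_0$ in this topology. Globally well-posed: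 the same with every $T>0$ (and likewise for negative times, the equation being time-reversible). *)

theory Defs
  imports "HOL-Probability.Essential_Supremum"
begin

type_synonym plane_fun = "real^2 \<Rightarrow> complex"

section \<open>The trilinear operator\<close>

definition rot :: "real^2 \<Rightarrow> real^2" where
  "rot x = vector [- (x $ 2), x $ 1]"

definition CR_op :: "plane_fun \<Rightarrow> plane_fun \<Rightarrow> plane_fun \<Rightarrow> plane_fun" where
  "CR_op f g h \<xi> =
     (LINT l:{-1..1::real}|lborel. LINT x|lborel.
        f (\<xi> + x) * cnj (g (\<xi> + x + l *\<^sub>R rot x)) * h (\<xi> + l *\<^sub>R rot x))"


section \<open>Function spaces\<close>

text \<open>
  A space of functions on the plane is given by an extended (semi)norm. Its elements are represented
  by Borel functions (every Lebesgue measurable function has a Borel representative), and two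
  elements are identified when they agree almost everywhere.
\<close>

type_synonym plane_norm = "plane_fun \<Rightarrow> ennreal"

definition fun_space :: "plane_norm \<Rightarrow> plane_fun set" where
  "fun_space N = {f \<in> borel_measurable borel. N f < \<infinity>}"

definition fun_dist :: "plane_norm \<Rightarrow> plane_fun \<Rightarrow> plane_fun \<Rightarrow> ennreal" where
  "fun_dist N f g = N (\<lambda>x. f x - g x)"

definition jbr :: "real^2 \<Rightarrow> real" where
  "jbr x = sqrt (1 + (norm x)\<^sup>2)"

definition L2_norm :: plane_norm where
  "L2_norm f =
     (let I = (\<integral>\<^sup>+ x. ennreal ((cmod (f x))\<^sup>2) \<partial>lborel)
      in if I = \<infinity> then \<infinity> else ennreal (sqrt (enn2real I)))"

definition Linf_norm :: plane_norm where
  "Linf_norm f = esssup lborel (\<lambda>x. ennreal (cmod (f x)))"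

definition Xdot1_norm :: plane_norm where
  "Xdot1_norm f = Linf_norm (\<lambda>x. norm x *\<^sub>R f x)"

definition X_norm :: "real \<Rightarrow> plane_norm" where
  "X_norm \<sigma> f = Linf_norm (\<lambda>x. (jbr x powr \<sigma>) *\<^sub>R f x)"

definition L2w_norm :: "real \<Rightarrow> plane_norm" where
  "L2w_norm s f = L2_norm (\<lambda>x. (jbr x powr s) *\<^sub>R f x)"

text \<open>
  The Fourier transform on \<open>L\<^sup>2\<close>, with the unitary normalisation, is the \<open>L\<^sup>2\<close> limit of the
  transforms of the truncations of the function to balls. It is a relation here because the
  transform is determined only up to null sets.
\<close>

definition is_L2_fourier :: "plane_fun \<Rightarrow> plane_fun \<Rightarrow> bool" where
  "is_L2_fourier f F \<longleftrightarrow>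
     f \<in> fun_space L2_norm \<and> F \<in> fun_space L2_norm \<and>
     (\<lambda>n. fun_dist L2_norm
            (\<lambda>\<xi>. (LINT x:cball 0 (real n)|lborel. cis (- (x \<bullet> \<xi>)) * f x) / of_real (2 * pi)) F)
       \<longlonglongrightarrow> 0"

text \<open>
  All transforms \<open>F\<close> of \<open>f\<close> give the same value below, and the infimum over the empty set is
  \<open>\<infinity>\<close>, so that functions outside \<open>L\<^sup>2\<close> have infinite norm.
\<close>

definition H_norm :: "real \<Rightarrow> plane_norm" where
  "H_norm s f = (INF F\<in>{F. is_L2_fourier f F}. L2w_norm s F)"


section \<open>Curves with values in a function space\<close>

definition cont_curve :: "plane_norm \<Rightarrow> real set \<Rightarrow> (real \<Rightarrow> plane_fun) \<Rightarrow> bool" where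
  "cont_curve N J u \<longleftrightarrow>
     (\<forall>t\<in>J. u t \<in> fun_space N \<and> ((\<lambda>s. fun_dist N (u s) (u t)) \<longlongrightarrow> 0) (at t within J))"

definition deriv_curve ::
    "plane_norm \<Rightarrow> real set \<Rightarrow> (real \<Rightarrow> plane_fun) \<Rightarrow> (real \<Rightarrow> plane_fun) \<Rightarrow> bool" where
  "deriv_curve N J u v \<longleftrightarrow>
     (\<forall>t\<in>J. ((\<lambda>s. fun_dist N (\<lambda>x. (u s x - u t x) /\<^sub>R (s - t)) (v t)) \<longlongrightarrow> 0) (at t within J))"

text \<open>Membership in \<open>C\<^sup>\<infinity>(J, X)\<close>; \<open>D k\<close> is the \<open>k\<close>-th time derivative of \<open>u\<close>.\<close>

definition smooth_curve :: "plane_norm \<Rightarrow> real set \<Rightarrow> (real \<Rightarrow> plane_fun) \<Rightarrow> bool" where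
  "smooth_curve N J u \<longleftrightarrow>
     (\<exists>D :: nat \<Rightarrow> real \<Rightarrow> plane_fun. D 0 = u \<and>
        (\<forall>k. cont_curve N J (D k) \<and> deriv_curve N J (D k) (D (Suc k))))"

text \<open>
  Bochner measurability and integrability. The spaces at hand are families of subspaces of one
  function type, some of them nonseparable, so the integral of the library, which needs a
  second countable type, does not apply. The definitions follow it with its norm replaced by \<open>N\<close>.
\<close>

definition simple_curve :: "plane_norm \<Rightarrow> real measure \<Rightarrow> (real \<Rightarrow> plane_fun) \<Rightarrow> bool" where
  "simple_curve N M s \<longleftrightarrow> simple_function M s \<and> (\<forall>t\<in>space M. s t \<in> fun_space N)"

definition approx_curve ::
    "plane_norm \<Rightarrow> real measure \<Rightarrow> (nat \<Rightarrow> real \<Rightarrow> plane_fun) \<Rightarrow> (real \<Rightarrow> plane_fun) \<Rightarrow> bool" where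
  "approx_curve N M s u \<longleftrightarrow>
     (\<forall>n. simple_curve N M (s n)) \<and>
     (AE t in M. (\<lambda>n. fun_dist N (u t) (s n t)) \<longlonglongrightarrow> 0)"

text \<open>Membership in \<open>L\<^sup>\<infinity>(J, X)\<close>.\<close>

definition Linf_curve :: "plane_norm \<Rightarrow> real set \<Rightarrow> (real \<Rightarrow> plane_fun) \<Rightarrow> bool" where
  "Linf_curve N J u \<longleftrightarrow>
     (AE t in restrict_space lborel J. u t \<in> fun_space N) \<and>
     (\<exists>s. approx_curve N (restrict_space lborel J) s u) \<and>
     (\<exists>C::real. AE t in restrict_space lborel J. N (u t) \<le> ennreal C)"

text \<open>
  To be used with finite measures \<open>M\<close> only. The values of a simple curve are plane functions, so its
  integral is taken pointwise in \<open>x\<close>.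
\<close>

definition has_curve_integral ::
    "plane_norm \<Rightarrow> real measure \<Rightarrow> (real \<Rightarrow> plane_fun) \<Rightarrow> plane_fun \<Rightarrow> bool" where
  "has_curve_integral N M u I \<longleftrightarrow>
     (AE t in M. u t \<in> fun_space N) \<and> I \<in> fun_space N \<and>
     (\<exists>s. approx_curve N M s u \<and>
        (\<lambda>n. \<integral>\<^sup>+ t. fun_dist N (u t) (s n t) \<partial>M) \<longlonglongrightarrow> 0 \<and>
        (\<lambda>n. fun_dist N (\<lambda>x. LINT t|M. s n t x) I) \<longlonglongrightarrow> 0)"


section \<open>The equation and well-posedness\<close>

text \<open>
  The equation \<open>u(t) = f\<^sub>0 + \<i> \<integral>\<^sub>0\<^sup>t T(u,u,u)(s) ds\<close> at time \<open>t\<close>, with the integral taken in the space;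
  \<open>sgn t\<close> accounts for the orientation when \<open>t\<close> is negative.
\<close>

definition CR_eq_at :: "plane_norm \<Rightarrow> plane_fun \<Rightarrow> (real \<Rightarrow> plane_fun) \<Rightarrow> real \<Rightarrow> bool" where
  "CR_eq_at N f0 u t \<longleftrightarrow>
     (\<exists>I. has_curve_integral N (restrict_space lborel {min 0 t..max 0 t})
            (\<lambda>s. CR_op (u s) (u s) (u s)) I \<and>
          (AE \<xi> in lborel. u t \<xi> = f0 \<xi> + \<i> * (of_real (sgn t) * I \<xi>)))"

definition CR_solution :: "plane_norm \<Rightarrow> real set \<Rightarrow> plane_fun \<Rightarrow> (real \<Rightarrow> plane_fun) \<Rightarrow> bool" where
  "CR_solution N J f0 u \<longleftrightarrow> smooth_curve N J u \<and> (\<forall>t\<in>J. CR_eq_at N f0 u t)"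

definition CR_Linf_solution ::
    "plane_norm \<Rightarrow> real set \<Rightarrow> plane_fun \<Rightarrow> (real \<Rightarrow> plane_fun) \<Rightarrow> bool" where
  "CR_Linf_solution N J f0 u \<longleftrightarrow>
     Linf_curve N J u \<and> (AE t in restrict_space lborel J. CR_eq_at N f0 u t)"

text \<open>
  Existence, uniqueness and continuous dependence on the time interval \<open>J\<close> for data in \<open>U\<close>;
  \<open>S\<close> is the solution map, continuous from \<open>U\<close> to \<open>L\<^sup>\<infinity>(J, X)\<close>.
\<close>

definition CR_well_posed_on :: "plane_norm \<Rightarrow> real set \<Rightarrow> plane_fun set \<Rightarrow> bool" where
  "CR_well_posed_on N J U \<longleftrightarrow>
     (\<exists>S :: plane_fun \<Rightarrow> real \<Rightarrow> plane_fun.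
        (\<forall>f0\<in>U. CR_solution N J f0 (S f0)) \<and>
        (\<forall>f0\<in>U. \<forall>v. CR_Linf_solution N J f0 v \<longrightarrow>
            (AE t in restrict_space lborel J. AE \<xi> in lborel. v t \<xi> = S f0 t \<xi>)) \<and>
        (\<forall>f0\<in>U. \<forall>\<epsilon>::real. 0 < \<epsilon> \<longrightarrow> (\<exists>\<delta>::real. 0 < \<delta> \<and>
            (\<forall>g0\<in>U. fun_dist N g0 f0 < ennreal \<delta> \<longrightarrow>
                (\<forall>t\<in>J. fun_dist N (S g0 t) (S f0 t) \<le> ennreal \<epsilon>)))))"

definition CR_locally_well_posed :: "plane_norm \<Rightarrow> bool" where
  "CR_locally_well_posed N \<longleftrightarrow>
     (\<forall>f0\<in>fun_space N. \<exists>T::real. 0 < T \<and> (\<exists>r::real. 0 < r \<and>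
        CR_well_posed_on N {0..T} {g0 \<in> fun_space N. fun_dist N g0 f0 < ennreal r}))"

definition CR_globally_well_posed :: "plane_norm \<Rightarrow> bool" where
  "CR_globally_well_posed N \<longleftrightarrow>
     (\<forall>T::real. 0 < T \<longrightarrow>
        CR_well_posed_on N {0..T} (fun_space N) \<and> CR_well_posed_on N {-T..0} (fun_space N))"


section \<open>Weak gradients\<close>

text \<open>
  \<open>D \<alpha>\<close> is the partial derivative of \<open>\<phi>\<close> of multi-index \<open>\<alpha>\<close>.
\<close>

definition test_function :: "(real^2 \<Rightarrow> real) \<Rightarrow> bool" where
  "test_function \<phi> \<longleftrightarrow>
     (\<exists>K. compact K \<and> (\<forall>x. x \<notin> K \<longrightarrow> \<phi> x = 0)) \<and>
     (\<exists>D :: (2 \<Rightarrow> nat) \<Rightarrow> real^2 \<Rightarrow> real. D (\<lambda>_. 0) = \<phi> \<and>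
        (\<forall>\<alpha> x. (D \<alpha> has_derivative (\<lambda>h. \<Sum>i\<in>UNIV. h $ i * D (\<alpha>(i := Suc (\<alpha> i))) x)) (at x)))"

definition loc_integrable :: "plane_fun \<Rightarrow> bool" where
  "loc_integrable f \<longleftrightarrow> (\<forall>K. compact K \<longrightarrow> set_integrable lborel K f)"

definition weak_partial :: "2 \<Rightarrow> plane_fun \<Rightarrow> plane_fun \<Rightarrow> bool" where
  "weak_partial i f p \<longleftrightarrow>
     loc_integrable f \<and> loc_integrable p \<and>
     (\<forall>\<phi>. test_function \<phi> \<longrightarrow>
        (LINT x|lborel. of_real (frechet_derivative \<phi> (at x) (axis i 1)) * f x) =
        - (LINT x|lborel. of_real (\<phi> x) * p x))"

definition weak_gradient :: "plane_fun \<Rightarrow> (2 \<Rightarrow> plane_fun) \<Rightarrow> bool" where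
  "weak_gradient f p \<longleftrightarrow> (\<forall>i. weak_partial i f (p i))"

end

theory Submission
  imports Defs "HOL-Probability.Probability"
begin

text \<open>
  The operator integrates over rectangles: with \<open>a = \<xi> + x\<close> and \<open>c = \<xi> + l rot x\<close> on one diagonal, the other
  diagonal consists of \<open>\<xi>\<close> and \<open>b = a + c - \<xi>\<close>. For fixed \<open>l\<close> the maps between such corners are similarities of the
  plane, so Cauchy--Schwarz and Fubini bound the operator on \<open>L\<^sup>2\<close>. Since \<open>\<bar>\<xi>\<bar>\<^sup>2 + \<bar>b\<bar>\<^sup>2 = \<bar>a\<bar>\<^sup>2 + \<bar>c\<bar>\<^sup>2\<close>, a weight at \<open>\<xi>\<close>
  is dominated by the sum of the weights at \<open>a\<close> and \<open>c\<close>; hence the weighted bounds, which are linear in the weighted norm.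
  In the scale invariant space a kernel estimate for three inverse norms takes the place of Cauchy--Schwarz.

  In each space the equation is therefore an ordinary differential equation with a bounded trilinear right-hand
  side: Picard iteration solves it locally, Gronwall's inequality compares solutions, and an a priori bound makes the
  solutions global. The locale \<open>CR_space\<close> carries this out once; the functions modulo null sets are represented by a
  Banach space, and the integral of a curve of functions is compared with the integral there.

  The a priori bounds come from conservation of the \<open>L\<^sup>2\<close> norm, which expresses a symmetry of the quartic form
  \<open>quartic\<close>. The weighted \<open>L\<^sup>2\<close> bound then follows from Gronwall's inequality. In the weighted sup norm the bound
  loses a logarithm: near \<open>l = 0\<close> the \<open>L\<^sup>1\<close> norm is used, and the cut is optimised (\<open>a_priori_X\<close>). The Sobolev spaces
  reduce to the weighted spaces because the operator commutes with the Fourier transform (\<open>Fe_F\<close>): for fixed \<open>l\<close> the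
  transform exchanges the two diagonals of the rectangle (\<open>rectangle_ft\<close>).

  For gradients, a weak derivative is multiplication by a frequency on the Fourier side, and the frequency at one
  corner of a rectangle is a signed sum of those at the other three. So the operator obeys the product rule, and the
  pairs of a function and its weak derivative form a closed subspace that the linearised equation preserves
  (\<open>tangent_flow\<close>). That equation is linear in the derivative and has global solutions.
\<close>

text \<open>Short notation for integrals, scalar multiples, limits and coercions that occur in almost every formula below.\<close>

abbreviation (input) nn_lborel :: "('a::euclidean_space => ennreal) => ennreal" (binder "NN " 60)
  where "nn_lborel f == nn_integral lborel f"
abbreviation (input) int_lborel :: "('a::euclidean_space => 'b::{banach, second_countable_topology}) => 'b" (binder "IN " 60)
  where "int_lborel f == lebesgue_integral lborel f"
abbreviation (input) lborel2 :: "('a::euclidean_space \<times> 'b::euclidean_space) measure"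
  where "lborel2 == lborel \<Otimes>\<^sub>M lborel"
abbreviation (input) tends (infixr "---->" 60)
  where "(X :: nat => 'a::topological_space) ----> l == X \<longlonglongrightarrow> l"
notation (input) scaleR (infixr "*R" 75)
abbreviation (input) "cor == complex_of_real"
abbreviation (input) "en == ennreal"
abbreviation (input) "ind == indicator"
abbreviation (input) "integ == integrable lborel"
abbreviation (input) bmf :: "('a::topological_space => 'b::topological_space) set" where "bmf == borel_measurable borel"

section \<open>Banach spaces of functions modulo null sets\<close>

lemma ennreal_power2_le_iff: "x^2 <= y^2 \<longleftrightarrow> x <= (y::ennreal)"
proof
 assume h: "x^2 <= y^2"
 show "x <= y"
 proof (rule ccontr)
 assume "~ x <= y"
 then have "y < x" by simp
 then have "y * y < x * x"
 by (cases x; cases y) (auto simp: ennreal_mult[symmetric] ennreal_less_iff ennreal_top_mult ennreal_mult_top mult_strict_mono intro: ennreal_mult_less_top[THEN iffD2])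
 with h show False by (simp add: power2_eq_square)
 qed
qed (simp add: power_mono)

lemma ennreal_power2_eq_iff: "x^2 = y^2 \<longleftrightarrow> x = (y::ennreal)"
 by (metis ennreal_power2_le_iff order_antisym order_refl)

lemma L2_norm_power2: "(L2_norm f)^2 = (NN x. en ((cmod (f x))^2))"
proof (cases "(NN x. en ((cmod (f x))^2)) = \<infinity>")
 case True
 then show ?thesis by (simp add: L2_norm_def power2_eq_square)
next
 case False
 then obtain r where "0 <= r" "(NN x. en ((cmod (f x))^2)) = en r"
 by (cases "NN x. en ((cmod (f x))^2)" rule: ennreal_cases) auto
 then show ?thesis by (simp add: L2_norm_def ennreal_power)
qed

lemma ball_borel [measurable]: "ball (c::real^2) r : sets borel"
 by simp

text \<open>
 The quotient construction needs the norm to depend only on its type argument. The properties of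
 the norm that matter are those below; the bound on \<open>\<integral>\<bar>f\<bar>\<close> over balls turns a rapidly
 convergent sequence into one that converges almost everywhere, and the Fatou property then
 identifies the limit in norm.
\<close>

class lebesgue_norm =
 fixes lnorm :: "'a itself => plane_norm"
 assumes lnorm_mono: "f : bmf ==> g : bmf ==>
 AE x in lborel. cmod (f x) <= cmod (g x) ==> lnorm TYPE('a) f <= lnorm TYPE('a) g"
 and lnorm_triangle: "f : bmf ==> g : bmf ==>
 lnorm TYPE('a) (%x. f x + g x) <= lnorm TYPE('a) f + lnorm TYPE('a) g"
 and lnorm_scale: "f : bmf ==>
 lnorm TYPE('a) (%x. c * f x) = en (cmod c) * lnorm TYPE('a) f"
 and lnorm_fatou: "(!!n. X n : bmf) ==> f : bmf ==>
 AE x in lborel. (%n. X n x) ----> f x ==> (!!n. lnorm TYPE('a) (X n) <= C) ==>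
 lnorm TYPE('a) f <= C"
 and lnorm_ball: "\<exists>C<\<infinity>. \<forall>f\<in>bmf.
 (NN x. en (cmod (f x)) * ind (ball 0 (real n)) x) <= C * lnorm TYPE('a) f"

datatype square_integrable = Square_Integrable
datatype essentially_bounded = Essentially_Bounded

instantiation square_integrable :: lebesgue_norm
begin
definition lnorm_square_integrable :: "square_integrable itself => plane_norm" where
 "lnorm_square_integrable _ = L2_norm"
instance
proof
 note [simp] = lnorm_square_integrable_def
 fix f g :: plane_fun and c :: complex
 assume [measurable]: "f : bmf" "g : bmf"
 show "AE x in lborel. cmod (f x) <= cmod (g x) ==> lnorm TYPE(square_integrable) f <= lnorm TYPE(square_integrable) g"
 unfolding lnorm_square_integrable_def
 by (subst ennreal_power2_le_iff[symmetric], unfold L2_norm_power2, rule nn_integral_mono_AE)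
 (auto elim!: eventually_mono intro!: ennreal_leI power_mono)
 show "lnorm TYPE(square_integrable) (%x. f x + g x) <= lnorm TYPE(square_integrable) f + lnorm TYPE(square_integrable) g"
 unfolding lnorm_square_integrable_def
 proof (subst ennreal_power2_le_iff[symmetric])
 have cs: "(NN x. en (cmod (f x)) * en (cmod (g x))) <= L2_norm f * L2_norm g"
 by (subst ennreal_power2_le_iff[symmetric], unfold power_mult_distrib L2_norm_power2,
 rule order_trans[OF Cauchy_Schwarz_nn_integral]) (auto simp: ennreal_power)
 have "(L2_norm (%x. f x + g x))^2 <= (NN x. en ((cmod (f x))^2)
 + 2 * (en (cmod (f x)) * en (cmod (g x))) + en ((cmod (g x))^2))"
 unfolding L2_norm_power2
 proof (rule nn_integral_mono)
 fix x
 have "(cmod (f x + g x))^2 <= (cmod (f x) + cmod (g x))^2"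
 by (intro power_mono norm_triangle_ineq) auto
 also have "... = (cmod (f x))^2 + 2 * (cmod (f x) * cmod (g x)) + (cmod (g x))^2"
 by (simp add: power2_eq_square algebra_simps)
 finally show "en ((cmod (f x + g x))^2) <= en ((cmod (f x))^2)
 + 2 * (en (cmod (f x)) * en (cmod (g x))) + en ((cmod (g x))^2)"
 by (simp add: ennreal_plus[symmetric] ennreal_mult[symmetric] ennreal_numeral[symmetric] ennreal_leI
 del: ennreal_plus ennreal_numeral)
 qed
 also have "... = (L2_norm f)^2 + 2 * (NN x. en (cmod (f x)) * en (cmod (g x))) + (L2_norm g)^2"
 unfolding L2_norm_power2 by (simp add: nn_integral_add nn_integral_cmult)
 also have "... <= (L2_norm f)^2 + 2 * (L2_norm f * L2_norm g) + (L2_norm g)^2"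
 by (intro add_mono mult_left_mono cs) auto
 also have "... = (L2_norm f + L2_norm g)^2"
 by (simp add: power2_eq_square distrib_left distrib_right mult_ac add_ac mult_2 mult_2_right)
 finally show "(L2_norm (%x. f x + g x))^2 <= (L2_norm f + L2_norm g)^2" .
 qed
 show "lnorm TYPE(square_integrable) (%x. c * f x) = en (cmod c) * lnorm TYPE(square_integrable) f"
 unfolding lnorm_square_integrable_def
 by (subst ennreal_power2_eq_iff[symmetric], unfold power_mult_distrib L2_norm_power2)
 (simp add: norm_mult power_mult_distrib ennreal_mult ennreal_power nn_integral_cmult)
next
 fix X :: "nat => plane_fun" and f C
 assume [measurable]: "!!n. X n : bmf" "f : bmf"
 and lim: "AE x in lborel. (%n. X n x) ----> f x" and le: "!!n. lnorm TYPE(square_integrable) (X n) <= C"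
 have "(L2_norm f)^2 = (NN x. liminf (%n. en ((cmod (X n x))^2)))"
 unfolding L2_norm_power2
 proof (rule nn_integral_cong_AE, use lim in eventually_elim)
 fix x assume "(%n. X n x) ----> f x"
 then have "(%n. en ((cmod (X n x))^2)) ----> en ((cmod (f x))^2)"
 by (intro tendsto_ennrealI tendsto_power tendsto_norm)
 then show "en ((cmod (f x))^2) = liminf (%n. en ((cmod (X n x))^2))"
 by (rule lim_imp_Liminf[OF sequentially_bot, symmetric])
 qed
 also have "... <= liminf (%n. NN x. en ((cmod (X n x))^2))"
 by (rule nn_integral_liminf) auto
 also have "... <= C^2"
 using le unfolding L2_norm_power2[symmetric]
 by (intro Liminf_le) (auto intro!: always_eventually power_mono simp: lnorm_square_integrable_def)
 finally show "lnorm TYPE(square_integrable) f <= C"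
 by (simp add: ennreal_power2_le_iff lnorm_square_integrable_def)
next
 fix n :: nat
 define m where "m = emeasure lborel (ball (0::real^2) n)"
 have m: "m < \<infinity>" unfolding m_def by (rule emeasure_lborel_ball_finite)
 obtain r where r: "0 <= r" "m = en r" using m by (cases m) auto
 have "(NN x. en (cmod (f x)) * ind (ball 0 (real n)) x) <= en (sqrt r) * L2_norm f"
 if [measurable]: "f : bmf" for f :: plane_fun
 proof (subst ennreal_power2_le_iff[symmetric])
 have "(NN x. en (cmod (f x)) * ind (ball 0 (real n)) x)^2
 <= (NN x. (en (cmod (f x)))^2) * (\<integral>\<^sup>+x. (ind (ball 0 (real n)) x)^2 \<partial>(lborel::(real^2) measure))"
 by (rule Cauchy_Schwarz_nn_integral) auto
 also have "(NN x. (ind (ball (0::real^2) (real n)) x)^2) = m"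
 proof -
 have "(NN x. (ind (ball (0::real^2) (real n)) x)^2) = (NN x. ind (ball (0::real^2) (real n)) x)"
 by (intro nn_integral_cong) (auto split: split_indicator)
 then show ?thesis unfolding m_def by simp
 qed
 finally show "(NN x. en (cmod (f x)) * ind (ball 0 (real n)) x)^2 <= (en (sqrt r) * L2_norm f)^2"
 unfolding power_mult_distrib L2_norm_power2 using r by (simp add: ennreal_power mult.commute)
 qed
 then show "\<exists>C<\<infinity>. \<forall>f\<in>bmf.
 (NN x. en (cmod (f x)) * ind (ball 0 (real n)) x) <= C * lnorm TYPE(square_integrable) f"
 by (intro exI[of _ "en (sqrt r)"]) (auto simp: lnorm_square_integrable_def)
qed
end

lemma Linf_norm_AE: "AE x in lborel. en (cmod (f x)) <= Linf_norm f"
 unfolding Linf_norm_def by (rule esssup_AE)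

lemma Linf_norm_le: "f : bmf ==> AE x in lborel. en (cmod (f x)) <= C ==> Linf_norm f <= C"
 unfolding Linf_norm_def by (rule esssup_I) auto

instantiation essentially_bounded :: lebesgue_norm
begin
definition lnorm_essentially_bounded :: "essentially_bounded itself => plane_norm" where
 "lnorm_essentially_bounded _ = Linf_norm"
instance
proof
 have scale: "Linf_norm (%x. c * f x) <= en (cmod c) * Linf_norm f"
 if [measurable]: "f : bmf" for c f
 by (rule Linf_norm_le, measurable, use Linf_norm_AE[of f] in eventually_elim)
 (auto simp: norm_mult ennreal_mult intro: mult_left_mono)
 fix f g :: plane_fun and c :: complex
 assume [measurable]: "f : bmf" "g : bmf"
 show "lnorm TYPE(essentially_bounded) f <= lnorm TYPE(essentially_bounded) g"
 if "AE x in lborel. cmod (f x) <= cmod (g x)"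
 unfolding lnorm_essentially_bounded_def
 by (rule Linf_norm_le, measurable, use that Linf_norm_AE[of g] in eventually_elim)
 (auto intro: order_trans ennreal_leI)
 show "lnorm TYPE(essentially_bounded) (%x. f x + g x) <= lnorm TYPE(essentially_bounded) f + lnorm TYPE(essentially_bounded) g"
 unfolding lnorm_essentially_bounded_def
 proof (rule Linf_norm_le, measurable, use Linf_norm_AE[of f] Linf_norm_AE[of g] in eventually_elim)
 fix x assume h: "en (cmod (f x)) <= Linf_norm f" "en (cmod (g x)) <= Linf_norm g"
 have "en (cmod (f x + g x)) <= en (cmod (f x)) + en (cmod (g x))"
 by (simp add: ennreal_plus[symmetric] norm_triangle_ineq ennreal_leI del: ennreal_plus)
 also have "... <= Linf_norm f + Linf_norm g" using h by (rule add_mono)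
 finally show "en (cmod (f x + g x)) <= Linf_norm f + Linf_norm g" .
 qed
 show "lnorm TYPE(essentially_bounded) (%x. c * f x) = en (cmod c) * lnorm TYPE(essentially_bounded) f"
 unfolding lnorm_essentially_bounded_def
 proof (rule antisym[OF scale])
 show "en (cmod c) * Linf_norm f <= Linf_norm (%x. c * f x)"
 proof (cases "c = 0")
 case False
 have "en (cmod c) * Linf_norm (%x. (1 / c) * (c * f x))
 <= en (cmod c) * (en (cmod (1 / c)) * Linf_norm (%x. c * f x))"
 by (intro mult_left_mono scale) auto
 also have "... = Linf_norm (%x. c * f x)"
 using False by (simp add: mult.assoc[symmetric] ennreal_mult[symmetric] norm_divide)
 finally show ?thesis using False by simp
 qed simp
 qed measurable
next
 fix X :: "nat => plane_fun" and f C
 assume [measurable]: "!!n. X n : bmf" "f : bmf"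
 and lim: "AE x in lborel. (%n. X n x) ----> f x" and le: "!!n. lnorm TYPE(essentially_bounded) (X n) <= C"
 have "AE x in lborel. \<forall>n. en (cmod (X n x)) <= Linf_norm (X n)"
 using Linf_norm_AE by (simp add: AE_all_countable)
 with lim have "AE x in lborel. en (cmod (f x)) <= C"
 proof eventually_elim
 fix x assume "(%n. X n x) ----> f x" and b: "\<forall>n. en (cmod (X n x)) <= Linf_norm (X n)"
 then have "(%n. en (cmod (X n x))) ----> en (cmod (f x))"
 by (intro tendsto_ennrealI tendsto_norm)
 then show "en (cmod (f x)) <= C"
 by (rule LIMSEQ_le_const2) (use b le in \<open>auto simp: lnorm_essentially_bounded_def intro: order_trans\<close>)
 qed
 then show "lnorm TYPE(essentially_bounded) f <= C"
 unfolding lnorm_essentially_bounded_def by (intro Linf_norm_le) auto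
next
 fix n :: nat
 have "(NN x. en (cmod (f x)) * ind (ball 0 (real n)) x) <= emeasure lborel (ball (0::real^2) n) * Linf_norm f"
 if [measurable]: "f : bmf" for f :: plane_fun
 proof -
 have "(NN x. en (cmod (f x)) * ind (ball 0 (real n)) x)
 <= (NN x. Linf_norm f * ind (ball (0::real^2) (real n)) x)"
 proof (rule nn_integral_mono_AE)
 show "AE x in lborel. en (cmod (f x)) * ind (ball 0 (real n)) x <= Linf_norm f * ind (ball 0 (real n)) x"
 using Linf_norm_AE[of f] by eventually_elim (rule mult_right_mono, auto)
 qed
 then show ?thesis by (simp add: nn_integral_cmult_indicator mult.commute)
 qed
 then show "\<exists>C<\<infinity>. \<forall>f\<in>bmf.
 (NN x. en (cmod (f x)) * ind (ball 0 (real n)) x) <= C * lnorm TYPE(essentially_bounded) f"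
 by (intro exI[of _ "emeasure lborel (ball (0::real^2) n)"])
 (use emeasure_lborel_ball_finite in \<open>auto simp: lnorm_essentially_bounded_def\<close>)
qed
end

context lebesgue_norm
begin

lemma lnorm_cong: "f : bmf ==> g : bmf ==> AE x in lborel. f x = g x ==> lnorm TYPE('a) f = lnorm TYPE('a) g"
 by (intro antisym lnorm_mono) (auto elim: eventually_mono)

lemma lnorm_zero: "lnorm TYPE('a) (%_. 0) = 0"
 using lnorm_scale[of "%_. 0" 0] by simp

lemma lnorm_eq_0: assumes [measurable]: "f : bmf" and "lnorm TYPE('a) f = 0" shows "AE x in lborel. f x = 0"
proof -
 have "AE x in lborel. x : ball 0 (real n) --> f x = 0" for n
 proof -
 obtain C where "C < \<infinity>" "(NN x. en (cmod (f x)) * ind (ball 0 (real n)) x) <= C * lnorm TYPE('a) f"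
 using lnorm_ball[of n] assms(1) by blast
 then have "(NN x. en (cmod (f x)) * ind (ball 0 (real n)) x) = 0"
 using assms(2) by simp
 then have "AE x in lborel. en (cmod (f x)) * ind (ball 0 (real n)) x = 0"
 by (subst (asm) nn_integral_0_iff_AE) auto
 then show ?thesis by eventually_elim (auto simp: indicator_def)
 qed
 then have "AE x in lborel. \<forall>n. x : ball 0 (real n) --> f x = 0" by (subst AE_all_countable) blast
 then show ?thesis
 proof eventually_elim
 fix x assume "\<forall>n. x : ball 0 (real n) --> f x = 0"
 moreover obtain n :: nat where "norm x < real n" using reals_Archimedean2 by blast
 ultimately show "f x = 0" by auto
 qed
qed

lemma fun_space_add: "f : fun_space (lnorm TYPE('a)) ==> g : fun_space (lnorm TYPE('a)) ==> (%x. f x + g x) : fun_space (lnorm TYPE('a))"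
 unfolding fun_space_def using lnorm_triangle[of f g] by (auto simp: less_top intro: le_less_trans)

lemma fun_space_scale: "f : fun_space (lnorm TYPE('a)) ==> (%x. c * f x) : fun_space (lnorm TYPE('a))"
 unfolding fun_space_def by (auto simp: lnorm_scale ennreal_mult_less_top)

lemma fun_space_uminus: "f : fun_space (lnorm TYPE('a)) ==> (%x. - f x) : fun_space (lnorm TYPE('a))"
 using fun_space_scale[of f "-1"] by simp

lemma fun_space_diff: "f : fun_space (lnorm TYPE('a)) ==> g : fun_space (lnorm TYPE('a)) ==> (%x. f x - g x) : fun_space (lnorm TYPE('a))"
 using fun_space_add[of f "%x. (-1) * g x"] fun_space_scale[of g "-1"] by simp

lemma fun_space_zero: "(%x. 0) : fun_space (lnorm TYPE('a))"
 by (simp add: fun_space_def lnorm_zero)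

lemma fun_space_cong: "f : fun_space (lnorm TYPE('a)) ==> g : bmf ==> AE x in lborel. f x = g x ==> g : fun_space (lnorm TYPE('a))"
 unfolding fun_space_def using lnorm_cong[of f g] by auto

text \<open>A subsequence with summable differences converges almost everywhere, and the Fatou property identifies the limit.\<close>

lemma fun_space_complete:
 fixes X :: "nat => plane_fun"
 assumes X: "!!n. X n : fun_space (lnorm TYPE('a))"
 and cauchy: "!!e::real. e > 0 ==> \<exists>M. \<forall>m\<ge>M. \<forall>n\<ge>M. lnorm TYPE('a) (%x. X m x - X n x) <= en e"
 shows "\<exists>f\<in>fun_space (lnorm TYPE('a)). \<forall>e>0. \<exists>M. \<forall>n\<ge>M. lnorm TYPE('a) (%x. X n x - f x) <= en e"
proof -
 have [measurable]: "X n : bmf" for n using X by (auto simp: fun_space_def)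
 have "\<forall>k. \<exists>M::nat. \<forall>m\<ge>M. \<forall>n\<ge>M. lnorm TYPE('a) (%x. X m x - X n x) <= en ((1/2)^k)"
 using cauchy by simp
 then obtain M where M: "!!k m n. m >= M k ==> n >= M k ==> lnorm TYPE('a) (%x. X m x - X n x) <= en ((1/2)^k)"
 by metis
 define r where "r k = k + (\<Sum>i\<le>k. M i)" for k
 have rM: "M k <= r k" for k unfolding r_def by (simp add: member_le_sum trans_le_add2)
 have rmono: "r j <= r k" if "j <= k" for j k
 unfolding r_def using that by (intro add_mono sum_mono2) auto
 define Y where "Y k = X (r k)" for k
 have [measurable]: "Y n : bmf" for n by (simp add: Y_def)
 have "AE x in lborel. x : ball 0 (real n) --> summable (%k. cmod (Y (Suc k) x - Y k x))" for n
 proof -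
 obtain C where C: "C < \<infinity>" "!!f. f : bmf ==>
 (NN x. en (cmod (f x)) * ind (ball 0 (real n)) x) <= C * lnorm TYPE('a) f"
 using lnorm_ball[of n] by blast
 have "(NN x. (\<Sum>k. en (cmod (Y (Suc k) x - Y k x)) * ind (ball 0 (real n)) x))
 = (\<Sum>k. NN x. en (cmod (Y (Suc k) x - Y k x)) * ind (ball 0 (real n)) x)"
 by (rule nn_integral_suminf) auto
 also have "... <= (\<Sum>k. C * en ((1/2)^k))"
 proof (rule suminf_le)
 fix k
 have "(NN x. en (cmod (Y (Suc k) x - Y k x)) * ind (ball 0 (real n)) x)
 <= C * lnorm TYPE('a) (%x. Y (Suc k) x - Y k x)" by (rule C(2)) auto
 also have "... <= C * en ((1/2)^k)"
 unfolding Y_def using rM[of k] rmono[of k "Suc k"] by (intro mult_left_mono M) auto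
 finally show "(NN x. en (cmod (Y (Suc k) x - Y k x)) * ind (ball 0 (real n)) x)
 <= C * en ((1/2)^k)" .
 qed auto
 also have "... = C * en (\<Sum>k. (1/2)^k)"
 by (simp add: ennreal_suminf_cmult suminf_ennreal2 summable_geometric)
 also have "... < \<infinity>" using C(1) by (simp add: ennreal_mult_less_top)
 finally have "AE x in lborel. (\<Sum>k. en (cmod (Y (Suc k) x - Y k x)) * ind (ball 0 (real n)) x) ~= \<infinity>"
 by (intro nn_integral_PInf_AE) auto
 then show ?thesis
 by eventually_elim (auto intro: summable_suminf_not_top)
 qed
 then have "AE x in lborel. \<forall>n. x : ball 0 (real n) --> summable (%k. cmod (Y (Suc k) x - Y k x))"
 by (subst AE_all_countable) blast
 then have conv: "AE x in lborel. (%k. Y k x) ----> lim (%k. Y k x)"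
 proof eventually_elim
 fix x assume h: "\<forall>n. x : ball 0 (real n) --> summable (%k. cmod (Y (Suc k) x - Y k x))"
 obtain n :: nat where "norm x < real n" using reals_Archimedean2 by blast
 then have "summable (%k. Y (Suc k) x - Y k x)" using h by (auto intro: summable_norm_cancel)
 then have "convergent (%k. \<Sum>i<k. Y (Suc i) x - Y i x)" by (simp add: summable_iff_convergent)
 then have "convergent (%k. Y k x - Y 0 x)" by (simp only: sum_lessThan_telescope[of "%i. Y i x"])
 then have "convergent (%k. (Y k x - Y 0 x) + Y 0 x)" by (rule convergent_add[OF _ convergent_const])
 then show "(%k. Y k x) ----> lim (%k. Y k x)" by (simp add: convergent_LIMSEQ_iff)
 qed
 define f where "f x = lim (%k. Y k x)" for x
 have [measurable]: "f : bmf"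
 unfolding f_def[abs_def] by (rule borel_measurable_lim_metric) auto
 have close: "lnorm TYPE('a) (%x. X n x - f x) <= en ((1/2)^k)" if "n >= r k" for n k
 proof (rule lnorm_fatou[of "%j x. X n x - Y (j + k) x"])
 show "AE x in lborel. (%j. X n x - Y (j + k) x) ----> X n x - f x"
 using conv unfolding f_def[symmetric]
 by eventually_elim (auto intro!: tendsto_diff tendsto_const LIMSEQ_ignore_initial_segment)
 show "lnorm TYPE('a) (%x. X n x - Y (j + k) x) <= en ((1/2)^k)" for j
 unfolding Y_def using that rM[of k] rmono[of k "j + k"] by (intro M) auto
 qed auto
 have "f : fun_space (lnorm TYPE('a))"
 proof -
 have "(%x. X (r 0) x - f x) : fun_space (lnorm TYPE('a))"
 using close[of 0 "r 0"] by (auto simp: fun_space_def intro: le_less_trans)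
 then show ?thesis using fun_space_diff[OF X[of "r 0"], of "%x. X (r 0) x - f x"] by simp
 qed
 moreover have "\<exists>M. \<forall>n\<ge>M. lnorm TYPE('a) (%x. X n x - f x) <= en e" if e: "e > 0" for e
 proof -
 obtain k where "(1/2::real)^k < e" using real_arch_pow_inv[of e "1/2"] e by auto
 then show ?thesis using close by (intro exI[of _ "r k"]) (meson ennreal_leI less_imp_le order_trans)
 qed
 ultimately show ?thesis by blast
qed

end

typedef (overloaded) ('a::lebesgue_norm) fsp =
 "{A. \<exists>f\<in>fun_space (lnorm TYPE('a)). A = {g : fun_space (lnorm TYPE('a)). AE x in lborel. g x = f x}}"
 using fun_space_zero by blast

definition cls :: "plane_fun => 'a::lebesgue_norm fsp" where
 "cls f = Abs_fsp {g : fun_space (lnorm TYPE('a)). AE x in lborel. g x = f x}"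

definition repr :: "'a::lebesgue_norm fsp => plane_fun" where
 "repr u = (SOME f. f : Rep_fsp u)"

lemma repr: "repr (u::'a::lebesgue_norm fsp) : fun_space (lnorm TYPE('a))" and cls_repr [simp]: "cls (repr u) = u"
proof -
 obtain f where f: "f : fun_space (lnorm TYPE('a))" "Rep_fsp u = {g : fun_space (lnorm TYPE('a)). AE x in lborel. g x = f x}"
 using Rep_fsp[of u] by blast
 then have "f : Rep_fsp u" by simp
 then have r: "repr u : Rep_fsp u" unfolding repr_def by (rule someI[of "%f. f : Rep_fsp u"])
 then show "repr u : fun_space (lnorm TYPE('a))" by (simp add: f)
 have "AE x in lborel. repr u x = f x" using r by (simp add: f)
 then have "{g : fun_space (lnorm TYPE('a)). AE x in lborel. g x = repr u x} = Rep_fsp u"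
 unfolding f by (auto elim!: eventually_elim2)
 then show "cls (repr u) = u" by (simp add: cls_def Rep_fsp_inverse)
qed

lemma cls_eq_iff:
 assumes "f : fun_space (lnorm TYPE('a::lebesgue_norm))" "g : fun_space (lnorm TYPE('a))"
 shows "(cls f :: 'a fsp) = cls g \<longleftrightarrow> (AE x in lborel. f x = g x)"
proof
 assume "(cls f :: 'a fsp) = cls g"
 then have "{h : fun_space (lnorm TYPE('a)). AE x in lborel. h x = f x} = {h : fun_space (lnorm TYPE('a)). AE x in lborel. h x = g x}"
 unfolding cls_def using assms by (subst (asm) Abs_fsp_inject) auto
 then show "AE x in lborel. f x = g x" using assms by auto
next
 assume h: "AE x in lborel. f x = g x"
 have "{h : fun_space (lnorm TYPE('a)). AE x in lborel. h x = f x} = {h : fun_space (lnorm TYPE('a)). AE x in lborel. h x = g x}"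
 using h by (auto elim: eventually_elim2)
 then show "(cls f :: 'a fsp) = cls g" by (simp add: cls_def)
qed

lemma repr_cls:
 assumes "f : fun_space (lnorm TYPE('a::lebesgue_norm))"
 shows "AE x in lborel. repr (cls f :: 'a fsp) x = f x"
 using cls_eq_iff[OF repr[of "cls f :: 'a fsp"] assms] by simp

instantiation fsp :: (lebesgue_norm) real_normed_vector
begin

definition plus_fsp :: "'a fsp => 'a fsp => 'a fsp" where "plus_fsp u v = cls (%x. repr u x + repr v x)"
definition minus_fsp :: "'a fsp => 'a fsp => 'a fsp" where "minus_fsp u v = cls (%x. repr u x - repr v x)"
definition uminus_fsp :: "'a fsp => 'a fsp" where "uminus_fsp u = cls (%x. - repr u x)"
definition zero_fsp :: "'a fsp" where "zero_fsp = cls (%_. 0)"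
definition scaleR_fsp :: "real => 'a fsp => 'a fsp" where "scaleR_fsp c u = cls (%x. cor c * repr u x)"
definition norm_fsp :: "'a fsp => real" where "norm_fsp u = enn2real (lnorm TYPE('a) (repr u))"
definition dist_fsp :: "'a fsp => 'a fsp => real" where "dist_fsp u v = norm (u - v)"
definition sgn_fsp :: "'a fsp => 'a fsp" where "sgn_fsp u = scaleR (inverse (norm u)) u"
definition uniformity_fsp :: "('a fsp \<times> 'a fsp) filter" where
 [code del]: "uniformity_fsp = (INF e\<in>{0 <..}. principal {(x, y). dist x y < e})"
definition open_fsp :: "'a fsp set => bool" where
 [code del]: "open_fsp U = (\<forall>x\<in>U. \<forall>\<^sub>F (x', y) in uniformity. x' = x --> y : U)"

lemma cls_add_aux:
 assumes "f : fun_space (lnorm TYPE('a))" "g : fun_space (lnorm TYPE('a))"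
 shows "(cls f :: 'a fsp) + cls g = cls (%x. f x + g x)"
 unfolding plus_fsp_def
 by (subst cls_eq_iff) (use repr_cls[OF assms(1)] repr_cls[OF assms(2)] in \<open>auto intro!: fun_space_add repr assms\<close>)

lemma cls_scale_aux:
 assumes "f : fun_space (lnorm TYPE('a))"
 shows "c *R (cls f :: 'a fsp) = cls (%x. cor c * f x)"
 unfolding scaleR_fsp_def
 by (subst cls_eq_iff) (use repr_cls[OF assms(1)] in \<open>auto intro!: fun_space_scale repr assms\<close>)

lemma cls_norm_aux:
 assumes f: "f : fun_space (lnorm TYPE('a))"
 shows "en (norm (cls f :: 'a fsp)) = lnorm TYPE('a) f"
proof -
 have "lnorm TYPE('a) (repr (cls f :: 'a fsp)) = lnorm TYPE('a) f"
 using f repr[of "cls f :: 'a fsp"] by (intro lnorm_cong repr_cls) (auto simp: fun_space_def)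
 then show ?thesis using f by (simp add: norm_fsp_def fun_space_def less_top)
qed

instance
proof
 let ?N = "lnorm TYPE('a)"
 note A = fun_space_add fun_space_scale fun_space_zero repr
 have m1: "- u = (-1) *R u" for u :: "'a fsp" by (simp add: uminus_fsp_def scaleR_fsp_def)
 have m2: "u - v = u + (-1) *R v" for u v :: "'a fsp"
 using cls_add_aux[OF repr[of u] fun_space_scale[OF repr[of v], of "-1"]]
 by (simp add: minus_fsp_def scaleR_fsp_def)
 have ex: "\<exists>f\<in>fun_space ?N. u = cls f" for u :: "'a fsp" by (metis cls_repr repr)
 fix u v w :: "'a fsp" and a b :: real
 obtain f g h where F: "f : fun_space ?N" "g : fun_space ?N" "h : fun_space ?N" "u = cls f" "v = cls g" "w = cls h"
 using ex by metis
 note S = F cls_add_aux cls_scale_aux A fun_space_uminus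
 show "u + v + w = u + (v + w)" by (simp add: S add.assoc)
 show "u + v = v + u" by (simp add: S add.commute)
 show "0 + u = u" by (simp add: S zero_fsp_def)
 show "- u + u = 0" by (simp add: m1 S zero_fsp_def)
 show "u - v = u + - v" by (simp add: m1 m2)
 show "a *R (u + v) = a *R u + a *R v" by (simp add: S distrib_left)
 show "(a + b) *R u = a *R u + b *R u" by (simp add: S distrib_right)
 show "a *R b *R u = (a * b) *R u" by (simp add: S mult.assoc)
 show "1 *R u = u" by (simp add: S)
 show "dist u v = norm (u - v)" by (rule dist_fsp_def)
 show "sgn u = inverse (norm u) *R u" by (rule sgn_fsp_def)
 show "uniformity = (INF e\<in>{0 <..}. principal {(x, y). dist x (y::'a fsp) < e})" by (rule uniformity_fsp_def)
 show "open U = (\<forall>x\<in>U. \<forall>\<^sub>F (x', y) in uniformity. x' = x --> y : U)" for U :: "'a fsp set" by (rule open_fsp_def)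
 have n0: "0 <= norm z" for z :: "'a fsp" by (simp add: norm_fsp_def)
 have N: "?N f = en (norm u)" "?N g = en (norm v)" using F cls_norm_aux by metis+
 show "(norm u = 0) = (u = 0)"
 proof
 assume "norm u = 0"
 then have "AE x in lborel. f x = 0" using N F by (intro lnorm_eq_0) (auto simp: fun_space_def)
 then show "u = 0" unfolding F zero_fsp_def using F by (subst cls_eq_iff) (auto intro: fun_space_zero)
 next
 assume "u = 0"
 then have "en (norm u) = 0" using cls_norm_aux[OF fun_space_zero] by (simp add: zero_fsp_def lnorm_zero)
 then show "norm u = 0" using n0[of u] by (simp add: ennreal_eq_0_iff)
 qed
 have "en (norm (u + v)) = ?N (%x. f x + g x)"
 unfolding F(4,5) cls_add_aux[OF F(1,2)] by (rule cls_norm_aux) (intro A F)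
 also have "... <= en (norm u) + en (norm v)"
 unfolding N[symmetric] using F by (intro lnorm_triangle) (auto simp: fun_space_def)
 finally show "norm (u + v) <= norm u + norm v" using n0 by (simp add: ennreal_plus[symmetric] del: ennreal_plus)
 have "en (norm (a *R u)) = ?N (%x. cor a * f x)"
 unfolding F(4) cls_scale_aux[OF F(1)] by (rule cls_norm_aux) (intro A F)
 also have "... = en (\<bar>a\<bar> * norm u)"
 using F N n0 by (subst lnorm_scale) (auto simp: fun_space_def ennreal_mult)
 finally show "norm (a *R u) = \<bar>a\<bar> * norm u" using n0 by (simp add: ennreal_inj)
qed

end

context
 fixes f g :: plane_fun
begin

lemma cls_add:
 assumes "f : fun_space (lnorm TYPE('a::lebesgue_norm))" "g : fun_space (lnorm TYPE('a))"
 shows "cls (%x. f x + g x) = (cls f :: 'a fsp) + cls g"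
 using cls_add_aux[OF assms] by simp

lemma cls_scale:
 assumes "f : fun_space (lnorm TYPE('a::lebesgue_norm))"
 shows "cls (%x. cor c * f x) = c *R (cls f :: 'a fsp)"
 using cls_scale_aux[OF assms] by simp

lemma norm_cls:
 assumes "f : fun_space (lnorm TYPE('a::lebesgue_norm))"
 shows "en (norm (cls f :: 'a fsp)) = lnorm TYPE('a) f"
 by (rule cls_norm_aux[OF assms])

end

lemma cls_diff:
 assumes "f : fun_space (lnorm TYPE('a::lebesgue_norm))" "g : fun_space (lnorm TYPE('a))"
 shows "cls (%x. f x - g x) = (cls f :: 'a fsp) - cls g"
 using cls_add[OF assms(1) fun_space_scale[OF assms(2)], of "-1"] cls_scale[OF assms(2), of "-1"] by simp

instance fsp :: (lebesgue_norm) banach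
proof
 let ?N = "lnorm TYPE('a)"
 fix X :: "nat => 'a fsp" assume X: "Cauchy X"
 have d: "lnorm TYPE('a) (%x. repr u x - repr v x) = en (norm (u - v))" for u v :: "'a fsp"
 using norm_cls[OF fun_space_diff[OF repr[of u] repr[of v]]] cls_diff[OF repr[of u] repr[of v]] by simp
 have "\<exists>f\<in>fun_space ?N. \<forall>e>0. \<exists>M. \<forall>n\<ge>M. ?N (%x. repr (X n) x - f x) <= en e"
 proof (rule fun_space_complete[OF repr])
 fix e :: real assume "e > 0"
 then obtain M where "\<forall>m\<ge>M. \<forall>n\<ge>M. dist (X m) (X n) < e" using X unfolding Cauchy_def by blast
 then show "\<exists>M. \<forall>m\<ge>M. \<forall>n\<ge>M. ?N (%x. repr (X m) x - repr (X n) x) <= en e"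
 unfolding d dist_norm by (meson ennreal_leI less_imp_le)
 qed
 then obtain f where f: "f : fun_space ?N" and lim: "!!e. e > 0 ==> \<exists>M. \<forall>n\<ge>M. ?N (%x. repr (X n) x - f x) <= en e"
 by blast
 have d2: "?N (%x. repr (X n) x - f x) = en (dist (X n) (cls f))" for n
 using norm_cls[OF fun_space_diff[OF repr[of "X n"] f]] cls_diff[OF repr[of "X n"] f] by (simp add: dist_norm)
 have "X ----> cls f"
 proof (rule metric_LIMSEQ_I)
 fix e :: real assume e: "e > 0"
 then obtain M where M: "!!n. n >= M ==> ?N (%x. repr (X n) x - f x) <= en (e/2)" using lim[of "e/2"] by auto
 then have "dist (X n) (cls f) <= e / 2" if "n >= M" for n using M[OF that] e unfolding d2 by (simp add: ennreal_le_iff)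
 then show "\<exists>no. \<forall>n\<ge>no. dist (X n) (cls f) < e" using e by (intro exI[of _ M]) force
 qed
 then show "convergent X" by (rule convergentI)
qed

section \<open>Cubic differential equations in a Banach space\<close>

lemma has_vector_derivative_iff_quotient:
 fixes f :: "real => 'a::real_normed_vector"
 shows "(f has_vector_derivative y) (at x within S) \<longleftrightarrow>
 ((%s. (f s - f x) /\<^sub>R (s - x)) \<longlongrightarrow> y) (at x within S)"
proof -
 have "(f has_vector_derivative y) (at x within S) \<longleftrightarrow>
 ((%s. norm ((f s - f x - (s - x) *R y) /\<^sub>R norm (s - x))) \<longlongrightarrow> 0) (at x within S)"
 unfolding has_vector_derivative_def has_derivative_iff_norm
 by (simp add: bounded_linear_scaleR_left divide_inverse_commute)
 also have "... \<longleftrightarrow> ((%s. norm ((f s - f x) /\<^sub>R (s - x) - y)) \<longlongrightarrow> 0) (at x within S)"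
 proof (rule filterlim_cong[OF refl refl], unfold eventually_at_filter, rule always_eventually, safe)
 fix s assume "s ~= x"
 then have "(f s - f x) /\<^sub>R (s - x) - y = (f s - f x - (s - x) *R y) /\<^sub>R (s - x)"
 by (simp add: scaleR_diff_right)
 then show "norm ((f s - f x - (s - x) *R y) /\<^sub>R norm (s - x)) = norm ((f s - f x) /\<^sub>R (s - x) - y)"
 by simp
 qed
 also have "... \<longleftrightarrow> ((%s. (f s - f x) /\<^sub>R (s - x)) \<longlongrightarrow> y) (at x within S)"
 by (simp only: tendsto_norm_zero_iff LIM_zero_iff)
 finally show ?thesis .
qed

locale bounded_trilinear =
 fixes F :: "'a::banach => 'a => 'a => 'a"
 assumes add1: "F (u + u') v w = F u v w + F u' v w"
 and add2: "F u (v + v') w = F u v w + F u v' w"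
 and add3: "F u v (w + w') = F u v w + F u v w'"
 and scale1: "F (c *R u) v w = c *R F u v w"
 and scale2: "F u (c *R v) w = c *R F u v w"
 and scale3: "F u v (c *R w) = c *R F u v w"
 and bounded: "\<exists>K. \<forall>u v w. norm (F u v w) <= K * norm u * norm v * norm w"
begin

lemma bound_ex: "\<exists>K\<ge>0. \<forall>u v w. norm (F u v w) <= K * norm u * norm v * norm w"
proof -
 obtain K where K: "!!u v w. norm (F u v w) <= K * norm u * norm v * norm w" using bounded by blast
 have "norm (F u v w) <= max K 0 * norm u * norm v * norm w" for u v w
 by (rule order_trans[OF K]) (intro mult_right_mono, auto)
 then show ?thesis by (intro exI[of _ "max K 0"]) auto
qed

definition "K = (SOME K. 0 <= K & (\<forall>u v w. norm (F u v w) <= K * norm u * norm v * norm w))"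

lemma K_nonneg: "0 <= K" and norm_le: "norm (F u v w) <= K * norm u * norm v * norm w"
 using someI_ex[OF bound_ex[unfolded Bex_def]] unfolding K_def by auto

lemma minus1: "F (- u) v w = - F u v w" and minus2: "F u (- v) w = - F u v w"
 and minus3: "F u v (- w) = - F u v w"
 using scale1[of "-1"] scale2[of _ "-1"] scale3[of _ _ "-1"] by simp_all

lemma diff1: "F (u - u') v w = F u v w - F u' v w" and diff2: "F u (v - v') w = F u v w - F u v' w"
 and diff3: "F u v (w - w') = F u v w - F u v w'"
 using add1[of u "- u'"] add2[of u v "- v'"] add3[of u v w "- w'"] by (simp_all add: minus1 minus2 minus3)

lemma telescope: "F u v w - F a b c = F (u - a) v w + F a (v - b) w + F a b (w - c)"
 by (simp add: diff1 diff2 diff3)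

lemma tendsto:
 assumes "(u \<longlongrightarrow> a) net" "(v \<longlongrightarrow> b) net" "(w \<longlongrightarrow> c) net"
 shows "((%t. F (u t) (v t) (w t)) \<longlongrightarrow> F a b c) net"
proof -
 have "((%t. F (u t) (v t) (w t) - F a b c) \<longlongrightarrow> 0) net"
 proof (rule Lim_null_comparison)
 show "\<forall>\<^sub>F t in net. norm (F (u t) (v t) (w t) - F a b c) \<le>
 K * norm (u t - a) * norm (v t) * norm (w t) + K * norm a * norm (v t - b) * norm (w t)
 + K * norm a * norm b * norm (w t - c)"
 unfolding telescope
 by (intro always_eventually allI order_trans[OF norm_triangle_ineq] add_mono norm_le)
 have 0: "((%t. norm (u t - a)) \<longlongrightarrow> 0) net" "((%t. norm (v t - b)) \<longlongrightarrow> 0) net"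
 "((%t. norm (w t - c)) \<longlongrightarrow> 0) net"
 using assms LIM_zero tendsto_norm_zero by blast+
 show "((%t. K * norm (u t - a) * norm (v t) * norm (w t) + K * norm a * norm (v t - b) * norm (w t)
 + K * norm a * norm b * norm (w t - c)) \<longlongrightarrow> 0) net"
 using 0 assms by (auto intro!: tendsto_eq_intros)
 qed
 then show ?thesis by (simp add: LIM_zero_cancel)
qed

lemma continuous_on:
 "continuous_on S u ==> continuous_on S v ==> continuous_on S w ==> continuous_on S (%t. F (u t) (v t) (w t))"
 unfolding continuous_on_def by (blast intro: tendsto)

lemma has_vector_derivative:
 assumes u: "(u has_vector_derivative u') (at t within S)" and v: "(v has_vector_derivative v') (at t within S)"
 and w: "(w has_vector_derivative w') (at t within S)"
 shows "((%t. F (u t) (v t) (w t)) has_vector_derivative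
 (F u' (v t) (w t) + F (u t) v' (w t) + F (u t) (v t) w')) (at t within S)"
proof -
 have c: "(u \<longlongrightarrow> u t) (at t within S)" "(v \<longlongrightarrow> v t) (at t within S)" "(w \<longlongrightarrow> w t) (at t within S)"
 using assms has_vector_derivative_continuous continuous_within by blast+
 have q: "(F (u s) (v s) (w s) - F (u t) (v t) (w t)) /\<^sub>R (s - t) =
 F ((u s - u t) /\<^sub>R (s - t)) (v s) (w s) + F (u t) ((v s - v t) /\<^sub>R (s - t)) (w s)
 + F (u t) (v t) ((w s - w t) /\<^sub>R (s - t))" for s
 unfolding telescope scale1 scale2 scale3 by (simp add: scaleR_add_right)
 show ?thesis
 unfolding has_vector_derivative_iff_quotient q
 by (intro tendsto_add tendsto c tendsto_const assms[unfolded has_vector_derivative_iff_quotient])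
qed

lemma lipschitz:
 assumes "norm u <= B" "norm v <= B"
 shows "norm (F u u u - F v v v) <= 3 * K * B^2 * norm (u - v)"
proof -
 have "0 <= B" using assms(1) norm_ge_zero order_trans by blast
 have "norm (F u u u - F v v v) <= K * norm (u - v) * norm u * norm u
 + K * norm v * norm (u - v) * norm u + K * norm v * norm v * norm (u - v)"
 unfolding telescope
 by (intro order_trans[OF norm_triangle_ineq] add_mono norm_le)
 also have "... <= K * norm (u - v) * B * B + K * B * norm (u - v) * B + K * B * B * norm (u - v)"
 using assms K_nonneg \<open>0 <= B\<close> by (intro add_mono mult_mono mult_nonneg_nonneg) auto
 finally show ?thesis by (simp add: power2_eq_square algebra_simps)
qed

lemma uminus: "bounded_trilinear (%u v w. - F u v w)"
 by unfold_locales (use norm_le in \<open>auto simp: add1 add2 add3 scale1 scale2 scale3\<close>)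

end

definition cubic_sol :: "('a::real_normed_vector => 'a => 'a => 'a) => real set => (real => 'a) => bool" where
 "cubic_sol F J u \<longleftrightarrow> (\<forall>t\<in>J. (u has_vector_derivative F (u t) (u t) (u t)) (at t within J))"

lemma cubic_solD: "cubic_sol F J u ==> t : J ==> (u has_vector_derivative F (u t) (u t) (u t)) (at t within J)"
 by (simp add: cubic_sol_def)

lemma cubic_sol_subset: "cubic_sol F J u ==> I \<subseteq> J ==> cubic_sol F I u"
 unfolding cubic_sol_def by (blast intro: has_vector_derivative_within_subset)

lemma cubic_sol_continuous: "cubic_sol F J u ==> continuous_on J u"
 unfolding cubic_sol_def continuous_on_eq_continuous_within
 by (blast intro: has_vector_derivative_continuous)

lemma cubic_sol_shift:
 assumes "cubic_sol F {0..b} v" shows "cubic_sol F {a..a + b} (%t. v (t - a))"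
 unfolding cubic_sol_def
proof
 fix t assume t: "t : {a..a+b}"
 have im: "(%t. t - a) ` {a..a+b} = {0..b}"
 by simp
 have "((v \<circ> (%t. t - a)) has_vector_derivative 1 *R F (v (t - a)) (v (t - a)) (v (t - a))) (at t within {a..a+b})"
 proof (rule vector_diff_chain_within)
 show "((%t. t - a) has_vector_derivative 1) (at t within {a..a + b})"
 by (auto intro!: derivative_eq_intros)
 show "(v has_vector_derivative F (v (t - a)) (v (t - a)) (v (t - a))) (at (t - a) within (%t. t - a) ` {a..a + b})"
 unfolding im using t by (intro cubic_solD[OF assms]) auto
 qed
 then show "((%t. v (t - a)) has_vector_derivative F (v (t - a)) (v (t - a)) (v (t - a))) (at t within {a..a+b})"
 by (simp add: o_def)
qed

lemma cubic_sol_reverse: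
 assumes "cubic_sol F J u" shows "cubic_sol (%u v w. - F u v w) (uminus ` J) (%t. u (- t))"
 unfolding cubic_sol_def
proof
 fix t assume t: "t : uminus ` J"
 have im: "uminus ` uminus ` J = J" by (auto simp: image_iff)
 have "((u \<circ> uminus) has_vector_derivative (-1) *R F (u (- t)) (u (- t)) (u (- t))) (at t within uminus ` J)"
 proof (rule vector_diff_chain_within)
 show "(uminus has_vector_derivative -1) (at t within uminus ` J)"
 by (auto intro!: derivative_eq_intros)
 show "(u has_vector_derivative F (u (- t)) (u (- t)) (u (- t))) (at (- t) within uminus ` uminus ` J)"
 unfolding im using t by (intro cubic_solD[OF assms]) auto
 qed
 then show "((%t. u (- t)) has_vector_derivative - F (u (- t)) (u (- t)) (u (- t))) (at t within uminus ` J)"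
 by (simp add: o_def)
qed

lemma cubic_sol_join:
 assumes u: "cubic_sol F {a..b} u" and v: "cubic_sol F {b..c} v" and e: "u b = v b" and "a <= b" "b <= c"
 shows "cubic_sol F {a..c} (%t. if t <= b then u t else v t)"
 unfolding cubic_sol_def
proof
 fix t assume t: "t : {a..c}"
 let ?w = "%t. if t <= b then u t else v t"
 have un: "{a..c} = {a..b} \<union> {b..c}" using assms by auto
 have 1: "(?w has_vector_derivative F (?w t) (?w t) (?w t)) (at t within {a..b})"
 proof (cases "t <= b")
 case True
 with t have "t : {a..b}" by auto
 show ?thesis
 by (rule has_vector_derivative_transform[OF \<open>t \<in> {a..b}\<close> _ ])
 (use cubic_solD[OF u \<open>t \<in> {a..b}\<close>] True in auto)
 next
 case False
 then have "t \<notin> closure ({a..b} - {t})"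
 using closure_mono[of "{a..b} - {t}" "{a..b}"] by auto
 then have "at t within {a..b} = bot"
 by (simp add: at_within_eq_bot_iff)
 then show ?thesis unfolding has_vector_derivative_iff_quotient by simp
 qed
 have 2: "(?w has_vector_derivative F (?w t) (?w t) (?w t)) (at t within {b..c})"
 proof (cases "t >= b")
 case True
 with t have tc: "t : {b..c}" by auto
 have w: "?w s = v s" if "s : {b..c}" for s using that e by auto
 show ?thesis
 unfolding w[OF tc]
 by (rule has_vector_derivative_transform[OF tc _ cubic_solD[OF v tc]]) (use w in auto)
 next
 case False
 then have "t \<notin> closure ({b..c} - {t})"
 using closure_mono[of "{b..c} - {t}" "{b..c}"] by auto
 then have "at t within {b..c} = bot"
 by (simp add: at_within_eq_bot_iff)
 then show ?thesis unfolding has_vector_derivative_iff_quotient by simp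
 qed
 show "(?w has_vector_derivative F (?w t) (?w t) (?w t)) (at t within {a..c})"
 using 1 2 unfolding un has_vector_derivative_iff_quotient Lim_within_Un by blast
qed

lemma integral_in_closed_subspace:
 fixes g :: "real => 'a::banach"
 assumes "closed W" "subspace W" "g integrable_on {a..b}" "!!s. s : {a..b} ==> g s : W"
 shows "integral {a..b} g : W"
proof -
 have "\<exists>y\<in>W. dist y (integral {a..b} g) < e" if "e > 0" for e
 proof -
 have "(g has_integral integral {a..b} g) (cbox a b)"
 using integrable_integral[OF assms(3)] unfolding box_real .
 then have "\<exists>\<gamma>. gauge \<gamma> & (\<forall>D. D tagged_division_of cbox a b & \<gamma> fine D -->
 norm ((\<Sum>(x,k)\<in>D. Henstock_Kurzweil_Integration.content k *R g x) - integral {a..b} g) < e)"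
 using \<open>e > 0\<close> by (simp only: has_integral)
 then obtain \<gamma> where \<gamma>: "gauge \<gamma>" and
 fin: "!!D. D tagged_division_of cbox a b ==> \<gamma> fine D ==>
 norm ((\<Sum>(x,k)\<in>D. Henstock_Kurzweil_Integration.content k *R g x) - integral {a..b} g) < e"
 by auto
 obtain D where D: "D tagged_division_of cbox a b" "\<gamma> fine D" using fine_division_exists[OF \<gamma>] by blast
 have "(\<Sum>(x,k)\<in>D. Henstock_Kurzweil_Integration.content k *R g x) : W"
 proof (rule subspace_sum[OF assms(2)])
 fix z assume z: "z : D"
 obtain x k where zk: "z = (x,k)" by fastforce
 have "x : {a..b}" using tag_in_interval[OF D(1)] z zk by auto
 then show "(case z of (x,k) => Henstock_Kurzweil_Integration.content k *R g x) : W"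
 using assms zk by (auto intro: subspace_scale)
 qed
 then show ?thesis using fin[OF D] by (auto simp: dist_norm)
 qed
 then have "integral {a..b} g : closure W" by (simp add: closure_approachable)
 then show ?thesis using assms(1) by simp
qed

lemma cubic_sol_integral:
 fixes u :: "real => 'a::banach"
 assumes "cubic_sol F {0..T} u" "t : {0..T}"
 shows "((%s. F (u s) (u s) (u s)) has_integral (u t - u 0)) {0..t}"
 by (rule fundamental_theorem_of_calculus)
 (use assms in \<open>auto intro: cubic_solD[OF cubic_sol_subset[OF assms(1)]]\<close>)

lemma nonincreasing_on_interval:
 fixes g :: "real => real"
 assumes d: "!!t. t : {0..T} ==> (g has_real_derivative g' t) (at t within {0..T})"
 and n: "!!t. t : {0..T} ==> g' t <= 0" and t: "t : {0..T}"
 shows "g t <= g 0"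
proof (rule DERIV_nonpos_imp_decreasing_open[of 0 t g])
 show "0 <= t" using t by auto
next
 fix s assume that: "0 < s" "s < t"
 have "s : interior {0..T}" using that t by auto
 then have "at s within {0..T} = at s" by (rule at_within_interior)
 then show "\<exists>y. (g has_real_derivative y) (at s) & y <= 0"
 using d[of s] n[of s] that t by auto
next
 show "continuous_on {0..t} g"
 proof (rule continuous_on_subset)
 show "continuous_on {0..T} g" by (rule DERIV_continuous_on[OF d])
 qed (use t in auto)
qed

lemma gronwall:
 fixes y :: "real => real"
 assumes y: "continuous_on {0..T} y" and L: "0 <= L"
 and le: "!!t. t : {0..T} ==> y t <= A + L * integral {0..t} y" and t: "t : {0..T}"
 shows "y t <= A * exp (L * t)"
proof -
 define G where "G t = (A + L * integral {0..t} y) * exp (- L * t)" for t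
 have dI: "((%t. integral {0..t} y) has_real_derivative y t) (at t within {0..T})" if "t : {0..T}" for t
 using integral_has_real_derivative[OF y that] .
 have "(G has_real_derivative L * (y t - (A + L * integral {0..t} y)) * exp (- L * t)) (at t within {0..T})"
 if "t : {0..T}" for t
 unfolding G_def by (auto intro!: derivative_eq_intros dI[OF that] simp: algebra_simps)
 moreover have "L * (y t - (A + L * integral {0..t} y)) * exp (- L * t) <= 0" if "t : {0..T}" for t
 using le[OF that] L by (simp add: mult_nonneg_nonpos mult_nonpos_nonneg)
 ultimately have "G t <= G 0" by (rule nonincreasing_on_interval) (use t in auto)
 then have "(A + L * integral {0..t} y) * exp (- L * t) <= A" by (simp add: G_def)
 then have "A + L * integral {0..t} y <= A * exp (L * t)"
 by (simp add: exp_minus field_simps)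
 with le[OF t] show ?thesis by simp
qed

text \<open>The comparison equation \<open>z' = C (1 + z) (1 + ln (1 + z))\<close> makes \<open>1 + ln (1 + z)\<close> grow exponentially, so \<open>z\<close> stays finite.\<close>

lemma log_growth:
 fixes y :: "real => real"
 assumes y: "continuous_on {0..T} y" and K: "0 <= K" and A: "0 <= A"
 and pos: "!!t. t : {0..T} ==> 0 <= y t"
 and le: "!!t. t : {0..T} ==> y t <= A + integral {0..t} (%s. K * (1 + y s) * (1 + ln (1 + y s)))"
 and t: "t : {0..T}"
 shows "y t <= exp (exp (K * T) * (1 + ln (1 + A)))"
proof -
 define w where "w s = K * (1 + y s) * (1 + ln (1 + y s))" for s
 have w0: "0 <= w s" if "s : {0..T}" for s
 using pos[OF that] K by (simp add: w_def)
 have wc: "continuous_on {0..T} w"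
 unfolding w_def by (intro continuous_intros y ballI) (drule pos, simp)
 define P where "P t = A + integral {0..t} w" for t
 have P0: "A <= P t" if "t : {0..T}" for t
 proof -
 have "w integrable_on {0..t}"
 using that by (intro integrable_continuous_interval continuous_on_subset[OF wc]) auto
 then have "0 <= integral {0..t} w"
 using that w0 by (intro integral_nonneg) auto
 then show ?thesis by (simp add: P_def)
 qed
 define G where "G t = exp (- K * t) * (1 + ln (1 + P t))" for t
 have dP: "(P has_real_derivative w t) (at t within {0..T})" if "t : {0..T}" for t
 unfolding P_def using integral_has_real_derivative[OF wc that] by (auto intro!: derivative_eq_intros)
 have "(G has_real_derivative exp (- K * t) * (w t / (1 + P t) - K * (1 + ln (1 + P t)))) (at t within {0..T})"
 if "t : {0..T}" for t
 proof -
 have "0 < 1 + P t" using P0[OF that] A by simp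
 have "((%t. ln (1 + P t)) has_real_derivative w t / (1 + P t)) (at t within {0..T})"
 using \<open>0 < 1 + P t\<close> by (auto intro!: derivative_eq_intros dP[OF that])
 moreover have "((%t. exp (- K * t)) has_real_derivative - K * exp (- K * t)) (at t within {0..T})"
 by (auto intro!: derivative_eq_intros)
 ultimately have "(G has_real_derivative
 exp (- K * t) * (0 + w t / (1 + P t)) + - K * exp (- K * t) * (1 + ln (1 + P t))) (at t within {0..T})"
 unfolding G_def[abs_def] by (intro DERIV_mult' DERIV_add DERIV_const)
 then show ?thesis by (simp add: algebra_simps)
 qed
 moreover have "exp (- K * t) * (w t / (1 + P t) - K * (1 + ln (1 + P t))) <= 0" if "t : {0..T}" for t
 proof -
 have yP: "y t <= P t" using le[OF that] by (simp add: P_def w_def[abs_def])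
 have p: "0 < 1 + P t" using P0[OF that] A by simp
 have "w t <= K * (1 + P t) * (1 + ln (1 + P t))"
 unfolding w_def using K yP pos[OF that] by (intro mult_mono) auto
 then have "w t / (1 + P t) <= K * (1 + ln (1 + P t))"
 using p by (simp add: divide_simps mult_ac)
 then show ?thesis by (simp add: mult_nonneg_nonpos)
 qed
 ultimately have "G t <= G 0" by (rule nonincreasing_on_interval) (use t in auto)
 then have "1 + ln (1 + P t) <= exp (K * t) * (1 + ln (1 + A))"
 by (simp add: G_def P_def exp_minus field_simps)
 also have "... <= exp (K * T) * (1 + ln (1 + A))"
 using t K A by (intro mult_right_mono) (auto simp: mult_left_mono)
 finally have "ln (1 + P t) <= exp (K * T) * (1 + ln (1 + A))" by simp
 then have "exp (ln (1 + P t)) <= exp (exp (K * T) * (1 + ln (1 + A)))"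
 by (rule exp_le_cancel_iff[THEN iffD2])
 then have "1 + P t <= exp (exp (K * T) * (1 + ln (1 + A)))"
 using P0[OF t] A by simp
 moreover have "y t <= P t" using le[OF t] by (simp add: P_def w_def[abs_def])
 ultimately show ?thesis by simp
qed

context bounded_trilinear
begin

text \<open>The contraction principle on bounded continuous curves with values in \<open>W\<close>.\<close>

lemma local_solution_in:
 assumes W: "closed W" "subspace W" "!!w. w : W ==> F w w w : W"
 and R: "0 < R" and tau: "0 < ta" "ta * (12 * K * R^2) <= 1 / 2"
 and u0: "u0 : W" "norm u0 <= R"
 shows "\<exists>u. cubic_sol F {0..ta} u & u 0 = u0 & (\<forall>t\<in>{0..ta}. norm (u t) <= 2 * R & u t : W)"
proof -
 define S where "S = {u :: real \<Rightarrow>\<^sub>C 'a. \<forall>t. norm (u t) <= 2 * R & u t : W}"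
 define c where "c t = max 0 (min ta t)" for t :: real
 have c: "c t : {0..ta}" for t using tau by (auto simp: c_def)
 have c_id: "c t = t" if "t : {0..ta}" for t using that by (auto simp: c_def)
 define G where "G u t = u0 + integral {0..c t} (%s. F (apply_bcontfun u s) (u s) (u s))" for u t
 have Fc: "continuous_on A (%s. F (apply_bcontfun u s) (u s) (u s))" for A u
 by (intro continuous_on continuous_on_apply_bcontfun continuous_on_id)
 have Fi: "(%s. F (apply_bcontfun u s) (u s) (u s)) integrable_on {0..c t}" for u t
 by (intro integrable_continuous_interval Fc)
 have GW: "G u t : W" if "u : S" for u t
 unfolding G_def using that
 by (intro subspace_add W u0 integral_in_closed_subspace Fi) (auto simp: S_def)
 have GR: "norm (G u t) <= 2 * R" if "u : S" for u t
 proof -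
 have "norm (F (u s) (u s) (u s)) <= K * (2 * R) * (2 * R) * (2 * R)" for s
 proof -
 have "norm (u s) <= 2 * R" using that by (auto simp: S_def)
 then show ?thesis
 using R K_nonneg by (intro order_trans[OF norm_le] mult_mono) auto
 qed
 then have "norm (integral {0..c t} (%s. F (u s) (u s) (u s))) <= K * (2 * R) * (2 * R) * (2 * R) * (c t - 0)"
 using c[of t] by (intro integral_bound) (auto intro: Fc)
 also have "... <= K * (2 * R) * (2 * R) * (2 * R) * ta"
 using c[of t] R K_nonneg by (intro mult_left_mono) auto
 also have "... = 2 / 3 * R * (ta * (12 * K * R^2))" by (simp add: power2_eq_square)
 also have "... <= 2 / 3 * R * (1 / 2)" using tau R by (intro mult_left_mono) auto
 also have "... <= R" using R by simp
 finally show ?thesis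
 unfolding G_def using u0(2) norm_triangle_ineq[of u0 "integral {0..c t} (%s. F (u s) (u s) (u s))"] by linarith
 qed
 have Gc: "continuous_on UNIV (G u)" for u
 proof -
 have "continuous_on {0..ta} (%t. integral {0..t} (%s. F (u s) (u s) (u s)))"
 by (intro indefinite_integral_continuous_1 integrable_continuous_interval Fc)
 moreover have "continuous_on UNIV c" unfolding c_def by (intro continuous_intros)
 ultimately have "continuous_on UNIV (%t. integral {0..c t} (%s. F (u s) (u s) (u s)))"
 using c by (auto intro: continuous_on_compose2)
 then show ?thesis unfolding G_def[abs_def] by (intro continuous_intros)
 qed
 have Gb: "G u : bcontfun" if "u : S" for u
 using GR[OF that] Gc by (auto intro!: bcontfun_normI)
 define Ph where "Ph u = Bcontfun (G u)" for u
 have Ph: "apply_bcontfun (Ph u) t = G u t" if "u : S" for u t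
 using Gb[OF that] by (simp add: Ph_def Bcontfun_inverse)
 have "uniform_space_class.complete S"
 unfolding complete_eq_closed closed_sequential_limits
 proof (intro allI impI)
 fix x l assume x: "(\<forall>n. x n : S) & x ----> l"
 have lim: "(%n. apply_bcontfun (x n) t) ----> l t" for t
 proof (rule metric_tendsto_imp_tendsto)
 show "x ----> l" using x by simp
 qed (simp add: dist_bounded)
 have "norm (l t) <= 2 * R" for t
 by (rule LIMSEQ_le_const2[OF tendsto_norm[OF lim[of t]]]) (use x in \<open>auto simp: S_def\<close>)
 moreover have "l t : W" for t
 by (rule closed_sequentially[OF W(1) _ lim[of t]]) (use x in \<open>auto simp: S_def\<close>)
 ultimately show "l : S" by (simp add: S_def)
 qed
 moreover have "S ~= {}"
 proof -
 have "const_bcontfun u0 : S" using u0 R by (simp add: S_def)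
 then show ?thesis by blast
 qed
 moreover have "Ph ` S \<subseteq> S" using GW GR Ph by (auto simp: S_def)
 moreover have "!!u v. u : S ==> v : S ==> dist (Ph u) (Ph v) <= 1 / 2 * dist u v"
 proof -
 fix u v assume uv: "u : S" "v : S"
 show "dist (Ph u) (Ph v) <= 1 / 2 * dist u v"
 proof (rule dist_bound)
 fix t
 have b: "norm (F (u s) (u s) (u s) - F (v s) (v s) (v s)) <= 3 * K * (2 * R)^2 * dist u v" for s
 proof -
 have "norm (F (u s) (u s) (u s) - F (v s) (v s) (v s)) <= 3 * K * (2 * R)^2 * norm (u s - v s)"
 using uv by (intro lipschitz) (auto simp: S_def)
 also have "... <= 3 * K * (2 * R)^2 * dist u v"
 using K_nonneg dist_bounded[of u s v] by (intro mult_left_mono) (auto simp: dist_norm)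
 finally show ?thesis .
 qed
 have "dist (Ph u t) (Ph v t) = norm (integral {0..c t} (%s. F (u s) (u s) (u s) - F (v s) (v s) (v s)))"
 using uv by (simp add: Ph G_def dist_norm integral_diff Fi)
 also have "... <= 3 * K * (2 * R)^2 * dist u v * (c t - 0)"
 using c[of t] b by (intro integral_bound continuous_on_diff Fc) auto
 also have "... <= 3 * K * (2 * R)^2 * dist u v * ta"
 using c[of t] K_nonneg by (intro mult_left_mono) auto
 also have "... = ta * (12 * K * R^2) * dist u v" by (simp add: power2_eq_square)
 also have "... <= 1 / 2 * dist u v" using tau by (intro mult_right_mono) auto
 finally show "dist (Ph u t) (Ph v t) <= 1 / 2 * dist u v" .
 qed
 qed
 ultimately have "\<exists>!u\<in>S. Ph u = u" by (intro Banach_fix[where c="1/2"]) auto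
 then obtain u where u: "u : S" "Ph u = u" by blast
 have ut: "u t = u0 + integral {0..t} (%s. F (u s) (u s) (u s))" if "t : {0..ta}" for t
 using Ph[OF u(1), of t] u(2) c_id[OF that] by (simp add: G_def)
 have "cubic_sol F {0..ta} u"
 unfolding cubic_sol_def
 proof
 fix t assume t: "t : {0..ta}"
 have "((%t. u0 + integral {0..t} (%s. F (u s) (u s) (u s))) has_vector_derivative 0 + F (u t) (u t) (u t)) (at t within {0..ta})"
 by (intro has_vector_derivative_add has_vector_derivative_const integral_has_vector_derivative Fc t)
 then show "(u has_vector_derivative F (u t) (u t) (u t)) (at t within {0..ta})"
 using ut t by (auto intro: has_vector_derivative_transform)
 qed
 moreover have "u 0 = u0" using ut[of 0] tau by simp
 ultimately show ?thesis using u(1) by (intro exI[of _ "apply_bcontfun u"]) (auto simp: S_def)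
qed

lemma cubic_sol_dist:
 assumes u: "cubic_sol F {0..T} u" and v: "cubic_sol F {0..T} v"
 and B: "!!t. t : {0..T} ==> norm (u t) <= B" "!!t. t : {0..T} ==> norm (v t) <= B" and t: "t : {0..T}"
 shows "norm (u t - v t) <= norm (u 0 - v 0) * exp (3 * K * B^2 * t)"
proof (rule gronwall[where y="%t. norm (u t - v t)"])
 show cont: "continuous_on {0..T} (%t. norm (u t - v t))"
 by (intro continuous_intros cubic_sol_continuous[OF u] cubic_sol_continuous[OF v])
 show "0 <= 3 * K * B^2" using K_nonneg by simp
 fix t assume t: "t : {0..T}"
 let ?D = "%s. F (u s) (u s) (u s) - F (v s) (v s) (v s)"
 have "(?D has_integral (u t - u 0) - (v t - v 0)) {0..t}"
 by (intro has_integral_diff cubic_sol_integral[OF u t] cubic_sol_integral[OF v t])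
 then have i: "?D integrable_on {0..t}" "integral {0..t} ?D = (u t - v t) - (u 0 - v 0)"
 by (auto simp: has_integral_integrable integral_unique)
 have c0: "(%s. norm (u s - v s)) integrable_on {0..t}"
 by (rule integrable_continuous_interval, rule continuous_on_subset[OF cont]) (use t in auto)
 have "norm (integral {0..t} ?D) <= integral {0..t} (%s. 3 * K * B^2 * norm (u s - v s))"
 using t B by (intro integral_norm_bound_integral i lipschitz integrable_on_mult_right c0) auto
 also have "... = 3 * K * B^2 * integral {0..t} (%s. norm (u s - v s))" by simp
 finally show "norm (u t - v t) <= norm (u 0 - v 0) + 3 * K * B^2 * integral {0..t} (%s. norm (u s - v s))"
 unfolding i(2) using norm_triangle_ineq2[of "u t - v t" "u 0 - v 0"] by linarith
qed (fact t)

lemma cubic_sol_bounded: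
 assumes "cubic_sol F {a..b} u"
 obtains B where "!!t. t : {a..b} ==> norm (u t) <= B"
proof -
 have "compact (u ` {a..b})"
 by (intro compact_continuous_image cubic_sol_continuous[OF assms] compact_Icc)
 then show ?thesis using that by (meson bounded_iff compact_imp_bounded imageI)
qed

lemma cubic_sol_unique_forward:
 assumes u: "cubic_sol F {0..T} u" and v: "cubic_sol F {0..T} v" and "u 0 = v 0" and t: "t : {0..T}"
 shows "u t = v t"
proof -
 obtain B1 B2 where "!!t. t : {0..T} ==> norm (u t) <= B1" "!!t. t : {0..T} ==> norm (v t) <= B2"
 using cubic_sol_bounded[OF u] cubic_sol_bounded[OF v] by metis
 then have "norm (u t - v t) <= norm (u 0 - v 0) * exp (3 * K * (max B1 B2)^2 * t)"
 by (intro cubic_sol_dist[OF u v _ _ t]) (auto simp: le_max_iff_disj)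
 then show ?thesis using assms(3) by simp
qed

end

lemma reverse_image [simp]: "uminus ` {a..b::real} = {-b..-a}"
 by simp

lemma (in bounded_trilinear) cubic_sol_unique:
 assumes u: "cubic_sol F {a..b} u" and v: "cubic_sol F {a..b} v" and "a <= 0" "0 <= b" "u 0 = v 0" and t: "t : {a..b}"
 shows "u t = v t"
proof (cases "0 <= t")
 case True
 show ?thesis
 by (rule cubic_sol_unique_forward[of b]) (use True assms in \<open>auto intro: cubic_sol_subset\<close>)
next
 case False
 interpret m: bounded_trilinear "%u v w. - F u v w" by (rule uminus)
 have "cubic_sol (%u v w. - F u v w) {0..-a} (%t. u (- t))" "cubic_sol (%u v w. - F u v w) {0..-a} (%t. v (- t))"
 using cubic_sol_reverse[OF u] cubic_sol_reverse[OF v] assms by (auto intro: cubic_sol_subset)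
 from m.cubic_sol_unique_forward[OF this, of "- t"] show ?thesis using False assms by auto
qed

definition a_priori_bounded :: "('a::real_normed_vector => 'a => 'a => 'a) => bool" where
 "a_priori_bounded F \<longleftrightarrow> (\<forall>R T. \<exists>B. \<forall>u ta. 0 <= ta --> ta <= T --> cubic_sol F {0..ta} u --> norm (u 0) <= R -->
 (\<forall>t\<in>{0..ta}. norm (u t) <= B))"

context bounded_trilinear
begin

lemma forward_solution_in:
 assumes ap: "a_priori_bounded F"
 and W: "closed W" "subspace W" "!!w. w : W ==> F w w w : W" and u0: "u0 : W" and T: "0 < T"
 shows "\<exists>u. cubic_sol F {0..T} u & u 0 = u0 & (\<forall>t\<in>{0..T}. u t : W)"
proof -
 obtain B0 where B0: "!!u ta. 0 <= ta ==> ta <= T ==> cubic_sol F {0..ta} u ==> norm (u 0) <= norm u0 ==>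
 (\<forall>t\<in>{0..ta}. norm (u t) <= B0)"
 using ap unfolding a_priori_bounded_def by meson
 define B where "B = max 1 (max B0 (norm u0))"
 have B: "0 < B" "norm u0 <= B" "B0 <= B" by (auto simp: B_def)
 obtain N :: nat where N: "T * (24 * K * B^2) <= real N" using real_arch_simple by blast
 define n where "n = Suc N"
 have n: "T * (24 * K * B^2) <= real n" "0 < real n" using N by (auto simp: n_def)
 define ta where "ta = T / n"
 have ta: "0 < ta" "ta * (12 * K * B^2) <= 1 / 2" "n * ta = T"
 using n T by (auto simp: ta_def field_simps)
 have "k <= n ==> k > 0 ==> \<exists>u. cubic_sol F {0..k * ta} u & u 0 = u0 & (\<forall>t\<in>{0..k * ta}. u t : W)" for k :: nat
 proof (induction k)
 case (Suc k)
 show ?case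
 proof (cases "k = 0")
 case True
 then show ?thesis using local_solution_in[OF W B(1) ta(1,2) u0 B(2)] by auto
 next
 case False
 with Suc obtain u where u: "cubic_sol F {0..k * ta} u" "u 0 = u0" "\<forall>t\<in>{0..k * ta}. u t : W" by auto
 have kT: "0 <= k * ta" "k * ta <= T" using Suc.prems ta(1) unfolding ta(3)[symmetric] by auto
 have "norm (u (k * ta)) <= B" using B0[OF kT u(1)] u(2) kT B(3) by force
 then obtain v where v: "cubic_sol F {0..ta} v" "v 0 = u (k * ta)" "\<forall>t\<in>{0..ta}. v t : W"
 using local_solution_in[OF W B(1) ta(1,2), of "u (k * ta)"] u(3) kT by auto
 define w where "w t = (if t <= k * ta then u t else v (t - k * ta))" for t
 have "cubic_sol F {0..k * ta + ta} w"
 unfolding w_def[abs_def]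
 by (rule cubic_sol_join[OF u(1) cubic_sol_shift[OF v(1)]]) (use v(2) kT ta(1) in auto)
 moreover have "w 0 = u0" using u(2) kT by (simp add: w_def)
 moreover have "\<forall>t\<in>{0..k * ta + ta}. w t : W" using u(3) v(3) by (auto simp: w_def)
 ultimately show ?thesis by (intro exI[of _ w]) (auto simp: algebra_simps)
 qed
 qed simp
 from this[of n] show ?thesis using ta(3) n by auto
qed

text \<open>Reversing time turns \<open>F\<close> into \<open>-F\<close>, so that both directions are covered by forward solutions.\<close>

theorem global_solution_in:
 assumes ap: "a_priori_bounded F" "a_priori_bounded (%u v w. - F u v w)"
 and W: "closed W" "subspace W" "!!w. w : W ==> F w w w : W" and u0: "u0 : W"
 shows "\<exists>u. cubic_sol F UNIV u & u 0 = u0 & (\<forall>t. u t : W)"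
proof -
 interpret m: bounded_trilinear "%u v w. - F u v w" by (rule uminus)
 have "\<exists>u. cubic_sol F {-T..T} u & u 0 = u0 & (\<forall>t\<in>{-T..T}. u t : W)" if T: "0 < T" for T
 proof -
 obtain u where u: "cubic_sol F {0..T} u" "u 0 = u0" "\<forall>t\<in>{0..T}. u t : W"
 using forward_solution_in[OF ap(1) W u0 T] by blast
 obtain v where v: "cubic_sol (%u v w. - F u v w) {0..T} v" "v 0 = u0" "\<forall>t\<in>{0..T}. v t : W"
 using m.forward_solution_in[OF ap(2) W(1,2) subspace_neg[OF W(2) W(3)] u0 T] by blast
 have "cubic_sol F {-T..0} (%t. v (- t))" using cubic_sol_reverse[OF v(1)] by simp
 then have "cubic_sol F {-T..T} (%t. if t <= 0 then v (- t) else u t)"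
 by (rule cubic_sol_join[OF _ u(1)]) (use u v T in auto)
 moreover have "(if t <= 0 then v (- t) else u t) : W" if "t : {-T..T}" for t using u v that by auto
 ultimately show ?thesis using v(2) by (intro exI[of _ "%t. if t <= 0 then v (- t) else u t"]) auto
 qed
 then have "\<exists>V. \<forall>T>0. cubic_sol F {-T..T} (V T) & V T 0 = u0 & (\<forall>t\<in>{-T..T}. V T t : W)"
 by metis
 then obtain V where V: "!!T. T > 0 ==> cubic_sol F {-T..T} (V T)" "!!T. T > 0 ==> V T 0 = u0"
 "!!T t. T > 0 ==> t : {-T..T} ==> V T t : W" by blast
 define u where "u t = V (\<bar>t\<bar> + 1) t" for t
 have uV: "u t = V T t" if "\<bar>t\<bar> <= T" "0 < T" for t T
 proof -
 define m where "m = min T (\<bar>t\<bar> + 1)"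
 have m: "0 < m" "m <= T" "m <= \<bar>t\<bar> + 1" "t : {-m..m}" using that by (auto simp: m_def)
 show ?thesis unfolding u_def
 by (rule cubic_sol_unique[of "-m" m])
 (use m V in \<open>auto intro!: cubic_sol_subset[OF V(1)]\<close>)
 qed
 have "(u has_vector_derivative F (u t) (u t) (u t)) (at t)" for t
 proof -
 define T where "T = \<bar>t\<bar> + 1"
 have t: "t : {-T<..<T}" "0 < T" by (auto simp: T_def)
 have tT: "t : {-T..T}" using t by auto
 have "at t within {-T..T} = at t" using t by (intro at_within_interior) (simp add: interior_atLeastAtMost_real)
 with cubic_solD[OF V(1)[OF t(2)] tT] have "(V T has_vector_derivative F (u t) (u t) (u t)) (at t)"
 using uV[of t T] t(2) by (simp add: T_def)
 then show ?thesis
 proof (rule has_vector_derivative_transform_within_open)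
 show "open {-T<..<T}" "t : {-T<..<T}" using t by auto
 show "V T s = u s" if "s : {-T<..<T}" for s using uV[of s T] t that by auto
 qed
 qed
 moreover have "u 0 = u0" using V(2)[of 1] by (simp add: u_def)
 moreover have "u t : W" for t unfolding u_def by (rule V(3)) auto
 ultimately show ?thesis by (auto simp: cubic_sol_def)
qed

lemma cubic_sol_log_growth:
 assumes u: "cubic_sol F {0..T} u" and C: "0 <= C"
 and g: "!!t. t : {0..T} ==> norm (F (u t) (u t) (u t)) <= C * (1 + norm (u t)) * (1 + ln (1 + norm (u t)))"
 and t: "t : {0..T}"
 shows "norm (u t) <= exp (exp (C * T) * (1 + ln (1 + norm (u 0))))"
proof (rule log_growth[where y="%t. norm (u t)"])
 show cont: "continuous_on {0..T} (%t. norm (u t))"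
 by (intro continuous_intros cubic_sol_continuous[OF u])
 fix t assume t: "t : {0..T}"
 have i: "(%s. F (u s) (u s) (u s)) integrable_on {0..t}" "integral {0..t} (%s. F (u s) (u s) (u s)) = u t - u 0"
 using cubic_sol_integral[OF u t] by (auto simp: has_integral_integrable integral_unique)
 have n0: "1 + norm z ~= 0" for z :: 'a using norm_ge_zero[of z] by linarith
 have "continuous_on {0..T} (%s. C * (1 + norm (u s)) * (1 + ln (1 + norm (u s))))"
 by (intro continuous_intros cont) (simp add: n0)
 then have c0: "(%s. C * (1 + norm (u s)) * (1 + ln (1 + norm (u s)))) integrable_on {0..t}"
 by (intro integrable_continuous_interval, elim continuous_on_subset) (use t in auto)
 have "norm (integral {0..t} (%s. F (u s) (u s) (u s))) <= integral {0..t} (%s. C * (1 + norm (u s)) * (1 + ln (1 + norm (u s))))"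
 using t g by (intro integral_norm_bound_integral i c0) auto
 then show "norm (u t) <= norm (u 0) + integral {0..t} (%s. C * (1 + norm (u s)) * (1 + ln (1 + norm (u s))))"
 unfolding i(2) using norm_triangle_ineq2[of "u t" "u 0"] by linarith
qed (use C t in auto)

end

section \<open>Rotations and changes of variables in the plane\<close>

lemma rot_nth [simp]: "rot x $ 1 = - x $ 2" "rot x $ 2 = x $ 1"
 by (simp_all add: rot_def vector_2)

lemma vec2_eq_iff: "(x::real^2) = y \<longleftrightarrow> x $ 1 = y $ 1 & x $ 2 = y $ 2"
 by (simp add: vec_eq_iff forall_2)

lemma linear_rot: "linear rot"
 by (rule linearI) (simp_all add: vec2_eq_iff)

lemma rot_add: "rot (x + y) = rot x + rot y" and rot_scaleR: "rot (c *R x) = c *R rot x"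
 and rot_minus: "rot (- x) = - rot x" and rot_diff: "rot (x - y) = rot x - rot y" and rot_rot: "rot (rot x) = - x"
 and rot_zero [simp]: "rot 0 = 0"
 by (simp_all add: vec2_eq_iff)

lemma inner_vec2: "(x::real^2) \<bullet> y = x $ 1 * y $ 1 + x $ 2 * y $ 2"
 by (simp add: inner_vec_def sum_2)

lemma continuous_rot: "continuous_on UNIV rot"
 by (rule linear_continuous_on) (simp add: linear_conv_bounded_linear[symmetric] linear_rot)

lemma borel_measurable_rot [measurable]: "rot : bmf"
 by (rule borel_measurable_continuous_onI[OF continuous_rot])

lemma norm_similarity: "(norm (a *R x + b *R rot x))^2 = (a^2 + b^2) * (norm x)^2"
 unfolding power2_norm_eq_inner by (simp add: inner_vec2 power2_eq_square algebra_simps)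

lemma lborel_similarity:
 assumes "a ~= 0 | b ~= 0"
 shows "lborel = density (distr lborel borel (%x. t + (a *R x + b *R rot x))) (%_. en (a^2 + b^2))"
proof (rule lborel_eqI)
 let ?d = "a^2 + b^2"
 have d: "?d > 0" using assms by (metis sum_power2_gt_zero_iff)
 define c where "c = 1 / ?d"
 have c: "c * ?d = 1" "0 < c" using d by (auto simp: c_def simp del: sum_power2_gt_zero_iff)
 define L where "L x = (c * a) *R x + (- (c * b)) *R rot x" for x
 have L: "linear L" unfolding L_def[abs_def]
 by (rule linearI) (simp_all add: rot_add rot_scaleR algebra_simps)
 have mat: "det (matrix L) = c"
 proof -
 have "matrix L = (\<chi> i j. if i = 1 then (if j = 1 then c * a else c * b) else (if j = 1 then - (c * b) else c * a))"
 by (simp add: matrix_def L_def vec_eq_iff forall_2 axis_def)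
 then have "det (matrix L) = c * (c * ?d)"
 by (simp add: det_2 power2_eq_square algebra_simps)
 then show ?thesis using c by simp
 qed
 have inv: "t + (a *R L y + b *R rot (L y)) = t + y" "L (a *R x + b *R rot x) = x" for x y
 proof -
 have "a *R L y + b *R rot (L y) = (c * ?d) *R y"
 by (simp add: vec2_eq_iff L_def power2_eq_square algebra_simps)
 then show "t + (a *R L y + b *R rot (L y)) = t + y" using c by simp
 have "L (a *R x + b *R rot x) = (c * ?d) *R x"
 by (simp add: vec2_eq_iff L_def power2_eq_square algebra_simps)
 then show "L (a *R x + b *R rot x) = x" using c by simp
 qed
 fix l u :: "real^2" assume lu: "!!b. b : Basis ==> l \<bullet> b <= u \<bullet> b"
 have eq: "(%x. t + (a *R x + b *R rot x)) -` box l u = L ` box (l - t) (u - t)"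
 proof (intro set_eqI iffI)
 fix x assume "x : (%x. t + (a *R x + b *R rot x)) -` box l u"
 then have "a *R x + b *R rot x : box (l - t) (u - t)"
 by (auto simp: box_def inner_diff_left inner_add_left algebra_simps)
 then show "x : L ` box (l - t) (u - t)" by (metis inv(2) imageI)
 next
 fix x assume "x : L ` box (l - t) (u - t)"
 then obtain y where y: "y : box (l - t) (u - t)" "x = L y" by blast
 have "t + (a *R x + b *R rot x) = t + y" unfolding y(2) by (rule inv(1))
 also have "t + y : box l u"
 using y(1) by (auto simp: box_def inner_diff_left inner_add_left algebra_simps)
 finally show "x : (%x. t + (a *R x + b *R rot x)) -` box l u" by simp
 qed
 have [measurable]: "(%x. t + (a *R x + b *R rot x)) : borel \<rightarrow>\<^sub>M borel" by measurable
 have oL: "L ` box (l - t) (u - t) : sets borel"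
 unfolding eq[symmetric] using measurable_sets[of "%x. t + (a *R x + b *R rot x)" borel borel "box l u"] by simp
 have bx: "box (l - t) (u - t) : lmeasurable" by simp
 have "measure lebesgue (L ` box (l - t) (u - t)) = c * measure lebesgue (box (l - t) (u - t))"
 unfolding measure_linear_image[OF L bx] mat using c(2) by simp
 moreover have "L ` box (l - t) (u - t) : lmeasurable" by (rule measurable_linear_image[OF L bx])
 ultimately have e: "emeasure lborel (L ` box (l - t) (u - t)) = en (c * measure lborel (box (l - t) (u - t)))"
 using oL by (simp add: fmeasurable_def emeasure_eq_ennreal_measure measure_completion)
 show "emeasure (density (distr lborel borel (%x. t + (a *R x + b *R rot x))) (%_. ennreal ?d)) (box l u) =
 en (\<Prod>b\<in>Basis. (u - l) \<bullet> b)"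
 proof -
 have "emeasure (density (distr lborel borel (%x. t + (a *R x + b *R rot x))) (%_. ennreal ?d)) (box l u)
 = ennreal ?d * emeasure lborel (L ` box (l - t) (u - t))"
 by (simp add: emeasure_density nn_integral_cmult_indicator emeasure_distr eq del: ennreal_plus)
 also have "... = en (measure lborel (box (l - t) (u - t)))"
 proof -
 have "ennreal ?d * en (c * measure lborel (box (l - t) (u - t))) = en ((c * ?d) * measure lborel (box (l - t) (u - t)))"
 using c d by (subst ennreal_mult[symmetric]) (auto simp: mult_ac)
 then show ?thesis unfolding e c by simp
 qed
 also have "measure lborel (box (l - t) (u - t)) = (\<Prod>b\<in>Basis. (u - l) \<bullet> b)"
 using lu by (subst measure_lborel_box_eq) (auto simp: inner_diff_left intro!: prod.cong)
 finally show ?thesis .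
 qed
qed simp

lemma nn_integral_similarity:
 assumes "a ~= 0 | b ~= 0" and [measurable]: "f : bmf"
 shows "(NN x. f (t + (a *R x + b *R rot x))) = en (1 / (a^2 + b^2)) * (NN x. f x)"
proof -
 have d: "a^2 + b^2 > 0" using assms(1) by (metis sum_power2_gt_zero_iff)
 have "(NN x. f x) = en (a^2 + b^2) * (NN x. f (t + (a *R x + b *R rot x)))"
 by (subst lborel_similarity[OF assms(1), of t])
 (simp add: nn_integral_density nn_integral_distr nn_integral_cmult del: ennreal_plus)
 then show ?thesis using d assms(1) by (auto simp: mult.assoc[symmetric] ennreal_mult[symmetric] simp del: ennreal_plus)
qed

lemma AE_similarity:
 assumes "a ~= 0 | b ~= 0" and "AE x in lborel. P x"
 shows "AE x in lborel. P (t + (a *R x + b *R rot x))"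
proof -
 have d: "a^2 + b^2 > 0" using assms(1) by (metis sum_power2_gt_zero_iff)
 obtain N where N: "{x. ~ P x} \<subseteq> N" "N : sets borel" "emeasure lborel N = 0"
 using assms(2) by (auto elim!: AE_E)
 have "(NN x. ind N (t + (a *R x + b *R rot x))) = 0"
 using N by (subst nn_integral_similarity[OF assms(1)]) auto
 then have "AE x in lborel. ind N (t + (a *R x + b *R rot x)) = (0::ennreal)"
 using N by (subst (asm) nn_integral_0_iff_AE) auto
 then show ?thesis by eventually_elim (use N in \<open>auto simp: indicator_def split: if_splits\<close>)
qed

lemma nn_integral_translate:
 fixes f :: "real^2 => ennreal"
 assumes [measurable]: "f : bmf"
 shows "(NN x. f (t + x)) = (NN x. f x)"
 using nn_integral_similarity[of 1 0 f t] by simp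

section \<open>Bounds for the trilinear operator\<close>

text \<open>
 The four points \<open>xi\<close>, \<open>xi + x\<close>, \<open>xi + x + l rot x\<close>, \<open>xi + l rot x\<close> are the vertices of a rectangle.
\<close>

definition abs_op :: "(real^2 => ennreal) => (real^2 => ennreal) => (real^2 => ennreal) => real^2 => ennreal" where
 "abs_op f g h xi = (NN l. ind {-1..1} l *
 (NN x. f (xi + x) * g (xi + x + l *R rot x) * h (xi + l *R rot x)))"

lemma borel_measurable_abs_op [measurable]:
 assumes [measurable]: "f : bmf" "g : bmf" "h : bmf"
 shows "abs_op f g h : bmf"
 unfolding abs_op_def[abs_def] by measurable

lemma abs_op_slice_measurable [measurable]:
 assumes [measurable]: "f : bmf" "g : bmf" "h : bmf"
 shows "(%l. NN x. f (xi + x) * g (xi + x + l *R rot x) * h (xi + l *R rot x)) : bmf"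
 by measurable

lemma inverse_1_plus_square_le: "1 / (1 + l^2) <= (1::real)"
 by (simp add: divide_le_eq_1_pos add_pos_nonneg)

lemma rectangle_similarity: "xi + x + l *R rot x = xi + (1 *R x + l *R rot x)"
 "xi + l *R rot x = xi + (0 *R x + l *R rot x)" "xi + x = xi + (1 *R x + 0 *R rot x)"
 by simp_all

lemma nn_integral_opposite_le:
 assumes [measurable]: "g : bmf"
 shows "(NN x. g (xi + x + l *R rot x)) <= (NN x. g x)"
proof -
 have "(NN x. g (xi + x + l *R rot x)) = en (1 / (1^2 + l^2)) * (NN x. g x)"
 unfolding rectangle_similarity(1) by (rule nn_integral_similarity) auto
 also have "... <= 1 * (NN x. g x)"
 by (intro mult_right_mono) (auto simp: ennreal_le_1 inverse_1_plus_square_le)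
 finally show ?thesis by simp
qed

text \<open>Cauchy--Schwarz in \<open>x\<close> splits off the corner \<open>xi + x + l rot x\<close>; in the remaining integral the other two corners are related to \<open>(xi, x)\<close> by a similarity.\<close>

lemma abs_op_L2:
 assumes [measurable]: "f : bmf" "g : bmf" "h : bmf"
 shows "(NN xi. (abs_op f g h xi)^2)
 <= 4 * (NN x. (f x)^2) * (NN x. (g x)^2) * (NN x. (h x)^2)"
proof -
 define G where "G = (NN x. (g x)^2)"
 define I where "I xi l = (NN x. f (xi + x) * g (xi + x + l *R rot x) * h (xi + l *R rot x))" for xi l
 define H where "H xi l = (NN x. (f (xi + x))^2 * (h (xi + l *R rot x))^2)" for xi l
 have [measurable]: "case_prod I : borel_measurable (borel \<Otimes>\<^sub>M borel)" "case_prod H : borel_measurable (borel \<Otimes>\<^sub>M borel)"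
 unfolding I_def[abs_def] H_def[abs_def] by measurable
 have I2: "(I xi l)^2 <= H xi l * G" for xi l
 proof -
 have "(I xi l)^2 = (NN x. (f (xi + x) * h (xi + l *R rot x)) * g (xi + x + l *R rot x))^2"
 by (simp add: I_def mult_ac)
 also have "... <= (NN x. (f (xi + x) * h (xi + l *R rot x))^2) * (NN x. (g (xi + x + l *R rot x))^2)"
 by (rule Cauchy_Schwarz_nn_integral) auto
 also have "... <= H xi l * G"
 unfolding H_def G_def power_mult_distrib
 by (intro mult_left_mono nn_integral_opposite_le[of "%x. (g x)^2"]) auto
 finally show ?thesis .
 qed
 have two: "(NN l. (ind {-1..1::real} l)^2) = (2::ennreal)"
 proof -
 have "(NN l. (ind {-1..1::real} l)^2) = (NN l. ind {-1..1::real} l)"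
 by (intro nn_integral_cong) (auto split: split_indicator)
 then show ?thesis by simp
 qed
 have "(abs_op f g h xi)^2 <= 2 * (NN l. ind {-1..1} l * (H xi l * G))" for xi
 proof -
 have "(abs_op f g h xi)^2 = (NN l. ind {-1..1} l * (ind {-1..1} l * I xi l))^2"
 unfolding abs_op_def I_def by (intro arg_cong[where f="%x. x^2"] nn_integral_cong) (auto split: split_indicator)
 also have "... <= (NN l. (ind {-1..1::real} l)^2) * (NN l. (ind {-1..1} l * I xi l)^2)"
 by (rule Cauchy_Schwarz_nn_integral[of "ind {-1..1}" lborel "%l. ind {-1..1} l * I xi l"]) auto
 also have "... <= 2 * (NN l. ind {-1..1} l * (H xi l * G))"
 unfolding two by (intro mult_left_mono nn_integral_mono) (auto simp: I2 split: split_indicator)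
 finally show ?thesis .
 qed
 then have "(NN xi. (abs_op f g h xi)^2) <= (NN xi. 2 * (NN l. ind {-1..1} l * (H xi l * G)))"
 by (intro nn_integral_mono) auto
 also have "... = 2 * (NN l. (NN xi. ind {-1..1} l * (H xi l * G)))"
 by (subst lborel_pair.Fubini') (auto simp: nn_integral_cmult)
 also have "... = 2 * (NN l. ind {-1..1} l * ((NN xi. H xi l) * G))"
 by (simp add: nn_integral_cmult nn_integral_multc)
 also have "... <= 2 * (\<integral>\<^sup>+l. ind {-1..1} l * ((NN x. (f x)^2) * (NN x. (h x)^2) * G) \<partial>(lborel::real measure))"
 proof (intro mult_left_mono nn_integral_mono mult_right_mono)
 fix l :: real
 have "(NN xi. H xi l) = (NN x. NN xi. (f (xi + x))^2 * (h (xi + l *R rot x))^2)"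
 unfolding H_def by (rule lborel_pair.Fubini'[symmetric]) measurable
 also have "... = (NN x. NN xi. (f xi)^2 * (h (xi + ((-1) *R x + l *R rot x)))^2)"
 proof (rule nn_integral_cong)
 fix x :: "real^2"
 show "(NN xi. (f (xi + x))^2 * (h (xi + l *R rot x))^2) = (NN xi. (f xi)^2 * (h (xi + ((-1) *R x + l *R rot x)))^2)"
 using nn_integral_translate[of "%xi. (f xi)^2 * (h (xi + ((-1) *R x + l *R rot x)))^2" x]
 by (simp add: algebra_simps)
 qed
 also have "... = (NN xi. NN x. (f xi)^2 * (h (xi + ((-1) *R x + l *R rot x)))^2)"
 by (rule lborel_pair.Fubini') measurable
 also have "... = (NN xi. (f xi)^2 * (en (1 / ((-1)^2 + l^2)) * (NN x. (h x)^2)))"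
 by (intro nn_integral_cong, subst nn_integral_cmult, measurable)
 (subst nn_integral_similarity[of "-1" l "%x. (h x)^2"], auto)
 also have "... <= (NN xi. (f xi)^2 * (1 * (NN x. (h x)^2)))"
 by (intro nn_integral_mono mult_left_mono mult_right_mono) (auto simp: ennreal_le_1 inverse_1_plus_square_le)
 also have "... = (NN x. (f x)^2) * (NN x. (h x)^2)"
 by (simp add: nn_integral_multc)
 finally show "(NN xi. H xi l) <= (NN x. (f x)^2) * (NN x. (h x)^2)" .
 qed auto
 also have "... = 2 * (2 * ((NN x. (f x)^2) * (NN x. (h x)^2) * G))"
 by (simp add: nn_integral_multc)
 also have "... = 4 * (NN x. (f x)^2) * G * (NN x. (h x)^2)"
 by (simp add: mult_ac)
 finally show ?thesis by (simp add: G_def)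
qed

lemma borel_measurable_cnj [measurable (raw)]:
 "f : borel_measurable M ==> (%x. cnj (f x)) : borel_measurable M"
 by (rule borel_measurable_continuous_on[OF linear_continuous_on[OF bounded_linear_cnj]])

definition eabs :: "plane_fun => real^2 => ennreal" where "eabs f x = en (cmod (f x))"

lemma borel_measurable_eabs [measurable]: "f : bmf ==> eabs f : bmf"
 unfolding eabs_def[abs_def] by measurable

lemma eabs_power2: "(eabs f x)^2 = en ((cmod (f x))^2)"
 by (simp add: eabs_def ennreal_power)

lemma L2_norm_eabs: "(L2_norm f)^2 = (NN x. (eabs f x)^2)"
 by (simp add: L2_norm_power2 eabs_power2)

text \<open>The integrand of the operator on the product of the \<open>l\<close>-line and the plane.\<close>

definition CR_kernel :: "plane_fun => plane_fun => plane_fun => real^2 => real \<times> (real^2) => complex" where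
 "CR_kernel f g h xi z = ind {-1..1} (fst z) *\<^sub>R
 (f (xi + snd z) * cnj (g (xi + snd z + fst z *R rot (snd z))) * h (xi + fst z *R rot (snd z)))"

lemma borel_measurable_kernel [measurable]:
 assumes [measurable]: "f : bmf" "g : bmf" "h : bmf"
 shows "(%(xi, z). CR_kernel f g h xi z) : borel_measurable (borel \<Otimes>\<^sub>M (borel \<Otimes>\<^sub>M borel))"
 "CR_kernel f g h xi : borel_measurable (borel \<Otimes>\<^sub>M borel)"
 unfolding CR_kernel_def[abs_def] by measurable

lemma nn_integral_norm_kernel:
 assumes [measurable]: "f : bmf" "g : bmf" "h : bmf"
 shows "(\<integral>\<^sup>+z. en (norm (CR_kernel f g h xi z)) \<partial>(lborel2)) = abs_op (eabs f) (eabs g) (eabs h) xi"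
proof -
 have "(\<integral>\<^sup>+z. en (norm (CR_kernel f g h xi z)) \<partial>(lborel2))
 = (NN l. NN x. en (norm (CR_kernel f g h xi (l, x))))"
 by (rule lborel.nn_integral_fst[symmetric]) measurable
 also have "... = abs_op (eabs f) (eabs g) (eabs h) xi"
 unfolding abs_op_def
 by (intro nn_integral_cong, subst nn_integral_cmult[symmetric], measurable)
 (auto simp: CR_kernel_def eabs_def norm_mult ennreal_mult split: split_indicator intro!: nn_integral_cong)
 finally show ?thesis .
qed

definition CR_converges :: "plane_fun => plane_fun => plane_fun => real^2 => bool" where
 "CR_converges f g h xi \<longleftrightarrow> integrable (lborel2) (CR_kernel f g h xi)"

lemma CR_convergesI:
 assumes [measurable]: "f : bmf" "g : bmf" "h : bmf"
 and "abs_op (eabs f) (eabs g) (eabs h) xi < \<infinity>"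
 shows "CR_converges f g h xi"
 unfolding CR_converges_def
 by (rule integrableI_bounded) (use assms(4) in \<open>auto simp: nn_integral_norm_kernel\<close>)

lemma CR_op_kernel:
 assumes "CR_converges f g h xi"
 shows "CR_op f g h xi = (LINT z|(lborel2). CR_kernel f g h xi z)"
 unfolding lborel_pair.integral_fst'[OF assms[unfolded CR_converges_def], symmetric]
 by (simp add: CR_op_def set_lebesgue_integral_def CR_kernel_def)

lemma norm_CR_op_le:
 assumes [measurable]: "f : bmf" "g : bmf" "h : bmf"
 shows "eabs (CR_op f g h) xi <= abs_op (eabs f) (eabs g) (eabs h) xi"
proof (cases "abs_op (eabs f) (eabs g) (eabs h) xi < \<infinity>")
 case True
 have c: "CR_converges f g h xi" by (rule CR_convergesI[OF assms True])
 show ?thesis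
 unfolding eabs_def CR_op_kernel[OF c] nn_integral_norm_kernel[OF assms, symmetric, unfolded eabs_def]
 using integral_norm_bound_ennreal[OF c[unfolded CR_converges_def]] by simp
next
 case False
 then show ?thesis by (simp add: less_top[symmetric])
qed

lemma borel_measurable_CR_op [measurable]:
 assumes [measurable]: "f : bmf" "g : bmf" "h : bmf"
 shows "CR_op f g h : bmf"
 unfolding CR_op_def[abs_def] set_lebesgue_integral_def by measurable

lemma CR_op_add:
 shows "CR_converges f g h xi ==> CR_converges f' g h xi ==> CR_op (%x. f x + f' x) g h xi = CR_op f g h xi + CR_op f' g h xi"
 and "CR_converges f g h xi ==> CR_converges f g' h xi ==> CR_op f (%x. g x + g' x) h xi = CR_op f g h xi + CR_op f g' h xi"
 and "CR_converges f g h xi ==> CR_converges f g h' xi ==> CR_op f g (%x. h x + h' x) xi = CR_op f g h xi + CR_op f g h' xi"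
proof -
 have 1: "CR_kernel (%x. f x + f' x) g h xi = (%z. CR_kernel f g h xi z + CR_kernel f' g h xi z)"
 "CR_kernel f (%x. g x + g' x) h xi = (%z. CR_kernel f g h xi z + CR_kernel f g' h xi z)"
 "CR_kernel f g (%x. h x + h' x) xi = (%z. CR_kernel f g h xi z + CR_kernel f g h' xi z)"
 by (auto simp: CR_kernel_def fun_eq_iff algebra_simps)
 note * = CR_converges_def
 show "CR_op (%x. f x + f' x) g h xi = CR_op f g h xi + CR_op f' g h xi" if c: "CR_converges f g h xi" "CR_converges f' g h xi"
 using c CR_op_kernel[of "%x. f x + f' x" g h xi] CR_op_kernel[OF c(1)] CR_op_kernel[OF c(2)]
 unfolding * 1 by simp
 show "CR_op f (%x. g x + g' x) h xi = CR_op f g h xi + CR_op f g' h xi" if c: "CR_converges f g h xi" "CR_converges f g' h xi"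
 using c CR_op_kernel[of f "%x. g x + g' x" h xi] CR_op_kernel[OF c(1)] CR_op_kernel[OF c(2)]
 unfolding * 1 by simp
 show "CR_op f g (%x. h x + h' x) xi = CR_op f g h xi + CR_op f g h' xi" if c: "CR_converges f g h xi" "CR_converges f g h' xi"
 using c CR_op_kernel[of f g "%x. h x + h' x" xi] CR_op_kernel[OF c(1)] CR_op_kernel[OF c(2)]
 unfolding * 1 by simp
qed

lemma CR_op_scale: "CR_op (%x. c * f x) g h xi = c * CR_op f g h xi"
 "CR_op f (%x. c * g x) h xi = cnj c * CR_op f g h xi"
 "CR_op f g (%x. c * h x) xi = c * CR_op f g h xi"
proof -
 have k: "!!l. (IN x. c * f (xi + x) * cnj (g (xi + x + l *R rot x)) * h (xi + l *R rot x))
 = c * (IN x. f (xi + x) * cnj (g (xi + x + l *R rot x)) * h (xi + l *R rot x))"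
 "!!l. (IN x. f (xi + x) * cnj (c * g (xi + x + l *R rot x)) * h (xi + l *R rot x))
 = cnj c * (IN x. f (xi + x) * cnj (g (xi + x + l *R rot x)) * h (xi + l *R rot x))"
 "!!l. (IN x. f (xi + x) * cnj (g (xi + x + l *R rot x)) * (c * h (xi + l *R rot x)))
 = c * (IN x. f (xi + x) * cnj (g (xi + x + l *R rot x)) * h (xi + l *R rot x))"
 by (simp_all add: integral_mult_right_zero[symmetric] mult_ac del: integral_mult_right_zero)
 show "CR_op (%x. c * f x) g h xi = c * CR_op f g h xi"
 "CR_op f (%x. c * g x) h xi = cnj c * CR_op f g h xi"
 "CR_op f g (%x. c * h x) xi = c * CR_op f g h xi"
 unfolding CR_op_def k set_lebesgue_integral_def mult_scaleR_right[symmetric]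
 by (rule integral_mult_right_zero)+
qed

lemma AE_rectangle:
 assumes f: "AE x in lborel. P x" and g: "AE x in lborel. Q x" and h: "AE x in lborel. R x" and l: "l ~= 0"
 shows "AE x in lborel. P (xi + x) & Q (xi + x + l *R rot x) & R (xi + l *R rot x)"
proof -
 have "AE x in lborel. P (xi + x)" "AE x in lborel. Q (xi + x + l *R rot x)" "AE x in lborel. R (xi + l *R rot x)"
 using AE_similarity[OF _ f, of 1 0 xi] AE_similarity[OF _ g, of 1 l xi] AE_similarity[OF _ h, of 0 l xi] l
 by (simp_all add: add.assoc)
 then show ?thesis by eventually_elim simp
qed

lemma AE_nonzero: "AE l in lborel. l ~= (0::real)"
 by (rule AE_lborel_singleton)

lemma CR_op_cong_AE:
 assumes [measurable]: "f : bmf" "g : bmf" "h : bmf"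
 "f' : bmf" "g' : bmf" "h' : bmf"
 and e: "AE x in lborel. f x = f' x" "AE x in lborel. g x = g' x" "AE x in lborel. h x = h' x"
 shows "CR_op f g h = CR_op f' g' h'"
proof
 fix xi
 show "CR_op f g h xi = CR_op f' g' h' xi"
 unfolding CR_op_def set_lebesgue_integral_def
 proof (rule integral_cong_AE, measurable, use AE_nonzero in eventually_elim)
 fix l :: real assume l: "l ~= 0"
 have "(IN x. f (xi + x) * cnj (g (xi + x + l *R rot x)) * h (xi + l *R rot x)) =
 (IN x. f' (xi + x) * cnj (g' (xi + x + l *R rot x)) * h' (xi + l *R rot x))"
 by (rule integral_cong_AE, measurable, use AE_rectangle[OF e l, of xi] in eventually_elim) simp
 then show "indicat_real {- 1..1} l *R (IN x. f (xi + x) * cnj (g (xi + x + l *R rot x)) * h (xi + l *R rot x)) =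
 indicat_real {- 1..1} l *R (IN x. f' (xi + x) * cnj (g' (xi + x + l *R rot x)) * h' (xi + l *R rot x))"
 by simp
 qed
qed

lemma abs_op_mono_AE:
 assumes e: "AE x in lborel. f x <= f' x" "AE x in lborel. g x <= g' x" "AE x in lborel. h x <= h' x"
 shows "abs_op f g h xi <= abs_op f' g' h' xi"
 unfolding abs_op_def
proof (rule nn_integral_mono_AE, use AE_nonzero in eventually_elim)
 fix l :: real assume l: "l ~= 0"
 show "ind {-1..1} l * (NN x. f (xi + x) * g (xi + x + l *R rot x) * h (xi + l *R rot x))
 <= ind {-1..1} l * (NN x. f' (xi + x) * g' (xi + x + l *R rot x) * h' (xi + l *R rot x))"
 by (rule mult_left_mono, rule nn_integral_mono_AE, use AE_rectangle[OF e l, of xi] in eventually_elim)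
 (auto intro!: mult_mono)
qed

lemma fun_spaceD: "f : fun_space N ==> f : bmf" "f : fun_space N ==> N f < \<infinity>"
 by (auto simp: fun_space_def)

lemma L2_norm_CR_op:
 assumes [measurable]: "f : bmf" "g : bmf" "h : bmf"
 shows "L2_norm (CR_op f g h) <= 2 * L2_norm f * L2_norm g * L2_norm h"
proof (subst ennreal_power2_le_iff[symmetric])
 have "(L2_norm (CR_op f g h))^2 <= (NN xi. (abs_op (eabs f) (eabs g) (eabs h) xi)^2)"
 unfolding L2_norm_eabs by (intro nn_integral_mono power_mono norm_CR_op_le) auto
 also have "... <= 4 * (L2_norm f)^2 * (L2_norm g)^2 * (L2_norm h)^2"
 unfolding L2_norm_eabs by (rule abs_op_L2) auto
 also have "... = (2 * L2_norm f * L2_norm g * L2_norm h)^2"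
 by (simp add: power_mult_distrib)
 finally show "(L2_norm (CR_op f g h))^2 <= (2 * L2_norm f * L2_norm g * L2_norm h)^2" .
qed

lemma CR_converges_L2:
 assumes f: "f : fun_space L2_norm" and g: "g : fun_space L2_norm" and h: "h : fun_space L2_norm"
 shows "AE xi in lborel. CR_converges f g h xi"
proof -
 have [measurable]: "f : bmf" "g : bmf" "h : bmf"
 using assms by (auto dest: fun_spaceD)
 have "(NN xi. (abs_op (eabs f) (eabs g) (eabs h) xi)^2) <= 4 * (L2_norm f)^2 * (L2_norm g)^2 * (L2_norm h)^2"
 unfolding L2_norm_eabs by (rule abs_op_L2) auto
 also have "... < \<infinity>"
 using assms[THEN fun_spaceD(2)] by (simp add: ennreal_mult_less_top power_less_top_ennreal)
 finally have "AE xi in lborel. (abs_op (eabs f) (eabs g) (eabs h) xi)^2 ~= \<infinity>"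
 by (intro nn_integral_PInf_AE) auto
 then show ?thesis
 by eventually_elim (rule CR_convergesI, auto simp: less_top[symmetric])
qed

subsection \<open>Weights\<close>

lemma jbr_ge_1: "1 <= jbr x" and jbr_pos [simp]: "0 < jbr x" and jbr_nonneg [simp]: "0 <= jbr x" and jbr_neq_0 [simp]: "jbr x ~= 0"
proof -
 show 1: "1 <= jbr x" by (simp add: jbr_def)
 then show "0 < jbr x" "0 <= jbr x" "jbr x ~= 0" by linarith+
qed

lemma jbr_power2: "(jbr x)^2 = 1 + (norm x)^2"
 by (simp add: jbr_def add_nonneg_nonneg)

lemma borel_measurable_jbr [measurable]: "jbr : bmf"
 unfolding jbr_def[abs_def] by measurable

lemma rectangle_norms: "(norm xi)^2 + (norm (xi + x + l *R rot x))^2 = (norm (xi + x))^2 + (norm (xi + l *R rot x))^2"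
 unfolding power2_norm_eq_inner by (simp add: inner_vec2 algebra_simps)

lemma jbr_rectangle:
 assumes "0 <= s"
 shows "jbr xi powr s <= 2 powr s * (jbr (xi + x) powr s + jbr (xi + l *R rot x) powr s)"
proof -
 let ?a = "jbr (xi + x)" and ?c = "jbr (xi + l *R rot x)"
 have "(jbr xi)^2 <= ?a\<^sup>2 + ?c\<^sup>2"
 unfolding jbr_power2 using rectangle_norms[of xi x l] zero_le_power2[of "norm (xi + x + l *R rot x)"] by linarith
 also have "... <= (?a + ?c)^2" by (simp add: power2_sum)
 finally have "jbr xi <= ?a + ?c" by (rule power2_le_imp_le) simp
 also have "... <= 2 * max ?a ?c" by simp
 finally have "jbr xi powr s <= (2 * max ?a ?c) powr s" using assms by (intro powr_mono2) auto
 also have "... = 2 powr s * (max ?a ?c) powr s" by (rule powr_mult)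
 also have "... <= 2 powr s * (?a powr s + ?c powr s)" by (intro mult_left_mono) (auto simp: max_def)
 finally show ?thesis .
qed

definition wt :: "real => real^2 => ennreal" where "wt s x = en (jbr x powr s)"

lemma borel_measurable_wt [measurable]: "wt s : bmf"
 unfolding wt_def[abs_def] by measurable

text \<open>The weight at \<open>xi\<close> is at most a multiple of the sum of the weights at the two adjacent corners.\<close>

lemma abs_op_weight:
 assumes [measurable]: "f : bmf" "g : bmf" "h : bmf" and s: "0 <= s"
 shows "wt s xi * abs_op f g h xi <= en (2 powr s) * (abs_op (%x. wt s x * f x) g h xi + abs_op f g (%x. wt s x * h x) xi)"
proof -
 have w: "wt s xi <= en (2 powr s) * (wt s (xi + x) + wt s (xi + l *R rot x))" for x l
 using jbr_rectangle[OF s, of xi x l] unfolding wt_def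
 by (simp add: ennreal_plus[symmetric] ennreal_mult[symmetric] ennreal_leI del: ennreal_plus)
 have "wt s xi * abs_op f g h xi = (NN l. ind {-1..1} l *
 (NN x. wt s xi * (f (xi + x) * g (xi + x + l *R rot x) * h (xi + l *R rot x))))"
 unfolding abs_op_def by (simp add: nn_integral_cmult[symmetric] mult_ac)
 also have "... <= (NN l. ind {-1..1} l *
 (NN x. en (2 powr s) * (wt s (xi + x) + wt s (xi + l *R rot x)) *
 (f (xi + x) * g (xi + x + l *R rot x) * h (xi + l *R rot x))))"
 by (intro nn_integral_mono mult_left_mono mult_right_mono w) auto
 also have "... = (NN l. en (2 powr s) * (
 ind {-1..1} l * (NN x. (wt s (xi + x) * f (xi + x)) * g (xi + x + l *R rot x) * h (xi + l *R rot x))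
 + ind {-1..1} l * (NN x. f (xi + x) * g (xi + x + l *R rot x) * (wt s (xi + l *R rot x) * h (xi + l *R rot x)))))"
 proof (rule nn_integral_cong)
 fix l :: real
 have "(NN x. en (2 powr s) * (wt s (xi + x) + wt s (xi + l *R rot x)) *
 (f (xi + x) * g (xi + x + l *R rot x) * h (xi + l *R rot x)))
 = (NN x. en (2 powr s) * ((wt s (xi + x) * f (xi + x)) * g (xi + x + l *R rot x) * h (xi + l *R rot x)
 + f (xi + x) * g (xi + x + l *R rot x) * (wt s (xi + l *R rot x) * h (xi + l *R rot x))))"
 by (intro nn_integral_cong) (simp add: distrib_left distrib_right mult_ac)
 also have "... = en (2 powr s) * ((NN x. (wt s (xi + x) * f (xi + x)) * g (xi + x + l *R rot x) * h (xi + l *R rot x))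
 + (NN x. f (xi + x) * g (xi + x + l *R rot x) * (wt s (xi + l *R rot x) * h (xi + l *R rot x))))"
 by (subst nn_integral_cmult, measurable, subst nn_integral_add, measurable)
 finally show "ind {-1..1} l * (NN x. en (2 powr s) * (wt s (xi + x) + wt s (xi + l *R rot x)) *
 (f (xi + x) * g (xi + x + l *R rot x) * h (xi + l *R rot x))) = en (2 powr s) * (
 ind {-1..1} l * (NN x. (wt s (xi + x) * f (xi + x)) * g (xi + x + l *R rot x) * h (xi + l *R rot x))
 + ind {-1..1} l * (NN x. f (xi + x) * g (xi + x + l *R rot x) * (wt s (xi + l *R rot x) * h (xi + l *R rot x))))"
 by (simp add: distrib_left mult_ac)
 qed
 also have "... = en (2 powr s) * (abs_op (%x. wt s x * f x) g h xi + abs_op f g (%x. wt s x * h x) xi)"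
 unfolding abs_op_def by (subst nn_integral_cmult, measurable, subst nn_integral_add, measurable)
 finally show ?thesis .
qed

lemma eabs_weight: "eabs (%x. (jbr x powr s) *R f x) x = wt s x * eabs f x"
 by (simp add: eabs_def wt_def ennreal_mult)

lemma L2w_norm_power2: "(L2w_norm s f)^2 = (NN x. (wt s x * eabs f x)^2)"
 unfolding L2w_norm_def L2_norm_eabs eabs_weight ..

lemma L2w_norm_mono:
 assumes "s <= s'" shows "L2w_norm s f <= L2w_norm s' f"
proof (subst ennreal_power2_le_iff[symmetric], unfold L2w_norm_power2, intro nn_integral_mono power_mono mult_right_mono)
 show "wt s x <= wt s' x" for x
 unfolding wt_def using assms jbr_ge_1[of x] by (intro ennreal_leI powr_mono) auto
qed auto

lemma L2w_norm_0: "L2w_norm 0 f = L2_norm f"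
 by (simp add: L2w_norm_def)

lemma L2_norm_le_L2w: "0 <= s ==> L2_norm f <= L2w_norm s f"
 using L2w_norm_mono[of 0 s f] by (simp add: L2w_norm_0)

lemma ennreal_power2_sum_le: "(a + b)^2 <= 2 * (a^2 + b^2)" for a b :: ennreal
proof -
 have "2 * a * b <= a^2 + b^2"
 by (rule sum_of_squares_ge_ennreal)
 then have "a^2 + b^2 + 2 * a * b <= a^2 + b^2 + (a^2 + b^2)" by (intro add_left_mono)
 then show ?thesis by (simp add: power2_eq_square distrib_left distrib_right mult_2 mult_2_right mult_ac add_ac)
qed

lemma L2w_norm_CR_op:
 assumes [measurable]: "f : bmf" "g : bmf" "h : bmf" and s: "0 <= s"
 shows "L2w_norm s (CR_op f g h) <= en (3 * 2 powr s) *
 (L2w_norm s f * L2_norm g * L2_norm h + L2_norm f * L2_norm g * L2w_norm s h)"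
proof (subst ennreal_power2_le_iff[symmetric])
 define A where "A xi = abs_op (%x. wt s x * eabs f x) (eabs g) (eabs h) xi" for xi
 define B where "B xi = abs_op (eabs f) (eabs g) (%x. wt s x * eabs h x) xi" for xi
 have [measurable]: "A : bmf" "B : bmf"
 unfolding A_def[abs_def] B_def[abs_def] by measurable
 let ?c = "en (2 powr s)"
 let ?P = "L2w_norm s f * L2_norm g * L2_norm h" and ?Q = "L2_norm f * L2_norm g * L2w_norm s h"
 have "(L2w_norm s (CR_op f g h))^2 <= (NN xi. (?c * (A xi + B xi))^2)"
 unfolding L2w_norm_power2
 proof (intro nn_integral_mono power_mono)
 fix xi
 have "wt s xi * eabs (CR_op f g h) xi <= wt s xi * abs_op (eabs f) (eabs g) (eabs h) xi"
 by (intro mult_left_mono norm_CR_op_le) auto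
 also have "... <= ?c * (A xi + B xi)"
 unfolding A_def B_def by (rule abs_op_weight) (use s in auto)
 finally show "wt s xi * eabs (CR_op f g h) xi <= ?c * (A xi + B xi)" .
 qed auto
 also have "... <= (NN xi. ?c\<^sup>2 * (2 * ((A xi)^2 + (B xi)^2)))"
 unfolding power_mult_distrib by (intro nn_integral_mono mult_left_mono ennreal_power2_sum_le) auto
 also have "... = ?c\<^sup>2 * (2 * ((NN xi. (A xi)^2) + (NN xi. (B xi)^2)))"
 by (subst nn_integral_cmult, measurable, subst nn_integral_cmult, measurable, subst nn_integral_add, measurable)
 also have "... <= ?c\<^sup>2 * (2 * (4 * ?P\<^sup>2 + 4 * ?Q\<^sup>2))"
 proof (intro mult_left_mono add_mono)
 show "(NN xi. (A xi)^2) <= 4 * ?P\<^sup>2"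
 unfolding A_def power_mult_distrib L2w_norm_power2 L2_norm_eabs mult.assoc[symmetric]
 using abs_op_L2[of "%x. wt s x * eabs f x" "eabs g" "eabs h"] by (simp add: power_mult_distrib)
 show "(NN xi. (B xi)^2) <= 4 * ?Q\<^sup>2"
 unfolding B_def power_mult_distrib L2w_norm_power2 L2_norm_eabs mult.assoc[symmetric]
 using abs_op_L2[of "eabs f" "eabs g" "%x. wt s x * eabs h x"] by (simp add: power_mult_distrib)
 qed auto
 also have "... = ?c\<^sup>2 * (8 * (?P\<^sup>2 + ?Q\<^sup>2))" by (simp add: distrib_left mult.assoc[symmetric])
 also have "... <= ?c\<^sup>2 * (9 * (?P + ?Q)^2)"
 proof (intro mult_left_mono mult_mono)
 show "?P\<^sup>2 + ?Q\<^sup>2 <= (?P + ?Q)^2"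
 by (simp add: power2_eq_square distrib_left distrib_right add_increasing add_mono le_add1 add.assoc)
 qed auto
 also have "... = (en (3 * 2 powr s) * (?P + ?Q))^2"
 by (simp add: power_mult_distrib ennreal_mult mult_ac)
 finally show "(L2w_norm s (CR_op f g h))^2 <= (en (3 * 2 powr s) * (?P + ?Q))^2" .
qed

section \<open>Radial integrals\<close>

lemma cball_borel [measurable]: "cball (c::real^2) r : sets borel"
 by simp

lemma nn_integral_dilate:
 fixes f :: "real^2 => ennreal"
 assumes [measurable]: "f : bmf" and r: "r ~= 0"
 shows "(NN x. f x) = en (r^2) * (NN x. f (r *R x))"
 using nn_integral_similarity[of r 0 f 0] r
 by (simp add: mult.assoc[symmetric] ennreal_mult[symmetric])

lemma nn_integral_annuli_finite:
 assumes q: "0 < q" "q powr (2 - al) < 1" and p: "0 < p" "p <= p'"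
 shows "(NN z. en (norm z powr - al) * ind {z::real^2. \<exists>n::nat. q ^ n * p < norm z & norm z <= q ^ n * p'} z) < \<infinity>"
proof -
 define A where "A n = {z::real^2. q ^ n * p < norm z & norm z <= q ^ n * p'}" for n :: nat
 have [measurable]: "A n : sets borel" for n
 unfolding A_def by measurable
 define I where "I = (NN z. en (norm z powr - al) * ind (A 0) z)"
 define m where "m = max (p powr - al) (p' powr - al)"
 have "I <= (NN z. en m * ind (cball (0::real^2) p') z)"
 unfolding I_def
 proof (rule nn_integral_mono)
 fix z :: "real^2"
 have "norm z powr - al <= m" if "p < norm z" "norm z <= p'"
 proof (cases "0 <= al")
 case True
 then have "norm z powr - al <= p powr - al" using that p by (intro powr_mono2') auto
 then show ?thesis by (simp add: m_def)
 next
 case False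
 then have "norm z powr - al <= p' powr - al" using that p by (intro powr_mono2) auto
 then show ?thesis by (simp add: m_def)
 qed
 then show "en (norm z powr - al) * ind (A 0) z <= en m * ind (cball 0 p') z"
 by (auto simp: A_def split: split_indicator intro: ennreal_leI)
 qed
 also have "... = en m * emeasure lborel (cball (0::real^2) p')"
 by (simp add: nn_integral_cmult_indicator)
 also have "... < \<infinity>"
 using emeasure_bounded_finite[of "cball (0::real^2) p'"] by (simp add: ennreal_mult_less_top)
 finally have I: "I < \<infinity>" .
 have scale: "(NN z. en (norm z powr - al) * ind (A n) z) = en ((q powr (2 - al)) ^ n) * I" for n
 proof -
 have qn: "q ^ n > 0" using q by simp
 have "(NN z. en (norm z powr - al) * ind (A n) z)
 = en ((q ^ n)^2) * (NN z. en (norm (q ^ n *R z) powr - al) * ind (A n) (q ^ n *R z))"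
 by (rule nn_integral_dilate, measurable, rule less_imp_neq[OF qn, symmetric])
 also have "(NN z. en (norm (q ^ n *R z) powr - al) * ind (A n) (q ^ n *R z))
 = (NN z. en ((q ^ n) powr - al) * (en (norm z powr - al) * ind (A 0) z))"
 proof (rule nn_integral_cong)
 fix z :: "real^2"
 have "ind (A n) (q ^ n *R z) = (ind (A 0) z :: ennreal)"
 proof -
 have "norm (q ^ n *R z) = q ^ n * norm z" using q by simp
 then show ?thesis unfolding A_def indicator_def using qn by simp
 qed
 moreover have "norm (q ^ n *R z) powr - al = (q ^ n) powr - al * norm z powr - al"
 using qn q by (simp add: powr_mult abs_of_pos)
 ultimately show "en (norm (q ^ n *R z) powr - al) * ind (A n) (q ^ n *R z)
 = en ((q ^ n) powr - al) * (en (norm z powr - al) * ind (A 0) z)"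
 by (simp add: ennreal_mult mult.assoc)
 qed
 also have "... = en ((q ^ n) powr - al) * I"
 unfolding I_def by (subst nn_integral_cmult) auto
 also have "en ((q ^ n)^2) * (en ((q ^ n) powr - al) * I) = en ((q powr (2 - al)) ^ n) * I"
 proof -
 have "(q ^ n)^2 * (q ^ n) powr - al = (q ^ n) powr (2 - al)"
 using qn by (simp add: powr_diff powr_minus divide_inverse powr_numeral)
 also have "... = (q powr (2 - al)) ^ n"
 using q by (simp add: powr_realpow[symmetric] powr_powr mult.commute)
 finally show ?thesis by (simp add: mult.assoc[symmetric] ennreal_mult[symmetric])
 qed
 finally show ?thesis .
 qed
 have "(NN z. en (norm z powr - al) * ind {z::real^2. \<exists>n::nat. q ^ n * p < norm z & norm z <= q ^ n * p'} z)
 <= (NN z. (\<Sum>n. en (norm z powr - al) * ind (A n) z))"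
 proof (rule nn_integral_mono)
 fix z :: "real^2"
 show "en (norm z powr - al) * ind {z. \<exists>n::nat. q ^ n * p < norm z & norm z <= q ^ n * p'} z
 <= (\<Sum>n. en (norm z powr - al) * ind (A n) z)"
 proof (cases "\<exists>n::nat. q ^ n * p < norm z & norm z <= q ^ n * p'")
 case True
 then obtain n where n: "z : A n" by (auto simp: A_def)
 have "en (norm z powr - al) = (\<Sum>m\<in>{n}. en (norm z powr - al) * ind (A m) z)" using n by simp
 also have "... <= (\<Sum>n. en (norm z powr - al) * ind (A n) z)" by (rule sum_le_suminf) auto
 finally show ?thesis using True by simp
 qed simp
 qed
 also have "... = (\<Sum>n. en ((q powr (2 - al)) ^ n) * I)"
 by (subst nn_integral_suminf) (auto simp: scale)
 also have "... = en (\<Sum>n. (q powr (2 - al)) ^ n) * I"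
 using q by (simp add: ennreal_suminf_multc suminf_ennreal2 summable_geometric)
 also have "... < \<infinity>" using I by (simp add: ennreal_mult_less_top)
 finally show ?thesis .
qed

definition "inner_mass al = (NN z. en (norm z powr - al) * ind {z::real^2. norm z <= 1} z)"
definition "outer_mass al = (NN z. en (norm z powr - al) * ind {z::real^2. 1 < norm z} z)"

lemma inner_mass_finite:
 assumes "al < 2" shows "inner_mass al < \<infinity>"
proof -
 have "inner_mass al <= (NN z. en (norm z powr - al) * ind {z::real^2. \<exists>n::nat. (1/2) ^ n * (1/2) < norm z & norm z <= (1/2) ^ n * 1} z)"
 unfolding inner_mass_def
 proof (rule nn_integral_mono)
 fix z :: "real^2"
 have "\<exists>n::nat. (1/2) ^ n * (1/2) < norm z & norm z <= (1/2) ^ n * 1" if z: "z ~= 0" "norm z <= 1"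
 proof -
 define n where "n = (LEAST n. (1/2::real) ^ n * (1/2) < norm z)"
 obtain k where "(1/2::real) ^ k < norm z" using real_arch_pow_inv[of "norm z" "1/2"] z by auto
 then have "(1/2::real) ^ k * (1/2) < norm z" using zero_less_power[of "1/2::real" k] by linarith
 then have n: "(1/2::real) ^ n * (1/2) < norm z" unfolding n_def by (rule LeastI)
 have "norm z <= (1/2) ^ n"
 proof (cases n)
 case (Suc m)
 then have "~ (1/2::real) ^ m * (1/2) < norm z" using not_less_Least[of m "%n. (1/2::real) ^ n * (1/2) < norm z"] by (simp add: n_def)
 then show ?thesis using Suc by simp
 qed (use z in simp)
 with n show ?thesis by auto
 qed
 then show "en (norm z powr - al) * ind {z. norm z <= 1} z
 <= en (norm z powr - al) * ind {z. \<exists>n::nat. (1/2) ^ n * (1/2) < norm z & norm z <= (1/2) ^ n * 1} z"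
 by (cases "z = 0") (auto split: split_indicator)
 qed
 also have "... < \<infinity>"
 proof (rule nn_integral_annuli_finite)
 show "(1/2::real) powr (2 - al) < 1" using assms powr01_less_one[of "1/2" "2 - al"] by simp
 qed auto
 finally show ?thesis .
qed

lemma outer_mass_finite:
 assumes "2 < al" shows "outer_mass al < \<infinity>"
proof -
 have "outer_mass al <= (NN z. en (norm z powr - al) * ind {z::real^2. \<exists>n::nat. 2 ^ n * 1 < norm z & norm z <= 2 ^ n * 2} z)"
 unfolding outer_mass_def
 proof (rule nn_integral_mono)
 fix z :: "real^2"
 have "\<exists>n::nat. 2 ^ n * 1 < norm z & norm z <= 2 ^ n * 2" if z: "1 < norm z"
 proof -
 define n where "n = (LEAST n. norm z <= (2::real) ^ n * 2)"
 obtain k where "norm z < (2::real) ^ k" using real_arch_pow[of 2 "norm z"] by auto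
 then have "norm z <= (2::real) ^ k * 2" using zero_less_power[of "2::real" k] by linarith
 then have n: "norm z <= (2::real) ^ n * 2" unfolding n_def by (rule LeastI)
 have "2 ^ n < norm z"
 proof (cases n)
 case (Suc m)
 then have "~ norm z <= (2::real) ^ m * 2" using not_less_Least[of m "%n. norm z <= (2::real) ^ n * 2"] by (simp add: n_def)
 then show ?thesis using Suc by simp
 qed (use z in simp)
 with n show ?thesis by auto
 qed
 then show "en (norm z powr - al) * ind {z. 1 < norm z} z
 <= en (norm z powr - al) * ind {z. \<exists>n::nat. 2 ^ n * 1 < norm z & norm z <= 2 ^ n * 2} z"
 by (auto split: split_indicator)
 qed
 also have "... < \<infinity>"
 proof (rule nn_integral_annuli_finite)
 show "(2::real) powr (2 - al) < 1" using assms powr_less_mono[of "2 - al" 0 "2::real"] by simp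
 qed auto
 finally show ?thesis .
qed

lemma inner_mass_scaled:
 fixes p :: "real^2"
 assumes r: "0 < r"
 shows "(NN z. en (norm (z - p) powr - al) * ind {z. norm (z - p) <= r} z) = en (r powr (2 - al)) * inner_mass al"
 and outer_mass_scaled:
 "(NN z. en (norm (z - p) powr - al) * ind {z. r < norm (z - p)} z) = en (r powr (2 - al)) * outer_mass al"
proof -
 have "(NN z. en (norm (z - p) powr - al) * ind S (norm (z - p)))
 = en (r powr (2 - al)) * (\<integral>\<^sup>+z. en (norm z powr - al) * ind S (r * norm z) \<partial>(lborel :: (real^2) measure))"
 if [measurable]: "S : sets borel" for S
 proof -
 have "(NN z. en (norm (z - p) powr - al) * ind S (norm (z - p)))
 = (\<integral>\<^sup>+z. en (norm z powr - al) * ind S (norm z) \<partial>(lborel :: (real^2) measure))"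
 using nn_integral_translate[of "%z. en (norm z powr - al) * ind S (norm z)" "- p"] by simp
 also have "... = en (r^2) * (\<integral>\<^sup>+z. en (norm (r *R z) powr - al) * ind S (norm (r *R z)) \<partial>(lborel :: (real^2) measure))"
 by (rule nn_integral_dilate) (use r in auto)
 also have "(\<integral>\<^sup>+z. en (norm (r *R z) powr - al) * ind S (norm (r *R z)) \<partial>(lborel :: (real^2) measure))
 = (\<integral>\<^sup>+z. en (r powr - al) * (en (norm z powr - al) * ind S (r * norm z)) \<partial>(lborel :: (real^2) measure))"
 using r by (intro nn_integral_cong) (simp add: powr_mult ennreal_mult mult.assoc)
 also have "... = en (r powr - al) * (\<integral>\<^sup>+z. en (norm z powr - al) * ind S (r * norm z) \<partial>(lborel :: (real^2) measure))"
 by (rule nn_integral_cmult) measurable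
 also have "en (r^2) * (en (r powr - al) * X) = en (r powr (2 - al)) * X" for X
 using r by (simp add: mult.assoc[symmetric] ennreal_mult[symmetric] powr_diff powr_minus divide_inverse powr_numeral)
 finally show ?thesis .
 qed
 from this[of "{..r}"] this[of "{r<..}"]
 show "(NN z. en (norm (z - p) powr - al) * ind {z. norm (z - p) <= r} z) = en (r powr (2 - al)) * inner_mass al"
 "(NN z. en (norm (z - p) powr - al) * ind {z. r < norm (z - p)} z) = en (r powr (2 - al)) * outer_mass al"
 using r unfolding inner_mass_def outer_mass_def
 by (simp_all add: indicator_def)
qed

lemma jbr_powr_integrable:
 assumes "2 < sg" shows "(NN x. wt (- sg) x) < \<infinity>"
proof -
 have "(NN x. wt (- sg) x) <= (NN x. ind (cball (0::real^2) 1) x + en (norm x powr - sg) * ind {z::real^2. 1 < norm z} x)"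
 proof (rule nn_integral_mono)
 fix x :: "real^2"
 have "jbr x powr - sg <= 1" using powr_mono[of "- sg" 0 "jbr x"] jbr_ge_1[of x] assms by simp
 moreover have "jbr x powr - sg <= norm x powr - sg" if "1 < norm x"
 proof (rule powr_mono2')
 show "norm x <= jbr x" by (rule power2_le_imp_le) (auto simp: jbr_power2)
 qed (use assms that in auto)
 ultimately show "wt (- sg) x <= ind (cball 0 1) x + en (norm x powr - sg) * ind {z. 1 < norm z} x"
 by (auto simp: wt_def ennreal_le_1 intro: ennreal_leI split: split_indicator)
 qed
 also have "... = emeasure lborel (cball (0::real^2) 1) + outer_mass sg"
 unfolding outer_mass_def by (subst nn_integral_add) auto
 also have "... < \<infinity>"
 using outer_mass_finite[OF assms] emeasure_bounded_finite[of "cball (0::real^2) 1"] by simp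
 finally show ?thesis .
qed

lemma radial_kernel_measurable:
 fixes s :: "real^2"
 shows "(%y. en (norm (y - s) powr a) * ind {y. norm (y - s) <= r} y) : borel_measurable lborel"
 and "(%y. en (norm (y - s) powr a) * ind {y. r < norm (y - s)} y) : borel_measurable lborel"
 by measurable

text \<open>
 A two-point kernel. The exponents sum to less than the dimension at each singularity and to more
 than the dimension at infinity, so that only the distance of the two points survives.
\<close>

lemma two_point_kernel_ex:
 "\<exists>C::real. 0 < C & (\<forall>p q::real^2. p ~= q -->
 (NN y. en (norm (y - p) powr -1 * norm (y - q) powr (-3/2))) <= en (C * norm (p - q) powr (-1/2)))"
proof -
 obtain i1 i2 o1 where m: "inner_mass 1 = en i1" "inner_mass (3/2) = en i2" "outer_mass (5/2) = en o1"
 and pos: "0 <= i1" "0 <= i2" "0 <= o1"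
 using inner_mass_finite[of 1] inner_mass_finite[of "3/2"] outer_mass_finite[of "5/2"]
 by (cases "inner_mass 1"; cases "inner_mass (3/2)"; cases "outer_mass (5/2)") auto
 define C where "C = i1 + i2 + 2 * o1 + 1"
 have "(NN y. en (norm (y - p) powr -1 * norm (y - q) powr (-3/2))) <= en (2 * C * norm (p - q) powr (-1/2))"
 if pq: "p ~= q" for p q :: "real^2"
 proof -
 define r where "r = norm (p - q) / 2"
 have "p - q ~= 0" using pq unfolding right_minus_eq .
 then have "0 < norm (p - q)" by (rule zero_less_norm_iff[THEN iffD2])
 then have r: "0 < r" unfolding r_def by (rule half_gt_zero)
 have "(NN y. en (norm (y - p) powr -1 * norm (y - q) powr (-3/2))) \<le>
 (NN y. en (r powr (-3/2)) * (en (norm (y - p) powr -1) * ind {y. norm (y - p) <= r} y)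
 + en (r powr -1) * (en (norm (y - q) powr -(3/2)) * ind {y. norm (y - q) <= r} y)
 + en (norm (y - p) powr -(5/2)) * ind {y. r < norm (y - p)} y
 + en (norm (y - q) powr -(5/2)) * ind {y. r < norm (y - q)} y)"
 proof (rule nn_integral_mono)
 fix y
 let ?u = "norm (y - p)" and ?v = "norm (y - q)"
 have tri: "2 * r <= ?u + ?v" unfolding r_def using norm_triangle_ineq4[of "y - q" "y - p"] by simp
 define a1 where "a1 = (if ?u <= r then r powr (-3/2) * ?u powr -1 else 0)"
 define a2 where "a2 = (if ?v <= r then r powr -1 * ?v powr -(3/2) else 0)"
 define a3 where "a3 = (if r < ?u then ?u powr -(5/2) else 0)"
 define a4 where "a4 = (if r < ?v then ?v powr -(5/2) else 0)"
 have a: "0 <= a1" "0 <= a2" "0 <= a3" "0 <= a4" by (simp_all add: a1_def a2_def a3_def a4_def)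
 have half: "z powr -1 * z powr (-3/2) = z powr -(5/2)" for z :: real
 by (simp only: powr_add[symmetric]) simp
 consider "?u <= r" | "?v <= r" | "r < ?u" "r < ?v" "?u <= ?v" | "r < ?u" "r < ?v" "?v <= ?u" by linarith
 then have "?u powr -1 * ?v powr (-3/2) <= a1 + a2 + a3 + a4"
 proof cases
 case 1
 then have "r <= ?v" using tri by linarith
 then have "?v powr (-3/2) <= r powr (-3/2)" using r by (intro powr_mono2') auto
 then have "?v powr (-3/2) * ?u powr -1 <= a1" unfolding a1_def if_P[OF 1] by (rule mult_right_mono) auto
 then show ?thesis using a by (subst mult.commute) linarith
 next
 case 2
 then have "r <= ?u" using tri by linarith
 then have "?u powr -1 <= r powr -1" using r by (intro powr_mono2') auto
 then have "?u powr -1 * ?v powr -(3/2) <= a2" unfolding a2_def if_P[OF 2] by (rule mult_right_mono) auto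
 then have "?u powr -1 * ?v powr (-3/2) <= a2" by simp
 then show ?thesis using a by linarith
 next
 case 3
 then have "?v powr (-3/2) <= ?u powr (-3/2)" using r by (intro powr_mono2') auto
 then have "?u powr -1 * ?v powr (-3/2) <= ?u powr -1 * ?u powr (-3/2)" by (rule mult_left_mono) auto
 then have "?u powr -1 * ?v powr (-3/2) <= a3" unfolding a3_def if_P[OF 3(1)] half .
 then show ?thesis using a by linarith
 next
 case 4
 then have "?u powr -1 <= ?v powr -1" using r by (intro powr_mono2') auto
 then have "?u powr -1 * ?v powr (-3/2) <= ?v powr -1 * ?v powr (-3/2)" by (rule mult_right_mono) auto
 then have "?u powr -1 * ?v powr (-3/2) <= a4" unfolding a4_def if_P[OF 4(2)] half .
 then show ?thesis using a by linarith
 qed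
 then have "en (?u powr -1 * ?v powr (-3/2)) <= en (a1 + a2 + a3 + a4)"
 by (rule ennreal_leI)
 also have "... = en a1 + en a2 + en a3 + en a4"
 using a by (simp add: ennreal_plus)
 also have "en a1 = en (r powr (-3/2)) * (en (?u powr -1) * ind {y. norm (y - p) <= r} y)"
 unfolding a1_def by (cases "?u <= r") (simp_all add: ennreal_mult[symmetric] indicator_def)
 also have "en a2 = en (r powr -1) * (en (?v powr -(3/2)) * ind {y. norm (y - q) <= r} y)"
 unfolding a2_def by (cases "?v <= r") (simp_all add: ennreal_mult[symmetric] indicator_def)
 also have "en a3 = en (?u powr -(5/2)) * ind {y. r < norm (y - p)} y"
 by (simp add: a3_def indicator_def)
 also have "en a4 = en (?v powr -(5/2)) * ind {y. r < norm (y - q)} y"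
 by (simp add: a4_def indicator_def)
 finally show "en (?u powr -1 * ?v powr (-3/2)) <= en (r powr (-3/2)) * (en (?u powr -1) * ind {y. norm (y - p) <= r} y)
 + en (r powr -1) * (en (?v powr -(3/2)) * ind {y. norm (y - q) <= r} y)
 + en (?u powr -(5/2)) * ind {y. r < norm (y - p)} y
 + en (?v powr -(5/2)) * ind {y. r < norm (y - q)} y" .
 qed
 also have "... = en (r powr (-3/2)) * (en (r powr (2 - 1)) * inner_mass 1)
 + en (r powr -1) * (en (r powr (2 - 3/2)) * inner_mass (3/2))
 + en (r powr (2 - 5/2)) * outer_mass (5/2) + en (r powr (2 - 5/2)) * outer_mass (5/2)"
 using inner_mass_scaled[OF r, of p 1] inner_mass_scaled[OF r, of q "3/2"]
 outer_mass_scaled[OF r, of p "5/2"] outer_mass_scaled[OF r, of q "5/2"]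
 by (simp only: nn_integral_add nn_integral_cmult radial_kernel_measurable borel_measurable_add
 borel_measurable_times_ennreal borel_measurable_const)
 also have "... = en (r powr (-3/2) * (r powr (2 - 1) * i1) + r powr -1 * (r powr (2 - 3/2) * i2)
 + r powr (2 - 5/2) * o1 + r powr (2 - 5/2) * o1)"
 unfolding m by (simp only: ennreal_mult[symmetric] ennreal_plus[symmetric] pos mult_nonneg_nonneg powr_ge_zero add_nonneg_nonneg)
 also have "r powr (-3/2) * (r powr (2 - 1) * i1) + r powr -1 * (r powr (2 - 3/2) * i2)
 + r powr (2 - 5/2) * o1 + r powr (2 - 5/2) * o1 = r powr (-1/2) * (C - 1)"
 proof -
 have "(-3/2 + (2 - 1)::real) = -1/2" "(-1 + (2 - 3/2)::real) = -1/2" by simp_all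
 with powr_add[of r "-3/2" "2 - 1"] powr_add[of r "-1" "2 - 3/2"]
 have "r powr (-3/2) * r powr (2 - 1) = r powr (-1/2)" "r powr -1 * r powr (2 - 3/2) = r powr (-1/2)"
 by (simp_all only:)
 then have "r powr (-3/2) * (r powr (2 - 1) * i1) = r powr (-1/2) * i1" "r powr -1 * (r powr (2 - 3/2) * i2) = r powr (-1/2) * i2"
 by (simp_all only: mult.assoc[symmetric])
 then show ?thesis by (simp only: C_def) (simp add: algebra_simps)
 qed
 also have "... <= en (2 * C * norm (p - q) powr (-1/2))"
 proof (rule ennreal_leI)
 have "r powr (-1/2) = norm (p - q) powr (-1/2) * (1/2) powr (-1/2)"
 unfolding r_def by (simp add: powr_mult[symmetric])
 also have "(1/2::real) powr (-1/2) <= (1/2) powr (-1)" by (rule powr_mono') auto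
 also have "(1/2::real) powr (-1) = 2" by (simp add: powr_minus)
 finally have "r powr (-1/2) <= norm (p - q) powr (-1/2) * 2" by (simp add: mult_left_mono)
 then have "r powr (-1/2) * (C - 1) <= (norm (p - q) powr (-1/2) * 2) * C"
 using pos by (intro mult_mono) (auto simp: C_def)
 then show "r powr (-1/2) * (C - 1) <= 2 * C * norm (p - q) powr (-1/2)" by (simp add: mult_ac)
 qed
 finally show ?thesis .
 qed
 moreover have "0 < C" using pos by (simp add: C_def)
 ultimately show ?thesis by (intro exI[of _ "2 * C"]) auto
qed

section \<open>Bounds in weighted sup norms\<close>

lemma nn_integral_eabs_mult_le:
 assumes [measurable]: "F : bmf" "G : bmf"
 and F: "(NN x. (F x)^2) <= A^2" and G: "(NN x. (G x)^2) <= B^2"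
 shows "(\<integral>\<^sup>+x. F x * G x \<partial>(lborel::(real^2) measure)) <= A * (B::ennreal)"
proof (subst ennreal_power2_le_iff[symmetric])
 have "(NN x. F x * G x)^2 <= (NN x. (F x)^2) * (NN x. (G x)^2)"
 by (rule Cauchy_Schwarz_nn_integral) auto
 also have "... <= A^2 * B^2" using F G by (rule mult_mono) auto
 finally show "(NN x. F x * G x)^2 <= (A * B)^2" by (simp add: power_mult_distrib)
qed

lemma abs_op_const_right:
 assumes [measurable]: "f : bmf" "g : bmf"
 shows "abs_op (eabs f) (eabs g) (%_. M) xi <= 2 * M * (L2_norm f * L2_norm g)"
proof -
 have "(NN x. eabs f (xi + x) * eabs g (xi + x + l *R rot x)) <= L2_norm f * L2_norm g" for l
 proof (rule nn_integral_eabs_mult_le)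
 show "(NN x. (eabs f (xi + x))^2) <= (L2_norm f)^2"
 unfolding L2_norm_eabs using nn_integral_translate[of "%x. (eabs f x)^2" xi] by simp
 show "(NN x. (eabs g (xi + x + l *R rot x))^2) <= (L2_norm g)^2"
 unfolding L2_norm_eabs by (rule nn_integral_opposite_le[of "%x. (eabs g x)^2"]) measurable
 qed measurable
 then have "abs_op (eabs f) (eabs g) (%_. M) xi <= (NN l. ind {-1..1::real} l * (L2_norm f * L2_norm g * M))"
 unfolding abs_op_def by (intro nn_integral_mono mult_left_mono) (auto simp: nn_integral_multc intro: mult_right_mono)
 also have "... = 2 * M * (L2_norm f * L2_norm g)"
 by (subst nn_integral_multc, measurable) (simp add: mult_ac)
 finally show ?thesis .
qed

lemma nn_integral_inverse:
 assumes "0 < de" "de <= 1"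
 shows "(NN l. en (1 / \<bar>l\<bar>) * ind {de..1} l) = en (ln (1 / de))"
 and "(NN l. en (1 / \<bar>l\<bar>) * ind {-1..-de} l) = en (ln (1 / de))"
proof -
 have "(NN l. en (1 / l) * ind {de..1} l) = ln 1 - ln de"
 by (rule nn_integral_FTC_Icc) (use assms in \<open>auto intro!: derivative_eq_intros simp: divide_simps\<close>)
 moreover have "(NN l. en (1 / \<bar>l\<bar>) * ind {de..1} l) = (NN l. en (1 / l) * ind {de..1} l)"
 using assms by (intro nn_integral_cong) (auto split: split_indicator)
 ultimately show 1: "(NN l. en (1 / \<bar>l\<bar>) * ind {de..1} l) = en (ln (1 / de))"
 using assms by (simp add: ln_div)
 have "(NN l. en (1 / \<bar>l\<bar>) * ind {-1..-de} l) = (NN l. en (1 / \<bar>l\<bar>) * ind {de..1} l)"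
 by (subst nn_integral_real_affine[where c="-1" and t=0]) (auto intro!: nn_integral_cong split: split_indicator)
 with 1 show "(NN l. en (1 / \<bar>l\<bar>) * ind {-1..-de} l) = en (ln (1 / de))" by simp
qed

text \<open>
 With the weight on the first factor, Cauchy--Schwarz in \<open>x\<close> costs a factor \<open>1/\<bar>l\<bar>\<close>, which fails to be
 integrable only logarithmically; for \<open>\<bar>l\<bar> < de\<close> the product of the \<open>L\<^sup>1\<close> and sup norms is used instead.
\<close>

lemma abs_op_const_left:
 assumes [measurable]: "g : bmf" "h : bmf"
 and de: "0 < de" "de <= 1" and hM: "AE x in lborel. eabs h x <= M"
 shows "abs_op (%_. c) (eabs g) (eabs h) xi \<le>
 c * (en (2 * de) * (M * (NN x. eabs g x)) + en (2 * ln (1 / de)) * (L2_norm g * L2_norm h))"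
proof -
 define J where "J l = (NN x. eabs g (xi + x + l *R rot x) * eabs h (xi + l *R rot x))" for l
 have [measurable]: "J : bmf" unfolding J_def[abs_def] by measurable
 let ?A = "M * (NN x. eabs g x)" and ?P = "L2_norm g * L2_norm h"
 have J1: "J l <= ?A" if "l ~= 0" for l
 proof -
 have "AE x in lborel. eabs h (xi + l *R rot x) <= M"
 using AE_similarity[OF _ hM, of 0 l xi] that by simp
 then have "J l <= (NN x. M * eabs g (xi + x + l *R rot x))"
 unfolding J_def by (intro nn_integral_mono_AE) (elim eventually_mono, subst mult.commute, rule mult_right_mono, auto)
 also have "... <= ?A"
 by (subst nn_integral_cmult, measurable) (intro mult_left_mono nn_integral_opposite_le, auto)
 finally show ?thesis .
 qed
 have J2: "J l <= en (1 / \<bar>l\<bar>) * ?P" if l: "l ~= 0" for l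
 proof -
 have "J l <= L2_norm g * (en (1 / \<bar>l\<bar>) * L2_norm h)"
 unfolding J_def
 proof (rule nn_integral_eabs_mult_le)
 show "(NN x. (eabs g (xi + x + l *R rot x))^2) <= (L2_norm g)^2"
 unfolding L2_norm_eabs by (rule nn_integral_opposite_le[of "%x. (eabs g x)^2"]) measurable
 have "(NN x. (eabs h (xi + (0 *R x + l *R rot x)))^2) = en (1 / (0^2 + l^2)) * (NN x. (eabs h x)^2)"
 by (rule nn_integral_similarity) (use l in auto)
 then show "(NN x. (eabs h (xi + l *R rot x))^2) <= (en (1 / \<bar>l\<bar>) * L2_norm h)^2"
 by (simp add: power_mult_distrib L2_norm_eabs ennreal_power power_divide)
 qed measurable
 then show ?thesis by (simp add: mult_ac)
 qed
 have "(NN l. ind {-1..1} l * J l) \<le>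
 (NN l. (?A * ind {-de..de} l + ?P * (en (1 / \<bar>l\<bar>) * ind {de..1} l)) + ?P * (en (1 / \<bar>l\<bar>) * ind {-1..-de} l))"
 proof (rule nn_integral_mono_AE, use AE_nonzero in eventually_elim)
 fix l :: real assume l: "l ~= 0"
 consider "l : {-de..de}" | "l : {de..1}" | "l : {-1..-de}" | "l \<notin> {-1..1}" by fastforce
 then show "ind {-1..1} l * J l <= (?A * ind {-de..de} l + ?P * (en (1 / \<bar>l\<bar>) * ind {de..1} l))
 + ?P * (en (1 / \<bar>l\<bar>) * ind {-1..-de} l)"
 proof cases
 case 1
 have "ind {-1..1} l * J l <= J l" by (simp split: split_indicator)
 also have "... <= ?A * ind {-de..de} l" using J1[OF l] 1 by simp
 finally show ?thesis by (simp add: add_increasing2)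
 next
 case 2
 have "ind {-1..1} l * J l <= J l" by (simp split: split_indicator)
 also have "... <= ?P * (en (1 / \<bar>l\<bar>) * ind {de..1} l)" using J2[OF l] 2 by (simp add: mult.commute)
 finally show ?thesis by (simp add: add_increasing2 add_increasing)
 next
 case 3
 have "ind {-1..1} l * J l <= J l" by (simp split: split_indicator)
 also have "... <= ?P * (en (1 / \<bar>l\<bar>) * ind {-1..-de} l)" using J2[OF l] 3 by (simp add: mult.commute)
 finally show ?thesis by (simp add: add_increasing)
 qed simp
 qed
 also have "... = ?A * (NN l. ind {-de..de} l) + ?P * (NN l. en (1 / \<bar>l\<bar>) * ind {de..1} l)
 + ?P * (NN l. en (1 / \<bar>l\<bar>) * ind {-1..-de} l)"
 by (simp add: nn_integral_add nn_integral_cmult)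
 also have "... = ?A * en (2 * de) + ?P * (en (ln (1 / de)) + en (ln (1 / de)))"
 unfolding nn_integral_inverse[OF de] using de by (simp add: distrib_left add.assoc)
 also have "en (ln (1 / de)) + en (ln (1 / de)) = en (2 * ln (1 / de))"
 using de by (subst ennreal_plus[symmetric]) (auto simp: ln_ge_zero)
 finally have "(NN l. ind {-1..1} l * J l) <= en (2 * de) * ?A + en (2 * ln (1 / de)) * ?P"
 by (simp add: mult_ac)
 moreover have "abs_op (%_. c) (eabs g) (eabs h) xi = c * (NN l. ind {-1..1} l * J l)"
 proof -
 have "abs_op (%_. c) (eabs g) (eabs h) xi = (NN l. c * (ind {-1..1} l * J l))"
 unfolding abs_op_def J_def
 by (intro nn_integral_cong) (simp add: nn_integral_cmult mult.assoc mult.left_commute)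
 then show ?thesis by (simp add: nn_integral_cmult)
 qed
 ultimately show ?thesis by (simp add: mult_left_mono)
qed

lemma X_norm_AE: "AE x in lborel. wt sg x * eabs f x <= X_norm sg f"
 using Linf_norm_AE[of "%x. (jbr x powr sg) *R f x"]
 unfolding X_norm_def eabs_weight[symmetric] by (simp add: eabs_def)

lemma X_norm_le:
 assumes [measurable]: "f : bmf" and "!!x. wt sg x * eabs f x <= C"
 shows "X_norm sg f <= C"
 unfolding X_norm_def
proof (rule Linf_norm_le, measurable, rule always_eventually, rule allI)
 fix x
 have "en (cmod ((jbr x powr sg) *R f x)) = wt sg x * eabs f x"
 unfolding eabs_weight[symmetric] by (simp only: eabs_def)
 then show "en (cmod ((jbr x powr sg) *R f x)) <= C" using assms(2)[of x] by simp
qed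

lemma wt_ge_1: "0 <= s ==> 1 <= wt s x"
 using ge_one_powr_ge_zero[of "jbr x" s] jbr_ge_1[of x] by (simp add: wt_def)

text \<open>The weight at \<open>xi\<close> passes to one of the two adjacent corners, where the weighted sup norm absorbs it.\<close>

lemma X_norm_CR_op:
 assumes [measurable]: "f : bmf" "g : bmf" "h : bmf"
 and sg: "0 <= sg" and de: "0 < de" "de <= 1"
 shows "X_norm sg (CR_op f g h) <= en (2 powr sg) *
 (X_norm sg f * (en (2 * de) * (X_norm sg h * (NN x. eabs g x)) + en (2 * ln (1 / de)) * (L2_norm g * L2_norm h))
 + 2 * X_norm sg h * (L2_norm f * L2_norm g))"
proof (rule X_norm_le)
 fix xi
 have hM: "AE x in lborel. eabs h x <= X_norm sg h"
 using X_norm_AE[of sg h]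
 proof eventually_elim
 fix x assume h: "wt sg x * eabs h x <= X_norm sg h"
 have "1 * eabs h x <= wt sg x * eabs h x" by (intro mult_right_mono wt_ge_1 sg) auto
 with h show "eabs h x <= X_norm sg h" by simp
 qed
 have "wt sg xi * eabs (CR_op f g h) xi <= wt sg xi * abs_op (eabs f) (eabs g) (eabs h) xi"
 by (intro mult_left_mono norm_CR_op_le) auto
 also have "... <= en (2 powr sg) * (abs_op (%x. wt sg x * eabs f x) (eabs g) (eabs h) xi + abs_op (eabs f) (eabs g) (%x. wt sg x * eabs h x) xi)"
 by (rule abs_op_weight) (use sg in auto)
 also have "... <= en (2 powr sg) * (abs_op (%x. X_norm sg f) (eabs g) (eabs h) xi + abs_op (eabs f) (eabs g) (%x. X_norm sg h) xi)"
 by (intro mult_left_mono add_mono abs_op_mono_AE X_norm_AE) auto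
 also have "... <= en (2 powr sg) *
 (X_norm sg f * (en (2 * de) * (X_norm sg h * (NN x. eabs g x)) + en (2 * ln (1 / de)) * (L2_norm g * L2_norm h))
 + 2 * X_norm sg h * (L2_norm f * L2_norm g))"
 by (intro mult_left_mono add_mono abs_op_const_left abs_op_const_right hM de) auto
 finally show "wt sg xi * eabs (CR_op f g h) xi <= ..." .
qed measurable

lemma wt_add: "wt a x * wt b x = wt (a + b) x"
 by (simp add: wt_def ennreal_mult[symmetric] powr_add)

lemma X_embeddings:
 assumes "2 < sg"
 shows "\<exists>c\<ge>0. \<forall>f\<in>bmf. L2w_norm (sg / 2) f <= en c * X_norm sg f
 & (NN x. eabs f x) <= en c * L2w_norm (sg / 2) f"
proof -
 obtain j where j: "0 <= j" "(NN x. wt (- sg) x) = en j"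
 using jbr_powr_integrable[OF assms] by (cases "NN x. wt (- sg) x") auto
 have sq: "(en (sqrt j))^2 = en j" using j by (simp add: ennreal_power)
 have "L2w_norm (sg / 2) f <= en (sqrt j) * X_norm sg f" if [measurable]: "f : bmf" for f
 proof (subst ennreal_power2_le_iff[symmetric], unfold L2w_norm_power2)
 have "(NN x. (wt (sg / 2) x * eabs f x)^2) <= (NN x. (X_norm sg f)^2 * wt (- sg) x)"
 proof (rule nn_integral_mono_AE, use X_norm_AE[of sg f] in eventually_elim)
 fix x assume h: "wt sg x * eabs f x <= X_norm sg f"
 have "(wt (sg / 2) x * eabs f x)^2 = (wt (sg/2) x * wt (sg/2) x) * (eabs f x)^2"
 by (simp add: power2_eq_square mult_ac)
 also have "wt (sg/2) x * wt (sg/2) x = (wt sg x * wt sg x) * wt (- sg) x" by (simp add: wt_add)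
 also have "... * (eabs f x)^2 = (wt sg x * eabs f x)^2 * wt (- sg) x" by (simp add: power2_eq_square mult_ac)
 also have "... <= (X_norm sg f)^2 * wt (- sg) x" by (intro mult_right_mono power_mono h) auto
 finally show "(wt (sg / 2) x * eabs f x)^2 <= (X_norm sg f)^2 * wt (- sg) x" .
 qed
 also have "... = (en (sqrt j) * X_norm sg f)^2"
 by (subst nn_integral_cmult, measurable) (simp add: j power_mult_distrib sq mult.commute)
 finally show "(NN x. (wt (sg / 2) x * eabs f x)^2) <= (en (sqrt j) * X_norm sg f)^2" .
 qed
 moreover have "(NN x. eabs f x) <= en (sqrt j) * L2w_norm (sg / 2) f" if [measurable]: "f : bmf" for f
 proof -
 have "(NN x. eabs f x) = (NN x. wt (-sg/2) x * (wt (sg/2) x * eabs f x))"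
 by (intro nn_integral_cong) (simp add: mult.assoc[symmetric] wt_add, simp add: wt_def)
 also have "... <= en (sqrt j) * L2w_norm (sg / 2) f"
 proof (rule nn_integral_eabs_mult_le)
 show "(NN x. (wt (-sg/2) x)^2) <= (en (sqrt j))^2"
 proof -
 have "(wt (-sg/2) x)^2 = wt (-sg) x" for x by (simp add: power2_eq_square wt_add)
 then show ?thesis by (simp only: sq j(2) order_refl)
 qed
 qed (auto simp: L2w_norm_power2)
 finally show ?thesis .
 qed
 ultimately show ?thesis using j by (intro exI[of _ "sqrt j"]) auto
qed

section \<open>The homogeneous space\<close>

lemma rectangle_product_bound:
 fixes A B E G :: real
 assumes "0 <= A" "0 <= B" "0 <= E" "0 <= G" "E^2 + G^2 = A^2 + B^2"
 shows "E * (A powr -1 * G powr -1 * B powr -1) <= E powr (1/2) * (A powr -1 * G powr (-3/2)) + E powr (1/2) * (B powr -1 * G powr (-3/2))"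
proof (cases "A = 0 | B = 0 | E = 0 | G = 0")
 case True
 then show ?thesis by auto
next
 case False
 then have pos: "0 < A" "0 < B" "0 < E" "0 < G" using assms by auto
 have key: "E * (a powr -1 * G powr -1 * b powr -1) <= E powr (1/2) * (a powr -1 * G powr (-3/2))"
 if ab: "0 < a" "0 < b" "E * G <= b^2" for a b
 proof -
 have "(E * G) powr (1/2) <= (b^2) powr (1/2)" using ab pos by (intro powr_mono2) auto
 also have "(b^2) powr (1/2) = b" using ab by (simp add: powr_half_sqrt)
 finally have b: "E powr (1/2) * G powr (1/2) <= b" by (simp add: powr_mult)
 have "E * (a powr -1 * G powr -1 * b powr -1) = (E powr (1/2) * a powr -1 * G powr (-3/2)) * ((E powr (1/2) * G powr (1/2)) * b powr -1)"
 proof -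
 define e g1 g2 x y where d: "e = E powr (1/2)" "g1 = G powr (-3/2)" "g2 = G powr (1/2)" "x = a powr -1" "y = b powr -1"
 have "E = e * e" using pos by (simp add: d powr_add[symmetric])
 moreover have "(-3/2 + 1/2::real) = -1" by simp
 with powr_add[of G "-3/2" "1/2"] have "G powr -1 = g1 * g2" unfolding d by (simp only:)
 moreover have "e * e * (x * (g1 * g2) * y) = (e * x * g1) * ((e * g2) * y)" by (simp only: mult_ac)
 ultimately show ?thesis unfolding d[symmetric] by simp
 qed
 also have "... <= (E powr (1/2) * a powr -1 * G powr (-3/2)) * (b * b powr -1)"
 using b ab by (intro mult_left_mono mult_right_mono) auto
 also have "b * b powr -1 = 1" using ab by (simp add: powr_minus)
 finally show ?thesis by (simp add: mult_ac)
 qed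
 have "2 * E * G <= A^2 + B^2" using sum_squares_bound[of E G] assms(5) by simp
 then have "E * G <= A^2 | E * G <= B^2" by linarith
 then show ?thesis
 proof
 assume "E * G <= A^2"
 from key[OF pos(2,1) this] show ?thesis by (simp add: mult_ac add_increasing)
 next
 assume "E * G <= B^2"
 from key[OF pos(1,2) this] show ?thesis by (simp add: add_increasing2)
 qed
qed

lemma nn_integral_inverse_sqrt: "(NN l. ind {-1..1::real} l * en (\<bar>l\<bar> powr (-1/2))) <= en 4"
proof -
 have h: "(NN l. en (l powr (-1/2)) * ind {0..1} l) = en 2"
 using nn_integral_has_integral_lebesgue'[OF _ has_integral_powr_from_0[of "-1/2" 1]] by simp
 have p: "(NN l. en (\<bar>l\<bar> powr (-1/2)) * ind {0..1} l) = en 2"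
 unfolding h[symmetric] by (intro nn_integral_cong) (auto split: split_indicator)
 have m: "(NN l. en (\<bar>l\<bar> powr (-1/2)) * ind {-1..0} l) = en 2"
 unfolding p[symmetric]
 by (subst nn_integral_real_affine[where c="-1" and t=0]) (auto intro!: nn_integral_cong split: split_indicator)
 have "(NN l. ind {-1..1::real} l * en (\<bar>l\<bar> powr (-1/2)))
 <= (NN l. en (\<bar>l\<bar> powr (-1/2)) * ind {0..1} l + en (\<bar>l\<bar> powr (-1/2)) * ind {-1..0} l)"
 by (intro nn_integral_mono) (auto split: split_indicator)
 also have "... = en 2 + en 2"
 by (subst nn_integral_add, measurable) (simp only: m p)
 finally show ?thesis by (simp add: ennreal_plus[symmetric] del: ennreal_plus)
qed

lemma abs_op_inverse_norm:
 "\<exists>C\<ge>0. \<forall>xi. en (norm xi) * abs_op (%x. en (norm x powr -1)) (%x. en (norm x powr -1)) (%x. en (norm x powr -1)) xi <= en C"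
proof -
 let ?n = "%x::real^2. en (norm x powr -1)"
 obtain C where C: "0 < C" "!!p q::real^2. p ~= q ==>
 (NN y. en (norm (y - p) powr -1 * norm (y - q) powr (-3/2))) <= en (C * norm (p - q) powr (-1/2))"
 using two_point_kernel_ex by blast
 have "en (norm xi) * abs_op ?n ?n ?n xi <= en (16 * C)" for xi
 proof (cases "xi = 0")
 case False
 let ?E = "norm xi"
 have E: "?E > 0" using False by simp
 have slice: "ennreal ?E * (NN x. ?n (xi + x) * ?n (xi + x + l *R rot x) * ?n (xi + l *R rot x)) <= en (4 * C) * en (\<bar>l\<bar> powr (-1/2))"
 if l: "l ~= 0" "\<bar>l\<bar> <= 1" for l
 proof -
 define b where "b x = xi + (1 *R x + l *R rot x)" for x
 define s where "s = sqrt (1 + l^2)"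
 have s: "1 <= s" "s <= 2" "s^2 = 1 + l^2"
 proof -
 show "1 <= s" "s^2 = 1 + l^2" by (auto simp: s_def add_nonneg_nonneg)
 have "l^2 <= 1" using l by (simp add: abs_square_le_1)
 then show "s <= 2" unfolding s_def by (intro real_le_lsqrt) auto
 qed
 have sim: "norm (1 *R y + l *R rot y) = s * norm y" for y
 by (rule power2_eq_imp_eq) (use s norm_similarity[of 1 y l] in \<open>auto simp: power_mult_distrib\<close>)
 have A: "norm (xi + x) powr -1 <= 2 * norm (b x - (- l *R rot xi)) powr -1" for x
 proof -
 have "b x - (- l *R rot xi) = 1 *R (xi + x) + l *R rot (xi + x)"
 by (simp add: b_def rot_add algebra_simps)
 then have "norm (b x - (- l *R rot xi)) = s * norm (xi + x)" by (simp only: sim)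
 then have "norm (xi + x) powr -1 = s * norm (b x - (- l *R rot xi)) powr -1"
 using s(1) by (simp add: powr_mult powr_minus)
 also have "... <= 2 * norm (b x - (- l *R rot xi)) powr -1" using s by (intro mult_right_mono) auto
 finally show ?thesis .
 qed
 have B: "norm (xi + l *R rot x) powr -1 <= 2 * \<bar>l\<bar> powr -1 * norm (b x - (1 / l) *R rot xi) powr -1" for x
 proof -
 have "0 *R (b x - (1 / l) *R rot xi) + l *R rot (b x - (1 / l) *R rot xi) = 1 *R (xi + l *R rot x) + l *R rot (xi + l *R rot x)"
 using l by (simp add: b_def rot_add rot_diff rot_scaleR rot_rot algebra_simps)
 then have "norm (1 *R (xi + l *R rot x) + l *R rot (xi + l *R rot x)) = norm (0 *R (b x - (1 / l) *R rot xi) + l *R rot (b x - (1 / l) *R rot xi))"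
 by simp
 moreover have "norm (0 *R y + l *R rot y) = \<bar>l\<bar> * norm y" for y
 by (rule power2_eq_imp_eq) (use norm_similarity[of 0 y l] in \<open>auto simp: power_mult_distrib\<close>)
 ultimately have "s * norm (xi + l *R rot x) = \<bar>l\<bar> * norm (b x - (1 / l) *R rot xi)" by (simp only: sim)
 then have "norm (xi + l *R rot x) = \<bar>l\<bar> * norm (b x - (1 / l) *R rot xi) / s" using s by (simp add: field_simps)
 then have "norm (xi + l *R rot x) powr -1 = s * (\<bar>l\<bar> powr -1 * norm (b x - (1 / l) *R rot xi) powr -1)"
 using s(1) l by (simp only: powr_mult powr_divide) (simp add: powr_minus field_simps)
 also have "... <= 2 * (\<bar>l\<bar> powr -1 * norm (b x - (1 / l) *R rot xi) powr -1)" using s by (intro mult_right_mono) auto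
 finally show ?thesis by (simp add: mult.assoc)
 qed
 define P where "P y = norm (y - (- l *R rot xi)) powr -1 * norm (y - 0) powr (-3/2)" for y
 define Q where "Q y = norm (y - (1 / l) *R rot xi) powr -1 * norm (y - 0) powr (-3/2)" for y
 have [measurable]: "P : bmf" "Q : bmf"
 unfolding P_def[abs_def] Q_def[abs_def] by measurable
 have nrot: "norm (rot xi) = ?E"
 by (rule power2_eq_imp_eq) (use norm_similarity[of 0 xi 1] in auto)
 have rot0: "rot xi ~= 0" using nrot E by auto
 have pt: "ennreal ?E * (?n (xi + x) * ?n (xi + x + l *R rot x) * ?n (xi + l *R rot x))
 <= en (2 * ?E powr (1/2)) * en (P (b x)) + en (2 * ?E powr (1/2) * \<bar>l\<bar> powr -1) * en (Q (b x))" for x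
 proof -
 let ?a = "norm (xi + x)" and ?g = "norm (xi + x + l *R rot x)" and ?c = "norm (xi + l *R rot x)"
 have bg: "norm (b x - 0) = ?g" by (simp add: b_def add.assoc)
 have "?E * (?a powr -1 * ?g powr -1 * ?c powr -1) <= ?E powr (1/2) * (?a powr -1 * ?g powr (-3/2)) + ?E powr (1/2) * (?c powr -1 * ?g powr (-3/2))"
 by (rule rectangle_product_bound) (use rectangle_norms[of xi x l] in auto)
 also have "... <= ?E powr (1/2) * ((2 * norm (b x - (- l *R rot xi)) powr -1) * ?g powr (-3/2))
 + ?E powr (1/2) * ((2 * \<bar>l\<bar> powr -1 * norm (b x - (1 / l) *R rot xi) powr -1) * ?g powr (-3/2))"
 by (intro add_mono mult_left_mono mult_right_mono A B) auto
 also have "... = (2 * ?E powr (1/2)) * P (b x) + (2 * ?E powr (1/2) * \<bar>l\<bar> powr -1) * Q (b x)"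
 unfolding P_def Q_def bg by (simp only: mult_ac)
 finally have "en (?E * (?a powr -1 * ?g powr -1 * ?c powr -1)) <= en ((2 * ?E powr (1/2)) * P (b x) + (2 * ?E powr (1/2) * \<bar>l\<bar> powr -1) * Q (b x))"
 by (rule ennreal_leI)
 also have "... = en (2 * ?E powr (1/2)) * en (P (b x)) + en (2 * ?E powr (1/2) * \<bar>l\<bar> powr -1) * en (Q (b x))"
 proof -
 have "0 <= P (b x)" "0 <= Q (b x)" by (simp_all add: P_def Q_def)
 then show ?thesis by (simp only: ennreal_plus ennreal_mult mult_nonneg_nonneg powr_ge_zero zero_le_numeral)
 qed
 finally show ?thesis by (simp only: ennreal_mult norm_ge_zero powr_ge_zero mult_nonneg_nonneg)
 qed
 have sub: "(NN x. en (R (b x))) <= (NN y. en (R y))" if [measurable]: "R : bmf" for R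
 using nn_integral_opposite_le[of "%y. en (R y)" xi l] by (simp add: b_def add.assoc)
 have PI: "(NN y. en (P y)) <= en (C * (\<bar>l\<bar> powr (-1/2) * ?E powr (-1/2)))"
 using C(2)[of "- l *R rot xi" 0] l rot0 unfolding P_def by (simp add: nrot powr_mult)
 have QI: "(NN y. en (Q y)) <= en (C * (\<bar>l\<bar> powr (1/2) * ?E powr (-1/2)))"
 proof -
 have "norm ((1 / l) *R rot xi - 0) powr (-1/2) = \<bar>l\<bar> powr (1/2) * ?E powr (-1/2)"
 using l E by (simp add: nrot powr_divide powr_minus field_simps)
 then show ?thesis
 using C(2)[of "(1 / l) *R rot xi" 0] l rot0 unfolding Q_def by simp
 qed
 have "ennreal ?E * (NN x. ?n (xi + x) * ?n (xi + x + l *R rot x) * ?n (xi + l *R rot x))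
 = (NN x. ennreal ?E * (?n (xi + x) * ?n (xi + x + l *R rot x) * ?n (xi + l *R rot x)))"
 by (rule nn_integral_cmult[symmetric]) measurable
 also have "... <= (NN x. en (2 * ?E powr (1/2)) * en (P (b x)) + en (2 * ?E powr (1/2) * \<bar>l\<bar> powr -1) * en (Q (b x)))"
 by (intro nn_integral_mono pt)
 also have "... = en (2 * ?E powr (1/2)) * (NN x. en (P (b x))) + en (2 * ?E powr (1/2) * \<bar>l\<bar> powr -1) * (NN x. en (Q (b x)))"
 unfolding b_def by (subst nn_integral_add, measurable, subst nn_integral_cmult, measurable, subst nn_integral_cmult, measurable)
 also have "... <= en (2 * ?E powr (1/2)) * en (C * (\<bar>l\<bar> powr (-1/2) * ?E powr (-1/2)))
 + en (2 * ?E powr (1/2) * \<bar>l\<bar> powr -1) * en (C * (\<bar>l\<bar> powr (1/2) * ?E powr (-1/2)))"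
 by (intro add_mono mult_left_mono order_trans[OF sub] PI QI) auto
 also have "... = en ((2 * ?E powr (1/2)) * (C * (\<bar>l\<bar> powr (-1/2) * ?E powr (-1/2)))
 + (2 * ?E powr (1/2) * \<bar>l\<bar> powr -1) * (C * (\<bar>l\<bar> powr (1/2) * ?E powr (-1/2))))"
 using C(1) by (simp only: ennreal_mult[symmetric] ennreal_plus[symmetric] mult_nonneg_nonneg powr_ge_zero less_imp_le zero_le_numeral)
 also have "(2 * ?E powr (1/2)) * (C * (\<bar>l\<bar> powr (-1/2) * ?E powr (-1/2)))
 + (2 * ?E powr (1/2) * \<bar>l\<bar> powr -1) * (C * (\<bar>l\<bar> powr (1/2) * ?E powr (-1/2))) = 4 * C * \<bar>l\<bar> powr (-1/2)"
 proof -
 have e: "?E powr (1/2) * ?E powr (-1/2) = 1" using E by (simp add: powr_add[symmetric])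
 have m: "\<bar>l\<bar> powr -1 * \<bar>l\<bar> powr (1/2) = \<bar>l\<bar> powr (-1/2)" by (simp only: powr_add[symmetric]) simp
 have "(2 * ?E powr (1/2)) * (C * (\<bar>l\<bar> powr (-1/2) * ?E powr (-1/2))) = 2 * C * \<bar>l\<bar> powr (-1/2) * (?E powr (1/2) * ?E powr (-1/2))"
 "(2 * ?E powr (1/2) * \<bar>l\<bar> powr -1) * (C * (\<bar>l\<bar> powr (1/2) * ?E powr (-1/2))) = 2 * C * (\<bar>l\<bar> powr -1 * \<bar>l\<bar> powr (1/2)) * (?E powr (1/2) * ?E powr (-1/2))"
 by (simp_all only: mult_ac)
 then show ?thesis unfolding e m by simp
 qed
 finally show ?thesis using C(1) by (simp add: ennreal_mult)
 qed
 have "ennreal ?E * abs_op ?n ?n ?n xi = (NN l. ennreal ?E * (ind {-1..1} l *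
 (NN x. ?n (xi + x) * ?n (xi + x + l *R rot x) * ?n (xi + l *R rot x))))"
 unfolding abs_op_def by (rule nn_integral_cmult[symmetric]) measurable
 also have "... <= (NN l. en (4 * C) * (ind {-1..1} l * en (\<bar>l\<bar> powr (-1/2))))"
 proof (rule nn_integral_mono_AE, use AE_nonzero in eventually_elim)
 fix l :: real assume "l ~= 0"
 then show "ennreal ?E * (ind {-1..1} l * (NN x. ?n (xi + x) * ?n (xi + x + l *R rot x) * ?n (xi + l *R rot x)))
 <= en (4 * C) * (ind {-1..1} l * en (\<bar>l\<bar> powr (-1/2)))"
 using slice[of l] by (cases "l : {-1..1}") (simp_all add: abs_le_iff)
 qed
 also have "... = en (4 * C) * (NN l. ind {-1..1::real} l * en (\<bar>l\<bar> powr (-1/2)))"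
 by (rule nn_integral_cmult) measurable
 also have "... <= en (4 * C) * en 4" by (intro mult_left_mono nn_integral_inverse_sqrt) auto
 also have "... = en (16 * C)" using C(1) by (subst ennreal_mult[symmetric]) auto
 finally show ?thesis .
 qed (use C in simp)
 then show ?thesis using C(1) by (intro exI[of _ "16 * C"]) auto
qed

lemma abs_op_scale:
 assumes [measurable]: "f : bmf" "g : bmf" "h : bmf"
 shows "abs_op (%x. a * f x) (%x. b * g x) (%x. c * h x) xi = a * b * c * abs_op f g h xi"
proof -
 have "abs_op (%x. a * f x) (%x. b * g x) (%x. c * h x) xi = (NN l. ind {-1..1} l *
 (NN x. (a * b * c) * (f (xi + x) * g (xi + x + l *R rot x) * h (xi + l *R rot x))))"
 proof -
 have "a * p * (b * q) * (c * r) = (a * b * c) * (p * q * r)" for p q r by (simp only: mult_ac)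
 then show ?thesis unfolding abs_op_def by (simp only:)
 qed
 also have "... = (NN l. (a * b * c) * (ind {-1..1} l *
 (NN x. f (xi + x) * g (xi + x + l *R rot x) * h (xi + l *R rot x))))"
 by (intro nn_integral_cong, subst nn_integral_cmult, measurable) (rule mult.left_commute)
 also have "... = a * b * c * abs_op f g h xi"
 unfolding abs_op_def by (rule nn_integral_cmult) measurable
 finally show ?thesis .
qed

lemma Xdot1_AE: 
 "AE x in lborel. eabs f x <= Xdot1_norm f * en (norm x powr -1)"
proof -
 have "AE x in lborel. en (norm x) * eabs f x <= Xdot1_norm f"
 using Linf_norm_AE[of "%x. norm x *R f x"] unfolding Xdot1_norm_def
 by eventually_elim (simp add: eabs_def ennreal_mult)
 moreover have "AE x::real^2 in lborel. x ~= 0" by (rule AE_lborel_singleton)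
 ultimately show ?thesis
 proof eventually_elim
 fix x :: "real^2" assume h: "en (norm x) * eabs f x <= Xdot1_norm f" and x: "x ~= 0"
 have "eabs f x = en (norm x powr -1) * (en (norm x) * eabs f x)"
 using x by (simp add: mult.assoc[symmetric] ennreal_mult[symmetric] powr_minus)
 also have "... <= en (norm x powr -1) * Xdot1_norm f" by (rule mult_left_mono[OF h]) auto
 finally show "eabs f x <= Xdot1_norm f * en (norm x powr -1)" by (simp only: mult.commute)
 qed
qed

lemma Xdot1_norm_CR_op:
 "\<exists>C\<ge>0. \<forall>f\<in>bmf. \<forall>g\<in>bmf. \<forall>h\<in>bmf.
 Xdot1_norm (CR_op f g h) <= en C * Xdot1_norm f * Xdot1_norm g * Xdot1_norm h \<and>
 (\<forall>xi. en (norm xi) * abs_op (eabs f) (eabs g) (eabs h) xi <= en C * Xdot1_norm f * Xdot1_norm g * Xdot1_norm h)"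
proof -
 let ?n = "%x::real^2. en (norm x powr -1)"
 obtain C where C: "0 <= C" "!!xi. en (norm xi) * abs_op ?n ?n ?n xi <= en C"
 using abs_op_inverse_norm by blast
 have A: "en (norm xi) * abs_op (eabs f) (eabs g) (eabs h) xi <= en C * Xdot1_norm f * Xdot1_norm g * Xdot1_norm h"
 if [measurable]: "f : bmf" "g : bmf" "h : bmf" for f g h xi
 proof -
 have "abs_op (eabs f) (eabs g) (eabs h) xi <= abs_op (%x. Xdot1_norm f * ?n x) (%x. Xdot1_norm g * ?n x) (%x. Xdot1_norm h * ?n x) xi"
 by (intro abs_op_mono_AE Xdot1_AE)
 also have "... = Xdot1_norm f * Xdot1_norm g * Xdot1_norm h * abs_op ?n ?n ?n xi"
 by (rule abs_op_scale) measurable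
 finally have "en (norm xi) * abs_op (eabs f) (eabs g) (eabs h) xi <= en (norm xi) * (Xdot1_norm f * Xdot1_norm g * Xdot1_norm h * abs_op ?n ?n ?n xi)"
 by (rule mult_left_mono) auto
 also have "... = (Xdot1_norm f * Xdot1_norm g * Xdot1_norm h) * (en (norm xi) * abs_op ?n ?n ?n xi)" by (simp only: mult_ac)
 also have "... <= (Xdot1_norm f * Xdot1_norm g * Xdot1_norm h) * en C" by (intro mult_left_mono C) auto
 finally show ?thesis by (simp only: mult_ac)
 qed
 have "Xdot1_norm (CR_op f g h) <= en C * Xdot1_norm f * Xdot1_norm g * Xdot1_norm h"
 if [measurable]: "f : bmf" "g : bmf" "h : bmf" for f g h
 unfolding Xdot1_norm_def[of "CR_op f g h"]
 proof (rule Linf_norm_le, measurable, rule always_eventually, rule allI)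
 fix xi
 have "en (cmod (norm xi *R CR_op f g h xi)) = en (norm xi) * eabs (CR_op f g h) xi"
 by (simp add: eabs_def ennreal_mult)
 also have "... <= en (norm xi) * abs_op (eabs f) (eabs g) (eabs h) xi"
 by (intro mult_left_mono norm_CR_op_le) auto
 finally show "en (cmod (norm xi *R CR_op f g h xi)) <= en C * Xdot1_norm f * Xdot1_norm g * Xdot1_norm h"
 using A[of f g h xi] by (auto intro: order_trans)
 qed
 with A C(1) show ?thesis by blast
qed

section \<open>From the abstract equation to curves of functions\<close>

lemma indicator_scaleR_split:
 fixes ph :: "'a => 'v::real_vector"
 assumes "finite (s ` S)"
 shows "ind S t *R ph (s t) = (\<Sum>y\<in>s ` S. indicat_real (s -` {y} \<inter> S) t *R ph y)"
proof (cases "t : S")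
 case True
 have "(\<Sum>y\<in>s ` S. indicat_real (s -` {y} \<inter> S) t *R ph y) = (\<Sum>y\<in>s ` S. if y = s t then ph y else 0)"
 using True by (intro sum.cong) (auto simp: indicator_def)
 then show ?thesis using True assms by simp
next
 case False
 then have "(\<Sum>y\<in>s ` S. indicat_real (s -` {y} \<inter> S) t *R ph y) = 0" by (intro sum.neutral) auto
 with False show ?thesis by simp
qed

text \<open>
 \<open>J\<close> identifies a function space, modulo null sets, with a Banach space type. The abstract theory
 above is thereby available for each of the norms, although the norms form families that depend on
 a real parameter.
\<close>

locale realized_space =
 fixes N :: plane_norm and J :: "plane_fun => 'b::banach"
 assumes add_in: "f : fun_space N ==> g : fun_space N ==> (%x. f x + g x) : fun_space N"
 and J_add: "f : fun_space N ==> g : fun_space N ==> J (%x. f x + g x) = J f + J g"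
 and scale_in: "f : fun_space N ==> (%x. c * f x) : fun_space N"
 and norm_scale: "f : fun_space N ==> N (%x. c * f x) = en (cmod c) * N f"
 and J_scale: "f : fun_space N ==> J (%x. cor r * f x) = r *R J f"
 and J_norm: "f : fun_space N ==> N f = en (norm (J f))"
 and J_eq: "f : fun_space N ==> g : fun_space N ==> J f = J g \<longleftrightarrow> (AE x in lborel. f x = g x)"
 and cong_in: "f : fun_space N ==> g : bmf ==> AE x in lborel. f x = g x ==> g : fun_space N"
 and J_surj: "\<exists>f\<in>fun_space N. J f = u"
begin

definition lift :: "'b => plane_fun" where "lift u = (SOME f. f : fun_space N & J f = u)"

lemma lift_in [simp]: "lift u : fun_space N" and J_lift [simp]: "J (lift u) = u"
 using someI_ex[of "%f. f : fun_space N & J f = u"] J_surj[of u] unfolding lift_def by auto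

lemma diff_in: "f : fun_space N ==> g : fun_space N ==> (%x. f x - g x) : fun_space N"
 using add_in[of f "%x. (-1) * g x"] scale_in[of g "-1"] by simp

lemma J_diff: "f : fun_space N ==> g : fun_space N ==> J (%x. f x - g x) = J f - J g"
 using J_add[of f "%x. (-1) * g x"] scale_in[of g "-1"] J_scale[of g "-1"] by simp

lemma dist_eq: "f : fun_space N ==> g : fun_space N ==> fun_dist N f g = en (norm (J f - J g))"
 unfolding fun_dist_def by (subst J_norm) (simp_all add: diff_in J_diff)

lemma zero_in: "(%x. 0) : fun_space N" and J_zero: "J (%x. 0) = 0"
 using scale_in[OF lift_in, of 0 0] J_scale[OF lift_in, of 0 0] by simp_all

lemma sum_in: "finite A ==> (!!i. i : A ==> f i : fun_space N) ==> (%x. \<Sum>i\<in>A. c i *R f i x) : fun_space N \<and>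
 J (%x. \<Sum>i\<in>A. c i *R f i x) = (\<Sum>i\<in>A. c i *R J (f i))"
proof (induction A rule: finite_induct)
 case empty
 then show ?case by (simp add: zero_in J_zero)
next
 case (insert i A)
 have i: "(%x. c i *R f i x) : fun_space N" "J (%x. c i *R f i x) = c i *R J (f i)"
 using insert.prems[of i] scale_in[of "f i" "cor (c i)"] J_scale[of "f i" "c i"] by (simp_all add: scaleR_conv_of_real)
 show ?case
 using insert add_in[OF i(1)] J_add[OF i(1)] i by simp
qed

lemma cont_curveI:
 assumes "!!t. t : S ==> u t : fun_space N" "continuous_on S (%t. J (u t))"
 shows "cont_curve N S u"
 unfolding cont_curve_def
proof (intro ballI conjI)
 fix t assume t: "t : S"
 have "((%s. J (u s)) \<longlongrightarrow> J (u t)) (at t within S)"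
 using assms(2) t by (simp add: continuous_on_def)
 then have "((%s. en (norm (J (u s) - J (u t)))) \<longlongrightarrow> en 0) (at t within S)"
 by (intro tendsto_ennrealI tendsto_norm_zero LIM_zero)
 then show "((%s. fun_dist N (u s) (u t)) \<longlongrightarrow> 0) (at t within S)"
 proof (subst tendsto_cong)
 show "\<forall>\<^sub>F s in at t within S. fun_dist N (u s) (u t) = en (norm (J (u s) - J (u t)))"
 using t assms(1) by (auto simp: eventually_at_filter dist_eq)
 qed simp
qed (use assms in auto)

lemma deriv_curveI:
 assumes u: "!!t. t : S ==> u t : fun_space N" and v: "!!t. t : S ==> v t : fun_space N"
 and d: "!!t. t : S ==> ((%t. J (u t)) has_vector_derivative J (v t)) (at t within S)"
 shows "deriv_curve N S u v"
 unfolding deriv_curve_def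
proof
 fix t assume t: "t : S"
 have q: "(%x. (u s x - u t x) /\<^sub>R (s - t)) : fun_space N \<and>
 J (%x. (u s x - u t x) /\<^sub>R (s - t)) = (J (u s) - J (u t)) /\<^sub>R (s - t)" if "s : S" for s
 using scale_in[OF diff_in[OF u[OF that] u[OF t]], of "cor (inverse (s - t))"]
 J_scale[OF diff_in[OF u[OF that] u[OF t]], of "inverse (s - t)"] J_diff[OF u[OF that] u[OF t]]
 by (simp add: scaleR_conv_of_real)
 have "((%s. en (norm ((J (u s) - J (u t)) /\<^sub>R (s - t) - J (v t)))) \<longlongrightarrow> en 0) (at t within S)"
 using d[OF t] unfolding has_vector_derivative_iff_quotient
 by (intro tendsto_ennrealI tendsto_norm_zero LIM_zero)
 then show "((%s. fun_dist N (%x. (u s x - u t x) /\<^sub>R (s - t)) (v t)) \<longlongrightarrow> 0) (at t within S)"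
 proof (subst tendsto_cong)
 show "\<forall>\<^sub>F s in at t within S. fun_dist N (%x. (u s x - u t x) /\<^sub>R (s - t)) (v t) = en (norm ((J (u s) - J (u t)) /\<^sub>R (s - t) - J (v t)))"
 using t q v by (auto simp: eventually_at_filter dist_eq)
 qed simp
qed

subsection \<open>Integrals of simple curves\<close>

abbreviation (input) "MI a b \<equiv> restrict_space lborel {a..b::real}"

lemma simple_curve_integral:
 assumes "simple_curve N (MI a b) s"
 shows "(%x. LINT t|MI a b. s t x) : fun_space N"
 and "((%t. J (s t)) has_integral J (%x. LINT t|MI a b. s t x)) {a..b}"
proof -
 have sp: "space (MI a b) = {a..b}" by (simp add: space_restrict_space)
 define R where "R = s ` {a..b}"
 have fin: "finite R" and s: "!!t. t : {a..b} ==> s t : fun_space N" and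
 pre: "!!y. y : R ==> s -` {y} \<inter> {a..b} : sets (MI a b)"
 using assms by (auto simp: simple_curve_def simple_function_def R_def sp)
 define A where "A y = s -` {y} \<inter> {a..b}" for y
 have A [measurable]: "A y : sets borel" if "y : R" for y
 using pre[OF that] by (auto simp: A_def sets_restrict_space_iff)
 have Af: "emeasure lborel (A y) < \<infinity>" if "y : R" for y
 using emeasure_mono[of "A y" "{a..b}" lborel] emeasure_bounded_finite[of "{a..b}"] by (auto simp: A_def intro: le_less_trans)
 have Rin: "y : fun_space N" if "y : R" for y using that s by (auto simp: R_def)
 have eq: "(%x. LINT t|MI a b. s t x) = (%x. \<Sum>y\<in>R. measure lborel (A y) *R y x)"
 proof
 fix x
 have "(LINT t|MI a b. s t x) = (IN t. ind {a..b} t *R s t x)"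
 by (rule integral_restrict_space) simp
 also have "... = (IN t. (\<Sum>y\<in>R. indicat_real (A y) t *R y x))"
 using indicator_scaleR_split[OF fin[unfolded R_def], where ph="%y. y x"] by (simp add: R_def A_def)
 also have "... = (\<Sum>y\<in>R. measure lborel (A y) *R y x)"
 using A Af by (subst Bochner_Integration.integral_sum) (auto intro!: sum.cong)
 finally show "(LINT t|MI a b. s t x) = (\<Sum>y\<in>R. measure lborel (A y) *R y x)" .
 qed
 have Jeq: "J (%x. LINT t|MI a b. s t x) = (\<Sum>y\<in>R. measure lborel (A y) *R J y)"
 and in': "(%x. LINT t|MI a b. s t x) : fun_space N"
 unfolding eq using sum_in[OF fin Rin, of "%y. y"] by auto
 show "(%x. LINT t|MI a b. s t x) : fun_space N" by (fact in')
 have "((%t. \<Sum>y\<in>R. indicat_real (A y) t *R J y) has_integral (\<Sum>y\<in>R. measure lborel (A y) *R J y)) {a..b}"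
 proof (intro has_integral_sum fin has_integral_scaleR_left)
 fix y assume y: "y : R"
 have "((%t. 1::real) has_integral measure lborel (A y)) (A y)"
 using A[OF y] Af[OF y] by (intro has_integral_measure_lborel) auto
 then have "((%t. if t : A y then 1 else 0::real) has_integral measure lborel (A y)) {a..b}"
 by (subst has_integral_restrict) (auto simp: A_def)
 then show "(indicat_real (A y) has_integral measure lborel (A y)) {a..b}"
 by (simp add: indicator_def[abs_def] of_bool_def)
 qed
 then have "((%t. indicat_real {a..b} t *R J (s t)) has_integral J (%x. LINT t|MI a b. s t x)) {a..b}"
 unfolding indicator_scaleR_split[OF fin[unfolded R_def], where ph=J] Jeq by (simp add: R_def A_def)
 then show "((%t. J (s t)) has_integral J (%x. LINT t|MI a b. s t x)) {a..b}"
 by (rule has_integral_eq[rotated]) auto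
qed

lemma simple_function_grid:
 assumes "0 < c"
 shows "simple_function (MI a b) (%t. \<lfloor>(t - a) * c\<rfloor>)"
 unfolding simple_function_def
proof
 have sp: "space (MI a b) = {a..b}" by (simp add: space_restrict_space)
 have "(%t. \<lfloor>(t - a) * c\<rfloor>) ` {a..b} \<subseteq> {0..\<lfloor>(b - a) * c\<rfloor>}"
 using assms by (auto intro!: floor_mono mult_right_mono)
 then show "finite ((%t. \<lfloor>(t - a) * c\<rfloor>) ` space (MI a b))"
 unfolding sp by (rule finite_subset) simp
 have m: "(%t. \<lfloor>(t - a) * c\<rfloor>) : measurable (MI a b) (count_space UNIV)"
 by (intro measurable_restrict_space1) measurable
 show "\<forall>x\<in>(%t. \<lfloor>(t - a) * c\<rfloor>) ` space (MI a b). (%t. \<lfloor>(t - a) * c\<rfloor>) -` {x} \<inter> space (MI a b) : sets (MI a b)"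
 using measurable_sets[OF m] by auto
qed

lemma continuous_curve_integral:
 assumes ab: "a <= b" and w: "!!t. t : {a..b} ==> w t : fun_space N" and c: "continuous_on {a..b} (%t. J (w t))"
 shows "has_curve_integral N (MI a b) w (lift (integral {a..b} (%t. J (w t))))"
proof -
 have sp: "space (MI a b) = {a..b}" by (simp add: space_restrict_space)
 define g where "g n t = a + real_of_int \<lfloor>(t - a) * real (Suc n)\<rfloor> / real (Suc n)" for n t
 have g: "g n t : {a..b} & \<bar>t - g n t\<bar> <= 1 / real (Suc n)" if t: "t : {a..b}" for n t
 proof -
 let ?m = "real (Suc n)"
 have m: "?m > 0" by simp
 have f: "real_of_int \<lfloor>(t - a) * ?m\<rfloor> <= (t - a) * ?m" "(t - a) * ?m < real_of_int \<lfloor>(t - a) * ?m\<rfloor> + 1" "0 <= \<lfloor>(t - a) * ?m\<rfloor>"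
 using t by (auto intro: mult_nonneg_nonneg)
 have "real_of_int \<lfloor>(t - a) * ?m\<rfloor> / ?m <= t - a" using f(1) m by (simp only: pos_divide_le_eq)
 moreover have "t - a < (real_of_int \<lfloor>(t - a) * ?m\<rfloor> + 1) / ?m" using f(2) m by (simp only: pos_less_divide_eq)
 moreover have "0 <= real_of_int \<lfloor>(t - a) * ?m\<rfloor> / ?m" using f(3) by simp
 ultimately show ?thesis using t unfolding g_def add_divide_distrib by auto
 qed
 define s where "s n t = w (g n t)" for n t
 have simple: "simple_curve N (MI a b) (s n)" for n
 unfolding simple_curve_def
 proof
 have "simple_function (MI a b) ((%k. w (a + real_of_int k / real (Suc n))) \<circ> (%t. \<lfloor>(t - a) * real (Suc n)\<rfloor>))"
 by (intro simple_function_compose simple_function_grid) simp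
 then show "simple_function (MI a b) (s n)" by (simp add: s_def[abs_def] g_def[abs_def] o_def)
 qed (use g w in \<open>auto simp: s_def sp\<close>)
 have unif: "\<forall>\<^sub>F n in sequentially. \<forall>t\<in>{a..b}. norm (J (w t) - J (s n t)) <= e" if e: "0 < e" for e
 proof -
 have "uniformly_continuous_on {a..b} (%t. J (w t))" by (rule compact_uniformly_continuous[OF c]) simp
 then obtain d where d: "d > 0" "!!x y. x : {a..b} ==> y : {a..b} ==> dist y x < d ==> dist (J (w y)) (J (w x)) < e"
 using e unfolding uniformly_continuous_on_def by metis
 have "\<forall>\<^sub>F n in sequentially. 1 / real (Suc n) < d"
 using LIMSEQ_Suc[OF lim_1_over_n] d(1) by (rule order_tendstoD)
 then show ?thesis
 proof (rule eventually_mono, intro ballI)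
 fix n t assume n: "1 / real (Suc n) < d" and t: "t : {a..b}"
 show "norm (J (w t) - J (s n t)) <= e"
 using d(2)[of "g n t" t] g[OF t, of n] n t by (simp add: s_def dist_norm dist_real_def)
 qed
 qed
 have din: "fun_dist N (w t) (s n t) = en (norm (J (w t) - J (s n t)))" if "t : {a..b}" for n t
 by (rule dist_eq) (use that w g in \<open>auto simp: s_def\<close>)
 have "approx_curve N (MI a b) s w"
 unfolding approx_curve_def
 proof (intro conjI allI simple AE_I2)
 fix t assume "t : space (MI a b)"
 then have t: "t : {a..b}" by (simp add: sp)
 have "(%n. norm (J (w t) - J (s n t))) ----> 0"
 proof (rule tendstoI)
 fix e :: real assume "e > 0"
 then have "\<forall>\<^sub>F n in sequentially. \<forall>t\<in>{a..b}. norm (J (w t) - J (s n t)) <= e / 2" by (intro unif) simp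
 then show "\<forall>\<^sub>F n in sequentially. dist (norm (J (w t) - J (s n t))) 0 < e"
 by eventually_elim (use t \<open>e > 0\<close> in force)
 qed
 then show "(%n. fun_dist N (w t) (s n t)) ----> 0"
 unfolding din[OF t] using tendsto_ennrealI by fastforce
 qed
 moreover have "(%n. \<integral>\<^sup>+t. fun_dist N (w t) (s n t) \<partial>MI a b) ----> 0"
 proof (rule tendsto_sandwich)
 define e where "e n = Sup ((%t. norm (J (w t) - J (s n t))) ` {a..b})" for n
 show "(%n. 0::ennreal) ----> 0" by simp
 show "\<forall>\<^sub>F n in sequentially. 0 <= (\<integral>\<^sup>+t. fun_dist N (w t) (s n t) \<partial>MI a b)" by simp
 have "e ----> 0"
 proof (rule tendstoI)
 fix r :: real assume "r > 0"
 then have "\<forall>\<^sub>F n in sequentially. \<forall>t\<in>{a..b}. norm (J (w t) - J (s n t)) <= r / 2" by (intro unif) simp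
 then show "\<forall>\<^sub>F n in sequentially. dist (e n) 0 < r"
 proof eventually_elim
 fix n assume h: "\<forall>t\<in>{a..b}. norm (J (w t) - J (s n t)) <= r / 2"
 have "e n <= r / 2" unfolding e_def using h ab by (intro cSup_least) auto
 moreover have "norm (J (w a) - J (s n a)) <= e n"
 unfolding e_def using h ab by (intro cSup_upper) (auto intro!: bdd_aboveI2[where M="r / 2"])
 then have "0 <= e n" using norm_ge_zero order_trans by blast
 ultimately show "dist (e n) 0 < r" using \<open>r > 0\<close> by simp
 qed
 qed
 then have "(%n. e n * (b - a)) ----> 0 * (b - a)" by (intro tendsto_intros)
 then have "(%n. en (e n * (b - a))) ----> en (0 * (b - a))" by (rule tendsto_ennrealI)
 then show "(%n. en (e n * (b - a))) ----> 0" by simp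
 show "\<forall>\<^sub>F n in sequentially. (\<integral>\<^sup>+t. fun_dist N (w t) (s n t) \<partial>MI a b) <= en (e n * (b - a))"
 using unif[of 1, simplified]
 proof eventually_elim
 fix n assume h: "\<forall>t\<in>{a..b}. norm (J (w t) - J (s n t)) <= 1"
 have "(\<integral>\<^sup>+t. fun_dist N (w t) (s n t) \<partial>MI a b) <= (\<integral>\<^sup>+t. en (e n) \<partial>MI a b)"
 by (rule nn_integral_mono) (use h in \<open>auto simp: din sp e_def intro!: ennreal_leI cSup_upper bdd_aboveI2[where M=1]\<close>)
 then show "(\<integral>\<^sup>+t. fun_dist N (w t) (s n t) \<partial>MI a b) <= en (e n * (b - a))"
 using ab by (simp add: emeasure_restrict_space sp ennreal_mult'')
 qed
 qed
 moreover have "(%n. fun_dist N (%x. LINT t|MI a b. s n t x) (lift (integral {a..b} (%t. J (w t))))) ----> 0"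
 proof -
 have i: "((%t. J (w t)) has_integral integral {a..b} (%t. J (w t))) {a..b}"
 by (intro integrable_integral integrable_continuous_interval c)
 have "(%n. norm (J (%x. LINT t|MI a b. s n t x) - integral {a..b} (%t. J (w t)))) ----> 0"
 proof (rule tendstoI)
 fix r :: real assume r: "r > 0"
 define e where "e = r / (2 * (b - a + 1))"
 have e: "0 < e" "e * (b - a) < r"
 proof -
 have "0 < 2 * (b - a + 1)" using ab by simp
 then show "0 < e" and "e * (b - a) < r"
 proof -
 show "0 < e" using r \<open>0 < 2 * (b - a + 1)\<close> by (simp only: e_def divide_pos_pos)
 then have "e * (b - a) < e * (2 * (b - a + 1))" using ab by (intro mult_strict_left_mono) auto
 also have "... = r" using \<open>0 < 2 * (b - a + 1)\<close> unfolding e_def by simp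
 finally show "e * (b - a) < r" .
 qed
 qed
 show "\<forall>\<^sub>F n in sequentially. dist (norm (J (%x. LINT t|MI a b. s n t x) - integral {a..b} (%t. J (w t)))) 0 < r"
 using unif[OF e(1)]
 proof eventually_elim
 fix n assume h: "\<forall>t\<in>{a..b}. norm (J (w t) - J (s n t)) <= e"
 have "((%t. J (s n t) - J (w t)) has_integral (J (%x. LINT t|MI a b. s n t x) - integral {a..b} (%t. J (w t)))) (cbox a b)"
 using has_integral_diff[OF simple_curve_integral(2)[OF simple[of n]] i] by simp
 then have "norm (J (%x. LINT t|MI a b. s n t x) - integral {a..b} (%t. J (w t))) <= e * Henstock_Kurzweil_Integration.content (cbox a b)"
 by (rule has_integral_bound[rotated]) (use h e in \<open>auto simp: norm_minus_commute\<close>)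
 then show "dist (norm (J (%x. LINT t|MI a b. s n t x) - integral {a..b} (%t. J (w t)))) 0 < r"
 using e ab by simp
 qed
 qed
 then have "(%n. en (norm (J (%x. LINT t|MI a b. s n t x) - integral {a..b} (%t. J (w t))))) ----> en 0"
 by (rule tendsto_ennrealI)
 then show ?thesis
 using dist_eq[OF simple_curve_integral(1)[OF simple] lift_in] by simp
 qed
 ultimately show ?thesis
 unfolding has_curve_integral_def using w by (auto simp: sp intro!: AE_I2)
qed

text \<open>
 The distance of a limit of simple curves to a simple curve is, almost everywhere, a measurable
 function. This makes integrals of such distances additive.
\<close>

lemma approx_curve_measurable_distance:
 assumes u: "AE t in M. u t : fun_space N" and s: "approx_curve N M s u"
 shows "\<exists>d\<in>borel_measurable M. AE t in M. d t = en (norm (J (u t) - J (s n t)))"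
proof -
 have simple: "simple_function M (s m)" "!!t. t : space M ==> s m t : fun_space N" for m
 using s by (auto simp: approx_curve_def simple_curve_def)
 define d where "d t = liminf (%m. en (norm (J (s m t) - J (s n t))))" for t
 have "(%t. en (norm (J (s m t) - J (s n t)))) : borel_measurable M" for m
 using simple_function_compose2[OF simple(1)[of m] simple(1)[of n], of "%f g. en (norm (J f - J g))"]
 by (rule borel_measurable_simple_function)
 then have "d : borel_measurable M" unfolding d_def[abs_def] by measurable
 moreover have "AE t in M. d t = en (norm (J (u t) - J (s n t)))"
 proof -
 have "AE t in M. (%m. fun_dist N (u t) (s m t)) ----> 0" using s by (simp add: approx_curve_def)
 with u AE_space show ?thesis
 proof eventually_elim
 fix t assume t: "u t : fun_space N" "t : space M" and lim: "(%m. fun_dist N (u t) (s m t)) ----> 0"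
 have "(%m. en (norm (J (u t) - J (s m t)))) ----> en 0"
 using lim t simple(2) by (simp add: dist_eq)
 then have "(%m. norm (J (u t) - J (s m t))) ----> 0"
 by (subst (asm) tendsto_ennreal_iff) auto
 then have "(%m. J (u t) - J (s m t)) ----> 0" by (rule tendsto_norm_zero_cancel)
 then have "(%m. J (u t) - (J (u t) - J (s m t))) ----> J (u t) - 0" by (intro tendsto_intros)
 then have "(%m. en (norm (J (s m t) - J (s n t)))) ----> en (norm (J (u t) - J (s n t)))"
 by (intro tendsto_ennrealI tendsto_intros) simp
 then show "d t = en (norm (J (u t) - J (s n t)))"
 unfolding d_def by (intro lim_imp_Liminf) auto
 qed
 qed
 ultimately show ?thesis by blast
qed

lemma norm_simple_curve_integral_diff:
 assumes s: "simple_curve N (MI a b) s" and s': "simple_curve N (MI a b) s'"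
 shows "en (norm (J (%x. LINT t|MI a b. s t x) - J (%x. LINT t|MI a b. s' t x)))
 <= (\<integral>\<^sup>+t. en (norm (J (s t) - J (s' t))) \<partial>MI a b)"
proof -
 define p where "p t = norm (J (s t) - J (s' t))" for t
 have "simple_function (MI a b) p"
 using simple_function_compose2[of "MI a b" s s' "%f g. norm (J f - J g)"] s s'
 by (simp add: simple_curve_def p_def[abs_def])
 then have fin: "finite (p ` space (MI a b))" and [measurable]: "p : borel_measurable (MI a b)"
 by (auto simp: simple_function_def borel_measurable_simple_function)
 have sp: "space (MI a b) = {a..b}" by (simp add: space_restrict_space)
 have "\<exists>B. \<forall>t\<in>{a..b}. \<bar>p t\<bar> <= B"
 using finite_imp_bounded[OF fin] unfolding bounded_iff sp by auto
 then obtain B where B: "!!t. t : {a..b} ==> \<bar>p t\<bar> <= B" by blast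
 have i: "integrable (MI a b) p"
 proof (rule Bochner_Integration.integrable_bound)
 show "integrable (MI a b) (%_. B)"
 by (rule finite_measure.integrable_const, rule finite_measureI)
 (use emeasure_bounded_finite[of "{a..b}"] in \<open>simp add: emeasure_restrict_space sp\<close>)
 show "AE t in MI a b. norm (p t) <= norm B"
 by (rule AE_I2) (use B in \<open>force simp: sp\<close>)
 qed measurable
 then have si: "set_integrable lborel {a..b} p"
 by (simp add: set_integrable_def integrable_restrict_space)
 have "(p has_integral (LINT t:{a..b}|lborel. p t)) {a..b}"
 using set_borel_integral_eq_integral[OF si] by (simp add: has_integral_integral)
 then have "norm (J (%x. LINT t|MI a b. s t x) - J (%x. LINT t|MI a b. s' t x)) <= (LINT t:{a..b}|lborel. p t)"
 using has_integral_diff[OF simple_curve_integral(2)[OF s] simple_curve_integral(2)[OF s']]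
 integral_norm_bound_integral[of "%t. J (s t) - J (s' t)" "{a..b}" p]
 by (auto simp: p_def has_integral_integrable_integral)
 also have "en (LINT t:{a..b}|lborel. p t) = (\<integral>\<^sup>+t. en (p t) \<partial>MI a b)"
 using i by (subst nn_integral_eq_integral) (auto simp: p_def set_lebesgue_integral_def integral_restrict_space)
 finally show ?thesis by (simp add: p_def ennreal_leI)
qed

lemma curve_integral_distance_le:
 assumes u: "has_curve_integral N (MI a b) u I" and u': "has_curve_integral N (MI a b) u' I'"
 and be [measurable]: "be : bmf"
 and le: "AE t in MI a b. norm (J (u t) - J (u' t)) <= be t"
 shows "en (norm (J I - J I')) <= (\<integral>\<^sup>+t. en (be t) \<partial>MI a b)"
proof -
 let ?M = "MI a b"
 have [measurable]: "be : borel_measurable ?M" by (intro measurable_restrict_space1) simp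
 obtain s where s: "AE t in ?M. u t : fun_space N" "I : fun_space N" "approx_curve N ?M s u"
 "(%n. \<integral>\<^sup>+ t. fun_dist N (u t) (s n t) \<partial>?M) ----> 0" "(%n. fun_dist N (%x. LINT t|?M. s n t x) I) ----> 0"
 using u unfolding has_curve_integral_def by blast
 obtain s' where s': "AE t in ?M. u' t : fun_space N" "I' : fun_space N" "approx_curve N ?M s' u'"
 "(%n. \<integral>\<^sup>+ t. fun_dist N (u' t) (s' n t) \<partial>?M) ----> 0" "(%n. fun_dist N (%x. LINT t|?M. s' n t x) I') ----> 0"
 using u' unfolding has_curve_integral_def by blast
 have simple: "simple_curve N ?M (s n)" "simple_curve N ?M (s' n)" for n
 using s(3) s'(3) by (auto simp: approx_curve_def)
 let ?S = "%n x. LINT t|?M. s n t x" and ?S' = "%n x. LINT t|?M. s' n t x"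
 have bound: "en (norm (J I - J I')) <= fun_dist N (?S n) I + ((\<integral>\<^sup>+ t. fun_dist N (u t) (s n t) \<partial>?M)
 + (\<integral>\<^sup>+t. en (be t) \<partial>?M) + (\<integral>\<^sup>+ t. fun_dist N (u' t) (s' n t) \<partial>?M)) + fun_dist N (?S' n) I'" for n
 proof -
 obtain d where [measurable]: "d : borel_measurable ?M" and d: "AE t in ?M. d t = en (norm (J (u t) - J (s n t)))"
 using approx_curve_measurable_distance[OF s(1,3)] by blast
 obtain d' where [measurable]: "d' : borel_measurable ?M" and d': "AE t in ?M. d' t = en (norm (J (u' t) - J (s' n t)))"
 using approx_curve_measurable_distance[OF s'(1,3)] by blast
 have dd: "(\<integral>\<^sup>+ t. fun_dist N (u t) (s n t) \<partial>?M) = (\<integral>\<^sup>+ t. d t \<partial>?M)"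
 by (rule nn_integral_cong_AE, use d s(1) AE_space in eventually_elim)
 (use simple(1)[of n] in \<open>auto simp: dist_eq simple_curve_def\<close>)
 have dd': "(\<integral>\<^sup>+ t. fun_dist N (u' t) (s' n t) \<partial>?M) = (\<integral>\<^sup>+ t. d' t \<partial>?M)"
 by (rule nn_integral_cong_AE, use d' s'(1) AE_space in eventually_elim)
 (use simple(2)[of n] in \<open>auto simp: dist_eq simple_curve_def\<close>)
 have "en (norm (J (?S n) - J (?S' n))) <= (\<integral>\<^sup>+t. en (norm (J (s n t) - J (s' n t))) \<partial>?M)"
 by (rule norm_simple_curve_integral_diff[OF simple])
 also have "... <= (\<integral>\<^sup>+t. d t + en (be t) + d' t \<partial>?M)"
 proof (rule nn_integral_mono_AE, use d d' le in eventually_elim)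
 fix t assume h: "d t = en (norm (J (u t) - J (s n t)))" "d' t = en (norm (J (u' t) - J (s' n t)))"
 "norm (J (u t) - J (u' t)) <= be t"
 have "norm (J (s n t) - J (s' n t)) = norm ((J (u t) - J (u' t)) - (J (u t) - J (s n t)) + (J (u' t) - J (s' n t)))" by simp
 also have "... <= norm (J (u t) - J (u' t)) + norm (J (u t) - J (s n t)) + norm (J (u' t) - J (s' n t))"
 by (intro order_trans[OF norm_triangle_ineq] add_right_mono norm_triangle_ineq4)
 finally have "norm (J (s n t) - J (s' n t)) <= norm (J (u t) - J (s n t)) + be t + norm (J (u' t) - J (s' n t))" using h(3) by simp
 then have "en (norm (J (s n t) - J (s' n t))) <= en (norm (J (u t) - J (s n t)) + be t + norm (J (u' t) - J (s' n t)))"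
 by (rule ennreal_leI)
 also have "... = d t + en (be t) + d' t"
 proof -
 have "0 <= be t" using h(3) norm_ge_zero order_trans by blast
 then show ?thesis using h(1,2) by (simp add: ennreal_plus)
 qed
 finally show "en (norm (J (s n t) - J (s' n t))) <= d t + en (be t) + d' t" .
 qed
 also have "... = (\<integral>\<^sup>+t. d t \<partial>?M) + (\<integral>\<^sup>+t. en (be t) \<partial>?M) + (\<integral>\<^sup>+t. d' t \<partial>?M)"
 by (simp add: nn_integral_add)
 finally have m: "en (norm (J (?S n) - J (?S' n))) <= (\<integral>\<^sup>+ t. fun_dist N (u t) (s n t) \<partial>?M)
 + (\<integral>\<^sup>+t. en (be t) \<partial>?M) + (\<integral>\<^sup>+ t. fun_dist N (u' t) (s' n t) \<partial>?M)" unfolding dd dd' .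
 have "norm (J I - J I') = norm ((J (?S n) - J (?S' n)) - (J (?S n) - J I) + (J (?S' n) - J I'))" by simp
 also have "... <= norm (J (?S n) - J (?S' n)) + norm (J (?S n) - J I) + norm (J (?S' n) - J I')"
 by (intro order_trans[OF norm_triangle_ineq] add_right_mono norm_triangle_ineq4)
 finally have "en (norm (J I - J I')) <= en (norm (J (?S n) - J I)) + en (norm (J (?S n) - J (?S' n))) + en (norm (J (?S' n) - J I'))"
 by (simp add: ennreal_plus[symmetric] ennreal_leI add_ac del: ennreal_plus)
 also have "... <= fun_dist N (?S n) I + ((\<integral>\<^sup>+ t. fun_dist N (u t) (s n t) \<partial>?M)
 + (\<integral>\<^sup>+t. en (be t) \<partial>?M) + (\<integral>\<^sup>+ t. fun_dist N (u' t) (s' n t) \<partial>?M)) + fun_dist N (?S' n) I'"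
 using m dist_eq[OF simple_curve_integral(1)[OF simple(1)[of n]] s(2)] dist_eq[OF simple_curve_integral(1)[OF simple(2)[of n]] s'(2)]
 by (intro add_mono) auto
 finally show ?thesis .
 qed
 have "(%n. fun_dist N (?S n) I + ((\<integral>\<^sup>+ t. fun_dist N (u t) (s n t) \<partial>?M)
 + (\<integral>\<^sup>+t. en (be t) \<partial>?M) + (\<integral>\<^sup>+ t. fun_dist N (u' t) (s' n t) \<partial>?M)) + fun_dist N (?S' n) I')
 ----> 0 + (0 + (\<integral>\<^sup>+t. en (be t) \<partial>?M) + 0) + 0"
 by (intro tendsto_add s(4,5) s'(4,5) tendsto_const)
 then show ?thesis
 using bound by (intro LIMSEQ_le_const[where X="%n. fun_dist N (?S n) I + ((\<integral>\<^sup>+ t. fun_dist N (u t) (s n t) \<partial>?M)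
 + (\<integral>\<^sup>+t. en (be t) \<partial>?M) + (\<integral>\<^sup>+ t. fun_dist N (u' t) (s' n t) \<partial>?M)) + fun_dist N (?S' n) I'"]) auto
qed

end

subsection \<open>Well-posedness from the abstract flow\<close>

lemma (in bounded_trilinear) cubic_sol_dist_two_sided:
 assumes u: "cubic_sol F {a..b} u" and v: "cubic_sol F {a..b} v" and ab: "a <= 0" "0 <= b"
 and B: "!!t. t : {a..b} ==> norm (u t) <= B" "!!t. t : {a..b} ==> norm (v t) <= B" and t: "t : {a..b}"
 shows "norm (u t - v t) <= norm (u 0 - v 0) * exp (3 * K * B^2 * \<bar>t\<bar>)"
proof (cases "0 <= t")
 case True
 have "norm (u t - v t) <= norm (u 0 - v 0) * exp (3 * K * B^2 * t)"
 by (rule cubic_sol_dist[of b]) (use assms True in \<open>auto intro: cubic_sol_subset\<close>)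
 then show ?thesis using True by simp
next
 case False
 interpret m: bounded_trilinear "%u v w. - F u v w" by (rule uminus)
 have mK: "m.K = K" by (simp add: K_def m.K_def)
 have r: "cubic_sol (%u v w. - F u v w) {0..-a} (%t. u (- t))" "cubic_sol (%u v w. - F u v w) {0..-a} (%t. v (- t))"
 using cubic_sol_reverse[OF u] cubic_sol_reverse[OF v] ab by (auto intro: cubic_sol_subset)
 have "norm (u (- (- t)) - v (- (- t))) <= norm (u (- 0) - v (- 0)) * exp (3 * m.K * B^2 * (- t))"
 by (rule m.cubic_sol_dist[OF r]) (use assms False in auto)
 then show ?thesis using False by (simp add: mK)
qed

text \<open>The curves obtained from \<open>U\<close> by sums and by \<open>F\<close> are closed under differentiation if \<open>U\<close> solves the equation.\<close>

inductive generated_curve :: "('b::real_normed_vector => 'b => 'b => 'b) => (real => 'b) => (real => 'b) => bool"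
 for F U where
 generated_base: "generated_curve F U U"
 | generated_op: "generated_curve F U p ==> generated_curve F U q ==> generated_curve F U r ==> generated_curve F U (%t. F (p t) (q t) (r t))"
 | generated_add: "generated_curve F U p ==> generated_curve F U q ==> generated_curve F U (%t. p t + q t)"

lemma (in bounded_trilinear) generated_curve_derivative:
 assumes "cubic_sol F S U" and "generated_curve F U p"
 shows "\<exists>p'. generated_curve F U p' & (\<forall>t\<in>S. (p has_vector_derivative p' t) (at t within S))"
 using assms(2)
proof induction
 case generated_base
 then show ?case
 using assms(1) by (intro exI[of _ "%t. F (U t) (U t) (U t)"]) (auto simp: cubic_sol_def intro: generated_curve.intros)
next
 case (generated_op p q r)
 then obtain p' q' r' where "generated_curve F U p'" "generated_curve F U q'" "generated_curve F U r'"
 "\<forall>t\<in>S. (p has_vector_derivative p' t) (at t within S)" "\<forall>t\<in>S. (q has_vector_derivative q' t) (at t within S)"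
 "\<forall>t\<in>S. (r has_vector_derivative r' t) (at t within S)" by blast
 with generated_op.hyps show ?case
 by (intro exI[of _ "%t. F (p' t) (q t) (r t) + F (p t) (q' t) (r t) + F (p t) (q t) (r' t)"])
 (auto intro!: generated_curve.intros has_vector_derivative)
next
 case (generated_add p q)
 then obtain p' q' where "generated_curve F U p'" "generated_curve F U q'"
 "\<forall>t\<in>S. (p has_vector_derivative p' t) (at t within S)" "\<forall>t\<in>S. (q has_vector_derivative q' t) (at t within S)" by blast
 then show ?case
 by (intro exI[of _ "%t. p' t + q' t"]) (auto intro!: generated_curve.intros has_vector_derivative_add)
qed

lemma nn_integral_exp_abs_le:
 assumes L: "0 < L"
 shows "(\<integral>\<^sup>+s. en (L * exp (2 * L * \<bar>s\<bar>)) \<partial>restrict_space lborel {min 0 t..max 0 t}) <= en (exp (2 * L * \<bar>t\<bar>) / 2)"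
proof (cases "0 <= t")
 case True
 have "(\<integral>\<^sup>+s. en (L * exp (2 * L * \<bar>s\<bar>)) \<partial>restrict_space lborel {min 0 t..max 0 t})
 = (NN s. en (L * exp (2 * L * s)) * ind {0..t} s)"
 using True by (subst nn_integral_restrict_space) (auto intro!: nn_integral_cong split: split_indicator)
 also have "... = en (exp (2 * L * t) / 2 - exp (2 * L * 0) / 2)"
 by (rule nn_integral_FTC_Icc) (use True L in \<open>auto intro!: derivative_eq_intros\<close>)
 also have "... <= en (exp (2 * L * \<bar>t\<bar>) / 2)" using True by (intro ennreal_leI) auto
 finally show ?thesis .
next
 case False
 have "(\<integral>\<^sup>+s. en (L * exp (2 * L * \<bar>s\<bar>)) \<partial>restrict_space lborel {min 0 t..max 0 t})
 = (NN s. en (L * exp (- (2 * L * s))) * ind {t..0} s)"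
 using False by (subst nn_integral_restrict_space) (auto intro!: nn_integral_cong split: split_indicator)
 also have "... = en (- exp (- (2 * L * 0)) / 2 - (- exp (- (2 * L * t)) / 2))"
 by (rule nn_integral_FTC_Icc) (use False L in \<open>auto intro!: derivative_eq_intros\<close>)
 also have "... <= en (exp (2 * L * \<bar>t\<bar>) / 2)" using False by (intro ennreal_leI) auto
 finally show ?thesis .
qed

locale CR_space = realized_space N J for N :: plane_norm and J :: "plane_fun => 'b::banach" +
 assumes CR_in: "f : fun_space N ==> g : fun_space N ==> h : fun_space N ==> CR_op f g h : fun_space N"
 and CR_conv: "f : fun_space N ==> g : fun_space N ==> h : fun_space N ==> AE xi in lborel. CR_converges f g h xi"
 and CR_bound: "\<exists>C\<ge>0. \<forall>f\<in>fun_space N. \<forall>g\<in>fun_space N. \<forall>h\<in>fun_space N. N (CR_op f g h) <= en C * N f * N g * N h"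
begin

definition times_i :: "'b => 'b" where "times_i u = J (%x. \<i> * lift u x)"
definition F :: "'b => 'b => 'b => 'b" where "F u v w = times_i (J (CR_op (lift u) (lift v) (lift w)))"

lemma in_borel: "f : fun_space N ==> f : bmf"
 by (simp add: fun_space_def)

lemma times_i_J: "f : fun_space N ==> times_i (J f) = J (%x. \<i> * f x)"
 unfolding times_i_def
 by (subst J_eq) (use J_eq[of "lift (J f)" f] in \<open>auto intro!: scale_in elim: eventually_mono\<close>)

lemma norm_times_i: "norm (times_i u) = norm u"
proof -
 have "en (norm (times_i u)) = en (norm u)"
 using norm_scale[OF lift_in, of \<i> u] unfolding times_i_def by (simp add: J_norm scale_in)
 then show ?thesis by simp
qed

lemma linear_times_i: "linear times_i"
proof (rule linearI)
 fix u v :: 'b and r :: real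
 have "times_i (J (%x. lift u x + lift v x)) = J (%x. \<i> * lift u x + \<i> * lift v x)"
 by (subst times_i_J) (simp_all add: add_in distrib_left)
 then show "times_i (u + v) = times_i u + times_i v"
 by (simp add: J_add scale_in times_i_def)
 have "times_i (J (%x. cor r * lift u x)) = J (%x. cor r * (\<i> * lift u x))"
 by (subst times_i_J) (simp_all add: scale_in mult.left_commute)
 then show "times_i (r *R u) = r *R times_i u"
 by (simp add: J_scale scale_in times_i_def)
qed

lemma bounded_linear_times_i: "bounded_linear times_i"
 by (rule bounded_linear_intro[of _ 1]) (auto simp: linear_add[OF linear_times_i] linear_scale[OF linear_times_i] norm_times_i)

lemma CR_op_J:
 assumes "f : fun_space N" "g : fun_space N" "h : fun_space N"
 shows "F (J f) (J g) (J h) = times_i (J (CR_op f g h))"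
proof -
 have "AE x in lborel. lift (J f) x = f x" if "f : fun_space N" for f
 using J_eq[of "lift (J f)" f] that by simp
 then have "CR_op (lift (J f)) (lift (J g)) (lift (J h)) = CR_op f g h"
 using assms by (intro CR_op_cong_AE) (auto intro: in_borel)
 then show ?thesis by (simp add: F_def)
qed

lemma J_CR_op_add: "f : fun_space N ==> f' : fun_space N ==> g : fun_space N ==> h : fun_space N ==>
 J (CR_op (%x. f x + f' x) g h) = J (CR_op f g h) + J (CR_op f' g h)"
 "f : fun_space N ==> g : fun_space N ==> g' : fun_space N ==> h : fun_space N ==>
 J (CR_op f (%x. g x + g' x) h) = J (CR_op f g h) + J (CR_op f g' h)"
 "f : fun_space N ==> g : fun_space N ==> h : fun_space N ==> h' : fun_space N ==>
 J (CR_op f g (%x. h x + h' x)) = J (CR_op f g h) + J (CR_op f g h')"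
proof goal_cases
 case 1
 have "J (CR_op (%x. f x + f' x) g h) = J (%xi. CR_op f g h xi + CR_op f' g h xi)"
 using 1 CR_conv[OF 1(1,3,4)] CR_conv[OF 1(2,3,4)]
 by (subst J_eq) (auto intro!: add_in CR_in simp: CR_op_add)
 then show ?case using 1 by (simp add: J_add CR_in)
next
 case 2
 have "J (CR_op f (%x. g x + g' x) h) = J (%xi. CR_op f g h xi + CR_op f g' h xi)"
 using 2 CR_conv[OF 2(1,2,4)] CR_conv[OF 2(1,3,4)]
 by (subst J_eq) (auto intro!: add_in CR_in simp: CR_op_add)
 then show ?case using 2 by (simp add: J_add CR_in)
next
 case 3
 have "J (CR_op f g (%x. h x + h' x)) = J (%xi. CR_op f g h xi + CR_op f g h' xi)"
 using 3 CR_conv[OF 3(1,2,3)] CR_conv[OF 3(1,2,4)]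
 by (subst J_eq) (auto intro!: add_in CR_in simp: CR_op_add)
 then show ?case using 3 by (simp add: J_add CR_in)
qed

sublocale bounded_trilinear F
proof
 fix u u' v v' w w' :: 'b and c :: real
 have sc: "times_i (J (CR_op f g h)) = c *R times_i (J (CR_op f' g' h'))"
 if "CR_op f g h = (%xi. cor c * CR_op f' g' h' xi)" "CR_op f' g' h' : fun_space N" for f g h f' g' h'
 using that by (simp add: J_scale linear_scale[OF linear_times_i])
 show "F (u + u') v w = F u v w + F u' v w"
 using CR_op_J[of "%x. lift u x + lift u' x" "lift v" "lift w"]
 by (simp add: J_add add_in J_CR_op_add linear_add[OF linear_times_i] F_def)
 show "F u (v + v') w = F u v w + F u v' w"
 using CR_op_J[of "lift u" "%x. lift v x + lift v' x" "lift w"]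
 by (simp add: J_add add_in J_CR_op_add linear_add[OF linear_times_i] F_def)
 show "F u v (w + w') = F u v w + F u v w'"
 using CR_op_J[of "lift u" "lift v" "%x. lift w x + lift w' x"]
 by (simp add: J_add add_in J_CR_op_add linear_add[OF linear_times_i] F_def)
 show "F (c *R u) v w = c *R F u v w"
 using CR_op_J[of "%x. cor c * lift u x" "lift v" "lift w"] sc[of "%x. cor c * lift u x" "lift v" "lift w" "lift u" "lift v" "lift w"]
 by (simp add: J_scale scale_in F_def CR_op_scale CR_in fun_eq_iff)
 show "F u (c *R v) w = c *R F u v w"
 using CR_op_J[of "lift u" "%x. cor c * lift v x" "lift w"] sc[of "lift u" "%x. cor c * lift v x" "lift w" "lift u" "lift v" "lift w"]
 by (simp add: J_scale scale_in F_def CR_op_scale CR_in fun_eq_iff)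
 show "F u v (c *R w) = c *R F u v w"
 using CR_op_J[of "lift u" "lift v" "%x. cor c * lift w x"] sc[of "lift u" "lift v" "%x. cor c * lift w x" "lift u" "lift v" "lift w"]
 by (simp add: J_scale scale_in F_def CR_op_scale CR_in fun_eq_iff)
next
 obtain C where C: "0 <= C" "!!f g h. f : fun_space N ==> g : fun_space N ==> h : fun_space N ==>
 N (CR_op f g h) <= en C * N f * N g * N h" using CR_bound by blast
 have "norm (F u v w) <= C * norm u * norm v * norm w" for u v w
 proof -
 have "en (norm (F u v w)) = N (CR_op (lift u) (lift v) (lift w))"
 by (simp add: F_def norm_times_i J_norm CR_in)
 also have "... <= en C * N (lift u) * N (lift v) * N (lift w)" by (intro C) auto
 also have "... = en (C * norm u * norm v * norm w)"
 using C(1) by (simp add: J_norm ennreal_mult)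
 finally show ?thesis using C(1) by (simp add: ennreal_le_iff)
 qed
 then show "\<exists>K. \<forall>u v w. norm (F u v w) <= K * norm u * norm v * norm w" by blast
qed

lemma norm_CR_op_diff:
 assumes "f : fun_space N" "g : fun_space N"
 shows "norm (J (CR_op f f f) - J (CR_op g g g)) = norm (F (J f) (J f) (J f) - F (J g) (J g) (J g))"
 using assms by (simp add: CR_op_J norm_times_i flip: linear_diff[OF linear_times_i])

text \<open>Every time derivative of a solution is again built from the solution by sums and the trilinear map.\<close>

lemma smooth_lift:
 assumes U: "cubic_sol F S U"
 shows "smooth_curve N S (%t. lift (U t))"
proof -
 define P where "P p = generated_curve F U p" for p
 define Q where "Q p p' = (\<forall>t\<in>S. (p has_vector_derivative p' t) (at t within S))" for p p' :: "real => 'b"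
 have "\<exists>D. \<forall>n. (P (D n) & (n = 0 --> D n = U)) & Q (D n) (D (Suc n))"
 proof (rule dependent_nat_choice)
 show "\<exists>p. P p & (0 = (0::nat) --> p = U)" by (auto simp: P_def intro: generated_base)
 show "\<exists>p'. (P p' & (Suc n = 0 --> p' = U)) & Q p p'" if "P p & (n = 0 --> p = U)" for p n
 using generated_curve_derivative[OF U, of p] that by (auto simp: P_def Q_def)
 qed
 then obtain D where D: "D 0 = U" "!!n. Q (D n) (D (Suc n))" by blast
 show ?thesis
 unfolding smooth_curve_def
 proof (intro exI[of _ "%k t. lift (D k t)"] conjI allI)
 show "(%t. lift (D 0 t)) = (%t. lift (U t))" by (simp add: D)
 fix k
 have "continuous_on S (D k)"
 using D(2)[of k] unfolding Q_def continuous_on_eq_continuous_within by (blast intro: has_vector_derivative_continuous)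
 then show "cont_curve N S (%t. lift (D k t))" by (intro cont_curveI) auto
 show "deriv_curve N S (%t. lift (D k t)) (%t. lift (D (Suc k) t))"
 using D(2)[of k] by (intro deriv_curveI) (auto simp: Q_def)
 qed
qed

lemma CR_curve_integral:
 assumes U: "cubic_sol F {a..b} U" and ab: "a <= b"
 shows "\<exists>I. has_curve_integral N (restrict_space lborel {a..b}) (%s. CR_op (lift (U s)) (lift (U s)) (lift (U s))) I
 & times_i (J I) = U b - U a"
proof -
 let ?w = "%s. CR_op (lift (U s)) (lift (U s)) (lift (U s))"
 have c: "continuous_on {a..b} (%s. J (?w s))"
 unfolding continuous_on_def
 proof
 fix s assume s: "s : {a..b}"
 have "((%s. F (U s) (U s) (U s)) \<longlongrightarrow> F (U s) (U s) (U s)) (at s within {a..b})"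
 using cubic_sol_continuous[OF U] s by (intro tendsto) (auto simp: continuous_on_def)
 then have "((%r. norm (F (U r) (U r) (U r) - F (U s) (U s) (U s))) \<longlongrightarrow> 0) (at s within {a..b})"
 by (intro tendsto_norm_zero LIM_zero)
 then have "((%r. norm (J (?w r) - J (?w s))) \<longlongrightarrow> 0) (at s within {a..b})"
 by (simp add: norm_CR_op_diff)
 then show "((%s. J (?w s)) \<longlongrightarrow> J (?w s)) (at s within {a..b})"
 by (rule LIM_zero_cancel[OF tendsto_norm_zero_cancel])
 qed
 have i: "(%s. J (?w s)) integrable_on {a..b}" by (rule integrable_continuous_interval[OF c])
 have "((%s. times_i (J (?w s))) has_integral times_i (integral {a..b} (%s. J (?w s)))) {a..b}"
 using has_integral_linear[OF integrable_integral[OF i] bounded_linear_times_i] by (simp add: o_def)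
 moreover have "((%s. F (U s) (U s) (U s)) has_integral (U b - U a)) {a..b}"
 by (rule fundamental_theorem_of_calculus[OF ab]) (rule cubic_solD[OF U])
 ultimately have "times_i (integral {a..b} (%s. J (?w s))) = U b - U a"
 by (simp add: F_def has_integral_unique)
 then show ?thesis
 using continuous_curve_integral[OF ab CR_in[OF lift_in lift_in lift_in] c]
 by (intro exI[of _ "lift (integral {a..b} (%s. J (?w s)))"]) simp
qed

lemma CR_eq_at_lift:
 assumes U: "cubic_sol F S U" "{min 0 t..max 0 t} \<subseteq> S" and f0: "f0 : fun_space N" "U 0 = J f0"
 shows "CR_eq_at N f0 (%t. lift (U t)) t"
proof -
 obtain I where I: "has_curve_integral N (restrict_space lborel {min 0 t..max 0 t}) (%s. CR_op (lift (U s)) (lift (U s)) (lift (U s))) I"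
 "times_i (J I) = U (max 0 t) - U (min 0 t)"
 using CR_curve_integral[OF cubic_sol_subset[OF U]] by (meson max.cobounded1 min.cobounded1 order_trans)
 have Iin: "I : fun_space N" using I(1) by (simp add: has_curve_integral_def)
 have sI: "(%x. cor (sgn t) * I x) : fun_space N" by (intro scale_in Iin)
 have "J (%x. f0 x + \<i> * (cor (sgn t) * I x)) = J f0 + times_i (J (%x. cor (sgn t) * I x))"
 by (simp add: J_add f0 scale_in[OF sI] times_i_J[OF sI])
 also have "... = U 0 + sgn t *R (U (max 0 t) - U (min 0 t))"
 by (simp add: J_scale Iin linear_scale[OF linear_times_i] I(2) f0)
 also have "... = U t" by (cases "t = 0"; cases "t > 0") (auto simp: max_def min_def)
 finally have "J (lift (U t)) = J (%x. f0 x + \<i> * (cor (sgn t) * I x))" by simp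
 then have "AE x in lborel. lift (U t) x = f0 x + \<i> * (cor (sgn t) * I x)"
 by (subst (asm) J_eq) (auto intro!: add_in f0 scale_in Iin)
 with I(1) show ?thesis unfolding CR_eq_at_def by blast
qed

lemma CR_solution_lift:
 assumes "cubic_sol F S U" "!!t. t : S ==> {min 0 t..max 0 t} \<subseteq> S" "f0 : fun_space N" "U 0 = J f0"
 shows "CR_solution N S f0 (%t. lift (U t))"
 unfolding CR_solution_def using smooth_lift[OF assms(1)] CR_eq_at_lift[OF assms(1) _ assms(3,4)] assms(2) by blast

lemma CR_eq_at_J:
 assumes "CR_eq_at N f0 v t" "f0 : fun_space N" "v t : fun_space N"
 obtains I where "has_curve_integral N (restrict_space lborel {min 0 t..max 0 t}) (%s. CR_op (v s) (v s) (v s)) I"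
 "J (v t) = J f0 + sgn t *R times_i (J I)"
proof -
 obtain I where I: "has_curve_integral N (restrict_space lborel {min 0 t..max 0 t}) (%s. CR_op (v s) (v s) (v s)) I"
 and eq: "AE xi in lborel. v t xi = f0 xi + \<i> * (cor (sgn t) * I xi)"
 using assms(1) unfolding CR_eq_at_def by blast
 have Iin: "I : fun_space N" using I(1) by (simp add: has_curve_integral_def)
 have sI: "(%x. cor (sgn t) * I x) : fun_space N" by (intro scale_in Iin)
 have "J (v t) = J (%x. f0 x + \<i> * (cor (sgn t) * I x))"
 using eq by (subst J_eq) (auto intro!: add_in scale_in Iin assms)
 also have "... = J f0 + sgn t *R times_i (J I)"
 using times_i_J[OF sI] by (simp add: J_add assms scale_in[OF sI] J_scale Iin linear_scale[OF linear_times_i])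
 finally show ?thesis using that I by blast
qed

text \<open>
 Uniqueness among merely bounded measurable curves. The distance to the smooth solution satisfies
 \<open>d(t) \<le> L \<integral> d\<close>, hence a bound by \<open>c e\<^bsup>2L|t|\<^esup>\<close> improves to one by \<open>(c/2) e\<^bsup>2L|t|\<^esup>\<close>.
\<close>

lemma CR_Linf_solution_unique:
 assumes U: "cubic_sol F {a..b} U" and ab: "a <= 0" "0 <= b" and f0: "f0 : fun_space N" "U 0 = J f0"
 and v: "CR_Linf_solution N {a..b} f0 v"
 shows "AE t in restrict_space lborel {a..b}. AE xi in lborel. v t xi = lift (U t) xi"
proof -
 let ?M = "restrict_space lborel {a..b}"
 have spM: "space ?M = {a..b}" by (simp add: space_restrict_space)
 obtain C where vin: "AE t in ?M. v t : fun_space N" and vC: "AE t in ?M. N (v t) <= en C"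
 and veq: "AE t in ?M. CR_eq_at N f0 v t"
 using v unfolding CR_Linf_solution_def Linf_curve_def by blast
 obtain B0 where B0: "!!t. t : {a..b} ==> norm (U t) <= B0" using cubic_sol_bounded[OF U] by blast
 define B where "B = max B0 (max C 0)"
 define L where "L = 3 * K * B^2 + 1"
 have L: "0 < L" using K_nonneg by (simp add: L_def add_nonneg_pos)
 have vB: "AE t in ?M. v t : fun_space N & norm (J (v t)) <= B"
 using vin vC
 proof eventually_elim
 fix t assume h: "v t : fun_space N" "N (v t) <= en C"
 then have "en (norm (J (v t))) <= en C" by (simp add: J_norm)
 then have "norm (J (v t)) <= max C 0" by (auto simp: ennreal_le_iff2 max_def)
 then show "v t : fun_space N & norm (J (v t)) <= B" using h by (auto simp: B_def)
 qed
 have UB: "norm (U t) <= B" if "t : {a..b}" for t using B0[OF that] by (simp add: B_def)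
 have "AE t in ?M. norm (J (v t) - U t) <= 2 * B * (1 / 2) ^ n * exp (2 * L * \<bar>t\<bar>)" for n
 proof (induction n)
 case 0
 show ?case
 using vB AE_space
 proof eventually_elim
 fix t assume t: "v t : fun_space N & norm (J (v t)) <= B" "t : space ?M"
 have "norm (J (v t) - U t) <= norm (J (v t)) + norm (U t)" by (rule norm_triangle_ineq4)
 also have "... <= 2 * B * 1" using t UB[of t] by (simp add: spM)
 also have "... <= 2 * B * exp (2 * L * \<bar>t\<bar>)" using L by (intro mult_left_mono) (auto simp: B_def)
 finally show "norm (J (v t) - U t) <= 2 * B * (1 / 2) ^ 0 * exp (2 * L * \<bar>t\<bar>)" by simp
 qed
 next
 case (Suc n)
 define c where "c = 2 * B * (1 / 2) ^ n"
 have c: "0 <= c" by (simp add: c_def B_def)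
 have w: "AE s in ?M. norm (J (CR_op (v s) (v s) (v s)) - J (CR_op (lift (U s)) (lift (U s)) (lift (U s)))) <= c * (L * exp (2 * L * \<bar>s\<bar>))"
 using Suc vB AE_space
 proof eventually_elim
 fix s assume h: "norm (J (v s) - U s) <= 2 * B * (1 / 2) ^ n * exp (2 * L * \<bar>s\<bar>)" "v s : fun_space N & norm (J (v s)) <= B" "s : space ?M"
 have "norm (J (CR_op (v s) (v s) (v s)) - J (CR_op (lift (U s)) (lift (U s)) (lift (U s))))
 = norm (F (J (v s)) (J (v s)) (J (v s)) - F (U s) (U s) (U s))"
 using h by (simp add: norm_CR_op_diff)
 also have "... <= 3 * K * B^2 * norm (J (v s) - U s)" using h UB[of s] by (intro lipschitz) (auto simp: spM)
 also have "... <= L * (c * exp (2 * L * \<bar>s\<bar>))"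
 using h(1) K_nonneg L by (intro mult_mono) (auto simp: L_def c_def)
 finally show "norm (J (CR_op (v s) (v s) (v s)) - J (CR_op (lift (U s)) (lift (U s)) (lift (U s)))) <= c * (L * exp (2 * L * \<bar>s\<bar>))"
 by (simp add: mult_ac)
 qed
 show ?case
 using veq vB AE_space
 proof eventually_elim
 fix t assume h: "CR_eq_at N f0 v t" "v t : fun_space N & norm (J (v t)) <= B" "t : space ?M"
 have sub: "{min 0 t..max 0 t} \<subseteq> {a..b}" using h(3) ab by (auto simp: spM)
 obtain I where I: "has_curve_integral N (restrict_space lborel {min 0 t..max 0 t}) (%s. CR_op (v s) (v s) (v s)) I"
 "J (v t) = J f0 + sgn t *R times_i (J I)"
 using CR_eq_at_J[OF h(1) f0(1)] h(2) by blast
 obtain I' where I': "has_curve_integral N (restrict_space lborel {min 0 t..max 0 t}) (%s. CR_op (lift (U s)) (lift (U s)) (lift (U s))) I'"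
 "J (lift (U t)) = J f0 + sgn t *R times_i (J I')"
 using CR_eq_at_J[OF CR_eq_at_lift[OF U sub f0] f0(1)] by auto
 have w': "AE s in restrict_space lborel {min 0 t..max 0 t}. norm (J (CR_op (v s) (v s) (v s)) - J (CR_op (lift (U s)) (lift (U s)) (lift (U s)))) <= c * (L * exp (2 * L * \<bar>s\<bar>))"
 using w sub by (auto simp: AE_restrict_space_iff elim!: eventually_mono)
 have "en (norm (J I - J I')) <= (\<integral>\<^sup>+s. en (c * (L * exp (2 * L * \<bar>s\<bar>))) \<partial>restrict_space lborel {min 0 t..max 0 t})"
 by (rule curve_integral_distance_le[OF I(1) I'(1) _ w']) measurable
 also have "... = en c * (\<integral>\<^sup>+s. en (L * exp (2 * L * \<bar>s\<bar>)) \<partial>restrict_space lborel {min 0 t..max 0 t})"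
 using c L by (subst nn_integral_cmult[symmetric]) (auto simp: ennreal_mult intro!: measurable_restrict_space1)
 also have "... <= en c * en (exp (2 * L * \<bar>t\<bar>) / 2)"
 by (intro mult_left_mono nn_integral_exp_abs_le L) auto
 also have "... = en (c * (exp (2 * L * \<bar>t\<bar>) / 2))" using c by (subst ennreal_mult) auto
 finally have d: "norm (J I - J I') <= c * (exp (2 * L * \<bar>t\<bar>) / 2)" using c by (simp add: ennreal_le_iff)
 have "J (v t) - U t = sgn t *R times_i (J I - J I')"
 using I(2) I'(2) by (simp add: linear_diff[OF linear_times_i] scaleR_diff_right)
 then have "norm (J (v t) - U t) <= norm (J I - J I')"
 by (simp add: norm_times_i abs_sgn_eq)
 also note d
 finally show "norm (J (v t) - U t) <= 2 * B * (1 / 2) ^ Suc n * exp (2 * L * \<bar>t\<bar>)" by (simp add: c_def)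
 qed
 qed
 then have "AE t in ?M. \<forall>n. norm (J (v t) - U t) <= 2 * B * (1 / 2) ^ n * exp (2 * L * \<bar>t\<bar>)"
 by (subst AE_all_countable) blast
 with vB show ?thesis
 proof eventually_elim
 fix t assume vt: "v t : fun_space N & norm (J (v t)) <= B" and h: "\<forall>n. norm (J (v t) - U t) <= 2 * B * (1 / 2) ^ n * exp (2 * L * \<bar>t\<bar>)"
 have "(%n. 2 * B * (1 / 2) ^ n * exp (2 * L * \<bar>t\<bar>)) ----> 2 * B * 0 * exp (2 * L * \<bar>t\<bar>)"
 by (intro tendsto_intros) simp
 from LIMSEQ_le_const[OF this] h have "norm (J (v t) - U t) <= 2 * B * 0 * exp (2 * L * \<bar>t\<bar>)" by blast
 then have "J (v t) = J (lift (U t))" by simp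
 then show "AE xi in lborel. v t xi = lift (U t) xi" using vt by (subst (asm) J_eq) auto
 qed
qed

lemma well_posed_on:
 assumes ab: "a <= 0" "0 <= b" and X: "X \<subseteq> fun_space N"
 and ex: "!!f0. f0 : X ==> \<exists>u. cubic_sol F {a..b} u & u 0 = J f0"
 and bd: "!!f0. f0 : X ==> \<exists>r>0. \<exists>B. \<forall>g0\<in>X. norm (J g0 - J f0) < r -->
 (\<forall>u. cubic_sol F {a..b} u --> u 0 = J g0 --> (\<forall>t\<in>{a..b}. norm (u t) <= B))"
 shows "CR_well_posed_on N {a..b} X"
proof -
 define Sol where "Sol f0 = (SOME u. cubic_sol F {a..b} u & u 0 = J f0)" for f0
 have Sol: "cubic_sol F {a..b} (Sol f0)" "Sol f0 0 = J f0" if "f0 : X" for f0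
 using someI_ex[OF ex[OF that]] by (auto simp: Sol_def)
 show ?thesis
 unfolding CR_well_posed_on_def
 proof (intro exI[of _ "%f0 t. lift (Sol f0 t)"] conjI ballI allI impI)
 fix f0 assume f0: "f0 : X"
 then have f0N: "f0 : fun_space N" using X by auto
 show "CR_solution N {a..b} f0 (%t. lift (Sol f0 t))"
 using ab by (intro CR_solution_lift Sol f0 f0N) auto
 show "AE t in restrict_space lborel {a..b}. AE xi in lborel. v t xi = lift (Sol f0 t) xi" if "CR_Linf_solution N {a..b} f0 v" for v
 by (rule CR_Linf_solution_unique[OF Sol(1)[OF f0] ab f0N Sol(2)[OF f0] that])
 fix ep :: real assume e: "0 < ep"
 obtain r B where r: "r > 0" and B: "!!g0 u t. g0 : X ==> norm (J g0 - J f0) < r ==> cubic_sol F {a..b} u ==> u 0 = J g0 ==> t : {a..b} ==> norm (u t) <= B"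
 using bd[OF f0] by blast
 define C where "C = 3 * K"
 have C: "0 <= C" using K_nonneg by (simp add: C_def)
 define E where "E = exp (C * B^2 * (b - a))"
 define de where "de = min r (ep / E)"
 have E: "E > 0" by (simp add: E_def)
 show "\<exists>de>0. \<forall>g0\<in>X. fun_dist N g0 f0 < en de --> (\<forall>t\<in>{a..b}. fun_dist N (lift (Sol g0 t)) (lift (Sol f0 t)) <= en ep)"
 proof (intro exI[of _ de] conjI ballI impI)
 show "de > 0" using r e E by (simp add: de_def)
 fix g0 t assume g0: "g0 : X" and d: "fun_dist N g0 f0 < en de" and t: "t : {a..b}"
 have d': "norm (J g0 - J f0) < de"
 using d g0 f0N X by (subst (asm) dist_eq) (auto simp: ennreal_less_iff)
 have r0: "norm (J g0 - J f0) < r" "norm (J f0 - J f0) < r" using d' r by (auto simp: de_def)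
 have "norm (Sol g0 t - Sol f0 t) <= norm (Sol g0 0 - Sol f0 0) * exp (C * B^2 * \<bar>t\<bar>)"
 unfolding C_def
 by (rule cubic_sol_dist_two_sided[OF Sol(1)[OF g0] Sol(1)[OF f0] ab B[OF g0 r0(1) Sol[OF g0]] B[OF f0 r0(2) Sol[OF f0]] t])
 also have "... <= ep / E * E"
 proof (rule mult_mono)
 show "norm (Sol g0 0 - Sol f0 0) <= ep / E" using d' Sol(2)[OF g0] Sol(2)[OF f0] by (simp add: de_def)
 have "C * B^2 * \<bar>t\<bar> <= C * B^2 * (b - a)" using t ab C by (intro mult_left_mono) auto
 then show "exp (C * B^2 * \<bar>t\<bar>) <= E" unfolding E_def by simp
 qed (use e E in auto)
 finally show "fun_dist N (lift (Sol g0 t)) (lift (Sol f0 t)) <= en ep"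
 using E by (simp add: dist_eq ennreal_leI)
 qed
 qed
qed

text \<open>The length of the time interval depends only on a bound for the data, so one interval serves a whole ball.\<close>

lemma locally_well_posed: "CR_locally_well_posed N"
 unfolding CR_locally_well_posed_def
proof
 fix f0 assume f0: "f0 : fun_space N"
 define R where "R = norm (J f0) + 1"
 have R: "0 < R" by (simp add: R_def add_nonneg_pos)
 define T where "T = 1 / (24 * K * R^2 + 1)"
 have pos: "0 < 24 * K * R^2 + 1" using K_nonneg by (simp add: add_nonneg_pos)
 have T: "0 < T" "T * (12 * K * R^2) <= 1 / 2"
 using pos by (auto simp: T_def divide_simps)
 let ?X = "{g0 : fun_space N. fun_dist N g0 f0 < en 1}"
 have XR: "norm (J g0) <= R" if "g0 : ?X" for g0
 proof -
 have "norm (J g0 - J f0) < 1" using that f0 by (auto simp: dist_eq ennreal_less_iff)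
 then show ?thesis unfolding R_def using norm_triangle_ineq2[of "J g0" "J f0"] by linarith
 qed
 have loc: "\<exists>u. cubic_sol F {0..T} u & u 0 = J g0 & (\<forall>t\<in>{0..T}. norm (u t) <= 2 * R)" if "g0 : ?X" for g0
 using local_solution_in[of UNIV R T "J g0"] R T XR[OF that] by auto
 have "CR_well_posed_on N {0..T} ?X"
 proof (rule well_posed_on)
 show "\<exists>u. cubic_sol F {0..T} u & u 0 = J g0" if "g0 : ?X" for g0 using loc[OF that] by blast
 have "norm (u t) <= 2 * R" if g0: "g0 : ?X" and u: "cubic_sol F {0..T} u" "u 0 = J g0" "t : {0..T}" for g0 u t
 proof -
 obtain u' where u': "cubic_sol F {0..T} u'" "u' 0 = J g0" "\<forall>t\<in>{0..T}. norm (u' t) <= 2 * R" using loc[OF g0] by blast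
 have "u t = u' t" by (rule cubic_sol_unique_forward[OF u(1) u'(1)]) (use u u' in auto)
 then show ?thesis using u' u by auto
 qed
 then have b: "\<forall>g0\<in>?X. norm (J g0 - J f1) < 1 -->
 (\<forall>u. cubic_sol F {0..T} u --> u 0 = J g0 --> (\<forall>t\<in>{0..T}. norm (u t) <= 2 * R))" for f1 by blast
 show "\<exists>r>0. \<exists>B. \<forall>g0\<in>?X. norm (J g0 - J f1) < r -->
 (\<forall>u. cubic_sol F {0..T} u --> u 0 = J g0 --> (\<forall>t\<in>{0..T}. norm (u t) <= B))" for f1
 by (rule exI[of _ 1], rule conjI, rule zero_less_one, rule exI[of _ "2 * R"], rule b)
 qed (use T in auto)
 then show "\<exists>T>0. \<exists>r>0. CR_well_posed_on N {0..T} {g0 : fun_space N. fun_dist N g0 f0 < en r}"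
 using T(1) by (intro exI[of _ T] conjI exI[of _ 1]) auto
qed

text \<open>The a priori bound is uniform on balls of data, and so is the Lipschitz constant of the solution map.\<close>

lemma globally_well_posed:
 assumes ap: "a_priori_bounded F" "a_priori_bounded (%u v w. - F u v w)"
 shows "CR_globally_well_posed N"
 unfolding CR_globally_well_posed_def
proof (intro allI impI conjI)
 fix T :: real assume T: "0 < T"
 have ex: "\<exists>u. cubic_sol F S u & u 0 = u0" for S u0
 using global_solution_in[OF ap, of UNIV u0] by (auto intro: cubic_sol_subset)
 show "CR_well_posed_on N {0..T} (fun_space N)"
 proof (rule well_posed_on)
 fix f0 assume "f0 : fun_space N"
 obtain B where "!!u ta. 0 <= ta ==> ta <= T ==> cubic_sol F {0..ta} u ==> norm (u 0) <= norm (J f0) + 1 ==> (\<forall>t\<in>{0..ta}. norm (u t) <= B)"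
 using ap(1) unfolding a_priori_bounded_def by meson
 note B = this
 have n: "norm (J g0) <= norm (J f0) + 1" if "norm (J g0 - J f0) < 1" for g0
 using that norm_triangle_ineq2[of "J g0" "J f0"] by linarith
 show "\<exists>r>0. \<exists>B. \<forall>g0\<in>fun_space N. norm (J g0 - J f0) < r -->
 (\<forall>u. cubic_sol F {0..T} u --> u 0 = J g0 --> (\<forall>t\<in>{0..T}. norm (u t) <= B))"
 proof (rule exI[of _ 1], rule conjI, simp, rule exI[of _ B], intro ballI impI allI)
 fix g0 u t assume h: "norm (J g0 - J f0) < 1" "cubic_sol F {0..T} u" "u 0 = J g0" "t : {0..T}"
 show "norm (u t) <= B" using B[of T u] h T n[OF h(1)] by auto
 qed
 qed (use T ex in auto)
 show "CR_well_posed_on N {-T..0} (fun_space N)"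
 proof (rule well_posed_on)
 fix f0 assume "f0 : fun_space N"
 obtain B where B: "!!u ta. 0 <= ta ==> ta <= T ==> cubic_sol (%u v w. - F u v w) {0..ta} u ==> norm (u 0) <= norm (J f0) + 1 ==> (\<forall>t\<in>{0..ta}. norm (u t) <= B)"
 using ap(2) unfolding a_priori_bounded_def by meson
 have n: "norm (J g0) <= norm (J f0) + 1" if "norm (J g0 - J f0) < 1" for g0
 using that norm_triangle_ineq2[of "J g0" "J f0"] by linarith
 show "\<exists>r>0. \<exists>B. \<forall>g0\<in>fun_space N. norm (J g0 - J f0) < r -->
 (\<forall>u. cubic_sol F {-T..0} u --> u 0 = J g0 --> (\<forall>t\<in>{-T..0}. norm (u t) <= B))"
 proof (rule exI[of _ 1], rule conjI, simp, rule exI[of _ B], intro ballI impI allI)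
 fix g0 u t assume h: "norm (J g0 - J f0) < 1" "cubic_sol F {-T..0} u" "u 0 = J g0" "t : {-T..0}"
 have "\<forall>t\<in>{0..T}. norm (u (- t)) <= B"
 using B[of T "%t. u (- t)"] cubic_sol_reverse[OF h(2)] T n[OF h(1)] h(3) by simp
 then show "norm (u t) <= B" using h(4) by (auto dest: bspec[of _ _ "- t"])
 qed
 qed (use T ex in auto)
qed

end

section \<open>The Fourier transform on integrable functions\<close>

lemma borel_measurable_vector2 [measurable]: "(%(a, b). vector [a, b] :: real^2) : borel_measurable (borel \<Otimes>\<^sub>M borel)"
proof -
 have "(%(a, b). vector [a, b] :: real^2) = (%z. fst z *R axis 1 1 + snd z *R axis 2 1)"
 by (auto simp: fun_eq_iff vec2_eq_iff vector_2 axis_def)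
 then show ?thesis by simp
qed

lemma lborel_vec2: "lborel = distr (lborel2) borel (%(a, b). vector [a, b] :: real^2)"
proof (rule lborel_eqI)
 fix l u :: "real^2" assume lu: "!!b. b : Basis ==> l \<bullet> b <= u \<bullet> b"
 have B: "Basis = {axis 1 1, axis 2 (1::real) :: real^2}"
 by (auto simp: Basis_vec_def UNIV_2)
 have ne: "axis 1 (1::real) ~= (axis 2 1 :: real^2)" by (simp add: axis_eq_axis)
 have le: "l $ 1 <= u $ 1" "l $ 2 <= u $ 2" using lu[of "axis 1 1"] lu[of "axis 2 1"] by (auto simp: B inner_axis)
 have pre: "(%(a, b). vector [a, b] :: real^2) -` box l u \<inter> space (lborel2) = {l$1<..<u$1} \<times> {l$2<..<u$2}"
 by (auto simp: box_def B inner_axis vector_2 space_pair_measure)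
 show "emeasure (distr (lborel2) borel (%(a, b). vector [a, b] :: real^2)) (box l u) = en (\<Prod>b\<in>Basis. (u - l) \<bullet> b)"
 using le ne by (simp add: emeasure_distr pre lborel.emeasure_pair_measure_Times ennreal_mult B inner_axis inner_diff_left)
qed simp

lemma integral_vec2_product:
 fixes p q :: "real => complex"
 assumes p: "integ p" and q: "integ q"
 shows "integ (%x::real^2. p (x $ 1) * q (x $ 2))"
 and "(IN x. p (x $ 1) * q ((x::real^2) $ 2)) = (IN a. p a) * (IN b. q b)"
proof -
 have [measurable]: "p : bmf" "q : bmf" using p q by auto
 have i: "integrable (lborel2) (%z. p (fst z) * q (snd z))"
 using p q by (intro lborel_pair.Fubini_integrable) (auto simp: norm_mult)
 have m: "(%x::real^2. p (x $ 1) * q (x $ 2)) : bmf" by measurable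
 show "integ (%x::real^2. p (x $ 1) * q (x $ 2))"
 by (subst lborel_vec2, subst integrable_distr_eq) (use i in \<open>auto simp: case_prod_beta' vector_2\<close>)
 have "(IN x. p (x $ 1) * q ((x::real^2) $ 2)) = (LINT z|(lborel2). p (fst z) * q (snd z))"
 by (subst lborel_vec2, subst integral_distr) (auto simp: case_prod_beta' vector_2)
 also have "... = (IN a. IN b. p a * q b)"
 using lborel_pair.integral_fst'[OF i] by simp
 finally show "(IN x. p (x $ 1) * q ((x::real^2) $ 2)) = (IN a. p a) * (IN b. q b)" by simp
qed

lemma borel_measurable_cis [measurable]: "cis : bmf"
 unfolding cis_conv_exp[abs_def] by (intro borel_measurable_continuous_onI continuous_intros)

text \<open>The one-dimensional Gaussian, from the characteristic function of the normal distribution.\<close>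

lemma gaussian_fourier_1d:
 assumes e: "0 < ep"
 shows "integ (%t. cis (z * t) * cor (exp (- (ep * t)\<^sup>2 / 2)))"
 and "(IN t. cis (z * t) * cor (exp (- (ep * t)\<^sup>2 / 2))) = cor (sqrt (2 * pi) / ep * exp (- (z / ep)\<^sup>2 / 2))"
proof -
 have i1: "integ (%t. std_normal_density t *R cis (w * t))" for w
 proof -
 interpret N: prob_space std_normal_distribution by (rule prob_space_normal_density) simp
 have "integrable std_normal_distribution (%t. cis (w * t))"
 by (rule N.integrable_const_bound[of _ 1]) auto
 then show ?thesis by (subst (asm) integrable_density) auto
 qed
 have c: "(IN t. std_normal_density t *R cis (w * t)) = cor (exp (- w\<^sup>2 / 2))" for w
 proof -
 have "char std_normal_distribution w = (IN t. std_normal_density t *R cis (w * t))"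
 unfolding char_def by (subst integral_density) (auto simp: cis_conv_exp)
 then show ?thesis by (simp add: char_std_normal_distribution)
 qed
 have eq: "cis (z * t) * cor (exp (- (ep * t)\<^sup>2 / 2)) =
 sqrt (2 * pi) *R (std_normal_density (0 + ep * t) *R cis ((z / ep) * (0 + ep * t)))" for t
 using e by (simp add: std_normal_density_def scaleR_conv_of_real)
 have i2: "integ (%t. std_normal_density (0 + ep * t) *R cis ((z / ep) * (0 + ep * t)))"
 using lborel_integrable_real_affine[OF i1[of "z / ep"], of ep 0] e by simp
 show "integ (%t. cis (z * t) * cor (exp (- (ep * t)\<^sup>2 / 2)))"
 unfolding eq by (intro integrable_scaleR_right i2)
 have "(IN t. std_normal_density (0 + ep * t) *R cis ((z / ep) * (0 + ep * t))) = (1 / ep) *R cor (exp (- (z / ep)\<^sup>2 / 2))"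
 using lborel_integral_real_affine[of ep "%t. std_normal_density t *R cis ((z / ep) * t)" 0] e
 unfolding c by simp
 then show "(IN t. cis (z * t) * cor (exp (- (ep * t)\<^sup>2 / 2))) = cor (sqrt (2 * pi) / ep * exp (- (z / ep)\<^sup>2 / 2))"
 unfolding eq by (simp add: scaleR_conv_of_real)
qed

definition gauss :: "real => real^2 => real" where "gauss ep x = exp (- (ep * norm x)\<^sup>2 / 2)"

lemma gauss_split: "gauss ep x = exp (- (ep * x $ 1)\<^sup>2 / 2) * exp (- (ep * x $ 2)\<^sup>2 / 2)"
proof -
 have "(ep * norm x)^2 = (ep * x $ 1)^2 + (ep * x $ 2)^2"
 unfolding power_mult_distrib power2_norm_eq_inner inner_vec2 by (simp add: power2_eq_square algebra_simps)
 then show ?thesis unfolding gauss_def mult_exp_exp by (simp add: add_divide_distrib)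
qed

lemma gauss_pos: "0 < gauss ep x" and gauss_nonneg [simp]: "0 <= gauss ep x" and gauss_le_1: "gauss ep x <= 1"
 by (simp_all add: gauss_def)

lemma borel_measurable_gauss [measurable]: "gauss ep : bmf"
 unfolding gauss_def[abs_def] by measurable

lemma gaussian_fourier:
 assumes e: "0 < ep"
 shows "integ (%x. cis (z \<bullet> x) * cor (gauss ep x))"
 and "(IN x. cis (z \<bullet> x) * cor (gauss ep x)) = cor (2 * pi / ep^2 * gauss (1 / ep) z)"
proof -
 have eq: "cis (z \<bullet> x) * cor (gauss ep x) = (cis (z $ 1 * x $ 1) * cor (exp (- (ep * x $ 1)\<^sup>2 / 2)))
 * (cis (z $ 2 * x $ 2) * cor (exp (- (ep * x $ 2)\<^sup>2 / 2)))" for x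
 unfolding gauss_split inner_vec2 by (simp add: cis_mult[symmetric] mult_ac)
 show "integ (%x. cis (z \<bullet> x) * cor (gauss ep x))"
 unfolding eq by (rule integral_vec2_product[OF gaussian_fourier_1d(1)[OF e] gaussian_fourier_1d(1)[OF e]])
 have "(IN x. cis (z \<bullet> x) * cor (gauss ep x)) = cor (sqrt (2 * pi) / ep * exp (- (z $ 1 / ep)\<^sup>2 / 2))
 * cor (sqrt (2 * pi) / ep * exp (- (z $ 2 / ep)\<^sup>2 / 2))"
 unfolding eq integral_vec2_product(2)[OF gaussian_fourier_1d(1)[OF e] gaussian_fourier_1d(1)[OF e]] gaussian_fourier_1d(2)[OF e] ..
 also have "... = cor ((sqrt (2 * pi) / ep * (sqrt (2 * pi) / ep)) * (exp (- (z $ 1 / ep)\<^sup>2 / 2) * exp (- (z $ 2 / ep)\<^sup>2 / 2)))"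
 by (simp only: of_real_mult[symmetric] mult_ac)
 also have "sqrt (2 * pi) / ep * (sqrt (2 * pi) / ep) = 2 * pi / ep^2" by (simp add: power2_eq_square)
 also have "exp (- (z $ 1 / ep)\<^sup>2 / 2) * exp (- (z $ 2 / ep)\<^sup>2 / 2) = gauss (1 / ep) z"
 unfolding gauss_split by simp
 finally show "(IN x. cis (z \<bullet> x) * cor (gauss ep x)) = cor (2 * pi / ep^2 * gauss (1 / ep) z)" .
qed

lemma nn_integral_gauss:
 assumes e: "0 < ep" shows "(NN x. en (gauss ep x)) = en (2 * pi / ep^2)"
proof -
 have i: "integ (%x. cor (gauss ep x))" and v: "(IN x. cor (gauss ep x)) = cor (2 * pi / ep^2)"
 using gaussian_fourier[OF e, of 0] by (simp_all add: gauss_def)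
 have i': "integ (gauss ep)" using integrable_norm[OF i] by (simp add: abs_of_pos gauss_pos)
 have "(IN x. gauss ep x) = 2 * pi / ep^2"
 using v unfolding integral_complex_of_real by (simp only: of_real_eq_iff)
 then show ?thesis using i' by (subst nn_integral_eq_integral) auto
qed

definition ft :: "real => plane_fun => plane_fun" where
 "ft e f xi = (IN x. cis (e * (x \<bullet> xi)) * f x) / cor (2 * pi)"

lemma borel_measurable_ft [measurable]:
 assumes [measurable]: "f : bmf" shows "ft e f : bmf"
 unfolding ft_def[abs_def] by measurable

lemma integrable_cis_mult: "integrable M f ==> g : borel_measurable M ==> integrable M (%x. cis (g x) * f x)"
 by (rule Bochner_Integration.integrable_bound[of M f]) (auto simp: norm_mult)

lemma norm_ft_le:
 assumes "integ f" shows "cmod (ft e f xi) <= (IN x. cmod (f x)) / (2 * pi)"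
proof -
 have "cmod (IN x. cis (e * (x \<bullet> xi)) * f x) <= (IN x. cmod (cis (e * (x \<bullet> xi)) * f x))"
 by (rule integral_norm_bound)
 then show ?thesis by (simp add: ft_def norm_divide norm_mult divide_right_mono)
qed

lemma integrable_product2:
 fixes p q :: "'a::euclidean_space => complex"
 assumes p: "integ p" and q: "integ q"
 shows "integrable (lborel2) (%(x, y). p x * q y)"
 using p q by (intro lborel_pair.Fubini_integrable) (auto simp: norm_mult)

text \<open>
 The convolution with a Gaussian of total mass one is a contraction of \<open>L\<^sup>2\<close>, and by Fubini it is what the
 multiplication of the transform by a Gaussian amounts to.
\<close>

lemma integral_ft_gauss:
 assumes f: "integ f" and e: "\<bar>e\<bar> = 1" and eps: "0 < ep"
 shows "(IN xi. cor (gauss ep xi * (cmod (ft e f xi))^2)) =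
 (IN x. IN y. f x * cnj (f y) * cor (gauss (1 / ep) (x - y) / (2 * pi * ep^2)))"
proof -
 have [measurable]: "f : bmf" using f by auto
 have f': "integ (%y. cnj (f y))" using f by simp
 define H where "H x y xi = cis (e * (x \<bullet> xi)) * f x * cnj (cis (e * (y \<bullet> xi)) * f y) * cor (gauss ep xi)" for x y xi
 have G: "integ (%xi. cor (gauss ep xi))" using gaussian_fourier(1)[OF eps, of 0] by simp
 have IH: "integrable (lborel \<Otimes>\<^sub>M (lborel2)) (%(xi, x, y). H x y xi)"
 proof (rule integrableI_bounded)
 show "(%(xi, x, y). H x y xi) : borel_measurable (lborel \<Otimes>\<^sub>M (lborel2))"
 unfolding H_def by measurable
 have "(\<integral>\<^sup>+z. en (norm (case z of (xi, x, y) => H x y xi)) \<partial>(lborel \<Otimes>\<^sub>M (lborel2)))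
 = (NN xi. \<integral>\<^sup>+z. en (gauss ep xi) * (eabs f (fst z) * eabs f (snd z)) \<partial>(lborel2))"
 proof (subst sigma_finite_measure.nn_integral_fst[symmetric])
 show "sigma_finite_measure (lborel2 :: ((real^2) \<times> (real^2)) measure)"
 unfolding lborel_prod by (rule sigma_finite_lborel)
 show "(%x. en (norm (case x of (xi, x, y) => H x y xi))) : borel_measurable (lborel \<Otimes>\<^sub>M lborel \<Otimes>\<^sub>M lborel)"
 unfolding H_def by measurable
 qed (auto intro!: nn_integral_cong simp: H_def eabs_def norm_mult ennreal_mult case_prod_beta' mult_ac)
 also have "... = (NN xi. en (gauss ep xi)) * ((NN x. eabs f x) * (NN x. eabs f x))"
 proof -
 have "(\<integral>\<^sup>+z. eabs f (fst z) * eabs f (snd z) \<partial>(lborel2)) = (NN x. eabs f x) * (NN x. eabs f x)"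
 by (subst lborel.nn_integral_fst[symmetric], measurable) (simp add: nn_integral_cmult nn_integral_multc)
 then show ?thesis by (simp add: nn_integral_cmult nn_integral_multc)
 qed
 also have "... < \<infinity>"
 using f by (auto simp: nn_integral_gauss[OF eps] eabs_def integrable_iff_bounded ennreal_mult_less_top)
 finally show "(\<integral>\<^sup>+z. en (norm (case z of (xi, x, y) => H x y xi)) \<partial>(lborel \<Otimes>\<^sub>M (lborel2))) < \<infinity>" .
 qed
 have sq: "cor (gauss ep xi * (cmod (ft e f xi))^2) = (LINT z|(lborel2). H (fst z) (snd z) xi) / cor ((2 * pi)^2)" for xi
 proof -
 let ?A = "%x. cis (e * (x \<bullet> xi)) * f x"
 have A: "integ ?A" by (rule integrable_cis_mult[OF f]) measurable
 then have A': "integ (%y. cnj (?A y))" by (rule integrable_cnj)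
 have "(LINT z|(lborel2). H (fst z) (snd z) xi) = (LINT z|(lborel2). (case z of (x, y) => ?A x * cnj (?A y)) * cor (gauss ep xi))"
 by (simp add: H_def case_prod_beta')
 also have "... = (LINT z|(lborel2). (case z of (x, y) => ?A x * cnj (?A y))) * cor (gauss ep xi)"
 by (rule integral_mult_left_zero)
 also have "(LINT z|(lborel2). (case z of (x, y) => ?A x * cnj (?A y))) = (IN x. IN y. ?A x * cnj (?A y))"
 using lborel_pair.integral_fst'[OF integrable_product2[OF A A']] by simp
 also have "... = (IN x. ?A x) * cnj (IN y. ?A y)"
 using Bochner_Integration.integral_cnj[of lborel ?A] by simp
 also have "... = cor ((cmod (IN x. ?A x))^2)" by (rule complex_norm_square[symmetric])
 finally show ?thesis by (simp add: ft_def norm_divide power_divide mult.commute)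
 qed
 interpret P: pair_sigma_finite "lborel :: (real^2) measure" "lborel2 :: ((real^2) \<times> (real^2)) measure"
 unfolding lborel_prod ..
 have "(IN xi. cor (gauss ep xi * (cmod (ft e f xi))^2))
 = (IN xi. LINT z|(lborel2). H (fst z) (snd z) xi) / cor ((2 * pi)^2)"
 unfolding sq by simp
 also have "(IN xi. LINT z|(lborel2). H (fst z) (snd z) xi) = (LINT z|(lborel2). IN xi. H (fst z) (snd z) xi)"
 by (rule P.Fubini_integral[symmetric]) (use IH in \<open>simp add: case_prod_beta'\<close>)
 also have "... = (LINT z|(lborel2). f (fst z) * cnj (f (snd z)) * cor (2 * pi / ep^2 * gauss (1 / ep) (fst z - snd z)))"
 proof (rule Bochner_Integration.integral_cong[OF refl])
 fix z :: "(real^2) \<times> (real^2)"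
 have "H (fst z) (snd z) xi = f (fst z) * cnj (f (snd z)) * (cis ((e *R (fst z - snd z)) \<bullet> xi) * cor (gauss ep xi))" for xi
 proof -
 have "cis (e * (fst z \<bullet> xi)) * cnj (cis (e * (snd z \<bullet> xi))) = cis ((e *R (fst z - snd z)) \<bullet> xi)"
 by (simp add: cis_cnj cis_mult inner_diff_left right_diff_distrib)
 then show ?thesis unfolding H_def by (simp add: mult_ac)
 qed
 moreover have "gauss (1 / ep) (e *R (fst z - snd z)) = gauss (1 / ep) (fst z - snd z)"
 using e by (simp add: gauss_def)
 ultimately show "(IN xi. H (fst z) (snd z) xi) = f (fst z) * cnj (f (snd z)) * cor (2 * pi / ep^2 * gauss (1 / ep) (fst z - snd z))"
 using gaussian_fourier(2)[OF eps, of "e *R (fst z - snd z)"] by simp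
 qed
 also have "... = (IN x. IN y. f x * cnj (f y) * cor (2 * pi / ep^2 * gauss (1 / ep) (x - y)))"
 proof (rule lborel_pair.integral_fst'[symmetric, where f="%z. f (fst z) * cnj (f (snd z)) * cor (2 * pi / ep^2 * gauss (1 / ep) (fst z - snd z))", simplified fst_conv snd_conv])
 show "integrable (lborel2) (%z. f (fst z) * cnj (f (snd z)) * cor (2 * pi / ep^2 * gauss (1 / ep) (fst z - snd z)))"
 proof (rule Bochner_Integration.integrable_bound)
 show "integrable (lborel2) (%z. cor (2 * pi / ep^2) * (case z of (x, y) => f x * cnj (f y)))"
 by (intro integrable_mult_right integrable_product2 f f')
 show "AE z in (lborel2). norm (f (fst z) * cnj (f (snd z)) * cor (2 * pi / ep^2 * gauss (1 / ep) (fst z - snd z)))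
 <= norm (cor (2 * pi / ep^2) * (case z of (x, y) => f x * cnj (f y)))"
 proof (rule AE_I2)
 fix z :: "(real^2) \<times> (real^2)"
 let ?g = "gauss (1 / ep) (fst z - snd z)" and ?p = "cmod (f (fst z)) * cmod (f (snd z))"
 have "?p * (2 * pi / ep^2 * ?g) <= ?p * (2 * pi / ep^2 * 1)"
 by (intro mult_left_mono gauss_le_1) auto
 then show "norm (f (fst z) * cnj (f (snd z)) * cor (2 * pi / ep^2 * ?g))
 <= norm (cor (2 * pi / ep^2) * (case z of (x, y) => f x * cnj (f y)))"
 by (simp add: norm_mult norm_divide norm_power case_prod_beta' mult_ac)
 qed
 qed measurable
 qed
 also have "... / cor ((2 * pi)^2) = (IN x. IN y. f x * cnj (f y) * cor (gauss (1 / ep) (x - y) / (2 * pi * ep^2)))"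
 proof -
 have eq: "f x * cnj (f y) * cor (gauss (1 / ep) (x - y) / (2 * pi * ep^2)) =
 (f x * cnj (f y) * cor (2 * pi / ep^2 * gauss (1 / ep) (x - y))) / cor ((2 * pi)^2)" for x y
 using eps by (simp add: power2_eq_square field_simps)
 show ?thesis unfolding eq integral_divide_zero ..
 qed
 finally show ?thesis .
qed

lemma norm_integral_le_nn_integral:
 fixes g :: "'a => complex"
 shows "en (norm (LINT x|M. g x)) <= (\<integral>\<^sup>+x. en (norm (g x)) \<partial>M)"
 by (cases "integrable M g") (simp_all add: integral_norm_bound_ennreal not_integrable_integral_eq)

lemma nn_integral_scaled_gauss:
 assumes "0 < ep" shows "(NN x. en (gauss (1 / ep) x / (2 * pi * ep^2))) = 1"
proof -
 have "(NN x. en (gauss (1 / ep) x / (2 * pi * ep^2))) = (NN x. en (1 / (2 * pi * ep^2)) * en (gauss (1 / ep) x))"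
 by (intro nn_integral_cong) (simp add: ennreal_mult[symmetric])
 also have "... = en (1 / (2 * pi * ep^2)) * en (2 * pi / (1 / ep)^2)"
 using assms by (subst nn_integral_cmult, measurable, subst nn_integral_gauss) auto
 also have "... = 1" using assms by (simp add: ennreal_mult[symmetric] power_divide)
 finally show ?thesis .
qed

lemma nn_integral_reflect_translate:
 fixes f :: "real^2 => ennreal"
 assumes [measurable]: "f : bmf"
 shows "(NN y. f (x - y)) = (NN y. f y)" "(NN y. f (y - x)) = (NN y. f y)"
 using nn_integral_similarity[of "-1" 0 f x] nn_integral_translate[of f "-x"] by simp_all

lemma gauss_tendsto: "(%n. gauss (1 / real (Suc n)) x) ----> 1"
proof -
 have "(%n. exp (- (1 / real (Suc n) * norm x)\<^sup>2 / 2)) ----> exp (- (0 * norm x)\<^sup>2 / 2)"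
 by (intro tendsto_intros LIMSEQ_Suc[OF lim_1_over_n]) simp
 then show ?thesis by (simp add: gauss_def)
qed

lemma integrable_gauss_ft:
 assumes f: "integ f" and eps: "0 < ep"
 shows "integ (%xi. gauss ep xi * (cmod (ft e f xi))^2)"
proof -
 have [measurable]: "f : bmf" using f by auto
 define M where "M = (IN x. cmod (f x)) / (2 * pi)"
 have gi: "integ (gauss ep)"
 by (rule integrableI_bounded) (auto simp: nn_integral_gauss[OF eps])
 show ?thesis
 proof (rule Bochner_Integration.integrable_bound[of _ "%xi. M^2 * gauss ep xi"])
 show "integ (%xi. M^2 * gauss ep xi)" by (intro integrable_mult_right gi)
 show "AE xi in lborel. norm (gauss ep xi * (cmod (ft e f xi))^2) <= norm (M^2 * gauss ep xi)"
 proof (rule AE_I2)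
 fix xi
 have "(cmod (ft e f xi))^2 <= M^2" unfolding M_def by (intro power_mono norm_ft_le f) auto
 then show "norm (gauss ep xi * (cmod (ft e f xi))^2) <= norm (M^2 * gauss ep xi)"
 by (simp add: abs_mult mult.commute mult_left_mono)
 qed
 qed measurable
qed

text \<open>The Gaussian regularisations of the left side are convolutions with a kernel of mass one; Schur's test bounds them, and Fatou's lemma removes the regularisation.\<close>

lemma ft_contraction:
 assumes f: "integ f" and e: "\<bar>e\<bar> = 1"
 shows "L2_norm (ft e f) <= L2_norm f"
proof (subst ennreal_power2_le_iff[symmetric], unfold L2_norm_power2[of "ft e f"])
 have [measurable]: "f : bmf" using f by auto
 have bound: "(NN xi. en (gauss ep xi * (cmod (ft e f xi))^2)) <= (L2_norm f)^2" if eps: "0 < ep" for ep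
 proof -
 define k where "k z = en (gauss (1 / ep) z / (2 * pi * ep^2))" for z
 have [measurable]: "k : bmf" unfolding k_def[abs_def] by measurable
 have k1: "(NN y. k (x - y)) = 1" "(NN y. k (y - x)) = 1" for x
 using nn_integral_reflect_translate[of k x] nn_integral_scaled_gauss[OF eps] by (simp_all add: k_def[abs_def])
 note i = integrable_gauss_ft[OF f eps, of e]
 have "(NN xi. en (gauss ep xi * (cmod (ft e f xi))^2)) = en (IN xi. gauss ep xi * (cmod (ft e f xi))^2)"
 by (rule nn_integral_eq_integral[OF i]) simp
 also have "... <= en (norm (IN xi. cor (gauss ep xi * (cmod (ft e f xi))^2)))"
 unfolding integral_complex_of_real by (intro ennreal_leI) simp
 also have "... <= (NN x. en (norm (IN y. f x * cnj (f y) * cor (gauss (1 / ep) (x - y) / (2 * pi * ep^2)))))"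
 unfolding integral_ft_gauss[OF f e eps] by (rule norm_integral_le_nn_integral)
 also have "... <= (NN x. NN y. en (norm (f x * cnj (f y) * cor (gauss (1 / ep) (x - y) / (2 * pi * ep^2)))))"
 by (intro nn_integral_mono norm_integral_le_nn_integral)
 also have "... <= (NN x. NN y. en ((cmod (f x))^2 / 2) * k (x - y) + en ((cmod (f y))^2 / 2) * k (x - y))"
 proof (intro nn_integral_mono)
 fix x y
 let ?g = "gauss (1 / ep) (x - y) / (2 * pi * ep^2)"
 have g: "0 <= ?g" by simp
 have "cmod (f x) * cmod (f y) <= (cmod (f x))^2 / 2 + (cmod (f y))^2 / 2"
 using sum_squares_bound[of "cmod (f x)" "cmod (f y)"] by simp
 then have "cmod (f x) * cmod (f y) * ?g <= ((cmod (f x))^2 / 2 + (cmod (f y))^2 / 2) * ?g" by (rule mult_right_mono[OF _ g])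
 then have "en (cmod (f x) * cmod (f y) * ?g) <= en ((cmod (f x))^2 / 2 * ?g + (cmod (f y))^2 / 2 * ?g)"
 by (intro ennreal_leI) (simp only: distrib_right)
 also have "... = en ((cmod (f x))^2 / 2) * k (x - y) + en ((cmod (f y))^2 / 2) * k (x - y)"
 unfolding k_def using g by (subst ennreal_plus) (auto simp: ennreal_mult[symmetric])
 also have "cmod (f x) * cmod (f y) * ?g = norm (f x * cnj (f y) * cor ?g)"
 using g by (simp only: norm_mult complex_mod_cnj norm_of_real abs_of_nonneg)
 finally show "en (norm (f x * cnj (f y) * cor ?g))
 <= en ((cmod (f x))^2 / 2) * k (x - y) + en ((cmod (f y))^2 / 2) * k (x - y)" .
 qed
 also have "... = (NN x. (NN y. en ((cmod (f x))^2 / 2) * k (x - y)) + (NN y. en ((cmod (f y))^2 / 2) * k (x - y)))"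
 by (intro nn_integral_cong nn_integral_add) measurable
 also have "... = (NN x. (NN y. en ((cmod (f x))^2 / 2) * k (x - y))) + (NN x. (NN y. en ((cmod (f y))^2 / 2) * k (x - y)))"
 by (intro nn_integral_add) measurable
 also have "(NN x. (NN y. en ((cmod (f x))^2 / 2) * k (x - y))) = (NN x. en ((cmod (f x))^2 / 2))"
 by (intro nn_integral_cong) (simp add: nn_integral_cmult k1)
 also have "(NN x. (NN y. en ((cmod (f y))^2 / 2) * k (x - y)))
 = (NN y. (NN x. en ((cmod (f y))^2 / 2) * k (x - y)))"
 by (rule lborel_pair.Fubini'[symmetric]) measurable
 also have "... = (NN x. en ((cmod (f x))^2 / 2))"
 by (intro nn_integral_cong) (simp add: nn_integral_cmult k1)
 also have "(NN x. en ((cmod (f x))^2 / 2)) + (NN x. en ((cmod (f x))^2 / 2)) = (L2_norm f)^2"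
 unfolding L2_norm_power2 by (subst nn_integral_add[symmetric]) (auto intro!: nn_integral_cong simp: ennreal_plus[symmetric] simp del: ennreal_plus)
 finally show ?thesis .
 qed
 have "(NN xi. en ((cmod (ft e f xi))^2)) = (NN xi. liminf (%n. en (gauss (1 / real (Suc n)) xi * (cmod (ft e f xi))^2)))"
 proof (rule nn_integral_cong)
 fix xi
 have "(%n. en (gauss (1 / real (Suc n)) xi * (cmod (ft e f xi))^2)) ----> en (1 * (cmod (ft e f xi))^2)"
 by (intro tendsto_ennrealI tendsto_intros gauss_tendsto)
 then show "en ((cmod (ft e f xi))^2) = liminf (%n. en (gauss (1 / real (Suc n)) xi * (cmod (ft e f xi))^2))"
 using lim_imp_Liminf[OF sequentially_bot] by fastforce
 qed
 also have "... <= liminf (%n. NN xi. en (gauss (1 / real (Suc n)) xi * (cmod (ft e f xi))^2))"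
 by (rule nn_integral_liminf) measurable
 also have "... <= (L2_norm f)^2"
 by (intro Liminf_le always_eventually allI bound) auto
 finally show "(NN xi. en ((cmod (ft e f xi))^2)) <= (L2_norm f)^2" .
qed

section \<open>The space of square integrable functions\<close>

type_synonym l2 = "square_integrable fsp"

abbreviation (input) "L2 \<equiv> fun_space L2_norm"

lemmas lnorm_L2 = lnorm_square_integrable_def
lemmas L2_add = fun_space_add[where 'a=square_integrable, unfolded lnorm_L2]
lemmas L2_diff = fun_space_diff[where 'a=square_integrable, unfolded lnorm_L2]
lemmas L2_scale = fun_space_scale[where 'a=square_integrable, unfolded lnorm_L2]
lemmas L2_zero = fun_space_zero[where 'a=square_integrable, unfolded lnorm_L2]
lemmas L2_cong = fun_space_cong[where 'a=square_integrable, unfolded lnorm_L2]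
lemmas L2_repr = repr[where 'a=square_integrable, unfolded lnorm_L2]
lemmas L2_repr_cls = repr_cls[where 'a=square_integrable, unfolded lnorm_L2]
lemmas L2_cls_eq_iff = cls_eq_iff[where 'a=square_integrable, unfolded lnorm_L2]
lemmas L2_cls_add = cls_add[where 'a=square_integrable, unfolded lnorm_L2]
lemmas L2_cls_diff = cls_diff[where 'a=square_integrable, unfolded lnorm_L2]
lemmas L2_cls_scale = cls_scale[where 'a=square_integrable, unfolded lnorm_L2]
lemmas L2_norm_cls = norm_cls[where 'a=square_integrable, unfolded lnorm_L2]

lemma L2_borel: "f : L2 ==> f : bmf"
 by (simp add: fun_space_def)

lemma norm_cls_diff: "f : L2 ==> g : L2 ==> ennreal (norm (cls f - cls g :: l2)) = L2_norm (%x. f x - g x)"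
 using L2_norm_cls[OF L2_diff] L2_cls_diff by metis

text \<open>Dominated convergence in the square integrable functions.\<close>

lemma cls_tendsto_dominated:
 assumes X: "!!n. X n : bmf" "f : bmf" and w: "w : L2"
 and lim: "AE x in lborel. (%n. X n x) ----> f x" and le: "!!n. AE x in lborel. cmod (X n x) <= cmod (w x)"
 shows "f : L2" "!!n. X n : L2" "(%n. cls (X n) :: l2) ----> cls f"
proof -
 note [measurable] = X L2_borel[OF w]
 have fw: "AE x in lborel. cmod (f x) <= cmod (w x)"
 proof -
 have "AE x in lborel. \<forall>n. cmod (X n x) <= cmod (w x)" using le by (subst AE_all_countable) blast
 with lim show ?thesis
 proof eventually_elim
 fix x assume "(%n. X n x) ----> f x" "\<forall>n. cmod (X n x) <= cmod (w x)"
 then show "cmod (f x) <= cmod (w x)" by (intro LIMSEQ_le_const2[OF tendsto_norm]) auto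
 qed
 qed
 show XL: "X n : L2" for n
 using lnorm_mono[where 'a=square_integrable, unfolded lnorm_L2, of "X n" w] le[of n] w by (auto simp: fun_space_def)
 show fL: "f : L2"
 using lnorm_mono[where 'a=square_integrable, unfolded lnorm_L2, of f w] fw w by (auto simp: fun_space_def)
 have "(%n. NN x. en ((cmod (X n x - f x))^2)) ----> (\<integral>\<^sup>+x. 0 \<partial>(lborel :: (real^2) measure))"
 proof (rule nn_integral_dominated_convergence[where w="%x. en (4 * (cmod (w x))^2)"])
 show "AE x in lborel. en ((cmod (X j x - f x))^2) <= en (4 * (cmod (w x))^2)" for j
 using le[of j] fw
 proof eventually_elim
 fix x assume h: "cmod (X j x) <= cmod (w x)" "cmod (f x) <= cmod (w x)"
 have "cmod (X j x - f x) <= 2 * cmod (w x)" using norm_triangle_ineq4[of "X j x" "f x"] h by linarith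
 then have "(cmod (X j x - f x))^2 <= (2 * cmod (w x))^2" by (intro power_mono) auto
 then show "en ((cmod (X j x - f x))^2) <= en (4 * (cmod (w x))^2)" by (intro ennreal_leI) (simp add: power_mult_distrib)
 qed
 have "(NN x. en (4 * (cmod (w x))^2)) = 4 * (L2_norm w)^2"
 unfolding L2_norm_power2 by (simp add: ennreal_mult nn_integral_cmult)
 also have "... < \<infinity>" using w by (simp add: fun_space_def ennreal_mult_less_top power_less_top_ennreal)
 finally show "(NN x. en (4 * (cmod (w x))^2)) < \<infinity>" .
 show "AE x in lborel. (%n. en ((cmod (X n x - f x))^2)) ----> 0"
 using lim
 proof eventually_elim
 fix x assume "(%n. X n x) ----> f x"
 then have "(%n. en ((cmod (X n x - f x))^2)) ----> en ((cmod (f x - f x))^2)" by (intro tendsto_ennrealI tendsto_intros)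
 then show "(%n. en ((cmod (X n x - f x))^2)) ----> 0" by simp
 qed
 qed auto
 then have "(%n. en ((norm (cls (X n) - cls f :: l2))^2)) ----> en 0"
 using norm_cls_diff[OF XL fL] unfolding L2_norm_power2[symmetric] by (simp add: ennreal_power[symmetric])
 then have "(%n. (norm (cls (X n) - cls f :: l2))^2) ----> 0"
 by (subst (asm) tendsto_ennreal_iff) auto
 then have "(%n. sqrt ((norm (cls (X n) - cls f :: l2))^2)) ----> sqrt 0" by (rule tendsto_real_sqrt)
 then have "(%n. norm (cls (X n) - cls f :: l2)) ----> 0" by simp
 then show "(%n. cls (X n) :: l2) ----> cls f" by (rule LIM_zero_cancel[OF tendsto_norm_zero_cancel])
qed

definition trunc :: "nat => plane_fun => plane_fun" where
 "trunc n f x = ind (cball 0 (real n)) x *R f x"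

lemma borel_measurable_trunc [measurable]: "f : bmf ==> trunc n f : bmf"
 unfolding trunc_def[abs_def] by measurable

lemma trunc:
 assumes f: "f : L2"
 shows "trunc n f : L2" "(%n. cls (trunc n f) :: l2) ----> cls f" "integ (trunc n f)"
proof -
 note [measurable] = L2_borel[OF f]
 have lim: "(%n. trunc n f x) ----> f x" for x
 proof (rule tendsto_eventually)
 obtain m :: nat where m: "norm x <= real m" using real_arch_simple by blast
 then show "\<forall>\<^sub>F n in sequentially. trunc n f x = f x"
 unfolding eventually_sequentially by (intro exI[of _ m]) (auto simp: trunc_def indicator_def)
 qed
 have le: "cmod (trunc n f x) <= cmod (f x)" for n x by (simp add: trunc_def indicator_def)
 note dom = cls_tendsto_dominated[OF borel_measurable_trunc[OF L2_borel[OF f]] L2_borel[OF f] f AE_I2[OF lim] AE_I2[OF le]]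
 show "trunc n f : L2" "(%n. cls (trunc n f) :: l2) ----> cls f" by (rule dom)+
 show "integ (trunc n f)"
 proof (rule integrableI_bounded)
 have "(NN x. en (norm (trunc n f x))) <= (NN x. ind (cball (0::real^2) (real n)) x + en ((cmod (f x))^2))"
 proof (rule nn_integral_mono)
 fix x :: "real^2"
 have "cmod (f x) <= 1 + (cmod (f x))^2"
 using sum_squares_bound[of 1 "cmod (f x)"] norm_ge_zero[of "f x"] unfolding one_power2 by linarith
 then have "en (cmod (f x)) <= 1 + en ((cmod (f x))^2)"
 by (metis ennreal_1 ennreal_leI ennreal_plus zero_le_one zero_le_power2)
 then show "en (norm (trunc n f x)) <= ind (cball 0 (real n)) x + en ((cmod (f x))^2)"
 by (auto simp: trunc_def split: split_indicator)
 qed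
 also have "... = emeasure lborel (cball (0::real^2) (real n)) + (L2_norm f)^2"
 unfolding L2_norm_power2 by (subst nn_integral_add) auto
 also have "... < \<infinity>"
 using f emeasure_bounded_finite[of "cball (0::real^2) (real n)"] by (simp add: fun_space_def power_less_top_ennreal)
 finally show "(NN x. en (norm (trunc n f x))) < \<infinity>" .
 qed measurable
qed

text \<open>
 Square integrable functions are limits of combinations of indicators of bounded open sets: the sets whose
 intersection with a fixed ball is admissible form a Dynkin system.
\<close>

lemma L2_dense:
 fixes W :: "l2 set"
 assumes W: "closed W" "subspace W"
 and op: "!!c Q. open Q ==> bounded Q ==> cls (%x. c * ind Q x) : W"
 shows "W = UNIV"
proof -
 have indL: "(%x. c * ind A x) : L2" if [measurable]: "A : sets borel" and "bounded A" for c :: complex and A :: "(real^2) set"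
 proof -
 have "(L2_norm (%x. c * ind A x))^2 = en ((cmod c)^2) * emeasure lborel A"
 unfolding L2_norm_power2
 by (subst nn_integral_cmult_indicator[symmetric]) (auto intro!: nn_integral_cong split: split_indicator)
 also have "... < \<infinity>" using emeasure_bounded_finite[OF \<open>bounded A\<close>] by (simp add: ennreal_mult_less_top)
 finally have "L2_norm (%x. c * ind A x) < \<infinity>"
 by (auto simp: less_top[symmetric] power2_eq_square ennreal_mult_eq_top_iff)
 then show ?thesis by (simp add: fun_space_def)
 qed
 have ind: "cls (%x. c * ind (A \<inter> ball 0 R) x) : W" if "A : sets borel" for A c R
 proof -
 have "A : sigma_sets UNIV {S::(real^2) set. open S}" using that by (simp add: borel_def)
 moreover have "Int_stable {S::(real^2) set. open S}" "{S::(real^2) set. open S} \<subseteq> Pow UNIV" by (auto simp: Int_stable_def)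
 ultimately have "Int_stable {S::(real^2) set. open S}" "{S::(real^2) set. open S} \<subseteq> Pow UNIV" "A : sigma_sets UNIV {S::(real^2) set. open S}"
 by blast+
 then show ?thesis
 proof (induction rule: sigma_sets_induct_disjoint)
 case (basic A)
 then show ?case by (intro op open_Int bounded_Int) auto
 next
 case empty
 show ?case using subspace_0[OF W(2)] by (simp add: zero_fsp_def)
 next
 case (compl A)
 then have [measurable]: "A : sets borel" by (simp add: borel_def)
 have "cls (%x. c * ind (ball 0 R) x - c * ind (A \<inter> ball 0 R) x) = (cls (%x. c * ind (ball 0 R) x) - cls (%x. c * ind (A \<inter> ball 0 R) x) :: l2)"
 by (intro L2_cls_diff indL) (auto simp: bounded_Int)
 moreover have "(%x. c * ind (ball 0 R) x - c * ind (A \<inter> ball 0 R) x) = (%x. c * ind ((UNIV - A) \<inter> ball 0 R) x)"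
 by (auto simp: fun_eq_iff indicator_def)
 ultimately show ?case using subspace_diff[OF W(2) op[of "ball 0 R" c] compl(2)] by simp
 next
 case (union A)
 then have A: "A i : sets borel" for i by (auto simp: borel_def)
 have part: "(%x. \<Sum>i<n. c * ind (A i \<inter> ball 0 R) x) : L2 & cls (%x. \<Sum>i<n. c * ind (A i \<inter> ball 0 R) x) : W" for n
 proof (induction n)
 case 0
 show ?case using subspace_0[OF W(2)] by (simp add: zero_fsp_def L2_zero)
 next
 case (Suc n)
 have i: "(%x. c * ind (A n \<inter> ball 0 R) x) : L2" using A by (intro indL) (auto simp: bounded_Int)
 show ?case using L2_add[OF Suc[THEN conjunct1] i] L2_cls_add[OF Suc[THEN conjunct1] i] subspace_add[OF W(2) Suc[THEN conjunct2] union(3)[of n]] by simp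
 qed
 have eq: "(\<Sum>i<n. c * ind (A i \<inter> ball 0 R) x) = c * ind ((\<Union>i<n. A i) \<inter> ball 0 R) x" for n x
 proof -
 have "(\<Sum>i<n. ind (A i) x) = (ind (\<Union>i<n. A i) x :: complex)"
 using union(1) by (subst indicator_UN_disjoint) (auto simp: disjoint_family_on_def)
 then show ?thesis by (simp add: indicator_inter_arith sum_distrib_left[symmetric] sum_distrib_right[symmetric] mult.assoc[symmetric])
 qed
 have "(%n. cls (%x. \<Sum>i<n. c * ind (A i \<inter> ball 0 R) x) :: l2) ----> cls (%x. c * ind ((\<Union>i. A i) \<inter> ball 0 R) x)"
 proof (rule cls_tendsto_dominated(3)[where w="%x. c * ind (ball 0 R) x"])
 show "(%x. c * ind (ball 0 R) x) : L2" by (intro indL) auto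
 show "AE x in lborel. (%n. \<Sum>i<n. c * ind (A i \<inter> ball 0 R) x) ----> c * ind ((\<Union>i. A i) \<inter> ball 0 R) x"
 proof (rule AE_I2)
 fix x :: "real^2"
 have "\<forall>\<^sub>F n in sequentially. (\<Sum>i<n. c * ind (A i \<inter> ball 0 R) x) = c * ind ((\<Union>i. A i) \<inter> ball 0 R) x"
 proof (cases "\<exists>m. x : A m")
 case True
 then obtain m where "x : A m" by blast
 then show ?thesis unfolding eq eventually_sequentially
 by (intro exI[of _ "Suc m"]) (auto simp: indicator_def)
 next
 case False
 then show ?thesis unfolding eq by (auto simp: indicator_def)
 qed
 then show "(%n. \<Sum>i<n. c * ind (A i \<inter> ball 0 R) x) ----> c * ind ((\<Union>i. A i) \<inter> ball 0 R) x" by (rule tendsto_eventually)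
 qed
 show "AE x in lborel. cmod (\<Sum>i<n. c * ind (A i \<inter> ball 0 R) x) <= cmod (c * ind (ball 0 R) x)" for n
 unfolding eq by (auto simp: indicator_def)
 show "(%x. \<Sum>i<n. c * ind (A i \<inter> ball 0 R) x) : bmf" for n
 using part L2_borel by blast
 have "(\<Union>i. A i) : sets borel" using A by auto
 then show "(%x. c * ind ((\<Union>i. A i) \<inter> ball 0 R) x) : bmf" by measurable
 qed
 then show ?case by (rule closed_sequentially[OF W(1), rotated]) (use part in blast)
 qed
 qed
 have simple: "cls (%x. ind (ball 0 R) x * s x) : W" if s: "simple_function lborel s" for s :: plane_fun and R
 proof -
 have fin: "finite (range s)" using s by (simp add: simple_function_def)
 have [measurable]: "s : bmf" using borel_measurable_simple_function[OF s] by simp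
 have pre: "s -` {c} : sets borel" for c using measurable_sets[OF \<open>s \<in> borel_measurable borel\<close>, of "{c}"] by simp
 have eq: "ind (ball 0 R) x * s x = (\<Sum>c\<in>range s. c * ind (s -` {c} \<inter> ball 0 R) x)" for x
 proof -
 have "(\<Sum>c\<in>range s. c * ind (s -` {c} \<inter> ball 0 R) x) = (\<Sum>c\<in>range s. if c = s x then c * ind (ball 0 R) x else 0)"
 by (intro sum.cong) (auto simp: indicator_def)
 then show ?thesis using fin by (simp add: mult.commute)
 qed
 have "(%x. \<Sum>c\<in>D. c * ind (s -` {c} \<inter> ball 0 R) x) : L2 & cls (%x. \<Sum>c\<in>D. c * ind (s -` {c} \<inter> ball 0 R) x) : W" if "finite D" for D
 using that
 proof (induction D rule: finite_induct)
 case empty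
 show ?case using subspace_0[OF W(2)] by (simp add: zero_fsp_def L2_zero)
 next
 case (insert c D)
 have i: "(%x. c * ind (s -` {c} \<inter> ball 0 R) x) : L2" using pre[of c] by (intro indL) (auto simp: bounded_Int)
 show ?case
 unfolding sum.insert[OF insert(1,2)] L2_cls_add[OF i insert(3)[THEN conjunct1]]
 by (rule conjI[OF L2_add[OF i insert(3)[THEN conjunct1]] subspace_add[OF W(2) ind[OF pre[of c]] insert(3)[THEN conjunct2]]])
 qed
 from this[OF fin] show ?thesis unfolding eq by blast
 qed
 have "u : W" for u
 proof -
 obtain f where f: "f : L2" "u = cls f" using L2_repr[of u] cls_repr[of u] by metis
 note [measurable] = L2_borel[OF f(1)]
 have fR: "cls (%x. ind (ball 0 R) x * f x) : W" for R
 proof -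
 obtain F where F: "!!i. simple_function lborel (F i)" "!!x. (%i. F i x) ----> f x" "!!i x. norm (F i x) <= 2 * norm (f x)"
 using borel_measurable_implies_sequence_metric[of f lborel 0] by (auto simp: dist_norm)
 have [measurable]: "F i : bmf" for i using borel_measurable_simple_function[OF F(1)] by simp
 have "(%i. cls (%x. ind (ball 0 R) x * F i x) :: l2) ----> cls (%x. ind (ball 0 R) x * f x)"
 by (rule cls_tendsto_dominated(3)[OF _ _ L2_scale[OF f(1), of 2]])
 (use F(2,3) in \<open>auto intro!: tendsto_intros simp: norm_mult indicator_def\<close>)
 then show ?thesis by (rule closed_sequentially[OF W(1), rotated]) (use simple[OF F(1)] in blast)
 qed
 have "(%n. cls (%x. ind (ball 0 (real n)) x * f x) :: l2) ----> cls f"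
 proof (rule cls_tendsto_dominated(3)[OF _ _ f(1)])
 show "AE x in lborel. (%n. ind (ball 0 (real n)) x * f x) ----> f x"
 proof (rule AE_I2, rule tendsto_eventually)
 fix x :: "real^2"
 obtain m :: nat where m: "norm x < real m" using reals_Archimedean2 by blast
 then show "\<forall>\<^sub>F n in sequentially. ind (ball 0 (real n)) x * f x = f x"
 unfolding eventually_sequentially by (intro exI[of _ m]) (auto simp: indicator_def)
 qed
 qed (auto simp: norm_mult indicator_def)
 then show ?thesis unfolding f(2) by (rule closed_sequentially[OF W(1) fR])
 qed
 then show ?thesis by blast
qed

section \<open>The Fourier transform on square integrable functions\<close>

text \<open>Truncations are integrable and dense.\<close>

lemma l2_closed_induct:
 assumes cl: "closed {u::l2. P u}" and base: "!!f. f : L2 ==> integ f ==> P (cls f)"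
 shows "P u"
proof -
 have "(%n. cls (trunc n (repr u)) :: l2) ----> u" using trunc(2)[OF L2_repr, of u] by simp
 then have "u : {u. P u}"
 by (rule closed_sequentially[OF cl, rotated]) (use base trunc(1,3)[OF L2_repr, of _ u] in blast)
 then show ?thesis by simp
qed

lemma ft_integrable: "integ f ==> integ (%x. cis (e * (x \<bullet> xi)) * f x)"
 by (rule integrable_cis_mult) simp_all

lemma ft_cong_AE:
 assumes [measurable]: "f : bmf" "g : bmf" and e: "AE x in lborel. f x = g x"
 shows "ft e f = ft e g"
proof
 fix xi
 have "(IN x. cis (e * (x \<bullet> xi)) * f x) = (IN x. cis (e * (x \<bullet> xi)) * g x)"
 proof (rule integral_cong_AE)
 show "AE x in lborel. cis (e * (x \<bullet> xi)) * f x = cis (e * (x \<bullet> xi)) * g x" using e by eventually_elim simp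
 qed simp_all
 then show "ft e f xi = ft e g xi" by (simp add: ft_def)
qed

lemma ft_add: "integ f ==> integ g ==> ft e (%x. f x + g x) = (%xi. ft e f xi + ft e g xi)"
 by (simp add: fun_eq_iff ft_def distrib_left add_divide_distrib ft_integrable)

lemma ft_diff: "integ f ==> integ g ==> ft e (%x. f x - g x) = (%xi. ft e f xi - ft e g xi)"
 by (simp add: fun_eq_iff ft_def right_diff_distrib diff_divide_distrib ft_integrable)

lemma ft_scale: "ft e (%x. c * f x) = (%xi. c * ft e f xi)"
 by (simp add: fun_eq_iff ft_def mult.left_commute[of _ c])

lemma ft_L2: "\<bar>e\<bar> = 1 ==> f : L2 ==> integ f ==> ft e f : L2"
 using ft_contraction[of f e] by (auto simp: fun_space_def intro: le_less_trans)

lemma norm_ft_le_l2: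
 assumes "\<bar>e\<bar> = 1" "f : L2" "integ f" shows "norm (cls (ft e f) :: l2) <= norm (cls f :: l2)"
proof -
 have "en (norm (cls (ft e f) :: l2)) <= en (norm (cls f :: l2))"
 unfolding L2_norm_cls[OF assms(2)] L2_norm_cls[OF ft_L2[OF assms]] by (rule ft_contraction[OF assms(3,1)])
 then show ?thesis by simp
qed

lemma norm_ft_diff_le:
 assumes e: "\<bar>e\<bar> = 1" and f: "f : L2" "integ f" and g: "g : L2" "integ g"
 shows "norm (cls (ft e f) - cls (ft e g) :: l2) <= norm (cls f - cls g :: l2)"
proof -
 have "norm (cls (ft e (%x. f x - g x)) :: l2) <= norm (cls (%x. f x - g x) :: l2)"
 using f g by (intro norm_ft_le_l2 e L2_diff Bochner_Integration.integrable_diff)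
 then show ?thesis
 unfolding ft_diff[OF f(2) g(2)] L2_cls_diff[OF f(1) g(1)] L2_cls_diff[OF ft_L2[OF e f] ft_L2[OF e g]] .
qed

text \<open>The transform with kernel \<open>cis (e x \<bullet> xi)\<close>, extended to all square integrable functions by truncation; \<open>e\<close> is \<open>1\<close> or \<open>-1\<close>, and the two signs are adjoint to each other.\<close>

definition Fe :: "real => l2 => l2" where
 "Fe e u = lim (%n. cls (ft e (trunc n (repr u))))"

lemma Fe_tendsto:
 assumes e: "\<bar>e\<bar> = 1" and f: "f : L2"
 shows "(%n. cls (ft e (trunc n f))) ----> Fe e (cls f)"
proof -
 note [measurable] = L2_borel[OF f] L2_borel[OF L2_repr]
 have "ft e (trunc n (repr (cls f :: l2))) = ft e (trunc n f)" for n
 proof (rule ft_cong_AE)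
 show "AE x in lborel. trunc n (repr (cls f :: l2)) x = trunc n f x"
 using L2_repr_cls[OF f] by eventually_elim (simp add: trunc_def)
 qed measurable
 then have eq: "Fe e (cls f) = lim (%n. cls (ft e (trunc n f)))" by (simp add: Fe_def)
 have "Cauchy (%n. cls (trunc n f) :: l2)" by (rule LIMSEQ_imp_Cauchy[OF trunc(2)[OF f]])
 then have "Cauchy (%n. cls (ft e (trunc n f)) :: l2)"
 unfolding Cauchy_def dist_norm
 using norm_ft_diff_le[OF e trunc(1,3)[OF f] trunc(1,3)[OF f]] by (meson le_less_trans)
 then show ?thesis unfolding eq using Cauchy_convergent convergent_LIMSEQ_iff by blast
qed

lemma Fe_cls:
 assumes e: "\<bar>e\<bar> = 1" and f: "f : L2" "integ f"
 shows "Fe e (cls f) = cls (ft e f)"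
proof (rule LIMSEQ_unique[OF Fe_tendsto[OF e f(1)]])
 have z: "(%n. norm (cls (trunc n f) - cls f :: l2)) ----> 0"
 by (intro tendsto_norm_zero LIM_zero trunc(2) f)
 have "(%n. norm (cls (ft e (trunc n f)) - cls (ft e f) :: l2)) ----> 0"
 by (rule tendsto_sandwich[OF _ _ tendsto_const z]) (use norm_ft_diff_le[OF e trunc(1,3)[OF f(1)] f] in auto)
 then show "(%n. cls (ft e (trunc n f)) :: l2) ----> cls (ft e f)" by (rule LIM_zero_cancel[OF tendsto_norm_zero_cancel])
qed

lemma norm_Fe_le: assumes e: "\<bar>e\<bar> = 1" shows "norm (Fe e u) <= norm u"
proof -
 have "(%n. cls (ft e (trunc n (repr u)))) ----> Fe e u" using Fe_tendsto[OF e L2_repr[of u]] by simp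
 moreover have "(%n. cls (trunc n (repr u)) :: l2) ----> u" using trunc(2)[OF L2_repr[of u]] by simp
 ultimately show ?thesis
 by (intro LIMSEQ_le[OF tendsto_norm tendsto_norm]) (use norm_ft_le_l2[OF e trunc(1,3)[OF L2_repr]] in auto)
qed

lemma Fe_cscale:
 assumes e: "\<bar>e\<bar> = 1" and f: "f : L2" and G: "G : L2" "Fe e (cls f) = cls G"
 shows "Fe e (cls (%x. c * f x)) = cls (%x. c * G x)"
proof (rule LIMSEQ_unique[OF Fe_tendsto[OF e L2_scale[OF f]]])
 have t: "trunc n (%x. c * f x) = (%x. c * trunc n f x)" for n by (simp add: fun_eq_iff trunc_def)
 have i: "ft e (trunc n f) : L2" for n by (rule ft_L2[OF e trunc(1,3)[OF f]])
 have n: "norm (cls (ft e (trunc n (%x. c * f x))) - cls (%x. c * G x) :: l2) = cmod c * norm (cls (ft e (trunc n f)) - cls G :: l2)" for n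
 proof -
 have "en (norm (cls (%x. c * ft e (trunc n f) x) - cls (%x. c * G x) :: l2)) = L2_norm (%x. c * (ft e (trunc n f) x - G x))"
 using norm_cls_diff[OF L2_scale[OF i] L2_scale[OF G(1)]] by (simp add: right_diff_distrib)
 also have "... = en (cmod c) * L2_norm (%x. ft e (trunc n f) x - G x)"
 using lnorm_scale[where 'a=square_integrable, unfolded lnorm_L2] L2_borel[OF L2_diff[OF i G(1)]] by blast
 also have "... = en (cmod c * norm (cls (ft e (trunc n f)) - cls G :: l2))"
 unfolding norm_cls_diff[OF i G(1), symmetric] by (simp add: ennreal_mult)
 finally show ?thesis unfolding t ft_scale by simp
 qed
 have "(%n. cmod c * norm (cls (ft e (trunc n f)) - cls G :: l2)) ----> cmod c * 0"
 using Fe_tendsto[OF e f] unfolding G(2) by (intro tendsto_mult tendsto_const tendsto_norm_zero LIM_zero)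
 then have "(%n. norm (cls (ft e (trunc n (%x. c * f x))) - cls (%x. c * G x) :: l2)) ----> 0"
 by (simp only: n mult_zero_right)
 then show "(%n. cls (ft e (trunc n (%x. c * f x))) :: l2) ----> cls (%x. c * G x)"
 by (rule LIM_zero_cancel[OF tendsto_norm_zero_cancel])
qed

lemma Fe_add:
 assumes e: "\<bar>e\<bar> = 1" shows "Fe e (u + v) = Fe e u + Fe e v"
proof -
 let ?f = "repr u" and ?g = "repr v"
 have f: "?f : L2" and g: "?g : L2" by (rule L2_repr)+
 have s: "cls (%x. ?f x + ?g x) = u + v" using L2_cls_add[OF f g] by simp
 have t: "trunc n (%x. ?f x + ?g x) = (%x. trunc n ?f x + trunc n ?g x)" for n by (simp add: fun_eq_iff trunc_def scaleR_add_right)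
 have "cls (ft e (trunc n (%x. ?f x + ?g x))) = (cls (ft e (trunc n ?f)) + cls (ft e (trunc n ?g)) :: l2)" for n
 unfolding t ft_add[OF trunc(3)[OF f] trunc(3)[OF g]] by (intro L2_cls_add ft_L2 e trunc f g)
 then have "(%n. cls (ft e (trunc n ?f)) + cls (ft e (trunc n ?g)) :: l2) ----> Fe e (u + v)"
 using Fe_tendsto[OF e L2_add[OF f g]] unfolding s by simp
 moreover have "(%n. cls (ft e (trunc n ?f)) + cls (ft e (trunc n ?g)) :: l2) ----> Fe e u + Fe e v"
 using Fe_tendsto[OF e f] Fe_tendsto[OF e g] by (intro tendsto_add) simp_all
 ultimately show ?thesis by (rule LIMSEQ_unique)
qed

lemma bounded_linear_Fe: assumes e: "\<bar>e\<bar> = 1" shows "bounded_linear (Fe e)"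
proof (rule bounded_linear_intro)
 show "Fe e (u + v) = Fe e u + Fe e v" for u v by (rule Fe_add[OF e])
 show "norm (Fe e u) <= norm u * 1" for u using norm_Fe_le[OF e] by simp
 show "Fe e (r *R u) = r *R Fe e u" for r u
 using Fe_cscale[OF e L2_repr[of u] L2_repr[of "Fe e u"], of "cor r"]
 unfolding L2_cls_scale[OF L2_repr] by simp
qed

definition ip :: "l2 => l2 => real" where
 "ip u v = Re (IN x. repr u x * cnj (repr v x))"

lemma nn_integral_eabs_mult:
 assumes f: "f : L2" and g: "g : L2"
 shows "(NN x. eabs f x * eabs g x) <= en (norm (cls f :: l2) * norm (cls g :: l2))"
proof (subst ennreal_power2_le_iff[symmetric])
 note [measurable] = L2_borel[OF f] L2_borel[OF g]
 have "(NN x. eabs f x * eabs g x)^2 <= (L2_norm f)^2 * (L2_norm g)^2"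
 unfolding L2_norm_eabs by (rule Cauchy_Schwarz_nn_integral) measurable
 then show "(NN x. eabs f x * eabs g x)^2 <= (en (norm (cls f :: l2) * norm (cls g :: l2)))^2"
 unfolding L2_norm_cls[OF f, symmetric] L2_norm_cls[OF g, symmetric] by (simp add: ennreal_mult power_mult_distrib)
qed

lemma integrable_mult_cnj:
 assumes f: "f : L2" and g: "g : L2"
 shows "integ (%x. f x * cnj (g x))"
 and "cmod (IN x. f x * cnj (g x)) <= norm (cls f :: l2) * norm (cls g :: l2)"
proof -
 note [measurable] = L2_borel[OF f] L2_borel[OF g]
 have eq: "(NN x. en (norm (f x * cnj (g x)))) = (NN x. eabs f x * eabs g x)"
 by (simp add: eabs_def norm_mult ennreal_mult)
 show "integ (%x. f x * cnj (g x))"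
 proof (rule integrableI_bounded)
 show "(NN x. en (norm (f x * cnj (g x)))) < \<infinity>"
 unfolding eq by (rule le_less_trans[OF nn_integral_eabs_mult[OF f g]]) simp
 qed measurable
 have "en (cmod (IN x. f x * cnj (g x))) <= en (norm (cls f :: l2) * norm (cls g :: l2))"
 using norm_integral_le_nn_integral[of lborel "%x. f x * cnj (g x)"] nn_integral_eabs_mult[OF f g] unfolding eq by (rule order_trans)
 then show "cmod (IN x. f x * cnj (g x)) <= norm (cls f :: l2) * norm (cls g :: l2)" by simp
qed

lemma ip_cls:
 assumes f: "f : L2" and g: "g : L2"
 shows "ip (cls f) (cls g) = Re (IN x. f x * cnj (g x))"
proof -
 note [measurable] = L2_borel[OF f] L2_borel[OF g] L2_borel[OF L2_repr]
 have "(IN x. repr (cls f :: l2) x * cnj (repr (cls g :: l2) x)) = (IN x. f x * cnj (g x))"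
 proof (rule integral_cong_AE)
 show "AE x in lborel. repr (cls f :: l2) x * cnj (repr (cls g :: l2) x) = f x * cnj (g x)"
 using L2_repr_cls[OF f] L2_repr_cls[OF g] by eventually_elim simp
 qed simp_all
 then show ?thesis by (simp add: ip_def)
qed

lemma ip_commute: "ip u v = ip v u"
proof -
 have "(IN x. repr u x * cnj (repr v x)) = cnj (IN x. repr v x * cnj (repr u x))"
 unfolding Bochner_Integration.integral_cnj[symmetric] by (simp add: mult.commute)
 then show ?thesis by (simp add: ip_def)
qed

lemma ip_add_left: "ip (u + u') v = ip u v + ip u' v"
proof -
 have "cls (%x. repr u x + repr u' x) = u + u'" using L2_cls_add[OF L2_repr L2_repr] by simp
 then have "ip (u + u') v = Re (IN x. (repr u x + repr u' x) * cnj (repr v x))"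
 using ip_cls[OF L2_add[OF L2_repr L2_repr] L2_repr, of u u' v] by simp
 also have "... = ip u v + ip u' v"
 unfolding distrib_right by (subst Bochner_Integration.integral_add) (auto intro: integrable_mult_cnj L2_repr simp: ip_def)
 finally show ?thesis .
qed

lemma ip_scale_left: "ip (r *R u) v = r * ip u v"
proof -
 have "cls (%x. cor r * repr u x) = r *R u" using L2_cls_scale[OF L2_repr] by simp
 then have "ip (r *R u) v = Re (IN x. cor r * repr u x * cnj (repr v x))"
 using ip_cls[OF L2_scale[OF L2_repr] L2_repr, of "cor r" u v] by simp
 then show ?thesis by (simp add: ip_def mult.assoc)
qed

lemma bounded_bilinear_ip: "bounded_bilinear ip"
proof
 show "ip (u + u') v = ip u v + ip u' v" for u u' v by (rule ip_add_left)
 show "ip u (v + v') = ip u v + ip u v'" for u v v' unfolding ip_commute[of u] by (rule ip_add_left)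
 show "ip (r *R u) v = r *R ip u v" for r u v by (simp add: ip_scale_left)
 show "ip u (r *R v) = r *R ip u v" for r u v unfolding ip_commute[of u] by (simp add: ip_scale_left)
 have "norm (ip u v) <= norm u * norm v * 1" for u v
 using order_trans[OF abs_Re_le_cmod integrable_mult_cnj(2)[OF L2_repr L2_repr, of u v]] by (simp add: ip_def)
 then show "\<exists>K. \<forall>u v. norm (ip u v) <= norm u * norm v * K" by blast
qed

interpretation ip: bounded_bilinear ip by (rule bounded_bilinear_ip)

lemma ip_self: "ip u u = (norm u)^2"
proof -
 note [measurable] = L2_borel[OF L2_repr[of u]]
 have i: "integ (%x. (cmod (repr u x))^2)"
 using integrable_norm[OF integrable_mult_cnj(1)[OF L2_repr[of u] L2_repr[of u]]] by (simp add: norm_mult power2_eq_square)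
 have "(IN x. repr u x * cnj (repr u x)) = cor (IN x. (cmod (repr u x))^2)"
 unfolding integral_complex_of_real[symmetric] complex_norm_square ..
 then have ip: "ip u u = (IN x. (cmod (repr u x))^2)" by (simp add: ip_def)
 have "en ((norm u)^2) = (L2_norm (repr u))^2"
 using L2_norm_cls[OF L2_repr[of u]] by (simp add: ennreal_power[symmetric])
 also have "... = en (ip u u)" unfolding ip L2_norm_power2 by (rule nn_integral_eq_integral[OF i]) simp
 finally show ?thesis using ip by (subst (asm) ennreal_inj) auto
qed

lemma ip_eqI: assumes "!!f. f : L2 ==> integ f ==> ip u (cls f) = ip v (cls f)" shows "u = v"
proof -
 have "ip u z = ip v z" for z
 proof (induction z rule: l2_closed_induct)
 show "closed {z. ip u z = ip v z}" by (intro closed_Collect_eq ip.continuous_on continuous_intros)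
 qed (rule assms)
 then have "ip (u - v) (u - v) = 0" by (simp add: ip.diff_left)
 then show ?thesis by (simp add: ip_self)
qed

lemma ip_ft:
 assumes f: "integ f" and g: "integ g"
 shows "(IN xi. ft e f xi * cnj (g xi)) = (IN xi. f xi * cnj (ft (- e) g xi))"
proof -
 have [measurable]: "f : bmf" "g : bmf" using f g by auto
 let ?H = "%xi x. cis (e * (x \<bullet> xi)) * f x * cnj (g xi) / cor (2 * pi)"
 have i: "integrable (lborel2) (%(xi, x). ?H xi x)"
 proof (rule Bochner_Integration.integrable_bound[OF integrable_product2[OF integrable_cnj[OF g] f]])
 show "AE z in (lborel2). norm (case z of (xi, x) => ?H xi x) <= norm (case z of (x, y) => cnj (g x) * f y)"
 proof (rule AE_I2, clarify)
 fix xi x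
 have "1 <= 2 * pi" using pi_ge_two by linarith
 then have "cmod (f x) * cmod (g xi) / (2 * pi) <= cmod (f x) * cmod (g xi) / 1"
 by (intro divide_left_mono mult_nonneg_nonneg) auto
 then show "norm (?H xi x) <= norm (cnj (g xi) * f x)" by (simp add: norm_mult norm_divide mult.commute)
 qed
 qed measurable
 have "(IN xi. ft e f xi * cnj (g xi)) = (IN xi. IN x. ?H xi x)"
 by (simp add: ft_def)
 also have "... = (IN x. IN xi. ?H xi x)"
 by (rule lborel_pair.Fubini_integral[OF i, symmetric])
 also have "... = (IN x. f x * cnj (ft (- e) g x))"
 proof (rule Bochner_Integration.integral_cong[OF refl])
 fix x
 have eq: "?H xi x = (f x / cor (2 * pi)) * cnj (cis (- e * (xi \<bullet> x)) * g xi)" for xi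
 by (simp add: cis_cnj inner_commute)
 show "(IN xi. ?H xi x) = f x * cnj (ft (- e) g x)"
 unfolding eq integral_mult_right_zero Bochner_Integration.integral_cnj by (simp add: ft_def)
 qed
 finally show ?thesis .
qed

lemma ip_Fe:
 assumes e: "\<bar>e\<bar> = 1" shows "ip (Fe e u) v = ip u (Fe (- e) v)"
proof -
 have e': "\<bar>- e\<bar> = 1" using e by simp
 note [continuous_intros] = linear_continuous_on[OF bounded_linear_Fe[OF e]] linear_continuous_on[OF bounded_linear_Fe[OF e']]
 have 1: "ip (Fe e (cls f)) (cls g) = ip (cls f) (Fe (- e) (cls g))"
 if f: "f : L2" "integ f" and g: "g : L2" "integ g" for f g
 unfolding Fe_cls[OF e f] Fe_cls[OF e' g] ip_cls[OF ft_L2[OF e f] g(1)] ip_cls[OF f(1) ft_L2[OF e' g]]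
 by (simp add: ip_ft[OF f(2) g(2)])
 have 2: "ip (Fe e (cls f)) v = ip (cls f) (Fe (- e) v)" if f: "f : L2" "integ f" for f v
 proof (induction v rule: l2_closed_induct)
 show "closed {v. ip (Fe e (cls f)) v = ip (cls f) (Fe (- e) v)}"
 by (intro closed_Collect_eq ip.continuous_on continuous_intros)
 qed (rule 1[OF f])
 show ?thesis
 proof (induction u rule: l2_closed_induct)
 show "closed {u. ip (Fe e u) v = ip u (Fe (- e) v)}"
 by (intro closed_Collect_eq ip.continuous_on continuous_intros)
 qed (rule 2)
qed

text \<open>
 For the indicator of an open set the Gaussian regularisations converge from below pointwise, and Fatou's lemma
 gives the reverse of the contraction inequality.
\<close>

lemma L2_norm_ft_indicator:
 fixes c :: complex
 assumes Q: "open Q" "bounded Q" and e: "\<bar>e\<bar> = 1"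
 defines "f \<equiv> %x. c * ind Q x"
 shows "integ f" "f : L2" "L2_norm f <= L2_norm (ft e f)"
proof -
 have [measurable]: "Q : sets borel" using Q by simp
 have fin: "emeasure lborel Q < \<infinity>" by (rule emeasure_bounded_finite[OF Q(2)])
 have [measurable]: "f : bmf" unfolding f_def by measurable
 show f: "integ f"
 proof (rule integrableI_bounded)
 have "(NN x. en (norm (f x))) = (NN x. en (cmod c) * ind Q x)"
 by (intro nn_integral_cong) (auto simp: f_def split: split_indicator)
 also have "... < \<infinity>" using fin by (subst nn_integral_cmult_indicator) (auto simp: ennreal_mult_less_top)
 finally show "(NN x. en (norm (f x))) < \<infinity>" .
 qed simp
 have fsq: "(L2_norm f)^2 = en ((cmod c)^2) * emeasure lborel Q"
 unfolding L2_norm_power2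
 by (subst nn_integral_cmult_indicator[symmetric]) (auto intro!: nn_integral_cong simp: f_def split: split_indicator)
 then have "(L2_norm f)^2 < \<infinity>" using fin by (simp add: ennreal_mult_less_top)
 then have "L2_norm f < \<infinity>" by (simp add: power_less_top_ennreal)
 then show "f : L2" by (simp add: fun_space_def)
 define R where "R n x w = en ((cmod c)^2 * ind Q x * ind Q (x - (1 / real (Suc n)) *R w)) * en (gauss 1 w / (2 * pi))" for n :: nat and x w :: "real^2"
 have [measurable]: "(%(x, w). R n x w) : borel_measurable (borel \<Otimes>\<^sub>M borel)" for n
 unfolding R_def by measurable
 have R: "(NN x. NN w. R n x w) <= (L2_norm (ft e f))^2" for n
 proof -
 define ep where "ep = 1 / real (Suc n)"
 have eps: "0 < ep" by (simp add: ep_def)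
 define k where "k z = gauss (1 / ep) z / (2 * pi * ep^2)" for z
 have [measurable]: "k : bmf" unfolding k_def[abs_def] by measurable
 have k0: "0 <= k z" for z by (simp add: k_def)
 define r where "r x y = (cmod c)^2 * ind Q x * ind Q y * k (x - y)" for x y
 have [measurable]: "(%z. r (fst z) (snd z)) : borel_measurable (lborel2)" unfolding r_def by measurable
 have r0: "0 <= r x y" for x y by (simp add: r_def k0)
 have rn: "(NN y. en (r x y)) = (NN w. R n x w)" for x
 proof -
 define ph where "ph y = en ((cmod c)^2 * ind Q x * ind Q y) * en (gauss (1 / ep) (x - y) / (2 * pi))" for y
 have [measurable]: "ph : bmf" unfolding ph_def[abs_def] by measurable
 have "(NN w. ph (x + ((- ep) *R w + 0 *R rot w))) = en (1 / ((- ep)^2 + 0^2)) * (NN y. ph y)"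
 using eps by (intro nn_integral_similarity) auto
 also have "... = (NN y. en (1 / ep^2) * ph y)" by (simp add: nn_integral_cmult)
 also have "... = (NN y. en (r x y))"
 using eps by (intro nn_integral_cong) (simp add: ph_def r_def k_def ennreal_mult[symmetric] mult_ac)
 finally show ?thesis using eps
 by (simp add: ph_def R_def ep_def[symmetric] gauss_def del: of_nat_Suc)
 qed
 have ir: "integrable (lborel2) (%z. r (fst z) (snd z))"
 proof (rule integrableI_bounded)
 have "(\<integral>\<^sup>+z. en (norm (r (fst z) (snd z))) \<partial>(lborel2)) = (NN x. NN y. en (r x y))"
 by (subst lborel.nn_integral_fst[symmetric]) (simp_all add: r0)
 also have "... <= (NN x. en ((cmod c)^2) * ind Q x * (NN y. en (k (x - y))))"
 proof (rule nn_integral_mono)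
 fix x
 have "(NN y. en (r x y)) <= (NN y. en ((cmod c)^2) * ind Q x * en (k (x - y)))"
 by (intro nn_integral_mono) (auto simp: r_def k0 ennreal_mult[symmetric] split: split_indicator)
 also have "... = en ((cmod c)^2) * ind Q x * (NN y. en (k (x - y)))"
 by (rule nn_integral_cmult) measurable
 finally show "(NN y. en (r x y)) <= en ((cmod c)^2) * ind Q x * (NN y. en (k (x - y)))" .
 qed
 also have "... = en ((cmod c)^2) * emeasure lborel Q"
 using nn_integral_reflect_translate(1)[of "%z. en (k z)"] nn_integral_scaled_gauss[OF eps]
 by (simp add: k_def[symmetric] nn_integral_cmult_indicator)
 also have "... < \<infinity>" using fin by (simp add: ennreal_mult_less_top)
 finally show "(\<integral>\<^sup>+z. en (norm (r (fst z) (snd z))) \<partial>(lborel2)) < \<infinity>" .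
 qed measurable
 have "cor (IN xi. gauss ep xi * (cmod (ft e f xi))^2)
 = (IN x. IN y. f x * cnj (f y) * cor (k (x - y)))"
 unfolding integral_complex_of_real[symmetric] integral_ft_gauss[OF f e eps] k_def ..
 also have "... = (IN x. IN y. cor (r x y))"
 proof -
 have "f x * cnj (f y) * cor (k (x - y)) = cor (r x y)" for x y
 unfolding r_def f_def of_real_mult complex_norm_square by (auto split: split_indicator)
 then show ?thesis by simp
 qed
 also have "... = cor (IN x. IN y. r x y)"
 by (simp only: integral_complex_of_real)
 finally have eq: "(IN xi. gauss ep xi * (cmod (ft e f xi))^2) = (IN x. IN y. r x y)"
 by (simp only: of_real_eq_iff)
 have "(NN x. NN w. R n x w) = (NN x. NN y. en (r x y))" by (simp only: rn)
 also have "... = (\<integral>\<^sup>+z. en (r (fst z) (snd z)) \<partial>(lborel2))"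
 by (subst lborel.nn_integral_fst[symmetric]) simp_all
 also have "... = en (LINT z|(lborel2). r (fst z) (snd z))"
 by (rule nn_integral_eq_integral[OF ir]) (simp add: r0)
 also have "(LINT z|(lborel2). r (fst z) (snd z)) = (IN x. IN y. r x y)"
 using lborel_pair.integral_fst'[OF ir] by simp
 also have "ennreal ... = (NN xi. en (gauss ep xi * (cmod (ft e f xi))^2))"
 unfolding eq[symmetric] by (rule nn_integral_eq_integral[OF integrable_gauss_ft[OF f eps], symmetric]) simp
 also have "... <= (L2_norm (ft e f))^2"
 unfolding L2_norm_power2
 proof (intro nn_integral_mono ennreal_leI)
 fix xi show "gauss ep xi * (cmod (ft e f xi))^2 <= (cmod (ft e f xi))^2"
 using mult_right_mono[OF gauss_le_1[of ep xi], of "(cmod (ft e f xi))^2"] by simp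
 qed
 finally show ?thesis .
 qed
 define L where "L x w = en ((cmod c)^2 * ind Q x) * en (gauss 1 w / (2 * pi))" for x w :: "real^2"
 have LR: "L x w <= liminf (%n. R n x w)" for x w
 proof (cases "x : Q")
 case True
 have "(%n. x - (1 / real (Suc n)) *R w) ----> x - 0 *R w"
 by (intro tendsto_intros LIMSEQ_Suc[OF lim_1_over_n])
 then have "(%n. x - (1 / real (Suc n)) *R w) ----> x" by simp
 then have "\<forall>\<^sub>F n in sequentially. x - (1 / real (Suc n)) *R w : Q"
 by (rule topological_tendstoD) (use Q True in auto)
 then have "\<forall>\<^sub>F n in sequentially. L x w <= R n x w"
 by eventually_elim (use True in \<open>simp add: L_def R_def del: of_nat_Suc\<close>)
 then show ?thesis by (rule Liminf_bounded)
 qed (simp add: L_def)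
 have "(L2_norm f)^2 = (NN x. NN w. L x w)"
 proof -
 have "(NN w. en (gauss 1 w / (2 * pi))) = 1" using nn_integral_scaled_gauss[of 1] by simp
 then have "(NN w. L x w) = en ((cmod c)^2) * ind Q x" for x
 unfolding L_def by (simp add: nn_integral_cmult split: split_indicator)
 then show ?thesis unfolding fsq by (simp add: nn_integral_cmult_indicator)
 qed
 also have "... <= (NN x. NN w. liminf (%n. R n x w))" by (intro nn_integral_mono LR)
 also have "... <= (NN x. liminf (%n. NN w. R n x w))"
 by (intro nn_integral_mono nn_integral_liminf) measurable
 also have "... <= liminf (%n. NN x. NN w. R n x w)"
 by (intro nn_integral_liminf) measurable
 also have "... <= (L2_norm (ft e f))^2"
 by (intro Liminf_le always_eventually allI R) auto
 finally show "L2_norm f <= L2_norm (ft e f)" by (simp add: ennreal_power2_le_iff)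
qed

text \<open>The adjoint of a contraction that preserves the norm of \<open>u\<close> maps the image of \<open>u\<close> back to \<open>u\<close>, and indicators of open sets span a dense subspace.\<close>

lemma Fe_inverse:
 assumes e: "\<bar>e\<bar> = 1" shows "Fe (- e) (Fe e u) = u"
proof -
 have e': "\<bar>- e\<bar> = 1" using e by simp
 interpret A: bounded_linear "Fe e" by (rule bounded_linear_Fe[OF e])
 interpret B: bounded_linear "Fe (- e)" by (rule bounded_linear_Fe[OF e'])
 let ?W = "{u. Fe (- e) (Fe e u) = u}"
 have "?W = UNIV"
 proof (rule L2_dense)
 show "closed ?W" by (intro closed_Collect_eq B.continuous_on A.continuous_on continuous_intros)
 show "subspace ?W" by (auto simp: subspace_def A.add B.add A.scaleR B.scaleR A.zero B.zero)
 fix c :: complex and Q :: "(real^2) set" assume Q: "open Q" "bounded Q"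
 let ?f = "%x. c * ind Q x" and ?u = "cls (%x. c * ind Q x) :: l2"
 note f = L2_norm_ft_indicator[OF Q e, of c]
 have "en (norm ?u) <= en (norm (Fe e ?u))"
 unfolding Fe_cls[OF e f(2,1)] L2_norm_cls[OF f(2)] L2_norm_cls[OF ft_L2[OF e f(2,1)]] by (rule f(3))
 then have 1: "(norm ?u)^2 <= (norm (Fe e ?u))^2" by (intro power_mono) simp_all
 have 2: "(norm (Fe (- e) (Fe e ?u)))^2 <= (norm (Fe e ?u))^2" by (intro power_mono norm_Fe_le e') simp
 have 3: "ip (Fe (- e) (Fe e ?u)) ?u = (norm (Fe e ?u))^2" unfolding ip_Fe[OF e'] by (simp add: ip_self)
 have "(norm (Fe (- e) (Fe e ?u) - ?u))^2 = (norm (Fe (- e) (Fe e ?u)))^2 - 2 * ip (Fe (- e) (Fe e ?u)) ?u + (norm ?u)^2"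
 unfolding ip_self[symmetric] ip.diff_left ip.diff_right using ip_commute[of ?u "Fe (- e) (Fe e ?u)"] by simp
 also have "... <= 0" unfolding 3 using 1 2 by linarith
 finally show "?u : ?W" by simp
 qed
 then show ?thesis by blast
qed

lemma norm_Fe: assumes e: "\<bar>e\<bar> = 1" shows "norm (Fe e u) = norm u"
 using norm_Fe_le[OF e, of u] norm_Fe_le[of "- e" "Fe e u"] Fe_inverse[OF e, of u] e by simp

text \<open>The relation of the definitions is the graph of the operator with the negative sign.\<close>

lemma is_L2_fourier_iff: "is_L2_fourier f G \<longleftrightarrow> f : L2 & G : L2 & Fe (- 1) (cls f) = cls G"
proof -
 have e: "\<bar>- 1 :: real\<bar> = 1" by simp
 have "(%n. fun_dist L2_norm (%xi. (LINT x:cball 0 (real n)|lborel. cis (- (x \<bullet> xi)) * f x) / of_real (2 * pi)) G) ----> 0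
 \<longleftrightarrow> Fe (- 1) (cls f) = cls G" if f: "f : L2" and G: "G : L2"
 proof -
 have "fun_dist L2_norm (%xi. (LINT x:cball 0 (real n)|lborel. cis (- (x \<bullet> xi)) * f x) / of_real (2 * pi)) G
 = en (norm (cls (ft (- 1) (trunc n f)) - cls G :: l2))" for n
 proof -
 have eq: "(%xi. (LINT x:cball 0 (real n)|lborel. cis (- (x \<bullet> xi)) * f x) / of_real (2 * pi)) = ft (- 1) (trunc n f)"
 by (simp add: fun_eq_iff ft_def trunc_def set_lebesgue_integral_def)
 show ?thesis unfolding eq fun_dist_def norm_cls_diff[OF ft_L2[OF e trunc(1,3)[OF f]] G] ..
 qed
 moreover have "(%n. en (norm (cls (ft (- 1) (trunc n f)) - cls G :: l2))) ----> 0
 \<longleftrightarrow> (%n. norm (cls (ft (- 1) (trunc n f)) - cls G :: l2)) ----> 0"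
 unfolding ennreal_0[symmetric] by (rule tendsto_ennreal_iff) auto
 moreover have "(%n. norm (cls (ft (- 1) (trunc n f)) - cls G :: l2)) ----> 0
 \<longleftrightarrow> (%n. cls (ft (- 1) (trunc n f)) :: l2) ----> cls G"
 unfolding tendsto_norm_zero_iff by (rule LIM_zero_iff)
 moreover have "(%n. cls (ft (- 1) (trunc n f)) :: l2) ----> cls G \<longleftrightarrow> Fe (- 1) (cls f) = cls G"
 using Fe_tendsto[OF e f] LIMSEQ_unique by metis
 ultimately show ?thesis by simp
 qed
 then show ?thesis unfolding is_L2_fourier_def by blast
qed

section \<open>The equation in the square integrable functions\<close>

text \<open>Equivalence classes realise the seminormed function space as a Banach space.\<close>

lemma realized_space_fsp: "realized_space (lnorm TYPE('a::lebesgue_norm)) (cls :: plane_fun => 'a fsp)"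
proof
 fix f g :: plane_fun and c :: complex and r :: real and u :: "'a fsp"
 assume f: "f : fun_space (lnorm TYPE('a))"
 show "(%x. c * f x) : fun_space (lnorm TYPE('a))" by (rule fun_space_scale[OF f])
 show "lnorm TYPE('a) (%x. c * f x) = en (cmod c) * lnorm TYPE('a) f"
 using f by (intro lnorm_scale) (simp add: fun_space_def)
 show "(cls (%x. cor r * f x) :: 'a fsp) = r *R cls f" by (rule cls_scale[OF f])
 show "lnorm TYPE('a) f = en (norm (cls f :: 'a fsp))" by (rule norm_cls[OF f, symmetric])
 show "g : fun_space (lnorm TYPE('a))" if "g : bmf" "AE x in lborel. f x = g x"
 by (rule fun_space_cong[OF f that])
 show "(%x. f x + g x) : fun_space (lnorm TYPE('a))" if g: "g : fun_space (lnorm TYPE('a))"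
 by (rule fun_space_add[OF f g])
 show "(cls (%x. f x + g x) :: 'a fsp) = cls f + cls g" if g: "g : fun_space (lnorm TYPE('a))"
 by (rule cls_add[OF f g])
 show "(cls f :: 'a fsp) = cls g \<longleftrightarrow> (AE x in lborel. f x = g x)" if g: "g : fun_space (lnorm TYPE('a))"
 by (rule cls_eq_iff[OF f g])
next
 fix u :: "'a fsp"
 show "\<exists>f\<in>fun_space (lnorm TYPE('a)). cls f = u" using repr[of u] cls_repr[of u] by blast
qed

interpretation L2: realized_space L2_norm "cls :: plane_fun => l2"
 by (rule realized_space_fsp[where 'a=square_integrable, unfolded lnorm_L2])

interpretation L2: CR_space L2_norm "cls :: plane_fun => l2"
proof
 fix f g h assume f: "f : L2" and g: "g : L2" and h: "h : L2"
 note [measurable] = L2_borel[OF f] L2_borel[OF g] L2_borel[OF h]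
 have "L2_norm (CR_op f g h) <= 2 * L2_norm f * L2_norm g * L2_norm h" by (rule L2_norm_CR_op) measurable
 also have "... < \<infinity>" using fun_spaceD(2)[OF f] fun_spaceD(2)[OF g] fun_spaceD(2)[OF h] by (simp add: ennreal_mult_less_top)
 finally show "CR_op f g h : L2" by (simp add: fun_space_def)
 show "AE xi in lborel. CR_converges f g h xi" by (rule CR_converges_L2[OF f g h])
next
 show "\<exists>C\<ge>0. \<forall>f\<in>L2. \<forall>g\<in>L2. \<forall>h\<in>L2. L2_norm (CR_op f g h) <= en C * L2_norm f * L2_norm g * L2_norm h"
 by (intro exI[of _ 2]) (auto intro!: L2_norm_CR_op L2_borel)
qed

section \<open>Symmetries of the quartic form\<close>

lemma integral_map_scaled:
 fixes Ps :: "'b => complex"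
 assumes T [measurable]: "T : measurable M N" and c: "0 <= c"
 and nn: "!!ph. ph : borel_measurable N ==> (\<integral>\<^sup>+z. ph (T z) \<partial>M) = en c * (\<integral>\<^sup>+z. ph z \<partial>N)"
 and Ps [measurable]: "Ps : borel_measurable N"
 shows "(LINT z|M. Ps (T z)) = c *R (LINT z|N. Ps z)"
proof -
 have d: "distr M N T = density N (%_. en c)"
 proof (rule measure_eqI)
 fix A assume "A : sets (distr M N T)"
 then have [measurable]: "A : sets N" by simp
 have "emeasure (distr M N T) A = (\<integral>\<^sup>+z. ind A z \<partial>distr M N T)" by simp
 also have "... = en c * emeasure N A" by (subst nn_integral_distr) (simp_all add: nn)
 finally show "emeasure (distr M N T) A = emeasure (density N (%_. en c)) A" by (simp add: emeasure_density_const)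
 qed simp
 have "(LINT z|M. Ps (T z)) = (LINT z|distr M N T. Ps z)" by (rule integral_distr[OF T Ps, symmetric])
 also have "... = c *R (LINT z|N. Ps z)" unfolding d using c by (subst integral_density) auto
 finally show ?thesis .
qed

lemma integral_product:
 fixes p q :: "'a::euclidean_space => complex"
 assumes p: "integ p" and q: "integ q"
 shows "(LINT z|(lborel2). p (fst z) * q (snd z)) = (IN x. p x) * (IN y. q y)"
 using lborel_pair.integral_fst'[OF integrable_product2[OF p q]] by (simp add: case_prod_beta')

text \<open>
 For fixed \<open>l\<close> the corners \<open>xi + x\<close>, \<open>xi + l rot x\<close> on one diagonal of the rectangle determine the other two,
 and the phases of the two sides agree.
\<close>

lemma rectangle_ft:
 assumes f: "integ f" and G: "integ G" and h: "integ h" and K: "integ K"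
 shows "(LINT z|(lborel2). ft e f (fst z + snd z) * cnj (G (fst z + snd z + l *R rot (snd z))) * ft e h (fst z + l *R rot (snd z)) * cnj (K (fst z)))
 = (LINT z|(lborel2). f (fst z + snd z) * cnj (ft (- e) G (fst z + snd z + l *R rot (snd z))) * h (fst z + l *R rot (snd z)) * cnj (ft (- e) K (fst z)))"
proof -
 have [measurable]: "f : bmf" "G : bmf" "h : bmf" "K : bmf"
 using f G h K by auto
 let ?M = "lborel2 :: ((real^2) \<times> (real^2)) measure"
 have M: "?M = lborel" by (rule lborel_prod)
 define c where "c = 1 / (1 + l^2)"
 have l1: "0 < 1 + l^2" by (simp add: add_pos_nonneg)
 have c0: "0 <= c" using l1 by (simp add: c_def)
 have cl: "c * (1 + l^2) = 1" using l1 by (simp add: c_def)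
 define A where "A v = c *R (v - l *R rot v)" for v
 define A' where "A' v = c *R (v + l *R rot v)" for v
 have [measurable]: "A : bmf" "A' : bmf"
 unfolding A_def[abs_def] A'_def[abs_def] by measurable
 have c2: "c * t + c * (l^2 * t) = t" for t using cl by (simp add: algebra_simps) (metis mult.assoc mult.commute mult_1 distrib_right)
 have A: "A (x + l *R rot x) = x" and A': "A' (x - l *R rot x) = x" for x
 unfolding A_def A'_def vec2_eq_iff using c2[of "x $ 1"] c2[of "x $ 2"]
 by (simp_all add: algebra_simps power2_eq_square)
 have lA: "l *R rot (A v) = v - A v" for v
 unfolding A_def vec2_eq_iff using c2[of "v $ 1"] c2[of "v $ 2"]
 by (simp add: algebra_simps power2_eq_square)
 have adj: "u \<bullet> A' v = A u \<bullet> v" for u v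
 by (simp add: A_def A'_def inner_vec2 algebra_simps)
 define Ph where "Ph w z = fst w \<bullet> snd z + snd w \<bullet> fst z + (fst w - snd w) \<bullet> A (fst z - snd z)"
 for w z :: "(real^2) \<times> (real^2)"
 define H where "H w z = (f (fst w) * h (snd w)) * (cnj (G (fst z)) * cnj (K (snd z))) * cis (e * Ph w z)" for w z
 have iH: "integrable (?M \<Otimes>\<^sub>M ?M) (%(w, z). H w z)"
 proof -
 have 1: "integrable ?M (%w. f (fst w) * h (snd w))" using integrable_product2[OF f h] by (simp add: case_prod_beta')
 have 2: "integrable ?M (%z. cnj (G (fst z)) * cnj (K (snd z)))"
 using integrable_product2[OF integrable_cnj[OF G] integrable_cnj[OF K]] by (simp add: case_prod_beta')
 have 3: "integrable (?M \<Otimes>\<^sub>M ?M) (%(w, z). (f (fst w) * h (snd w)) * (cnj (G (fst z)) * cnj (K (snd z))))"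
 using integrable_product2[OF 1[unfolded M] 2[unfolded M]] unfolding M .
 show ?thesis
 proof (rule Bochner_Integration.integrable_bound[OF 3])
 show "(%(w, z). H w z) : borel_measurable (?M \<Otimes>\<^sub>M ?M)"
 unfolding H_def Ph_def by measurable
 qed (auto simp: H_def norm_mult)
 qed
 interpret P: pair_sigma_finite ?M ?M unfolding M ..
 define C where "C = 1 / cor ((2 * pi)^2)"
 define Ps1 where "Ps1 z = ft e f (snd z + A (fst z - snd z)) * cnj (G (fst z)) * ft e h (snd z + l *R rot (A (fst z - snd z))) * cnj (K (snd z))" for z
 define Ps2 where "Ps2 w = f (fst w) * cnj (ft (- e) G (snd w + A' (fst w - snd w))) * h (snd w) * cnj (ft (- e) K (fst w - A' (fst w - snd w)))" for w
 have [measurable]: "Ps1 : borel_measurable ?M" "Ps2 : borel_measurable ?M"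
 unfolding Ps1_def[abs_def] Ps2_def[abs_def] by measurable
 have Ps1: "Ps1 z = C * (LINT w|?M. H w z)" for z
 proof -
 let ?a = "snd z + A (fst z - snd z)" and ?b = "snd z + l *R rot (A (fst z - snd z))"
 have ph: "p \<bullet> ?a + q \<bullet> ?b = Ph (p, q) z" for p q
 unfolding Ph_def lA by (simp add: inner_add_right inner_diff_right inner_diff_left)
 have "ft e f ?a * ft e h ?b = C * ((IN p. cis (e * (p \<bullet> ?a)) * f p) * (IN q. cis (e * (q \<bullet> ?b)) * h q))"
 by (simp add: ft_def C_def power2_eq_square)
 also have "... = C * (LINT w|?M. (cis (e * (fst w \<bullet> ?a)) * f (fst w)) * (cis (e * (snd w \<bullet> ?b)) * h (snd w)))"
 by (simp only: integral_product[OF ft_integrable[OF f] ft_integrable[OF h]])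
 finally have "Ps1 z = C * ((LINT w|?M. (cis (e * (fst w \<bullet> ?a)) * f (fst w)) * (cis (e * (snd w \<bullet> ?b)) * h (snd w))) * (cnj (G (fst z)) * cnj (K (snd z))))"
 unfolding Ps1_def by (simp add: mult_ac)
 also have "... = C * (LINT w|?M. (cis (e * (fst w \<bullet> ?a)) * f (fst w)) * (cis (e * (snd w \<bullet> ?b)) * h (snd w)) * (cnj (G (fst z)) * cnj (K (snd z))))"
 by (simp only: integral_mult_left_zero)
 also have "... = C * (LINT w|?M. H w z)"
 proof -
 have "(cis (e * (fst w \<bullet> ?a)) * f (fst w)) * (cis (e * (snd w \<bullet> ?b)) * h (snd w)) * (cnj (G (fst z)) * cnj (K (snd z))) = H w z" for w
 proof -
 have "cis (e * Ph w z) = cis (e * (fst w \<bullet> ?a)) * cis (e * (snd w \<bullet> ?b))"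
 using ph[of "fst w" "snd w"] by (simp add: cis_mult distrib_left[symmetric])
 then show ?thesis unfolding H_def by (simp only: mult_ac)
 qed
 then show ?thesis by simp
 qed
 finally show ?thesis .
 qed
 have Ps2: "Ps2 w = C * (LINT z|?M. H w z)" for w
 proof -
 let ?a = "snd w + A' (fst w - snd w)" and ?b = "fst w - A' (fst w - snd w)"
 have ph: "r \<bullet> ?a + s \<bullet> ?b = Ph w (r, s)" for r s
 using adj[of "r - s" "fst w - snd w"]
 by (simp add: Ph_def inner_add_right inner_diff_right inner_diff_left inner_commute)
 have cf: "cnj (ft (- e) g a) = (IN r. cis (e * (r \<bullet> a)) * cnj (g r)) / cor (2 * pi)" for g a
 unfolding ft_def complex_cnj_divide Bochner_Integration.integral_cnj[symmetric] by (simp add: cis_cnj)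
 have "cnj (ft (- e) G ?a) * cnj (ft (- e) K ?b) = C * ((IN r. cis (e * (r \<bullet> ?a)) * cnj (G r)) * (IN s. cis (e * (s \<bullet> ?b)) * cnj (K s)))"
 by (simp add: cf C_def power2_eq_square)
 also have "... = C * (LINT z|?M. (cis (e * (fst z \<bullet> ?a)) * cnj (G (fst z))) * (cis (e * (snd z \<bullet> ?b)) * cnj (K (snd z))))"
 by (simp only: integral_product[OF ft_integrable[OF integrable_cnj[OF G]] ft_integrable[OF integrable_cnj[OF K]]])
 finally have "Ps2 w = C * ((LINT z|?M. (cis (e * (fst z \<bullet> ?a)) * cnj (G (fst z))) * (cis (e * (snd z \<bullet> ?b)) * cnj (K (snd z)))) * (f (fst w) * h (snd w)))"
 unfolding Ps2_def by (simp add: mult_ac)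
 also have "... = C * (LINT z|?M. (cis (e * (fst z \<bullet> ?a)) * cnj (G (fst z))) * (cis (e * (snd z \<bullet> ?b)) * cnj (K (snd z))) * (f (fst w) * h (snd w)))"
 by (simp only: integral_mult_left_zero)
 also have "... = C * (LINT z|?M. H w z)"
 proof -
 have "(cis (e * (fst z \<bullet> ?a)) * cnj (G (fst z))) * (cis (e * (snd z \<bullet> ?b)) * cnj (K (snd z))) * (f (fst w) * h (snd w)) = H w z" for z
 proof -
 have "cis (e * Ph w z) = cis (e * (fst z \<bullet> ?a)) * cis (e * (snd z \<bullet> ?b))"
 using ph[of "fst z" "snd z"] by (simp add: cis_mult distrib_left[symmetric])
 then show ?thesis unfolding H_def by (simp only: mult_ac)
 qed
 then show ?thesis by simp
 qed
 finally show ?thesis .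
 qed
 have be: "(LINT z|?M. Ps1 (fst z + (snd z + l *R rot (snd z)), fst z)) = c *R (LINT z|?M. Ps1 z)"
 proof (rule integral_map_scaled[OF _ c0])
 fix ph :: "(real^2) \<times> (real^2) => ennreal" assume [measurable]: "ph : borel_measurable ?M"
 have "(\<integral>\<^sup>+z. ph (fst z + (snd z + l *R rot (snd z)), fst z) \<partial>?M) = (NN xi. NN x. ph (xi + (1 *R x + l *R rot x), xi))"
 by (subst lborel.nn_integral_fst[symmetric]) simp_all
 also have "... = (NN xi. en c * (NN x. ph (x, xi)))"
 proof (rule nn_integral_cong)
 fix xi show "(NN x. ph (xi + (1 *R x + l *R rot x), xi)) = en c * (NN x. ph (x, xi))"
 using nn_integral_similarity[of 1 l "%y. ph (y, xi)" xi] by (simp add: c_def)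
 qed
 also have "... = en c * (NN xi. NN x. ph (x, xi))" by (rule nn_integral_cmult) measurable
 also have "(NN xi. NN x. ph (x, xi)) = (\<integral>\<^sup>+z. ph z \<partial>?M)" by (rule lborel_pair.nn_integral_snd) measurable
 finally show "(\<integral>\<^sup>+z. ph (fst z + (snd z + l *R rot (snd z)), fst z) \<partial>?M) = en c * (\<integral>\<^sup>+z. ph z \<partial>?M)" .
 qed measurable
 have al: "(LINT z|?M. Ps2 (fst z + snd z, fst z + l *R rot (snd z))) = c *R (LINT z|?M. Ps2 z)"
 proof (rule integral_map_scaled[OF _ c0])
 fix ph :: "(real^2) \<times> (real^2) => ennreal" assume [measurable]: "ph : borel_measurable ?M"
 have "(\<integral>\<^sup>+z. ph (fst z + snd z, fst z + l *R rot (snd z)) \<partial>?M) = (NN xi. NN x. ph (xi + x, xi + l *R rot x))"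
 by (subst lborel.nn_integral_fst[symmetric]) simp_all
 also have "... = (NN x. NN xi. ph (xi + x, xi + l *R rot x))"
 by (rule lborel_pair.Fubini'[symmetric]) measurable
 also have "... = (NN x. NN xi. ph (xi, xi + ((- 1) *R x + l *R rot x)))"
 proof (rule nn_integral_cong)
 fix x :: "real^2"
 show "(NN xi. ph (xi + x, xi + l *R rot x)) = (NN xi. ph (xi, xi + ((- 1) *R x + l *R rot x)))"
 using nn_integral_reflect_translate(2)[of "%xi. ph (xi, xi + ((- 1) *R x + l *R rot x))" "- x"]
 by (simp add: algebra_simps)
 qed
 also have "... = (NN xi. NN x. ph (xi, xi + ((- 1) *R x + l *R rot x)))"
 by (rule lborel_pair.Fubini') measurable
 also have "... = (NN xi. en c * (NN x. ph (xi, x)))"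
 proof (rule nn_integral_cong)
 fix xi show "(NN x. ph (xi, xi + ((- 1) *R x + l *R rot x))) = en c * (NN x. ph (xi, x))"
 using nn_integral_similarity[of "- 1" l "%y. ph (xi, y)" xi] by (simp add: c_def)
 qed
 also have "... = en c * (NN xi. NN x. ph (xi, x))" by (rule nn_integral_cmult) measurable
 also have "(NN xi. NN x. ph (xi, x)) = (\<integral>\<^sup>+z. ph z \<partial>?M)" by (rule lborel.nn_integral_fst) measurable
 finally show "(\<integral>\<^sup>+z. ph (fst z + snd z, fst z + l *R rot (snd z)) \<partial>?M) = en c * (\<integral>\<^sup>+z. ph z \<partial>?M)" .
 qed measurable
 have s1: "Ps1 (xi + (x + l *R rot x), xi) = ft e f (xi + x) * cnj (G (xi + x + l *R rot x)) * ft e h (xi + l *R rot x) * cnj (K xi)" for xi x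
 by (simp add: Ps1_def A add.assoc)
 have s2: "Ps2 (xi + x, xi + l *R rot x) = f (xi + x) * cnj (ft (- e) G (xi + x + l *R rot x)) * h (xi + l *R rot x) * cnj (ft (- e) K xi)" for xi x
 proof -
 have "xi + x - (xi + l *R rot x) = x - l *R rot x" by simp
 then show ?thesis unfolding Ps2_def fst_conv snd_conv by (simp only: A') (simp add: algebra_simps)
 qed
 have "(LINT z|?M. LINT w|?M. H w z) = (LINT w|?M. LINT z|?M. H w z)" by (rule P.Fubini_integral[OF iH])
 then have "(LINT z|?M. Ps1 z) = (LINT z|?M. Ps2 z)" unfolding Ps1 Ps2 integral_mult_right_zero by simp
 then show ?thesis unfolding al[unfolded s2] be[unfolded s1] by simp
qed

text \<open>The integrand of the pairing of the operator with a fourth function, over all rectangles at once.\<close>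

definition rect_kernel :: "plane_fun => plane_fun => plane_fun => plane_fun => real \<times> (real^2) \<times> (real^2) => complex" where
 "rect_kernel f g h k z = CR_kernel f g h (fst (snd z)) (fst z, snd (snd z)) * cnj (k (fst (snd z)))"

definition quartic :: "plane_fun => plane_fun => plane_fun => plane_fun => complex" where
 "quartic f g h k = (LINT z|(lborel \<Otimes>\<^sub>M (lborel2)). rect_kernel f g h k z)"

lemma borel_measurable_rect_kernel [measurable]:
 assumes [measurable]: "f : bmf" "g : bmf" "h : bmf" "k : bmf"
 shows "rect_kernel f g h k : borel_measurable (borel \<Otimes>\<^sub>M (borel \<Otimes>\<^sub>M borel))"
 unfolding rect_kernel_def[abs_def] CR_kernel_def by measurable

text \<open>Fubini and Tonelli for the line and two planes.\<close>

lemma nn_integral_line_planes: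
 fixes ph :: "real \<times> (real^2) \<times> (real^2) => ennreal"
 assumes [measurable]: "ph : borel_measurable (borel \<Otimes>\<^sub>M (borel \<Otimes>\<^sub>M borel))"
 shows "(\<integral>\<^sup>+z. ph z \<partial>(lborel \<Otimes>\<^sub>M (lborel2))) = (NN l. NN xi. NN x. ph (l, xi, x))"
 and "(\<integral>\<^sup>+z. ph (fst (snd z), fst z, snd (snd z)) \<partial>(lborel \<Otimes>\<^sub>M (lborel2))) = (\<integral>\<^sup>+z. ph z \<partial>(lborel \<Otimes>\<^sub>M (lborel2)))"
proof -
 have s1: "sigma_finite_measure (lborel2 :: ((real^2) \<times> (real^2)) measure)"
 unfolding lborel_prod by (rule sigma_finite_lborel)
 have s2: "sigma_finite_measure (lborel2 :: (real \<times> (real^2)) measure)"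
 unfolding lborel_prod by (rule sigma_finite_lborel)
 have "(\<integral>\<^sup>+z. ph z \<partial>(lborel \<Otimes>\<^sub>M (lborel2))) = (NN l. \<integral>\<^sup>+z. ph (l, z) \<partial>(lborel2))"
 by (rule sigma_finite_measure.nn_integral_fst[OF s1, symmetric]) measurable
 also have "... = (NN l. NN xi. NN x. ph (l, xi, x))"
 by (intro nn_integral_cong lborel.nn_integral_fst[symmetric]) measurable
 finally show 1: "(\<integral>\<^sup>+z. ph z \<partial>(lborel \<Otimes>\<^sub>M (lborel2))) = (NN l. NN xi. NN x. ph (l, xi, x))" .
 have "(\<integral>\<^sup>+z. ph (fst (snd z), fst z, snd (snd z)) \<partial>(lborel \<Otimes>\<^sub>M (lborel2))) = (NN xi. \<integral>\<^sup>+z. ph (fst z, xi, snd z) \<partial>(lborel2))"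
 by (subst sigma_finite_measure.nn_integral_fst[OF s2, symmetric]) simp_all
 also have "... = (NN xi. NN l. NN x. ph (l, xi, x))"
 proof (rule nn_integral_cong)
 fix xi
 show "(\<integral>\<^sup>+z. ph (fst z, xi, snd z) \<partial>(lborel2)) = (NN l. NN x. ph (l, xi, x))"
 by (subst lborel.nn_integral_fst[symmetric]) simp_all
 qed
 also have "... = (NN l. NN xi. NN x. ph (l, xi, x))"
 by (rule lborel_pair.Fubini'[symmetric]) measurable
 finally show "(\<integral>\<^sup>+z. ph (fst (snd z), fst z, snd (snd z)) \<partial>(lborel \<Otimes>\<^sub>M (lborel2))) = (\<integral>\<^sup>+z. ph z \<partial>(lborel \<Otimes>\<^sub>M (lborel2)))"
 unfolding 1 .
qed

lemma quartic:
 assumes f: "f : L2" and g: "g : L2" and h: "h : L2" and k: "k : L2"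
 shows "integrable (lborel \<Otimes>\<^sub>M (lborel2)) (rect_kernel f g h k)"
 and "quartic f g h k = (IN xi. CR_op f g h xi * cnj (k xi))"
proof -
 note [measurable] = L2_borel[OF f] L2_borel[OF g] L2_borel[OF h] L2_borel[OF k]
 let ?M = "lborel \<Otimes>\<^sub>M (lborel2) :: (real \<times> (real^2) \<times> (real^2)) measure"
 let ?M' = "lborel \<Otimes>\<^sub>M (lborel2) :: ((real^2) \<times> real \<times> (real^2)) measure"
 let ?T = "%z::(real^2) \<times> real \<times> (real^2). (fst (snd z), fst z, snd (snd z))"
 have s2: "sigma_finite_measure (lborel2 :: (real \<times> (real^2)) measure)"
 unfolding lborel_prod by (rule sigma_finite_lborel)
 let ?a = "abs_op (eabs f) (eabs g) (eabs h)"
 have fin: "(\<integral>\<^sup>+z. en (norm (rect_kernel f g h k (?T z))) \<partial>?M') < \<infinity>"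
 proof -
 have "(\<integral>\<^sup>+z. en (norm (rect_kernel f g h k (?T z))) \<partial>?M') = (NN xi. \<integral>\<^sup>+z. en (norm (rect_kernel f g h k (fst z, xi, snd z))) \<partial>(lborel2))"
 by (subst sigma_finite_measure.nn_integral_fst[OF s2, symmetric]) simp_all
 also have "... = (NN xi. \<integral>\<^sup>+z. en (norm (CR_kernel f g h xi z)) * eabs k xi \<partial>(lborel2))"
 by (simp add: rect_kernel_def norm_mult ennreal_mult eabs_def)
 also have "... = (NN xi. ?a xi * eabs k xi)"
 proof (rule nn_integral_cong)
 fix xi
 have "(\<integral>\<^sup>+z. en (norm (CR_kernel f g h xi z)) * eabs k xi \<partial>(lborel2)) = (\<integral>\<^sup>+z. en (norm (CR_kernel f g h xi z)) \<partial>(lborel2)) * eabs k xi"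
 by (rule nn_integral_multc) measurable
 then show "(\<integral>\<^sup>+z. en (norm (CR_kernel f g h xi z)) * eabs k xi \<partial>(lborel2)) = ?a xi * eabs k xi"
 by (subst (asm) nn_integral_norm_kernel) simp_all
 qed
 finally have eq: "(\<integral>\<^sup>+z. en (norm (rect_kernel f g h k (?T z))) \<partial>?M') = (NN xi. ?a xi * eabs k xi)" .
 have "(NN xi. ?a xi * eabs k xi)^2 <= (NN xi. (?a xi)^2) * (NN xi. (eabs k xi)^2)"
 by (rule Cauchy_Schwarz_nn_integral) measurable
 also have "... <= (4 * (NN x. (eabs f x)^2) * (NN x. (eabs g x)^2) * (NN x. (eabs h x)^2)) * (NN xi. (eabs k xi)^2)"
 by (intro mult_right_mono abs_op_L2) simp_all
 also have "... < \<infinity>"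
 using f g h k unfolding L2_norm_eabs[symmetric] by (simp add: fun_space_def ennreal_mult_less_top power_less_top_ennreal)
 finally show ?thesis unfolding eq by (simp add: power_less_top_ennreal)
 qed
 have fin2: "(\<integral>\<^sup>+z. en (norm (rect_kernel f g h k z)) \<partial>?M) < \<infinity>"
 using fin nn_integral_line_planes(2)[of "%z. en (norm (rect_kernel f g h k z))"] by simp
 show "integrable ?M (rect_kernel f g h k)"
 by (rule integrableI_bounded[OF _ fin2]) measurable
 have i': "integrable ?M' (%z. rect_kernel f g h k (?T z))"
 by (rule integrableI_bounded[OF _ fin]) measurable
 interpret P: pair_sigma_finite "lborel :: (real^2) measure" "lborel2 :: (real \<times> (real^2)) measure"
 unfolding lborel_prod ..
 have "(LINT z|?M'. rect_kernel f g h k (?T z)) = 1 *R (LINT z|?M. rect_kernel f g h k z)"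
 by (rule integral_map_scaled) (simp_all add: nn_integral_line_planes(2))
 then have "quartic f g h k = (LINT z|?M'. rect_kernel f g h k (?T z))" by (simp add: quartic_def)
 also have "... = (IN xi. LINT z|(lborel2). rect_kernel f g h k (fst z, xi, snd z))"
 using P.integral_fst'[OF i'] by simp
 also have "... = (IN xi. CR_op f g h xi * cnj (k xi))"
 proof (rule integral_cong_AE)
 show "AE xi in lborel. (LINT z|(lborel2). rect_kernel f g h k (fst z, xi, snd z)) = CR_op f g h xi * cnj (k xi)"
 using CR_converges_L2[OF f g h] by eventually_elim (simp add: rect_kernel_def CR_op_kernel)
 show "(%xi. LINT z|(lborel2). rect_kernel f g h k (fst z, xi, snd z)) : borel_measurable lborel" by measurable
 show "(%xi. CR_op f g h xi * cnj (k xi)) : borel_measurable lborel" by measurable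
 qed
 finally show "quartic f g h k = (IN xi. CR_op f g h xi * cnj (k xi))" .
qed

text \<open>The symmetry under the Fourier transform, integrated over \<open>l\<close>.\<close>

lemma quartic_ft:
 assumes e: "\<bar>e\<bar> = 1" and f: "f : L2" "integ f" and g: "g : L2" "integ g"
 and h: "h : L2" "integ h" and k: "k : L2" "integ k"
 shows "quartic (ft e f) g (ft e h) k = quartic f (ft (- e) g) h (ft (- e) k)"
proof -
 have e': "\<bar>- e\<bar> = 1" using e by simp
 interpret P: pair_sigma_finite "lborel :: real measure" "lborel2 :: ((real^2) \<times> (real^2)) measure"
 unfolding lborel_prod ..
 have 1: "rect_kernel a b c d (l, z) = ind {-1..1} l *R (a (fst z + snd z) * cnj (b (fst z + snd z + l *R rot (snd z))) * c (fst z + l *R rot (snd z)) * cnj (d (fst z)))"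
 for a b c d l z by (simp add: rect_kernel_def CR_kernel_def)
 have 2: "quartic a b c d = (IN l. ind {-1..1} l *R (LINT z|(lborel2). a (fst z + snd z) * cnj (b (fst z + snd z + l *R rot (snd z))) * c (fst z + l *R rot (snd z)) * cnj (d (fst z))))"
 if "a : L2" "b : L2" "c : L2" "d : L2" for a b c d
 unfolding quartic_def P.integral_fst'[OF quartic(1)[OF that], symmetric] 1 integral_scaleR_right ..
 show ?thesis
 unfolding 2[OF ft_L2[OF e f] g(1) ft_L2[OF e h] k(1)] 2[OF f(1) ft_L2[OF e' g] h(1) ft_L2[OF e' k]]
 rectangle_ft[OF f(2) g(2) h(2) k(2)] ..
qed

text \<open>Conjugation swaps the diagonals; the substitution \<open>(l, xi, x) \<mapsto> (-l, xi + l rot x, x)\<close> restores the order of the corners.\<close>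

lemma cnj_quartic:
 assumes f: "f : L2" and g: "g : L2" and h: "h : L2" and k: "k : L2"
 shows "cnj (quartic f g h k) = quartic g f k h"
proof -
 note [measurable] = L2_borel[OF f] L2_borel[OF g] L2_borel[OF h] L2_borel[OF k]
 let ?M = "lborel \<Otimes>\<^sub>M (lborel2) :: (real \<times> (real^2) \<times> (real^2)) measure"
 let ?T = "%z::real \<times> (real^2) \<times> (real^2). (- fst z, fst (snd z) + fst z *R rot (snd (snd z)), snd (snd z))"
 have rm: "rot : bmf" by measurable
 have T: "?T : measurable ?M ?M" by measurable
 have "(LINT z|?M. rect_kernel g f k h (?T z)) = 1 *R (LINT z|?M. rect_kernel g f k h z)"
 proof (rule integral_map_scaled[OF T])
 fix ph :: "real \<times> (real^2) \<times> (real^2) => ennreal" assume "ph : borel_measurable ?M"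
 then have [measurable]: "ph : borel_measurable (borel \<Otimes>\<^sub>M (borel \<Otimes>\<^sub>M borel))" by simp
 have "(\<integral>\<^sup>+z. ph (?T z) \<partial>?M) = (NN l. NN xi. NN x. ph (- l, xi + l *R rot x, x))"
 by (subst nn_integral_line_planes(1)) simp_all
 also have "... = (NN l. NN x. NN xi. ph (- l, xi + l *R rot x, x))"
 by (rule nn_integral_cong, rule lborel_pair.Fubini'[symmetric]) measurable
 also have "... = (NN l. NN x. NN xi. ph (- l, xi, x))"
 proof (rule nn_integral_cong, rule nn_integral_cong)
 fix l :: real and x :: "real^2"
 show "(NN xi. ph (- l, xi + l *R rot x, x)) = (NN xi. ph (- l, xi, x))"
 using nn_integral_reflect_translate(2)[of "%xi. ph (- l, xi, x)" "- (l *R rot x)"] by simp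
 qed
 also have "... = (NN l. NN xi. NN x. ph (- l, xi, x))"
 by (rule nn_integral_cong, rule lborel_pair.Fubini') measurable
 also have "... = (NN l. NN xi. NN x. ph (l, xi, x))"
 using nn_integral_real_affine[of "%l. NN xi. NN x. ph (l, xi, x)" "- 1" 0] by simp
 also have "... = (\<integral>\<^sup>+z. ph z \<partial>?M)" by (subst nn_integral_line_planes(1)) simp_all
 finally show "(\<integral>\<^sup>+z. ph (?T z) \<partial>?M) = en 1 * (\<integral>\<^sup>+z. ph z \<partial>?M)" by simp
 qed simp_all
 moreover have "rect_kernel g f k h (?T z) = cnj (rect_kernel f g h k z)" for z
 by (auto simp: rect_kernel_def CR_kernel_def add_ac mult_ac split: split_indicator)
 ultimately show ?thesis by (simp add: quartic_def)
qed

lemma L2_F_cls: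
 "f : L2 ==> g : L2 ==> h : L2 ==> L2.F (cls f) (cls g) (cls h) = cls (%x. \<i> * CR_op f g h x)"
 using L2.CR_op_J L2.times_i_J[OF L2.CR_in] by simp

lemma ip_F:
 assumes f: "f : L2" and g: "g : L2" and h: "h : L2" and k: "k : L2"
 shows "ip (L2.F (cls f) (cls g) (cls h)) (cls k) = - Im (quartic f g h k)"
 unfolding L2_F_cls[OF f g h] ip_cls[OF L2_scale[OF L2.CR_in[OF f g h]] k] quartic(2)[OF f g h k]
 by (simp add: mult.assoc)

text \<open>The quartic form is real on the diagonal, so the vector field is orthogonal to its argument.\<close>

lemma ip_F_self: "ip (L2.F u u u) u = 0"
proof -
 have "cnj (quartic (repr u) (repr u) (repr u) (repr u)) = quartic (repr u) (repr u) (repr u) (repr u)"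
 by (rule cnj_quartic) (rule L2_repr)+
 then have "Im (quartic (repr u) (repr u) (repr u) (repr u)) = 0" by (simp add: complex_eq_iff)
 then show ?thesis using ip_F[OF L2_repr L2_repr L2_repr L2_repr, of u u u u] by simp
qed

text \<open>Move the transforms of the outer arguments to the middle one and to the test function, and use that the two signs are inverse to each other.\<close>

lemma Fe_F:
 assumes e: "\<bar>e\<bar> = 1" shows "Fe e (L2.F u v w) = L2.F (Fe e u) (Fe e v) (Fe e w)"
proof -
 have e': "\<bar>- e\<bar> = 1" using e by simp
 interpret A: bounded_linear "Fe e" by (rule bounded_linear_Fe[OF e])
 interpret B: bounded_linear "Fe (- e)" by (rule bounded_linear_Fe[OF e'])
 note cont = closed_Collect_eq ip.continuous_on L2.continuous_on A.continuous_on B.continuous_on continuous_on_const continuous_on_id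
 let ?P = "%u v w z. ip (L2.F (Fe e u) v (Fe e w)) z = ip (L2.F u (Fe (- e) v) w) (Fe (- e) z)"
 let ?D = "{u. \<exists>f. f : L2 & integ f & u = cls f}"
 have 0: "?P u v w z" if d: "u : ?D" "v : ?D" "w : ?D" "z : ?D" for u v w z
 proof -
 obtain f where f: "f : L2" "integ f" "u = cls f" using d(1) by blast
 obtain g where g: "g : L2" "integ g" "v = cls g" using d(2) by blast
 obtain h where h: "h : L2" "integ h" "w = cls h" using d(3) by blast
 obtain k where k: "k : L2" "integ k" "z = cls k" using d(4) by blast
 show ?thesis
 unfolding f(3) g(3) h(3) k(3) Fe_cls[OF e f(1,2)] Fe_cls[OF e h(1,2)] Fe_cls[OF e' g(1,2)] Fe_cls[OF e' k(1,2)]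
 ip_F[OF ft_L2[OF e f(1,2)] g(1) ft_L2[OF e h(1,2)] k(1)] ip_F[OF f(1) ft_L2[OF e' g(1,2)] h(1) ft_L2[OF e' k(1,2)]]
 quartic_ft[OF e f(1,2) g(1,2) h(1,2) k(1,2)] ..
 qed
 have 1: "?P u v w z" if d: "u : ?D" "v : ?D" "w : ?D" for u v w z
 proof (induction z rule: l2_closed_induct)
 show "closed {z. ?P u v w z}" by (intro cont)
 qed (rule 0[OF d], blast)
 have 2: "?P u v w z" if d: "u : ?D" "v : ?D" for u v w z
 proof (induction w rule: l2_closed_induct)
 show "closed {w. ?P u v w z}" by (intro cont)
 qed (rule 1[OF d], blast)
 have 3: "?P u v w z" if d: "u : ?D" for u v w z
 proof (induction v rule: l2_closed_induct)
 show "closed {v. ?P u v w z}" by (intro cont)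
 qed (rule 2[OF d], blast)
 have 4: "?P u v w z" for u v w z
 proof (induction u rule: l2_closed_induct)
 show "closed {u. ?P u v w z}" by (intro cont)
 qed (rule 3, blast)
 have "L2.F (Fe e u) (Fe e v) (Fe e w) = Fe e (L2.F u v w)"
 proof (rule ip_eqI)
 fix f
 show "ip (L2.F (Fe e u) (Fe e v) (Fe e w)) (cls f) = ip (Fe e (L2.F u v w)) (cls f)"
 unfolding 4 Fe_inverse[OF e] ip_Fe[OF e] ..
 qed
 then show ?thesis by simp
qed

lemma norm_constant:
 assumes u: "cubic_sol (%u v w. r *R L2.F u v w) {0..T} u" and t: "t : {0..T}"
 shows "norm (u t) = norm (u 0)"
proof -
 have "((%t. ip (u t) (u t)) has_real_derivative 0) (at t within {0..T})" if "t : {0..T}" for t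
 proof -
 let ?f = "r *R L2.F (u t) (u t) (u t)"
 have "((%t. ip (u t) (u t)) has_vector_derivative (ip (u t) ?f + ip ?f (u t))) (at t within {0..T})"
 by (rule ip.has_vector_derivative[OF cubic_solD[OF u that] cubic_solD[OF u that]])
 moreover have "ip (u t) ?f + ip ?f (u t) = 0" by (simp add: ip_commute[of "u t"] ip.scaleR_left ip_F_self)
 ultimately show ?thesis by (simp add: has_real_derivative_iff_has_vector_derivative)
 qed
 then have "\<exists>c. \<forall>t\<in>{0..T}. ip (u t) (u t) = c"
 by (intro has_field_derivative_zero_constant convex_real_interval(5))
 then have "ip (u t) (u t) = ip (u 0) (u 0)" using t by auto
 then show ?thesis by (simp add: ip_self)
qed

lemma a_priori_L2: "a_priori_bounded (%u v w. r *R L2.F u v w)"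
 unfolding a_priori_bounded_def
proof (intro allI)
 fix R T :: real
 show "\<exists>B. \<forall>u ta. 0 <= ta --> ta <= T --> cubic_sol (%u v w. r *R L2.F u v w) {0..ta} u --> norm (u 0) <= R --> (\<forall>t\<in>{0..ta}. norm (u t) <= B)"
 proof (rule exI[of _ R], intro allI impI ballI)
 fix u ta t assume "cubic_sol (%u v w. r *R L2.F u v w) {0..ta} u" "norm (u 0) <= R" "t : {0..ta}"
 then show "norm (u t) <= R" using norm_constant[of r ta u t] by simp
 qed
qed

section \<open>Comparison of the equation in two spaces\<close>

lemma (in bounded_trilinear) scaled: "bounded_trilinear (%u v w. r *R F u v w)"
proof
 have "norm (r *R F u v w) <= \<bar>r\<bar> * K * norm u * norm v * norm w" for u v w
 using mult_left_mono[OF norm_le[of u v w], of "\<bar>r\<bar>"] by (simp add: mult.assoc)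
 then show "\<exists>K. \<forall>u v w. norm (r *R F u v w) <= K * norm u * norm v * norm w" by blast
qed (simp_all add: add1 add2 add3 scale1 scale2 scale3 scaleR_add_right)

text \<open>A solution in the smaller space is one in the larger space, whose bounds it inherits.\<close>

locale CR_embedding = A: CR_space N J + B: CR_space M I
 for N :: plane_norm and J :: "plane_fun => 'b::banach" and M :: plane_norm and I :: "plane_fun => 'c::banach" +
 assumes emb: "\<exists>c\<ge>0. \<forall>f\<in>fun_space N. M f <= en c * N f"
begin

lemma emb_in: "f : fun_space N ==> f : fun_space M"
proof -
 assume f: "f : fun_space N"
 obtain c where "M f <= en c * N f" using emb f by blast
 also have "... < \<infinity>" using fun_spaceD(2)[OF f] by (simp add: ennreal_mult_less_top)
 finally show ?thesis using fun_spaceD(1)[OF f] by (simp add: fun_space_def)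
qed

definition io :: "'b => 'c" where "io u = I (A.lift u)"

lemma io_J: "f : fun_space N ==> io (J f) = I f"
 unfolding io_def using A.J_eq[of "A.lift (J f)" f] B.J_eq[of "A.lift (J f)" f] emb_in by simp

lemma bounded_linear_io: "bounded_linear io"
proof -
 obtain c where c: "0 <= c" "!!f. f : fun_space N ==> M f <= en c * N f" using emb by blast
 show ?thesis
 proof (rule bounded_linear_intro)
 show "io (u + v) = io u + io v" for u v
 using io_J[OF A.add_in[OF A.lift_in[of u] A.lift_in[of v]]]
 by (simp add: A.J_add B.J_add emb_in io_def)
 show "io (r *R u) = r *R io u" for r u
 using io_J[OF A.scale_in[OF A.lift_in[of u]], of "cor r"]
 by (simp add: A.J_scale B.J_scale emb_in io_def)
 fix u
 have "en (norm (io u)) <= en c * en (norm u)"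
 using c(2)[OF A.lift_in[of u]] B.J_norm[OF emb_in[OF A.lift_in[of u]]] A.J_norm[OF A.lift_in[of u]]
 by (simp add: io_def)
 then show "norm (io u) <= norm u * c" using c(1) by (simp add: ennreal_mult[symmetric] mult.commute)
 qed
qed

lemma io_F: "io (A.F u v w) = B.F (io u) (io v) (io w)"
proof -
 let ?f = "A.lift u" and ?g = "A.lift v" and ?h = "A.lift w"
 have in': "CR_op ?f ?g ?h : fun_space N" by (simp add: A.CR_in)
 have "A.F u v w = J (%x. \<i> * CR_op ?f ?g ?h x)"
 using A.CR_op_J[of ?f ?g ?h] A.times_i_J[OF in'] by simp
 then have "io (A.F u v w) = I (%x. \<i> * CR_op ?f ?g ?h x)" using io_J[OF A.scale_in[OF in']] by simp
 also have "... = B.F (I ?f) (I ?g) (I ?h)"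
 using B.CR_op_J[of ?f ?g ?h] B.times_i_J[OF emb_in[OF in']] emb_in by simp
 finally show ?thesis by (simp add: io_def)
qed

lemma cubic_sol_io:
 assumes u: "cubic_sol (%u v w. r *R A.F u v w) S u"
 shows "cubic_sol (%u v w. r *R B.F u v w) S (%t. io (u t))"
 unfolding cubic_sol_def
proof
 interpret l: bounded_linear io by (rule bounded_linear_io)
 fix t assume "t : S"
 from l.has_vector_derivative[OF cubic_solD[OF u this]]
 show "((%t. io (u t)) has_vector_derivative r *R B.F (io (u t)) (io (u t)) (io (u t))) (at t within S)"
 by (simp add: l.scaleR io_F)
qed

text \<open>A bound in the larger space gives one in the smaller space when the operator is at most logarithmically superlinear.\<close>

lemma a_priori_transfer:
 assumes K: "0 <= K" "!!u. norm (A.F u u u) <= K * (1 + norm (io u))^2 * (1 + norm u) * (1 + ln (1 + norm u))"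
 and r: "\<bar>r\<bar> = 1" and ap: "a_priori_bounded (%u v w. r *R B.F u v w)"
 shows "a_priori_bounded (%u v w. r *R A.F u v w)"
 unfolding a_priori_bounded_def
proof (intro allI)
 fix R T :: real
 interpret l: bounded_linear io by (rule bounded_linear_io)
 interpret r: bounded_trilinear "%u v w. r *R A.F u v w" by (rule A.scaled)
 obtain c where c: "0 < c" "!!u. norm (io u) <= norm u * c" using l.pos_bounded by blast
 obtain B where B: "!!v ta t. 0 <= ta ==> ta <= T ==> cubic_sol (%u v w. r *R B.F u v w) {0..ta} v ==> norm (v 0) <= R * c ==> t : {0..ta} ==> norm (v t) <= B"
 using ap unfolding a_priori_bounded_def by meson
 define C where "C = K * (1 + max B 0)^2"
 have C: "0 <= C" using K by (simp add: C_def)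
 show "\<exists>B. \<forall>u ta. 0 <= ta --> ta <= T --> cubic_sol (%u v w. r *R A.F u v w) {0..ta} u --> norm (u 0) <= R --> (\<forall>t\<in>{0..ta}. norm (u t) <= B)"
 proof (rule exI[of _ "exp (exp (C * T) * (1 + ln (1 + R)))"], intro allI impI ballI)
 fix u ta t assume h: "0 <= ta" "ta <= T" "cubic_sol (%u v w. r *R A.F u v w) {0..ta} u" "norm (u 0) <= R" "t : {0..ta}"
 have R0: "norm (io (u 0)) <= R * c" using c(2)[of "u 0"] mult_right_mono[OF h(4), of c] c(1) by linarith
 have "norm (u t) <= exp (exp (C * ta) * (1 + ln (1 + norm (u 0))))"
 proof (rule r.cubic_sol_log_growth[OF h(3) C _ h(5)])
 fix s assume s: "s : {0..ta}"
 have b: "norm (io (u s)) <= max B 0" using B[OF h(1,2) cubic_sol_io[OF h(3)] R0 s] by simp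
 have "norm (r *R A.F (u s) (u s) (u s)) <= K * (1 + norm (io (u s)))^2 * (1 + norm (u s)) * (1 + ln (1 + norm (u s)))"
 using K(2)[of "u s"] r by simp
 also have "... <= C * (1 + norm (u s)) * (1 + ln (1 + norm (u s)))"
 unfolding C_def using K(1) b by (intro mult_right_mono mult_left_mono power_mono) auto
 finally show "norm (r *R A.F (u s) (u s) (u s)) <= C * (1 + norm (u s)) * (1 + ln (1 + norm (u s)))" .
 qed
 also have "... <= exp (exp (C * T) * (1 + ln (1 + R)))"
 proof -
 have "ln (1 + norm (u 0)) <= ln (1 + R)" using h(4) norm_ge_zero[of "u 0"] by (subst ln_le_cancel_iff) linarith+
 then show ?thesis using h(2) C by (simp, intro mult_mono) (auto intro: mult_left_mono)
 qed
 finally show "norm (u t) <= exp (exp (C * T) * (1 + ln (1 + R)))" .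
 qed
qed

end

lemma (in CR_space) norm_F_self:
 assumes "f : fun_space N" shows "en (norm (F (J f) (J f) (J f))) = N (CR_op f f f)"
 unfolding CR_op_J[OF assms assms assms] norm_times_i J_norm[OF CR_in[OF assms assms assms]] ..

lemma (in CR_space) globally_well_posed':
 assumes "!!r. \<bar>r\<bar> = 1 ==> a_priori_bounded (%u v w. r *R F u v w)"
 shows "CR_globally_well_posed N"
 using assms[of 1] assms[of "- 1"] by (intro globally_well_posed) simp_all

section \<open>The spaces of the theorem\<close>

text \<open>Multiplication by a weight that vanishes only on a null set transports the realisation.\<close>

lemma realized_space_weighted:
 fixes w :: "real^2 => real"
 assumes [measurable]: "w : bmf" and nz: "AE x in lborel. w x ~= 0"
 shows "realized_space (%f. lnorm TYPE('a::lebesgue_norm) (%x. w x *R f x)) (%f. cls (%x. w x *R f x) :: 'a fsp)"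
proof -
 interpret R: realized_space "lnorm TYPE('a)" "cls :: plane_fun => 'a fsp" by (rule realized_space_fsp)
 let ?N = "%f. lnorm TYPE('a) (%x. w x *R f x)"
 have fs: "f : fun_space ?N \<longleftrightarrow> f : bmf & (%x. w x *R f x) : fun_space (lnorm TYPE('a))" for f
 by (auto simp: fun_space_def)
 show ?thesis
 proof
 fix f g :: plane_fun and c :: complex and r :: real
 assume f: "f : fun_space ?N"
 then have f': "f : bmf" "(%x. w x *R f x) : fun_space (lnorm TYPE('a))" by (auto simp: fs)
 note [measurable] = f'(1)
 have c: "(%x. w x *R (c * f x)) = (%x. c * (w x *R f x))" for c by (simp add: fun_eq_iff)
 show "(%x. c * f x) : fun_space ?N" unfolding fs c using R.scale_in[OF f'(2)] by simp
 show "?N (%x. c * f x) = en (cmod c) * ?N f" unfolding c by (rule R.norm_scale[OF f'(2)])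
 show "(cls (%x. w x *R (cor r * f x)) :: 'a fsp) = r *R cls (%x. w x *R f x)"
 unfolding c by (rule R.J_scale[OF f'(2)])
 show "?N f = en (norm (cls (%x. w x *R f x) :: 'a fsp))" by (rule R.J_norm[OF f'(2)])
 show "g : fun_space ?N" if g: "g : bmf" "AE x in lborel. f x = g x"
 proof -
 note [measurable] = g(1)
 have "AE x in lborel. w x *R f x = w x *R g x" using g(2) by eventually_elim simp
 then show ?thesis unfolding fs by (intro conjI g(1) R.cong_in[OF f'(2)]) measurable
 qed
 assume g: "g : fun_space ?N"
 then have g': "g : bmf" "(%x. w x *R g x) : fun_space (lnorm TYPE('a))" by (auto simp: fs)
 note [measurable] = g'(1)
 show "(%x. f x + g x) : fun_space ?N" unfolding fs scaleR_add_right using R.add_in[OF f'(2) g'(2)] by simp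
 show "(cls (%x. w x *R (f x + g x)) :: 'a fsp) = cls (%x. w x *R f x) + cls (%x. w x *R g x)"
 unfolding scaleR_add_right by (rule R.J_add[OF f'(2) g'(2)])
 show "((cls (%x. w x *R f x) :: 'a fsp) = cls (%x. w x *R g x)) \<longleftrightarrow> (AE x in lborel. f x = g x)"
 unfolding R.J_eq[OF f'(2) g'(2)] using nz by (auto elim!: eventually_elim2 elim: eventually_mono)
 next
 fix u :: "'a fsp"
 note [measurable] = fun_spaceD(1)[OF repr[of u]]
 let ?f = "%x. repr u x /\<^sub>R w x"
 have e: "AE x in lborel. repr u x = w x *R ?f x" using nz by eventually_elim simp
 have in': "(%x. w x *R ?f x) : fun_space (lnorm TYPE('a))" by (rule R.cong_in[OF repr _ e]) measurable
 have "(cls (%x. w x *R ?f x) :: 'a fsp) = cls (repr u)" using e by (subst R.J_eq[OF in' repr]) (auto elim: eventually_mono)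
 then show "\<exists>f\<in>fun_space ?N. cls (%x. w x *R f x) = u" using in' by (intro bexI[of _ ?f]) (auto simp: fs)
 qed
qed

definition wcls :: "real => plane_fun => l2" where "wcls s f = cls (%x. (jbr x powr s) *R f x)"
definition xcls :: "real => plane_fun => essentially_bounded fsp" where "xcls s f = cls (%x. (jbr x powr s) *R f x)"

lemma realized_space_L2w: "realized_space (L2w_norm s) (wcls s)"
proof -
 have eq: "L2w_norm s = (%f. lnorm TYPE(square_integrable) (%x. (jbr x powr s) *R f x))" "wcls s = (%f. cls (%x. (jbr x powr s) *R f x))"
 by (simp_all add: fun_eq_iff L2w_norm_def lnorm_square_integrable_def wcls_def)
 show ?thesis unfolding eq by (rule realized_space_weighted) simp_all
qed

lemma realized_space_X: "realized_space (X_norm s) (xcls s)"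
proof -
 have eq: "X_norm s = (%f. lnorm TYPE(essentially_bounded) (%x. (jbr x powr s) *R f x))" "xcls s = (%f. cls (%x. (jbr x powr s) *R f x))"
 by (simp_all add: fun_eq_iff X_norm_def lnorm_essentially_bounded_def xcls_def)
 show ?thesis unfolding eq by (rule realized_space_weighted) simp_all
qed

lemma realized_space_Xdot1: "realized_space Xdot1_norm (%f. cls (%x. norm x *R f x) :: essentially_bounded fsp)"
proof -
 have eq: "Xdot1_norm = (%f. lnorm TYPE(essentially_bounded) (%x. norm x *R f x))"
 by (simp add: fun_eq_iff Xdot1_norm_def lnorm_essentially_bounded_def)
 have "AE x::real^2 in lborel. x ~= 0" by (rule AE_lborel_singleton)
 then show ?thesis unfolding eq by (intro realized_space_weighted) auto
qed

lemma L2w_in_L2: "0 <= s ==> f : fun_space (L2w_norm s) ==> f : L2"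
 using L2_norm_le_L2w[of s f] by (auto simp: fun_space_def intro: le_less_trans)

lemma CR_space_L2w:
 assumes s: "0 <= s" shows "CR_space (L2w_norm s) (wcls s)"
proof -
 interpret realized_space "L2w_norm s" "wcls s" by (rule realized_space_L2w)
 have e: "en (3 * 2 powr s * 2) = en (3 * 2 powr s) * 2" by (subst ennreal_mult) auto
 have bound: "L2w_norm s (CR_op f g h) <= en (3 * 2 powr s * 2) * L2w_norm s f * L2w_norm s g * L2w_norm s h"
 if f: "f : bmf" "g : bmf" "h : bmf" for f g h
 proof -
 have "L2w_norm s (CR_op f g h) <= en (3 * 2 powr s) * (L2w_norm s f * L2_norm g * L2_norm h + L2_norm f * L2_norm g * L2w_norm s h)"
 by (rule L2w_norm_CR_op[OF f s])
 also have "... <= en (3 * 2 powr s) * (L2w_norm s f * L2w_norm s g * L2w_norm s h + L2w_norm s f * L2w_norm s g * L2w_norm s h)"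
 by (intro mult_left_mono add_mono mult_mono L2_norm_le_L2w s) auto
 also have "... = en (3 * 2 powr s) * (2 * (L2w_norm s f * L2w_norm s g * L2w_norm s h))" by (simp only: mult_2)
 finally show ?thesis unfolding e by (simp only: mult.assoc)
 qed
 show ?thesis
 proof
 fix f g h assume f: "f : fun_space (L2w_norm s)" and g: "g : fun_space (L2w_norm s)" and h: "h : fun_space (L2w_norm s)"
 note [measurable] = fun_spaceD(1)[OF f] fun_spaceD(1)[OF g] fun_spaceD(1)[OF h]
 have "L2w_norm s (CR_op f g h) <= en (3 * 2 powr s * 2) * L2w_norm s f * L2w_norm s g * L2w_norm s h"
 by (rule bound) measurable
 also have "... < \<infinity>" using fun_spaceD(2)[OF f] fun_spaceD(2)[OF g] fun_spaceD(2)[OF h] by (simp add: ennreal_mult_less_top)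
 finally show "CR_op f g h : fun_space (L2w_norm s)" by (simp add: fun_space_def)
 show "AE xi in lborel. CR_converges f g h xi" by (intro CR_converges_L2 L2w_in_L2[OF s] f g h)
 next
 show "\<exists>C\<ge>0. \<forall>f\<in>fun_space (L2w_norm s). \<forall>g\<in>fun_space (L2w_norm s). \<forall>h\<in>fun_space (L2w_norm s).
 L2w_norm s (CR_op f g h) <= en C * L2w_norm s f * L2w_norm s g * L2w_norm s h"
 by (rule exI[of _ "3 * 2 powr s * 2"]) (use bound fun_spaceD(1) in auto)
 qed
qed

text \<open>The growth condition that \<open>a_priori_transfer\<close> needs follows from a linear bound.\<close>

lemma (in CR_embedding) a_priori_transfer_linear:
 assumes K: "0 <= K" "!!f. f : fun_space N ==> N (CR_op f f f) <= en K * (N f * (M f)^2)"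
 and r: "\<bar>r\<bar> = 1" and ap: "a_priori_bounded (%u v w. r *R B.F u v w)"
 shows "a_priori_bounded (%u v w. r *R A.F u v w)"
proof (rule a_priori_transfer[OF K(1) _ r ap])
 fix u
 let ?f = "A.lift u"
 have f: "?f : fun_space N" by simp
 have "en (norm (A.F u u u)) <= en K * (en (norm u) * (en (norm (io u)))^2)"
 using A.norm_F_self[OF f] K(2)[OF f] A.J_norm[OF f] B.J_norm[OF emb_in[OF f]] by (simp add: io_def)
 also have "... = en (K * (norm u * (norm (io u))^2))" using K(1) by (simp add: ennreal_mult ennreal_power)
 finally have "norm (A.F u u u) <= K * (norm u * (norm (io u))^2)" using K(1) by simp
 also have "... <= K * (((1 + norm u) * (1 + ln (1 + norm u))) * (1 + norm (io u))^2)"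
 proof (intro mult_left_mono mult_mono power_mono K(1))
 have "0 <= ln (1 + norm u)" by simp
 then have "0 <= (1 + norm u) * ln (1 + norm u)" by (intro mult_nonneg_nonneg) auto
 then show "norm u <= (1 + norm u) * (1 + ln (1 + norm u))" by (simp add: distrib_left)
 then show "0 <= (1 + norm u) * (1 + ln (1 + norm u))" using norm_ge_zero order_trans by blast
 qed auto
 finally show "norm (A.F u u u) <= K * (1 + norm (io u))^2 * (1 + norm u) * (1 + ln (1 + norm u))" by (simp only: mult_ac)
qed

lemma L2w_self_bound:
 assumes s: "0 <= s" and f: "f : bmf"
 shows "L2w_norm s (CR_op f f f) <= en (3 * 2 powr s * 2) * (L2w_norm s f * (L2_norm f)^2)"
proof -
 have "L2w_norm s (CR_op f f f) <= en (3 * 2 powr s) * (L2w_norm s f * L2_norm f * L2_norm f + L2_norm f * L2_norm f * L2w_norm s f)"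
 by (rule L2w_norm_CR_op[OF f f f s])
 also have "... = en (3 * 2 powr s) * (2 * (L2w_norm s f * (L2_norm f)^2))"
 by (subst mult_2) (simp only: power2_eq_square mult_ac)
 also have "... = en (3 * 2 powr s * 2) * (L2w_norm s f * (L2_norm f)^2)"
 by (subst ennreal_mult) (auto simp: mult.assoc)
 finally show ?thesis .
qed

lemma CR_embedding_L2w: assumes s: "0 <= s" shows "CR_embedding (L2w_norm s) (wcls s) L2_norm (cls :: plane_fun => l2)"
proof -
 interpret CR_space "L2w_norm s" "wcls s" by (rule CR_space_L2w[OF s])
 show ?thesis by unfold_locales (intro exI[of _ 1], simp add: L2_norm_le_L2w[OF s])
qed

lemma a_priori_L2w:
 assumes s: "0 <= s" and r: "\<bar>r\<bar> = 1"
 shows "a_priori_bounded (%u v w. r *R CR_space.F (L2w_norm s) (wcls s) u v w)"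
proof -
 interpret CR_embedding "L2w_norm s" "wcls s" L2_norm "cls :: plane_fun => l2" by (rule CR_embedding_L2w[OF s])
 show ?thesis
 by (rule a_priori_transfer_linear[of "3 * 2 powr s * 2"]) (use L2w_self_bound[OF s] fun_spaceD(1) r a_priori_L2 in auto)
qed

lemma globally_well_posed_L2w: assumes s: "0 <= s" shows "CR_globally_well_posed (L2w_norm s)"
proof -
 interpret CR_space "L2w_norm s" "wcls s" by (rule CR_space_L2w[OF s])
 show ?thesis by (rule globally_well_posed'[OF a_priori_L2w[OF s]])
qed

lemma locally_well_posed_Xdot1: "CR_locally_well_posed Xdot1_norm"
proof -
 interpret realized_space Xdot1_norm "%f. cls (%x. norm x *R f x) :: essentially_bounded fsp" by (rule realized_space_Xdot1)
 obtain C where C: "0 <= C" "!!f g h. f : bmf ==> g : bmf ==> h : bmf ==>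
 Xdot1_norm (CR_op f g h) <= en C * Xdot1_norm f * Xdot1_norm g * Xdot1_norm h \<and>
 (\<forall>xi. en (norm xi) * abs_op (eabs f) (eabs g) (eabs h) xi <= en C * Xdot1_norm f * Xdot1_norm g * Xdot1_norm h)"
 using Xdot1_norm_CR_op by blast
 interpret CR_space Xdot1_norm "%f. cls (%x. norm x *R f x) :: essentially_bounded fsp"
 proof
 fix f g h assume f: "f : fun_space Xdot1_norm" and g: "g : fun_space Xdot1_norm" and h: "h : fun_space Xdot1_norm"
 note m = fun_spaceD(1)[OF f] fun_spaceD(1)[OF g] fun_spaceD(1)[OF h]
 note [measurable] = m
 have fin: "en C * Xdot1_norm f * Xdot1_norm g * Xdot1_norm h < \<infinity>"
 using fun_spaceD(2)[OF f] fun_spaceD(2)[OF g] fun_spaceD(2)[OF h] by (simp add: ennreal_mult_less_top)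
 show "CR_op f g h : fun_space Xdot1_norm"
 using le_less_trans[OF C(2)[OF m, THEN conjunct1] fin] by (simp add: fun_space_def)
 have "AE x::real^2 in lborel. x ~= 0" by (rule AE_lborel_singleton)
 then show "AE xi in lborel. CR_converges f g h xi"
 proof eventually_elim
 fix xi :: "real^2" assume nz: "xi ~= 0"
 have "en (norm xi) * abs_op (eabs f) (eabs g) (eabs h) xi < \<infinity>"
 using le_less_trans[OF C(2)[OF m, THEN conjunct2, THEN spec] fin] .
 then have "abs_op (eabs f) (eabs g) (eabs h) xi < \<infinity>" using nz by (auto simp: ennreal_mult_less_top)
 then show "CR_converges f g h xi" by (intro CR_convergesI) measurable
 qed
 next
 show "\<exists>C\<ge>0. \<forall>f\<in>fun_space Xdot1_norm. \<forall>g\<in>fun_space Xdot1_norm. \<forall>h\<in>fun_space Xdot1_norm.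
 Xdot1_norm (CR_op f g h) <= en C * Xdot1_norm f * Xdot1_norm g * Xdot1_norm h"
 by (rule exI[of _ C]) (use C fun_spaceD(1) in blast)
 qed
 show ?thesis by (rule locally_well_posed)
qed

section \<open>Sobolev spaces\<close>

definition FT :: "plane_fun => plane_fun" where "FT f = repr (Fe (- 1) (cls f))"

lemma FT_L2: "FT f : L2" and cls_FT: "cls (FT f) = Fe (- 1) (cls f)"
 unfolding FT_def using L2_repr by auto

lemma FT_AE: "g : L2 ==> Fe (- 1) (cls f) = cls g ==> AE x in lborel. FT f x = g x"
 using L2_cls_eq_iff[OF FT_L2] cls_FT by simp

lemma L2w_norm_cong: "f : bmf ==> g : bmf ==> AE x in lborel. f x = g x ==> L2w_norm s f = L2w_norm s g"
 unfolding L2w_norm_def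
 by (rule lnorm_cong[where 'a=square_integrable, unfolded lnorm_L2]) (auto elim: eventually_mono)

text \<open>All transforms of a function agree almost everywhere, so the infimum is over a single value.\<close>

lemma H_norm_eq: assumes f: "f : L2" shows "H_norm s f = L2w_norm s (FT f)"
proof -
 have F: "is_L2_fourier f (FT f)" using f FT_L2 cls_FT by (simp add: is_L2_fourier_iff)
 have eq: "L2w_norm s G = L2w_norm s (FT f)" if "is_L2_fourier f G" for G
 proof -
 have G: "G : L2" "Fe (- 1) (cls f) = cls G" using that by (auto simp: is_L2_fourier_iff)
 show ?thesis by (rule L2w_norm_cong[symmetric]) (use FT_AE[OF G] L2_borel[OF FT_L2] L2_borel[OF G(1)] in auto)
 qed
 have "H_norm s f = (INF G\<in>{G. is_L2_fourier f G}. L2w_norm s (FT f))"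
 unfolding H_norm_def by (rule INF_cong) (use eq in auto)
 also have "... = L2w_norm s (FT f)" using F by (subst cINF_const) auto
 finally show ?thesis .
qed

lemma H_norm_infinite: "f \<notin> L2 ==> H_norm s f = \<infinity>"
 unfolding H_norm_def is_L2_fourier_iff by simp

lemma fun_space_H: "f : fun_space (H_norm s) \<longleftrightarrow> f : L2 & FT f : fun_space (L2w_norm s)"
proof (cases "f : L2")
 case True
 then show ?thesis using L2_borel[OF True] L2_borel[OF FT_L2[of f]] by (simp add: fun_space_def H_norm_eq)
qed (auto simp: fun_space_def H_norm_infinite)

lemma FT_add: "f : L2 ==> g : L2 ==> AE x in lborel. FT (%x. f x + g x) x = FT f x + FT g x"
 by (intro FT_AE L2_add FT_L2) (simp add: L2_cls_add Fe_add L2_cls_add[OF FT_L2 FT_L2] cls_FT)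

lemma FT_scale: "f : L2 ==> AE x in lborel. FT (%x. c * f x) x = c * FT f x"
 by (intro FT_AE L2_scale FT_L2 Fe_cscale) (simp_all add: cls_FT FT_L2)

lemma FT_CR_op:
 assumes f: "f : L2" and g: "g : L2" and h: "h : L2"
 shows "AE x in lborel. FT (CR_op f g h) x = CR_op (FT f) (FT g) (FT h) x"
proof (rule FT_AE)
 let ?T = "CR_op f g h" and ?T' = "CR_op (FT f) (FT g) (FT h)"
 have T: "?T : L2" by (rule L2.CR_in[OF f g h])
 show T': "?T' : L2" by (intro L2.CR_in FT_L2)
 have e: "\<bar>- 1 :: real\<bar> = 1" by simp
 have "Fe (- 1) (cls (%x. \<i> * ?T x)) = cls (%x. \<i> * ?T' x)"
 using Fe_F[OF e, of "cls f" "cls g" "cls h"]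
 unfolding cls_FT[symmetric] L2_F_cls[OF f g h] L2_F_cls[OF FT_L2 FT_L2 FT_L2] .
 then have "Fe (- 1) (cls (%x. - \<i> * (\<i> * ?T x))) = cls (%x. - \<i> * (\<i> * ?T' x))"
 by (rule Fe_cscale[OF e L2_scale[OF T] L2_scale[OF T']])
 moreover have "(%x. - \<i> * (\<i> * k x)) = k" for k :: plane_fun by (simp add: fun_eq_iff mult.assoc[symmetric])
 ultimately show "Fe (- 1) (cls ?T) = cls ?T'" by (simp only:)
qed

lemma Fe_eq_iff: "\<bar>e\<bar> = 1 ==> Fe e u = Fe e v \<longleftrightarrow> u = v"
 using Fe_inverse[of e u] Fe_inverse[of e v] by metis

lemma realized_space_H:
 assumes s: "0 <= s" shows "realized_space (H_norm s) (%f. wcls s (FT f))"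
proof -
 interpret R: realized_space "L2w_norm s" "wcls s" by (rule realized_space_L2w)
 have in': "FT f : fun_space (L2w_norm s)" "f : L2" if "f : fun_space (H_norm s)" for f
 using that by (simp_all add: fun_space_H)
 have inj: "(AE x in lborel. FT f x = FT g x) \<longleftrightarrow> (AE x in lborel. f x = g x)" if f: "f : L2" and g: "g : L2" for f g
 proof -
 have "cls (FT f) = (cls (FT g) :: l2) \<longleftrightarrow> cls f = (cls g :: l2)"
 unfolding cls_FT by (rule Fe_eq_iff) simp
 then show ?thesis unfolding L2_cls_eq_iff[OF FT_L2 FT_L2] L2_cls_eq_iff[OF f g] .
 qed
 have move: "k : fun_space (L2w_norm s) ==> AE x in lborel. FT f x = k x ==> FT f : fun_space (L2w_norm s) & wcls s (FT f) = wcls s k & L2w_norm s (FT f) = L2w_norm s k" for f k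
 proof -
 assume k: "k : fun_space (L2w_norm s)" and e: "AE x in lborel. FT f x = k x"
 have e': "AE x in lborel. k x = FT f x" using e by eventually_elim simp
 have 1: "FT f : fun_space (L2w_norm s)" by (rule R.cong_in[OF k L2_borel[OF FT_L2] e'])
 then show ?thesis using R.J_eq[OF 1 k] e L2w_norm_cong[OF L2_borel[OF FT_L2] fun_spaceD(1)[OF k] e] by simp
 qed
 show ?thesis
 proof
 fix f g :: plane_fun and c :: complex and r :: real
 assume f: "f : fun_space (H_norm s)"
 note fc = move[OF R.scale_in[OF in'(1)[OF f]] FT_scale[OF in'(2)[OF f]]]
 show "(%x. c * f x) : fun_space (H_norm s)" using fc[of c] L2_scale[OF in'(2)[OF f]] by (simp add: fun_space_H)
 show "H_norm s (%x. c * f x) = en (cmod c) * H_norm s f"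
 using fc[of c] L2_scale[OF in'(2)[OF f]] in'[OF f] by (simp add: H_norm_eq R.norm_scale)
 show "wcls s (FT (%x. cor r * f x)) = r *R wcls s (FT f)"
 using fc[of "cor r"] in'[OF f] by (simp add: R.J_scale)
 show "H_norm s f = en (norm (wcls s (FT f)))" using in'[OF f] by (simp add: H_norm_eq R.J_norm)
 show "g : fun_space (H_norm s)" if g: "g : bmf" "AE x in lborel. f x = g x"
 proof -
 have g2: "g : L2" by (rule L2_cong[OF in'(2)[OF f] g])
 then have "AE x in lborel. FT f x = FT g x" using g(2) inj[OF in'(2)[OF f] g2] by simp
 then have "FT g : fun_space (L2w_norm s)" by (rule R.cong_in[OF in'(1)[OF f] L2_borel[OF FT_L2]])
 then show ?thesis using g2 by (simp add: fun_space_H)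
 qed
 assume g: "g : fun_space (H_norm s)"
 note fg = move[OF R.add_in[OF in'(1)[OF f] in'(1)[OF g]] FT_add[OF in'(2)[OF f] in'(2)[OF g]]]
 show "(%x. f x + g x) : fun_space (H_norm s)" using fg L2_add[OF in'(2)[OF f] in'(2)[OF g]] by (simp add: fun_space_H)
 show "wcls s (FT (%x. f x + g x)) = wcls s (FT f) + wcls s (FT g)" using fg in'[OF f] in'[OF g] by (simp add: R.J_add)
 show "(wcls s (FT f) = wcls s (FT g)) \<longleftrightarrow> (AE x in lborel. f x = g x)"
 unfolding R.J_eq[OF in'(1)[OF f] in'(1)[OF g]] by (rule inj[OF in'(2)[OF f] in'(2)[OF g]])
 next
 fix u :: l2
 obtain k where k: "k : fun_space (L2w_norm s)" "wcls s k = u" using R.J_surj by blast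
 have k2: "k : L2" by (rule L2w_in_L2[OF s k(1)])
 let ?f = "repr (Fe 1 (cls k))"
 have "AE x in lborel. FT ?f x = k x" using Fe_inverse[of 1 "cls k"] by (intro FT_AE k2) simp
 from move[OF k(1) this] show "\<exists>f\<in>fun_space (H_norm s). wcls s (FT f) = u"
 using k(2) L2_repr by (intro bexI[of _ ?f]) (auto simp: fun_space_H)
 qed
qed

lemma H_norm_CR_op:
 assumes s: "0 <= s" and f: "f : fun_space (H_norm s)" and g: "g : fun_space (H_norm s)" and h: "h : fun_space (H_norm s)"
 shows "CR_op f g h : fun_space (H_norm s)" "H_norm s (CR_op f g h) = L2w_norm s (CR_op (FT f) (FT g) (FT h))"
proof -
 interpret W: CR_space "L2w_norm s" "wcls s" by (rule CR_space_L2w[OF s])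
 have in': "FT f : fun_space (L2w_norm s)" "FT g : fun_space (L2w_norm s)" "FT h : fun_space (L2w_norm s)" "f : L2" "g : L2" "h : L2"
 using f g h by (auto simp: fun_space_H)
 have T: "CR_op (FT f) (FT g) (FT h) : fun_space (L2w_norm s)" by (intro W.CR_in in')
 have e: "AE x in lborel. FT (CR_op f g h) x = CR_op (FT f) (FT g) (FT h) x" by (intro FT_CR_op in')
 then have e': "AE x in lborel. CR_op (FT f) (FT g) (FT h) x = FT (CR_op f g h) x" by eventually_elim simp
 have T2: "CR_op f g h : L2" by (intro L2.CR_in in')
 have "FT (CR_op f g h) : fun_space (L2w_norm s)" by (rule W.cong_in[OF T L2_borel[OF FT_L2] e'])
 then show "CR_op f g h : fun_space (H_norm s)" using T2 by (simp add: fun_space_H)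
 show "H_norm s (CR_op f g h) = L2w_norm s (CR_op (FT f) (FT g) (FT h))"
 unfolding H_norm_eq[OF T2] by (rule L2w_norm_cong[OF L2_borel[OF FT_L2] fun_spaceD(1)[OF T] e])
qed

lemma L2_norm_FT: assumes f: "f : L2" shows "L2_norm (FT f) = L2_norm f"
 unfolding L2_norm_cls[OF FT_L2, symmetric] L2_norm_cls[OF f, symmetric] cls_FT by (simp add: norm_Fe)

lemma globally_well_posed_H: assumes s: "0 <= s" shows "CR_globally_well_posed (H_norm s)"
proof -
 interpret W: CR_space "L2w_norm s" "wcls s" by (rule CR_space_L2w[OF s])
 interpret realized_space "H_norm s" "%f. wcls s (FT f)" by (rule realized_space_H[OF s])
 interpret CR_space "H_norm s" "%f. wcls s (FT f)"
 proof
 show "CR_op f g h : fun_space (H_norm s)" if "f : fun_space (H_norm s)" "g : fun_space (H_norm s)" "h : fun_space (H_norm s)" for f g h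
 by (rule H_norm_CR_op[OF s that])
 show "AE xi in lborel. CR_converges f g h xi" if "f : fun_space (H_norm s)" "g : fun_space (H_norm s)" "h : fun_space (H_norm s)" for f g h
 using that by (intro CR_converges_L2) (auto simp: fun_space_H)
 obtain C where C: "0 <= C" "!!f g h. f : fun_space (L2w_norm s) ==> g : fun_space (L2w_norm s) ==> h : fun_space (L2w_norm s) ==>
 L2w_norm s (CR_op f g h) <= en C * L2w_norm s f * L2w_norm s g * L2w_norm s h" using W.CR_bound by blast
 have "H_norm s (CR_op f g h) <= en C * H_norm s f * H_norm s g * H_norm s h"
 if h: "f : fun_space (H_norm s)" "g : fun_space (H_norm s)" "h : fun_space (H_norm s)" for f g h
 using C(2)[of "FT f" "FT g" "FT h"] h H_norm_CR_op(2)[OF s h] by (simp add: fun_space_H H_norm_eq)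
 then show "\<exists>C\<ge>0. \<forall>f\<in>fun_space (H_norm s). \<forall>g\<in>fun_space (H_norm s). \<forall>h\<in>fun_space (H_norm s).
 H_norm s (CR_op f g h) <= en C * H_norm s f * H_norm s g * H_norm s h" using C(1) by blast
 qed
 have le: "L2_norm f <= H_norm s f" if "f : fun_space (H_norm s)" for f
 proof -
 have f: "f : L2" using that by (simp add: fun_space_H)
 show ?thesis using L2_norm_le_L2w[OF s, of "FT f"] by (simp add: L2_norm_FT[OF f] H_norm_eq[OF f])
 qed
 interpret E: CR_embedding "H_norm s" "%f. wcls s (FT f)" L2_norm "cls :: plane_fun => l2"
 by unfold_locales (intro exI[of _ 1], simp add: le)
 have K: "H_norm s (CR_op f f f) <= en (3 * 2 powr s * 2) * (H_norm s f * (L2_norm f)^2)" if h: "f : fun_space (H_norm s)" for f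
 proof -
 have f: "f : L2" using h by (simp add: fun_space_H)
 show ?thesis using L2w_self_bound[OF s L2_borel[OF FT_L2[of f]]] H_norm_CR_op(2)[OF s h h h]
 by (simp add: L2_norm_FT[OF f] H_norm_eq[OF f])
 qed
 show ?thesis
 by (rule globally_well_posed', rule E.a_priori_transfer_linear[OF _ K]) (use a_priori_L2 in auto)
qed

section \<open>The weighted spaces of bounded functions\<close>

text \<open>Since \<open>sg > 2\<close>, the powers of the bracket that are needed are integrable.\<close>

lemma X_norm_bounds:
 assumes sg: "2 < sg"
 shows "\<exists>c\<ge>0. \<forall>f\<in>bmf. L2w_norm (sg / 2) f <= en c * X_norm sg f & L2_norm f <= L2w_norm (sg / 2) f
 & (NN x. eabs f x) <= en c * L2w_norm (sg / 2) f"
 using X_embeddings[OF sg] L2_norm_le_L2w[of "sg / 2"] sg by auto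

lemma X_in_L2w:
 assumes sg: "2 < sg" and f: "f : fun_space (X_norm sg)" shows "f : fun_space (L2w_norm (sg / 2))"
proof -
 obtain c where "L2w_norm (sg / 2) f <= en c * X_norm sg f" using X_norm_bounds[OF sg] fun_spaceD(1)[OF f] by blast
 also have "... < \<infinity>" using fun_spaceD(2)[OF f] by (simp add: ennreal_mult_less_top)
 finally show ?thesis using fun_spaceD(1)[OF f] by (simp add: fun_space_def)
qed

lemma X_in_L2: "2 < sg ==> f : fun_space (X_norm sg) ==> f : L2"
 using X_in_L2w L2w_in_L2[of "sg / 2"] by auto

lemma X_integrable:
 assumes sg: "2 < sg" and f: "f : fun_space (X_norm sg)" shows "integ f"
proof (rule integrableI_bounded)
 show "f : borel_measurable lborel" using fun_spaceD(1)[OF f] by simp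
 obtain c where "(NN x. eabs f x) <= en c * L2w_norm (sg / 2) f" using X_norm_bounds[OF sg] fun_spaceD(1)[OF f] by blast
 also have "... < \<infinity>" using fun_spaceD(2)[OF X_in_L2w[OF sg f]] by (simp add: ennreal_mult_less_top)
 finally show "(NN x. en (norm (f x))) < \<infinity>" by (simp add: eabs_def)
qed

lemma CR_space_X:
 assumes sg: "2 < sg" shows "CR_space (X_norm sg) (xcls sg)"
proof -
 interpret realized_space "X_norm sg" "xcls sg" by (rule realized_space_X)
 obtain c where c: "0 <= c" "!!f. f : bmf ==> L2w_norm (sg / 2) f <= en c * X_norm sg f & L2_norm f <= L2w_norm (sg / 2) f
 & (NN x. eabs f x) <= en c * L2w_norm (sg / 2) f" using X_norm_bounds[OF sg] by blast
 define C where "C = 2 powr sg * (4 * (c * c))"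
 have C0: "0 <= C" using c(1) by (simp add: C_def)
 have bound: "X_norm sg (CR_op f g h) <= en C * X_norm sg f * X_norm sg g * X_norm sg h"
 if m: "f : bmf" "g : bmf" "h : bmf" for f g h
 proof -
 have L: "L2_norm k <= en c * X_norm sg k" if "k : bmf" for k using c(2)[OF that] order_trans by blast
 have I: "(NN x. eabs g x) <= en c * (en c * X_norm sg g)"
 using c(2)[OF m(2)] by (meson order_trans mult_left_mono zero_le)
 have "X_norm sg (CR_op f g h) <= en (2 powr sg) *
 (X_norm sg f * (en (2 * 1) * (X_norm sg h * (NN x. eabs g x)) + en (2 * ln (1 / 1)) * (L2_norm g * L2_norm h))
 + 2 * X_norm sg h * (L2_norm f * L2_norm g))"
 by (rule X_norm_CR_op[OF m]) (use sg in auto)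
 also have "... = en (2 powr sg) * (X_norm sg f * (2 * (X_norm sg h * (NN x. eabs g x))) + 2 * X_norm sg h * (L2_norm f * L2_norm g))"
 by simp
 also have "... <= en (2 powr sg) * (X_norm sg f * (2 * (X_norm sg h * (en c * (en c * X_norm sg g))))
 + 2 * X_norm sg h * ((en c * X_norm sg f) * (en c * X_norm sg g)))"
 by (intro mult_left_mono add_mono mult_mono I L m) auto
 also have "... = en (2 powr sg) * ((2 + 2) * ((en c * en c) * (X_norm sg f * X_norm sg g * X_norm sg h)))"
 unfolding distrib_right by (simp only: mult_ac)
 also have "... = en C * X_norm sg f * X_norm sg g * X_norm sg h"
 using c(1) by (simp add: C_def ennreal_mult mult.assoc)
 finally show ?thesis .
 qed
 show ?thesis
 proof
 fix f g h assume f: "f : fun_space (X_norm sg)" and g: "g : fun_space (X_norm sg)" and h: "h : fun_space (X_norm sg)"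
 note [measurable] = fun_spaceD(1)[OF f] fun_spaceD(1)[OF g] fun_spaceD(1)[OF h]
 have "X_norm sg (CR_op f g h) <= en C * X_norm sg f * X_norm sg g * X_norm sg h" by (rule bound) measurable
 also have "... < \<infinity>" using fun_spaceD(2)[OF f] fun_spaceD(2)[OF g] fun_spaceD(2)[OF h] by (simp add: ennreal_mult_less_top)
 finally show "CR_op f g h : fun_space (X_norm sg)" by (simp add: fun_space_def)
 show "AE xi in lborel. CR_converges f g h xi" by (intro CR_converges_L2 X_in_L2[OF sg] f g h)
 next
 show "\<exists>C\<ge>0. \<forall>f\<in>fun_space (X_norm sg). \<forall>g\<in>fun_space (X_norm sg). \<forall>h\<in>fun_space (X_norm sg).
 X_norm sg (CR_op f g h) <= en C * X_norm sg f * X_norm sg g * X_norm sg h"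
 by (rule exI[of _ C]) (use bound fun_spaceD(1) C0 in auto)
 qed
qed

text \<open>With \<open>y\<close> the sup norm and \<open>m\<close> the weighted \<open>L\<^sup>2\<close> norm, the cut at \<open>1 / (1 + y)\<close> turns the sup norm estimate into \<open>m\<^sup>2 y (1 + ln (1 + y))\<close> up to constants, and \<open>m\<close> stays bounded in finite time.\<close>

lemma a_priori_X:
 assumes sg: "2 < sg" and r: "\<bar>r\<bar> = 1"
 shows "a_priori_bounded (%u v w. r *R CR_space.F (X_norm sg) (xcls sg) u v w)"
proof -
 have s: "0 <= sg / 2" using sg by simp
 interpret X: CR_space "X_norm sg" "xcls sg" by (rule CR_space_X[OF sg])
 interpret W: CR_space "L2w_norm (sg / 2)" "wcls (sg / 2)" by (rule CR_space_L2w[OF s])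
 obtain c where c: "0 <= c" "!!f. f : bmf ==> L2w_norm (sg / 2) f <= en c * X_norm sg f & L2_norm f <= L2w_norm (sg / 2) f
 & (NN x. eabs f x) <= en c * L2w_norm (sg / 2) f" using X_norm_bounds[OF sg] by blast
 interpret E: CR_embedding "X_norm sg" "xcls sg" "L2w_norm (sg / 2)" "wcls (sg / 2)"
 by unfold_locales (use c fun_spaceD(1) in blast)
 define K where "K = 2 powr sg * (2 * c + 4)"
 have K0: "0 <= K" using c(1) by (simp add: K_def)
 have id: "en P * (en y * (en d * (en y * (en c * en m)) + en l * (en m * en m)) + 2 * en y * (en m * en m))
 = en (P * (y * (d * (y * (c * m)) + l * (m * m)) + 2 * y * (m * m)))"
 if "0 <= P" "0 <= y" "0 <= d" "0 <= c" "0 <= m" "0 <= l" for P y d c m l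
 using that by (simp add: ennreal_mult ennreal_plus)
 show ?thesis
 proof (rule E.a_priori_transfer[OF K0 _ r a_priori_L2w[OF s r]])
 fix u
 let ?f = "X.lift u"
 define y where "y = norm u"
 define m where "m = norm (E.io u)"
 have f: "?f : fun_space (X_norm sg)" by simp
 note fm = fun_spaceD(1)[OF f]
 have y0: "0 <= y" and m0: "0 <= m" by (simp_all add: y_def m_def)
 have Xf: "X_norm sg ?f = en y" using X.J_norm[OF f] by (simp add: y_def)
 have Mf: "L2w_norm (sg / 2) ?f = en m" using W.J_norm[OF E.emb_in[OF f]] by (simp add: m_def E.io_def)
 have l0: "0 <= ln (1 + y)" using y0 by simp
 have "en (norm (X.F u u u)) = X_norm sg (CR_op ?f ?f ?f)" using X.norm_F_self[OF f] by simp
 also have "... <= en (2 powr sg) *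
 (X_norm sg ?f * (en (2 * (1 / (1 + y))) * (X_norm sg ?f * (NN x. eabs ?f x)) + en (2 * ln (1 / (1 / (1 + y)))) * (L2_norm ?f * L2_norm ?f))
 + 2 * X_norm sg ?f * (L2_norm ?f * L2_norm ?f))"
 by (rule X_norm_CR_op[OF fm fm fm]) (use sg y0 in auto)
 also have "... <= en (2 powr sg) *
 (en y * (en (2 * (1 / (1 + y))) * (en y * (en c * en m)) + en (2 * ln (1 / (1 / (1 + y)))) * (en m * en m))
 + 2 * en y * (en m * en m))"
 unfolding Xf using c(2)[OF fm] unfolding Mf by (intro mult_left_mono add_mono mult_mono) auto
 also have "... = en (2 powr sg * (y * (2 * (1 / (1 + y)) * (y * (c * m)) + 2 * ln (1 / (1 / (1 + y))) * (m * m)) + 2 * y * (m * m)))"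
 using y0 m0 c(1) l0 by (intro id) simp_all
 finally have "norm (X.F u u u) <= 2 powr sg * (y * (2 * (1 / (1 + y)) * (y * (c * m)) + 2 * ln (1 / (1 / (1 + y))) * (m * m)) + 2 * y * (m * m))"
 using y0 m0 c(1) l0 by (subst (asm) ennreal_le_iff) simp_all
 also have "... <= 2 powr sg * ((2 * c + 4) * ((1 + m)^2 * ((1 + y) * (1 + ln (1 + y)))))"
 proof (rule mult_left_mono)
 define Z where "Z = (1 + m)^2 * ((1 + y) * (1 + ln (1 + y)))"
 have 1: "y * (1 + ln (1 + y)) <= (1 + y) * (1 + ln (1 + y))" using l0 by (intro mult_right_mono) auto
 have yl: "0 <= y * ln (1 + y)" using y0 l0 by simp
 have m1: "m <= (1 + m)^2" "m * m <= (1 + m)^2" using m0 by (simp_all add: power2_eq_square algebra_simps)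
 have a: "m * y <= Z" unfolding Z_def using m1 1 yl y0 m0 l0 by (intro mult_mono) (auto simp: distrib_left)
 have b: "(m * m) * (y * ln (1 + y)) <= Z" unfolding Z_def using m1 1 yl y0 m0 l0 by (intro mult_mono) (auto simp: distrib_left)
 have d: "(m * m) * y <= Z" unfolding Z_def using m1 1 yl y0 m0 l0 by (intro mult_mono) (auto simp: distrib_left)
 have "y * (1 / (1 + y)) <= 1" using y0 by (simp add: field_simps)
 then have "(y * (1 / (1 + y))) * (2 * c * (m * y)) <= 1 * (2 * c * (m * y))"
 using y0 m0 c(1) by (intro mult_right_mono) auto
 moreover have "c * (m * y) <= c * Z" using a c(1) by (rule mult_left_mono)
 moreover have "y * (2 * (1 / (1 + y)) * (y * (c * m)) + 2 * ln (1 / (1 / (1 + y))) * (m * m)) + 2 * y * (m * m)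
 = (y * (1 / (1 + y))) * (2 * c * (m * y)) + 2 * ((m * m) * (y * ln (1 + y))) + 2 * ((m * m) * y)"
 by (simp add: distrib_left mult_ac)
 moreover have "(2 * c + 4) * Z = 2 * (c * Z) + 2 * Z + 2 * Z" by (simp add: algebra_simps)
 ultimately show "y * (2 * (1 / (1 + y)) * (y * (c * m)) + 2 * ln (1 / (1 / (1 + y))) * (m * m)) + 2 * y * (m * m) <= (2 * c + 4) * Z"
 using b d by linarith
 qed simp
 finally show "norm (X.F u u u) <= K * (1 + norm (E.io u))^2 * (1 + norm u) * (1 + ln (1 + norm u))"
 unfolding K_def y_def m_def by (simp only: mult.assoc)
 qed
qed

section \<open>Weak derivatives and the Fourier transform\<close>

text \<open>All derivatives of \<open>exp (-1 / x)\<close>, extended by zero, are combinations of these functions.\<close>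

definition ebump :: "nat => real => real" where
 "ebump k x = (if 0 < x then inverse x ^ k * exp (- inverse x) else 0)"

lemma ebump_tendsto_0: "(ebump k \<longlongrightarrow> 0) (at_right 0)"
proof -
 have "((%x. inverse x ^ k / exp (inverse x)) \<longlongrightarrow> 0) (at_right (0::real))"
 by (rule filterlim_compose[OF tendsto_power_div_exp_0 filterlim_inverse_at_top_right])
 then show ?thesis
 by (rule Lim_transform_eventually) (auto simp: eventually_at_filter ebump_def exp_minus divide_inverse)
qed

lemma ebump_derivative: "(ebump k has_real_derivative (ebump (k + 2) x - real k * ebump (k + 1) x)) (at x)"
proof -
 consider "x < 0" | "x = 0" | "0 < x" by linarith
 then show ?thesis
 proof cases
 case 1
 have "(ebump k has_real_derivative 0) (at x)"
 by (rule has_field_derivative_transform_within_open[of "%_. 0" _ _ "{..<0}"]) (use 1 in \<open>auto simp: ebump_def\<close>)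
 then show ?thesis using 1 by (simp add: ebump_def)
 next
 case 2
 have "((%y. (ebump k y - ebump k 0) / (y - 0)) \<longlongrightarrow> 0) (at 0)"
 proof (rule filterlim_split_at)
 show "((%y. (ebump k y - ebump k 0) / (y - 0)) \<longlongrightarrow> 0) (at_left 0)"
 by (rule tendsto_eventually) (auto simp: eventually_at_filter ebump_def)
 show "((%y. (ebump k y - ebump k 0) / (y - 0)) \<longlongrightarrow> 0) (at_right 0)"
 by (rule Lim_transform_eventually[OF ebump_tendsto_0[of "Suc k"]]) (auto simp: eventually_at_filter ebump_def divide_inverse)
 qed
 then show ?thesis unfolding 2 by (simp add: has_field_derivative_iff ebump_def)
 next
 case 3
 have "((%x. inverse x ^ k * exp (- inverse x)) has_real_derivative (ebump (k + 2) x - real k * ebump (k + 1) x)) (at x)"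
 proof -
 have p: "((%x. inverse x ^ k) has_real_derivative - real k * inverse x ^ (k + 1)) (at x)"
 proof (induction k)
 case (Suc k)
 have "((%x. inverse x * inverse x ^ k) has_real_derivative - (inverse x ^ Suc (Suc 0)) * inverse x ^ k + (- real k * inverse x ^ (k + 1)) * inverse x) (at x)"
 using 3 by (intro DERIV_mult DERIV_inverse Suc) simp
 then show ?case by (simp add: algebra_simps)
 qed simp
 have e: "((%x. exp (- inverse x)) has_real_derivative exp (- inverse x) * inverse x ^ 2) (at x)"
 using 3 by (auto intro!: derivative_eq_intros simp: power2_eq_square)
 show ?thesis
 by (rule DERIV_cong[OF DERIV_mult[OF p e]]) (use 3 in \<open>simp add: ebump_def power2_eq_square algebra_simps\<close>)
 qed
 then show ?thesis
 by (rule has_field_derivative_transform_within_open[of _ _ _ "{0<..}"]) (use 3 in \<open>auto simp: ebump_def\<close>)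
 qed
qed

text \<open>A class of smooth functions that is closed under differentiation and contains products of cut-offs and trigonometric functions. Products of two of them in separate variables are test functions, with explicit mixed derivatives.\<close>

inductive smooth_gen :: "(real => real) => bool" where
 ebump: "smooth_gen (%t. ebump k (1 + r * t))"
| cos: "smooth_gen (%t. cos (a * t + c))"
| const: "smooth_gen (%t. d)"
| add: "smooth_gen f ==> smooth_gen g ==> smooth_gen (%t. f t + g t)"
| mult: "smooth_gen f ==> smooth_gen g ==> smooth_gen (%t. f t * g t)"

lemma smooth_gen_derivative: "smooth_gen f ==> \<exists>f'. smooth_gen f' & (\<forall>t. (f has_real_derivative f' t) (at t))"
proof (induction rule: smooth_gen.induct)
 case (ebump k r)
 have "((%t. ebump k (1 + r * t)) has_real_derivative r * (ebump (k + 2) (1 + r * t) + (- real k) * ebump (k + 1) (1 + r * t))) (at t)" for t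
 by (rule DERIV_cong[OF DERIV_chain2[OF ebump_derivative]]) (auto intro!: derivative_eq_intros)
 moreover have "smooth_gen (%t. r * (ebump (k + 2) (1 + r * t) + (- real k) * ebump (k + 1) (1 + r * t)))"
 by (intro smooth_gen.intros)
 ultimately show ?case by blast
next
 case (cos a c)
 have "((%t. cos (a * t + c)) has_real_derivative a * cos (a * t + (c + pi / 2))) (at t)" for t
 by (auto intro!: derivative_eq_intros simp: cos_add sin_add algebra_simps)
 moreover have "smooth_gen (%t. a * cos (a * t + (c + pi / 2)))" by (intro smooth_gen.intros)
 ultimately show ?case by blast
next
 case (const d)
 show ?case by (rule exI[of _ "%_. 0"]) (auto intro: smooth_gen.intros)
next
 case (add f g)
 then obtain f' g' where d: "smooth_gen f'" "smooth_gen g'" "!!t. (f has_real_derivative f' t) (at t)" "!!t. (g has_real_derivative g' t) (at t)" by blast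
 then show ?case by (intro exI[of _ "%t. f' t + g' t"]) (auto intro!: smooth_gen.intros DERIV_add)
next
 case (mult f g)
 then obtain f' g' where d: "smooth_gen f'" "smooth_gen g'" "!!t. (f has_real_derivative f' t) (at t)" "!!t. (g has_real_derivative g' t) (at t)" by blast
 then show ?case using mult.hyps by (intro exI[of _ "%t. f' t * g t + g' t * f t"]) (auto intro!: smooth_gen.intros DERIV_mult)
qed

lemma smooth_gen_sequence:
 assumes "smooth_gen f"
 shows "\<exists>U. U 0 = f & (\<forall>k t. (U k has_real_derivative U (Suc k) t) (at t))"
proof -
 have "\<exists>U. \<forall>n. (smooth_gen (U n) & (n = 0 --> U n = f)) & (\<forall>t. (U n has_real_derivative U (Suc n) t) (at t))"
 proof (rule dependent_nat_choice)
 show "\<exists>u. smooth_gen u & (0 = (0::nat) --> u = f)" using assms by blast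
 show "\<exists>v. (smooth_gen v & (Suc n = 0 --> v = f)) & (\<forall>t. (u has_real_derivative v t) (at t))"
 if "smooth_gen u & (n = 0 --> u = f)" for u n using smooth_gen_derivative[of u] that by auto
 qed
 then show ?thesis by auto
qed

lemma product_has_derivative:
 assumes u: "(u has_real_derivative u') (at ((x::real^2) $ 1))" and v: "(v has_real_derivative v') (at (x $ 2))"
 shows "((%x. u (x $ 1) * v (x $ 2)) has_derivative (%h. h $ 1 * (u' * v (x $ 2)) + h $ 2 * (u (x $ 1) * v'))) (at x)"
proof -
 have c: "((%x::real^2. x $ i) has_derivative (%h. h $ i)) (at x)" for i
 by (rule bounded_linear_imp_has_derivative) (rule bounded_linear_vec_nth)
 show ?thesis
 by (rule has_derivative_eq_rhs[OF has_derivative_mult[OF DERIV_compose_FDERIV[OF u c] DERIV_compose_FDERIV[OF v c]]])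
 (auto simp: fun_eq_iff algebra_simps)
qed

lemma test_function_product:
 assumes u: "smooth_gen u" "!!t. r < \<bar>t\<bar> ==> u t = 0" and v: "smooth_gen v" "!!t. r < \<bar>t\<bar> ==> v t = 0"
 shows "test_function (%x. u (x $ 1) * v (x $ 2))"
proof -
 obtain U where U: "U 0 = u" "!!k t. (U k has_real_derivative U (Suc k) t) (at t)" using smooth_gen_sequence[OF u(1)] by blast
 obtain V where V: "V 0 = v" "!!k t. (V k has_real_derivative V (Suc k) t) (at t)" using smooth_gen_sequence[OF v(1)] by blast
 define D where "D al x = U (al 1) ((x::real^2) $ 1) * V (al 2) (x $ 2)" for al :: "2 => nat" and x
 have 1: "(D al has_derivative (%h. \<Sum>i\<in>UNIV. h $ i * D (al(i := Suc (al i))) x)) (at x)" for al x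
 using product_has_derivative[OF U(2)[of "al 1" "x $ 1"] V(2)[of "al 2" "x $ 2"]] by (simp add: D_def[abs_def] sum_2)
 have 2: "D (%_. 0) = (%x. u (x $ 1) * v (x $ 2))" by (simp add: D_def[abs_def] U V)
 have 3: "u (x $ 1) * v (x $ 2) = 0" if "x \<notin> cball 0 (\<bar>r\<bar> + \<bar>r\<bar>)" for x :: "real^2"
 proof -
 have "norm x <= \<bar>x $ 1\<bar> + \<bar>x $ 2\<bar>" using norm_le_l1_cart[of x] by (simp add: sum_2)
 then have "r < \<bar>x $ 1\<bar> | r < \<bar>x $ 2\<bar>" using that by (auto simp: not_le)
 then show ?thesis using u(2) v(2) by auto
 qed
 show ?thesis unfolding test_function_def
 by (rule conjI, rule exI[of _ "cball 0 (\<bar>r\<bar> + \<bar>r\<bar>)"], use 3 in simp, rule exI[of _ D], use 1 2 in simp)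
qed

lemma frechet_derivative_product:
 assumes u: "(u has_real_derivative u') (at ((x::real^2) $ 1))" and v: "(v has_real_derivative v') (at (x $ 2))"
 shows "frechet_derivative (%x. u (x $ 1) * v (x $ 2)) (at x) (axis 1 1) = u' * v (x $ 2)"
 "frechet_derivative (%x. u (x $ 1) * v (x $ 2)) (at x) (axis 2 1) = u (x $ 1) * v'"
 unfolding frechet_derivative_at[OF product_has_derivative[OF u v], symmetric] by (simp_all add: axis_def)

text \<open>Smooth cut-offs that increase to the constant one, with derivatives tending to zero uniformly.\<close>

definition cutoff :: "nat => real => real" where
 "cutoff n t = exp 2 * (ebump 0 (1 + (1 / real (Suc n)) * t) * ebump 0 (1 + (- (1 / real (Suc n))) * t))"

definition cutoff' :: "nat => real => real" where
 "cutoff' n t = exp 2 * (ebump 2 (1 + (1 / real (Suc n)) * t) * (1 / real (Suc n)) * ebump 0 (1 + (- (1 / real (Suc n))) * t)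
 - ebump 2 (1 + (- (1 / real (Suc n))) * t) * (1 / real (Suc n)) * ebump 0 (1 + (1 / real (Suc n)) * t))"

lemma smooth_gen_cutoff: "smooth_gen (cutoff n)"
 unfolding cutoff_def[abs_def] by (intro smooth_gen.intros)

lemma cutoff_derivative: "(cutoff n has_real_derivative cutoff' n t) (at t)"
proof -
 have e: "((%t. ebump 0 (1 + r * t)) has_real_derivative ebump 2 (1 + r * t) * r) (at t)" for r
 by (rule DERIV_cong[OF DERIV_chain2[OF ebump_derivative]]) (auto intro!: derivative_eq_intros simp: numeral_2_eq_2)
 show ?thesis
 unfolding cutoff_def[abs_def] cutoff'_def
 by (rule DERIV_cong[OF DERIV_cmult[OF DERIV_mult[OF e e]]]) (simp add: algebra_simps)
qed

lemma ebump_bounds: "0 <= ebump k x" "ebump 0 x <= 1" "ebump 2 x <= 2"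
proof -
 show "0 <= ebump k x" "ebump 0 x <= 1" by (auto simp: ebump_def)
 show "ebump 2 x <= 2"
 proof (cases "0 < x")
 case True
 define y where "y = inverse x"
 have y: "0 < y" using True by (simp add: y_def)
 then have "y^2 / 2 <= exp y" using exp_lower_Taylor_quadratic[of y] by linarith
 then have "y^2 * exp (- y) <= 2" by (simp add: exp_minus field_simps)
 then show ?thesis using True by (simp add: ebump_def y_def)
 qed (simp add: ebump_def)
qed

lemma cutoff_bounds: "\<bar>cutoff n t\<bar> <= exp 2" "\<bar>cutoff' n t\<bar> <= exp 2 * 4 * (1 / real (Suc n))" "real (Suc n) < \<bar>t\<bar> ==> cutoff n t = 0"
proof -
 let ?a = "1 + (1 / real (Suc n)) * t" and ?b = "1 + (- (1 / real (Suc n))) * t"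
 have "ebump 0 ?a * ebump 0 ?b <= 1 * 1" by (intro mult_mono ebump_bounds) auto
 then show "\<bar>cutoff n t\<bar> <= exp 2" using ebump_bounds(1) by (simp add: cutoff_def abs_mult)
 have p: "\<bar>ebump 2 s * (1 / real (Suc n)) * ebump 0 s'\<bar> <= 2 * (1 / real (Suc n)) * 1" for s s'
 proof -
 have "ebump 2 s * (1 / real (Suc n)) * ebump 0 s' <= 2 * (1 / real (Suc n)) * 1"
 using ebump_bounds by (intro mult_mono mult_nonneg_nonneg) auto
 then show ?thesis using ebump_bounds(1) by (simp add: abs_mult)
 qed
 have "\<bar>ebump 2 ?a * (1 / real (Suc n)) * ebump 0 ?b - ebump 2 ?b * (1 / real (Suc n)) * ebump 0 ?a\<bar> <= 4 * (1 / real (Suc n))"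
 using p[of ?a ?b] p[of ?b ?a] by linarith
 then have "exp 2 * \<bar>ebump 2 ?a * (1 / real (Suc n)) * ebump 0 ?b - ebump 2 ?b * (1 / real (Suc n)) * ebump 0 ?a\<bar> <= exp 2 * (4 * (1 / real (Suc n)))"
 by (intro mult_left_mono) auto
 then show "\<bar>cutoff' n t\<bar> <= exp 2 * 4 * (1 / real (Suc n))" unfolding cutoff'_def by (simp only: abs_mult abs_exp_cancel mult.assoc)
 assume t: "real (Suc n) < \<bar>t\<bar>"
 have s: "0 < real (Suc n)" by simp
 show "cutoff n t = 0"
 proof (cases "0 <= t")
 case True
 then have "?b <= 0" using t s by (simp add: field_simps)
 then show ?thesis by (simp add: cutoff_def ebump_def)
 next
 case False
 then have "?a <= 0" using t s by (simp add: field_simps)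
 then show ?thesis by (simp add: cutoff_def ebump_def)
 qed
qed

lemma cutoff_tendsto: "(%n. cutoff n t) ----> 1" "(%n. cutoff' n t) ----> 0"
proof -
 have z: "(%n. 1 / real (Suc n)) ----> 0" by (rule LIMSEQ_Suc[OF lim_1_over_n])
 have c: "isCont (ebump 0) 1" using ebump_derivative by (rule DERIV_isCont)
 have "(%n. 1 + (1 / real (Suc n)) * t) ----> 1 + 0 * t" "(%n. 1 + (- (1 / real (Suc n))) * t) ----> 1 + (- 0) * t"
 by (intro tendsto_intros z)+
 then have "(%n. cutoff n t) ----> exp 2 * (ebump 0 1 * ebump 0 1)"
 unfolding cutoff_def by (intro tendsto_intros isCont_tendsto_compose[OF c]) simp_all
 moreover have "exp 2 * (ebump 0 1 * ebump 0 1) = 1" by (simp add: ebump_def mult_exp_exp)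
 ultimately show "(%n. cutoff n t) ----> 1" by simp
 have "(%n. exp 2 * 4 * (1 / real (Suc n))) ----> exp 2 * 4 * 0" by (intro tendsto_intros z)
 then have l: "(%n. exp 2 * 4 * (1 / real (Suc n))) ----> (0::real)" by simp
 have "(%n. \<bar>cutoff' n t\<bar>) ----> 0"
 by (rule tendsto_sandwich[OF _ _ tendsto_const l]) (simp_all only: cutoff_bounds(2) abs_ge_zero eventually_True)
 then show "(%n. cutoff' n t) ----> 0" by (rule tendsto_rabs_zero_cancel)
qed

text \<open>The test functions are products of trigonometric functions and cut-offs; the cut-offs disappear by dominated convergence since \<open>f\<close> and \<open>p\<close> are integrable.\<close>

lemma weak_partial_trigonometric:
 assumes w: "weak_partial i f p" and f: "integ f" and p: "integ p"
 shows "(IN x. cor (if i = 1 then - a * sin (a * x $ 1 + c) * cos (b * x $ 2 + d) else cos (a * x $ 1 + c) * (- b * sin (b * x $ 2 + d))) * f x)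
 = - (IN x. cor (cos (a * x $ 1 + c) * cos (b * x $ 2 + d)) * p x)"
proof -
 have [measurable]: "f : bmf" "p : bmf" using f p by auto
 define u where "u e k n t = cutoff n t * cos (e * t + k)" for e k :: real and n t
 define u' where "u' e k n t = cutoff' n t * cos (e * t + k) + (- e * sin (e * t + k)) * cutoff n t" for e k :: real and n t
 have du: "(u e k n has_real_derivative u' e k n t) (at t)" for e k n t
 unfolding u_def[abs_def] u'_def
 by (rule DERIV_mult[OF cutoff_derivative]) (auto intro!: derivative_eq_intros)
 have su: "smooth_gen (u e k n)" for e k n
 unfolding u_def[abs_def] by (intro smooth_gen.mult smooth_gen_cutoff smooth_gen.cos)
 have bu: "\<bar>u e k n t\<bar> <= exp 2" for e k n t
 using mult_mono[OF cutoff_bounds(1)[of n t] abs_cos_le_one[of "e * t + k"]] by (simp add: u_def abs_mult)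
 have bu': "\<bar>u' e k n t\<bar> <= exp 2 * 4 + \<bar>e\<bar> * exp 2" for e k n t
 proof -
 have "exp 2 * 4 * (1 / real (Suc n)) <= exp 2 * 4 * (1::real)" by (intro mult_left_mono) auto
 then have "\<bar>cutoff' n t\<bar> <= exp 2 * 4" using cutoff_bounds(2)[of n t] by linarith
 then have 1: "\<bar>cutoff' n t\<bar> * \<bar>cos (e * t + k)\<bar> <= exp 2 * 4 * 1" by (intro mult_mono) auto
 have "\<bar>sin (e * t + k)\<bar> * \<bar>cutoff n t\<bar> <= 1 * exp 2" by (intro mult_mono cutoff_bounds) auto
 then have 2: "\<bar>e\<bar> * (\<bar>sin (e * t + k)\<bar> * \<bar>cutoff n t\<bar>) <= \<bar>e\<bar> * (1 * exp 2)" by (intro mult_left_mono) auto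
 show ?thesis using 1 2 abs_triangle_ineq[of "cutoff' n t * cos (e * t + k)" "(- e * sin (e * t + k)) * cutoff n t"]
 unfolding u'_def by (simp add: abs_mult mult.assoc)
 qed
 have lu: "(%n. u e k n t) ----> cos (e * t + k)" for e k t
 using tendsto_mult[OF cutoff_tendsto(1)[of t] tendsto_const[of "cos (e * t + k)"]] by (simp add: u_def)
 have lu': "(%n. u' e k n t) ----> - e * sin (e * t + k)" for e k t
 using tendsto_add[OF tendsto_mult[OF cutoff_tendsto(2)[of t] tendsto_const[of "cos (e * t + k)"]]
 tendsto_mult[OF tendsto_const[of "- e * sin (e * t + k)"] cutoff_tendsto(1)[of t]]] by (simp add: u'_def)
 have zu: "real (Suc n) < \<bar>t\<bar> ==> u e k n t = 0" for e k n t by (simp add: u_def cutoff_bounds(3))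
 define ph where "ph n x = u a c n ((x::real^2) $ 1) * u b d n (x $ 2)" for n x
 define ph' where "ph' n x = (if i = 1 then u' a c n ((x::real^2) $ 1) * u b d n (x $ 2) else u a c n (x $ 1) * u' b d n (x $ 2))" for n x
 have i12: "i = 1 | i = 2" by (rule exhaust_2)
 have [measurable]: "u e k n : bmf" for e k n
 by (intro borel_measurable_continuous_onI DERIV_continuous_on[OF has_field_derivative_at_within[OF du]])
 have sm: "u' e k n : bmf" for e k n
 proof -
 have "(ebump j) : bmf" for j
 by (intro borel_measurable_continuous_onI DERIV_continuous_on[OF has_field_derivative_at_within[OF ebump_derivative]])
 note [measurable] = this
 show ?thesis unfolding u'_def[abs_def] cutoff'_def cutoff_def by measurable
 qed
 note [measurable] = sm
 define C where "C = (exp 2 * 4 + \<bar>a\<bar> * exp 2 + \<bar>b\<bar> * exp 2) * exp (2::real)"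
 have bd: "\<bar>ph' n x\<bar> <= C" "\<bar>ph n x\<bar> <= C" for n x
 proof -
 have e2: "1 <= exp (2::real)" by simp
 have A: "\<bar>s\<bar> * \<bar>t\<bar> <= C" if "\<bar>s\<bar> <= exp 2 * 4 + \<bar>a\<bar> * exp 2 + \<bar>b\<bar> * exp 2" "\<bar>t\<bar> <= exp 2" for s t
 unfolding C_def using that by (intro mult_mono) auto
 have m: "exp 2 <= exp 2 * 4 + \<bar>a\<bar> * exp 2 + \<bar>b\<bar> * exp (2::real)" by simp
 have ma: "exp 2 * 4 + \<bar>a\<bar> * exp 2 <= exp 2 * 4 + \<bar>a\<bar> * exp 2 + \<bar>b\<bar> * exp (2::real)" by simp
 have mb: "exp 2 * 4 + \<bar>b\<bar> * exp 2 <= exp 2 * 4 + \<bar>a\<bar> * exp 2 + \<bar>b\<bar> * exp (2::real)" by simp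
 show "\<bar>ph n x\<bar> <= C" unfolding ph_def abs_mult by (rule A[OF order_trans[OF bu m] bu])
 have "\<bar>u' a c n (x $ 1)\<bar> * \<bar>u b d n (x $ 2)\<bar> <= C" by (rule A[OF order_trans[OF bu' ma] bu])
 moreover have "\<bar>u' b d n (x $ 2)\<bar> * \<bar>u a c n (x $ 1)\<bar> <= C" by (rule A[OF order_trans[OF bu' mb] bu])
 ultimately show "\<bar>ph' n x\<bar> <= C" unfolding ph'_def by (simp add: abs_mult mult.commute)
 qed
 have eq: "(IN x. cor (ph' n x) * f x) = - (IN x. cor (ph n x) * p x)" for n
 proof -
 have t: "test_function (ph n)" unfolding ph_def[abs_def] by (rule test_function_product[OF su zu su zu])
 have fr: "frechet_derivative (ph n) (at x) (axis i 1) = ph' n x" for x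
 using i12 frechet_derivative_product[OF du[of a c n "x $ 1"] du[of b d n "x $ 2"]]
 unfolding ph_def[abs_def] ph'_def by auto
 show ?thesis using w t unfolding weak_partial_def fr[symmetric] by blast
 qed
 have 1: "(%n. IN x. cor (ph' n x) * f x) ----> (IN x. cor (if i = 1 then - a * sin (a * x $ 1 + c) * cos (b * x $ 2 + d) else cos (a * x $ 1 + c) * (- b * sin (b * x $ 2 + d))) * f x)"
 proof (rule integral_dominated_convergence[where w="%x. C * cmod (f x)"])
 show "AE x in lborel. (%n. cor (ph' n x) * f x) ----> cor (if i = 1 then - a * sin (a * x $ 1 + c) * cos (b * x $ 2 + d) else cos (a * x $ 1 + c) * (- b * sin (b * x $ 2 + d))) * f x"
 proof (rule AE_I2)
 fix x :: "real^2"
 show "(%n. cor (ph' n x) * f x) ----> cor (if i = 1 then - a * sin (a * x $ 1 + c) * cos (b * x $ 2 + d) else cos (a * x $ 1 + c) * (- b * sin (b * x $ 2 + d))) * f x"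
 proof (cases "i = 1")
 case True
 show ?thesis unfolding ph'_def if_P[OF True]
 by (rule tendsto_mult[OF tendsto_of_real[OF tendsto_mult[OF lu' lu]] tendsto_const])
 next
 case False
 show ?thesis unfolding ph'_def if_not_P[OF False]
 by (rule tendsto_mult[OF tendsto_of_real[OF tendsto_mult[OF lu lu']] tendsto_const])
 qed
 qed
 show "AE x in lborel. norm (cor (ph' n x) * f x) <= C * cmod (f x)" for n
 using bd(1) by (auto simp: norm_mult intro!: mult_right_mono)
 show "(%x. cor (ph' n x) * f x) : borel_measurable lborel" for n unfolding ph'_def by measurable
 qed (use f in auto)
 have 2: "(%n. IN x. cor (ph n x) * p x) ----> (IN x. cor (cos (a * x $ 1 + c) * cos (b * x $ 2 + d)) * p x)"
 proof (rule integral_dominated_convergence[where w="%x. C * cmod (p x)"])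
 show "AE x in lborel. (%n. cor (ph n x) * p x) ----> cor (cos (a * x $ 1 + c) * cos (b * x $ 2 + d)) * p x"
 unfolding ph_def by (rule AE_I2, rule tendsto_mult[OF tendsto_of_real[OF tendsto_mult[OF lu lu]] tendsto_const])
 show "AE x in lborel. norm (cor (ph n x) * p x) <= C * cmod (p x)" for n
 using bd(2) by (auto simp: norm_mult intro!: mult_right_mono)
 show "(%x. cor (ph n x) * p x) : borel_measurable lborel" for n unfolding ph_def by measurable
 qed (use p in auto)
 show ?thesis by (rule LIMSEQ_unique[OF 1]) (unfold eq, rule tendsto_minus[OF 2])
qed

text \<open>The exponential is a combination of four products of cosines with shifted phases.\<close>

lemma ft_weak_partial:
 assumes w: "weak_partial i f p" and f: "integ f" and p: "integ p"
 shows "ft (- 1) p xi = \<i> * cor (xi $ i) * ft (- 1) f xi"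
proof -
 have [measurable]: "f : bmf" "p : bmf" using f p by auto
 let ?a = "xi $ 1" and ?b = "xi $ 2" and ?h = "- (pi / 2)"
 define T where "T c d x = cor (cos (?a * (x::real^2) $ 1 + c) * cos (?b * x $ 2 + d))" for c d x
 define T' where "T' c d x = cor (if i = 1 then - ?a * sin (?a * (x::real^2) $ 1 + c) * cos (?b * x $ 2 + d) else cos (?a * x $ 1 + c) * (- ?b * sin (?b * x $ 2 + d)))" for c d x
 have I: "(IN x. T' c d x * f x) = - (IN x. T c d x * p x)" for c d
 unfolding T_def T'_def by (rule weak_partial_trigonometric[OF w f p])
 have bT: "cmod (T c d x) <= 1" for c d x
 using mult_mono[OF abs_cos_le_one abs_cos_le_one, of "?a * x $ 1 + c" "?b * x $ 2 + d"] by (simp add: T_def abs_mult norm_mult mult.commute)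
 have bT': "cmod (T' c d x) <= \<bar>?a\<bar> + \<bar>?b\<bar>" for c d x
 proof -
 have 1: "\<bar>?a\<bar> * (\<bar>sin (?a * x $ 1 + c)\<bar> * \<bar>cos (?b * x $ 2 + d)\<bar>) <= \<bar>?a\<bar> * (1 * 1)" by (intro mult_left_mono mult_mono) auto
 have 2: "\<bar>?b\<bar> * (\<bar>cos (?a * x $ 1 + c)\<bar> * \<bar>sin (?b * x $ 2 + d)\<bar>) <= \<bar>?b\<bar> * (1 * 1)" by (intro mult_left_mono mult_mono) auto
 have "cmod (T' c d x) <= \<bar>?a\<bar> * (1 * 1) | cmod (T' c d x) <= \<bar>?b\<bar> * (1 * 1)"
 using 1 2 unfolding T'_def norm_of_real by (simp add: abs_mult mult_ac)
 then show ?thesis by auto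
 qed
 have iT: "integ (%x. T c d x * p x)" for c d
 proof (rule Bochner_Integration.integrable_bound[OF p])
 show "AE x in lborel. norm (T c d x * p x) <= norm (p x)"
 using mult_right_mono[OF bT] by (auto simp: norm_mult)
 qed (unfold T_def, measurable)
 have iT': "integ (%x. T' c d x * f x)" for c d
 proof (rule Bochner_Integration.integrable_bound[OF integrable_mult_right[OF f, of "cor (\<bar>?a\<bar> + \<bar>?b\<bar>)"]])
 show "AE x in lborel. norm (T' c d x * f x) <= norm (cor (\<bar>?a\<bar> + \<bar>?b\<bar>) * f x)"
 using mult_right_mono[OF bT'] by (auto simp: norm_mult simp del: of_real_add)
 qed (unfold T'_def, measurable)
 define E where "E x = cis (- 1 * ((x::real^2) \<bullet> xi))" for x
 have hc: "cos (s + ?h) = sin s" "sin (s + ?h) = - cos s" for s :: real by (simp_all add: cos_diff sin_diff)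
 have cm: "cis (- 1 * s) = Complex (cos s) (- sin s)" for s by (simp add: complex_eq_iff)
 have ix: "x \<bullet> xi = ?a * x $ 1 + ?b * x $ 2" for x by (simp add: inner_vec2 mult.commute)
 have Ex: "E x = Complex (cos (?a * x $ 1 + ?b * x $ 2)) (- sin (?a * x $ 1 + ?b * x $ 2))" for x
 unfolding E_def cm ix ..
 have E: "E x = T 0 0 x - \<i> * T ?h 0 x - \<i> * T 0 ?h x - T ?h ?h x" for x
 unfolding Ex T_def hc add_0_right by (simp add: complex_eq_iff cos_add sin_add)
 have i12: "i = 1 | i = 2" by (rule exhaust_2)
 have E': "- \<i> * cor (xi $ i) * E x = T' 0 0 x - \<i> * T' ?h 0 x - \<i> * T' 0 ?h x - T' ?h ?h x" for x
 using i12 unfolding Ex T'_def hc add_0_right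
 by (elim disjE) (simp_all add: complex_eq_iff cos_add sin_add algebra_simps)
 have "(IN x. E x * p x) = (IN x. T 0 0 x * p x - \<i> * (T ?h 0 x * p x) - \<i> * (T 0 ?h x * p x) - T ?h ?h x * p x)"
 unfolding E by (simp add: algebra_simps)
 also have "... = (IN x. T 0 0 x * p x) - \<i> * (IN x. T ?h 0 x * p x) - \<i> * (IN x. T 0 ?h x * p x) - (IN x. T ?h ?h x * p x)"
 using iT by simp
 also have "... = - ((IN x. T' 0 0 x * f x) - \<i> * (IN x. T' ?h 0 x * f x) - \<i> * (IN x. T' 0 ?h x * f x) - (IN x. T' ?h ?h x * f x))"
 unfolding I by simp
 also have "(IN x. T' 0 0 x * f x) - \<i> * (IN x. T' ?h 0 x * f x) - \<i> * (IN x. T' 0 ?h x * f x) - (IN x. T' ?h ?h x * f x)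
 = (IN x. T' 0 0 x * f x - \<i> * (T' ?h 0 x * f x) - \<i> * (T' 0 ?h x * f x) - T' ?h ?h x * f x)"
 using iT' by simp
 also have "... = (IN x. (- \<i> * cor (xi $ i)) * (E x * f x))"
 unfolding mult.assoc[symmetric] E' by (simp add: algebra_simps)
 also have "... = (- \<i> * cor (xi $ i)) * (IN x. E x * f x)" by (rule integral_mult_right_zero)
 finally show ?thesis by (simp add: ft_def E_def)
qed

lemma bounded_support_integrable:
 assumes [measurable]: "ps : bmf" and b: "!!x::real^2. \<bar>ps x\<bar> <= C * ind (cball 0 R) x"
 shows "integ (%x. cor (ps x))" "(%x. cor (ps x)) : L2"
proof -
 have fin: "emeasure lborel (cball (0::real^2) R) < \<infinity>" by (rule emeasure_bounded_finite) simp
 have i: "integ (%x::real^2. C * ind (cball 0 R) x :: real)"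
 using fin by (intro integrable_mult_right) (simp add: integrable_indicator_iff)
 show "integ (%x. cor (ps x))"
 proof (rule Bochner_Integration.integrable_bound[OF i])
 show "AE x in lborel. norm (cor (ps x)) <= norm (C * ind (cball 0 R) x :: real)"
 by (rule AE_I2) (use b in \<open>simp add: order_trans[OF _ abs_ge_self]\<close>)
 qed measurable
 have "(L2_norm (%x. cor (ps x)))^2 <= (NN x. en (C^2) * ind (cball (0::real^2) R) x)"
 unfolding L2_norm_power2
 proof (rule nn_integral_mono)
 fix x :: "real^2"
 have "\<bar>ps x\<bar>^2 <= (C * ind (cball 0 R) x)^2" by (intro power_mono b) simp
 then have "en ((cmod (cor (ps x)))^2) <= en ((C * ind (cball 0 R) x)^2)"
 by (intro ennreal_leI) simp
 then show "en ((cmod (cor (ps x)))^2) <= en (C^2) * ind (cball 0 R) x"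
 by (auto split: split_indicator_asm split_indicator)
 qed
 also have "... < \<infinity>" using fin by (subst nn_integral_cmult_indicator) (auto simp: ennreal_mult_less_top)
 finally have "L2_norm (%x. cor (ps x)) < \<infinity>" by (simp add: power_less_top_ennreal)
 then show "(%x. cor (ps x)) : L2" by (simp add: fun_space_def)
qed

lemma integral_translate:
 fixes k :: "real^2 => complex"
 assumes "k : bmf" shows "(IN x. k (x + c)) = (IN x. k x)"
proof -
 have "(IN x. k (x + c)) = 1 *R (IN x. k x)"
 proof (rule integral_map_scaled)
 fix ph :: "real^2 => ennreal" assume "ph : borel_measurable lborel"
 then show "(NN z. ph (z + c)) = en 1 * (NN z. ph z)"
 using nn_integral_reflect_translate(2)[of ph "- c"] by simp
 qed (use assms in simp_all)
 then show ?thesis by simp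
qed

text \<open>The difference quotients of a test function converge boundedly, so its transform is multiplied by the frequency.\<close>

lemma ft_test_function:
 fixes i :: 2
 assumes t: "test_function ph"
 defines "ph' \<equiv> %x. frechet_derivative ph (at x) (axis i 1)"
 shows "integ (%x. cor (ph x))" "(%x. cor (ph x)) : L2"
 "integ (%x. cor (ph' x))" "(%x. cor (ph' x)) : L2"
 "ft (- 1) (%x. cor (ph' x)) xi = \<i> * cor (xi $ i) * ft (- 1) (%x. cor (ph x)) xi"
proof -
 obtain Q where Q: "compact Q" "!!x. x \<notin> Q ==> ph x = 0" using t unfolding test_function_def by blast
 obtain D :: "(2 => nat) => real^2 => real" where D: "D (%_. 0) = ph"
 "!!al x. (D al has_derivative (%h. \<Sum>i\<in>UNIV. h $ i * D (al(i := Suc (al i))) x)) (at x)"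
 using t unfolding test_function_def by blast
 let ?e = "axis i 1 :: real^2"
 have i12: "i = 1 | i = 2" by (rule exhaust_2)
 have d: "(ph has_derivative (%h. \<Sum>j\<in>UNIV. h $ j * D ((%_. 0)(j := Suc 0)) x)) (at x)" for x
 using D(2)[of "%_. 0" x] D(1) by simp
 have ph': "ph' = D ((%_. 0)(i := Suc 0))"
 proof
 fix x show "ph' x = D ((%_. 0)(i := Suc 0)) x"
 unfolding ph'_def frechet_derivative_at[OF d, symmetric] using i12 by (auto simp: sum_2 axis_def)
 qed
 have cph: "continuous_on S ph" for S
 by (meson continuous_at_imp_continuous_on d has_derivative_continuous)
 have cph': "continuous_on S ph'" for S unfolding ph'
 by (meson continuous_at_imp_continuous_on D(2) has_derivative_continuous)
 have m [measurable]: "ph : bmf" "ph' : bmf"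
 by (intro borel_measurable_continuous_onI cph cph')+
 have line: "((%s. ph (x + s *R ?e)) has_real_derivative ph' (x + s *R ?e)) (at s)" for x s
 proof -
 have g: "((%s. x + s *R ?e) has_derivative (%h. h *R ?e)) (at s)" by (auto intro!: derivative_eq_intros)
 have "((%s. ph (x + s *R ?e)) has_derivative (%h. \<Sum>j\<in>UNIV. (h *R ?e) $ j * D ((%_. 0)(j := Suc 0)) (x + s *R ?e))) (at s)"
 using has_derivative_compose[OF g d] by simp
 moreover have "(%h. \<Sum>j\<in>UNIV. (h *R ?e) $ j * D ((%_. 0)(j := Suc 0)) (x + s *R ?e)) = (*) (ph' (x + s *R ?e))"
 unfolding ph' using i12 by (auto simp: fun_eq_iff sum_2 axis_def)
 ultimately show ?thesis by (simp add: has_field_derivative_def)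
 qed
 obtain R where R: "0 < R" "Q \<subseteq> ball 0 R" using compact_imp_bounded[OF Q(1)] bounded_subset_ballD[of Q 0] by blast
 have z: "ph x = 0" if "R <= norm x" for x using Q(2)[of x] R(2) that by force
 have z': "ph' x = 0" if x: "R < norm x" for x
 proof -
 have o: "open {y::real^2. R < norm y}" by (intro open_Collect_less continuous_intros)
 have "(ph has_derivative (%_. 0)) (at x)"
 by (rule has_derivative_transform_within_open[OF has_derivative_const[of 0] o]) (use x z in auto)
 from frechet_derivative_at[OF this, symmetric] show ?thesis unfolding ph'_def by simp
 qed
 obtain C where C: "!!x. x : cball 0 R ==> \<bar>ph x\<bar> <= C & \<bar>ph' x\<bar> <= C"
 proof -
 have "bounded (ph ` cball 0 R)" "bounded (ph' ` cball 0 R)"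
 by (intro compact_imp_bounded compact_continuous_image cph cph' compact_cball)+
 then obtain C1 C2 where "\<forall>x\<in>cball 0 R. \<bar>ph x\<bar> <= C1" "\<forall>x\<in>cball 0 R. \<bar>ph' x\<bar> <= C2"
 unfolding bounded_iff ball_simps real_norm_def by blast
 then show ?thesis by (intro that[of "max C1 C2"]) (auto simp: le_max_iff_disj)
 qed
 have C0: "0 <= C" using C[of 0] R(1) by force
 have b: "\<bar>ph x\<bar> <= C * ind (cball 0 R) x" "\<bar>ph' x\<bar> <= C * ind (cball 0 R) x" for x
 using C[of x] z[of x] z'[of x] by (auto simp: indicator_def)
 show I: "integ (%x. cor (ph x))" "(%x. cor (ph x)) : L2"
 "integ (%x. cor (ph' x))" "(%x. cor (ph' x)) : L2"
 by (rule bounded_support_integrable[OF m(1) b(1)] bounded_support_integrable[OF m(2) b(2)])+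
 have bC: "\<bar>ph' x\<bar> <= C" for x by (cases "norm x <= R") (use b(2)[of x] C0 in auto)
 define ta :: "nat => real" where "ta = (%n. 1 / real (Suc n))"
 have ta: "0 < ta n" "ta n <= 1" "ta ----> 0" for n
 unfolding ta_def by (simp, simp, rule LIMSEQ_Suc[OF lim_1_over_n])
 have ta_at: "filterlim ta (at 0) sequentially"
 proof (rule filterlim_atI[OF ta(3)], rule always_eventually, rule allI)
 fix n show "ta n ~= 0" using ta(1)[of n] by simp
 qed
 define q where "q n x = (ph (x + ta n *R ?e) - ph x) / ta n" for n x
 have [measurable]: "q n : bmf" for n unfolding q_def[abs_def] by measurable
 have qb: "\<bar>q n x\<bar> <= C * ind (cball 0 (R + 1)) x" for n x
 proof (cases "norm x <= R + 1")
 case True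
 have "\<exists>s. 0 < s & s < ta n & ph (x + ta n *R ?e) - ph (x + 0 *R ?e) = (ta n - 0) * ph' (x + s *R ?e)"
 by (rule MVT2[OF ta(1)]) (rule line)
 then obtain s where "ph (x + ta n *R ?e) - ph x = ta n * ph' (x + s *R ?e)" by auto
 then have "q n x = ph' (x + s *R ?e)" using ta(1)[of n] by (simp add: q_def)
 then show ?thesis using bC True by simp
 next
 case False
 have "norm x <= norm (x + ta n *R ?e) + norm (ta n *R ?e)" using norm_triangle_ineq4[of "x + ta n *R ?e" "ta n *R ?e"] by simp
 then have "R <= norm (x + ta n *R ?e)" using False ta(1,2)[of n] by simp
 then show ?thesis using z[of x] z[of "x + ta n *R ?e"] False by (simp add: q_def)
 qed
 have ql: "(%n. q n x) ----> ph' x" for x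
 proof -
 have "((%h. (ph (x + h *R ?e) - ph x) / h) \<longlongrightarrow> ph' x) (at 0)"
 using line[of x 0] by (simp add: has_field_derivative_iff)
 then show ?thesis unfolding q_def by (rule filterlim_compose[OF _ ta_at])
 qed
 define E where "E x = cis (- 1 * (x \<bullet> xi))" for x
 have [measurable]: "E : bmf" unfolding E_def[abs_def] by measurable
 have lim: "(%n. IN x. E x * cor (q n x)) ----> (IN x. E x * cor (ph' x))"
 proof (rule integral_dominated_convergence[where w="%x. C * ind (cball 0 (R + 1)) x"])
 show "AE x in lborel. (%n. E x * cor (q n x)) ----> E x * cor (ph' x)"
 by (rule AE_I2, rule tendsto_mult[OF tendsto_const tendsto_of_real[OF ql]])
 show "AE x in lborel. norm (E x * cor (q n x)) <= C * ind (cball 0 (R + 1)) x" for n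
 using qb by (simp add: norm_mult E_def)
 have "emeasure lborel (cball (0::real^2) (R + 1)) < \<infinity>" by (rule emeasure_bounded_finite) simp
 then show "integ (%x::real^2. C * ind (cball 0 (R + 1)) x)"
 by (intro integrable_mult_right) (simp add: integrable_indicator_iff)
 qed simp_all
 define P where "P = (IN x. E x * cor (ph x))"
 have val: "(IN x. E x * cor (q n x)) = (cis (ta n * xi $ i) - 1) / cor (ta n) * P" for n
 proof -
 let ?c = "ta n *R ?e"
 have Es: "E (x + - ?c) = cis (ta n * xi $ i) * E x" for x
 by (simp add: E_def cis_mult inner_diff_left inner_axis' algebra_simps)
 have iE: "integ (%x. E x * cor (ph x))" unfolding E_def by (rule ft_integrable[OF I(1)])
 have iE2: "integ (%x. E x * cor (ph (x + ?c)))"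
 proof -
 have "integ (%x. E x * cor (q n x))"
 unfolding E_def using qb by (intro ft_integrable bounded_support_integrable(1)) auto
 then have "integ (%x. cor (ta n) * (E x * cor (q n x)) + E x * cor (ph x))"
 by (intro Bochner_Integration.integrable_add integrable_mult_right iE)
 moreover have "cor (ta n) * (E x * cor (q n x)) + E x * cor (ph x) = E x * cor (ph (x + ?c))" for x
 using ta(1)[of n] by (simp add: q_def field_simps)
 ultimately show ?thesis by simp
 qed
 have "(IN x. E x * cor (q n x)) = (IN x. (E x * cor (ph (x + ?c)) - E x * cor (ph x)) / cor (ta n))"
 by (simp add: q_def right_diff_distrib diff_divide_distrib)
 also have "... = ((IN x. E x * cor (ph (x + ?c))) - P) / cor (ta n)"
 unfolding integral_divide_zero P_def Bochner_Integration.integral_diff[OF iE2 iE] ..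
 also have "(IN x. E x * cor (ph (x + ?c))) = cis (ta n * xi $ i) * P"
 proof -
 have "(IN x. E x * cor (ph (x + ?c))) = (IN x. E (x + - ?c) * cor (ph x))"
 using integral_translate[of "%x. E (x + - ?c) * cor (ph x)" ?c] by simp
 then show ?thesis unfolding Es P_def by (simp add: mult.assoc)
 qed
 finally show ?thesis by (simp add: left_diff_distrib)
 qed
 have "(%n. (cis (ta n * xi $ i) - 1) / cor (ta n)) ----> \<i> * cor (xi $ i)"
 proof -
 let ?A = "\<i> * cor (xi $ i)"
 have "((%t. exp (t *R ?A)) has_vector_derivative exp (0 *R ?A) * ?A) (at 0)"
 by (rule exp_scaleR_has_vector_derivative_right)
 then have "((%t. (exp (t *R ?A) - exp (0 *R ?A)) /\<^sub>R (t - 0)) \<longlongrightarrow> exp (0 *R ?A) * ?A) (at 0)"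
 unfolding has_vector_derivative_iff_quotient .
 then have "(%n. (exp (ta n *R ?A) - exp (0 *R ?A)) /\<^sub>R (ta n - 0)) ----> exp (0 *R ?A) * ?A" by (rule filterlim_compose[OF _ ta_at])
 moreover have "(exp (ta n *R ?A) - exp (0 *R ?A)) /\<^sub>R (ta n - 0) = (cis (ta n * xi $ i) - 1) / cor (ta n)" for n
 by (simp add: cis_conv_exp scaleR_conv_of_real divide_inverse mult_ac)
 ultimately show ?thesis by simp
 qed
 then have "(%n. (cis (ta n * xi $ i) - 1) / cor (ta n) * P) ----> \<i> * cor (xi $ i) * P"
 by (rule tendsto_mult[OF _ tendsto_const])
 then have "(IN x. E x * cor (ph' x)) = \<i> * cor (xi $ i) * P"
 using lim unfolding val by (rule LIMSEQ_unique[rotated])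
 then show "ft (- 1) (%x. cor (ph' x)) xi = \<i> * cor (xi $ i) * ft (- 1) (%x. cor (ph x)) xi"
 by (simp add: ft_def P_def E_def)
qed

lemma ip_Fe_Fe: assumes e: "\<bar>e\<bar> = 1" shows "ip (Fe e u) (Fe e v) = ip u v"
 unfolding ip_Fe[OF e] Fe_inverse[OF e] ..

text \<open>Parseval's identity against the transform of a test function; applying the real form of it to \<open>\<i> f\<close> as well gives the imaginary part.\<close>

lemma weak_partialI:
 assumes f: "f : L2" "integ f" and p: "p : L2" "integ p"
 and r: "AE xi in lborel. ft (- 1) p xi = \<i> * cor (xi $ i) * ft (- 1) f xi"
 shows "weak_partial i f p"
 unfolding weak_partial_def
proof (intro conjI allI impI)
 have l: "loc_integrable g" if "integ g" for g
 unfolding loc_integrable_def set_integrable_def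
 using that by (auto intro!: integrable_mult_indicator borel_compact)
 show "loc_integrable f" "loc_integrable p" by (rule l[OF f(2)], rule l[OF p(2)])
 fix ph assume t: "test_function ph"
 note T = ft_test_function(1,2)[OF t] ft_test_function(3-5)[OF t, where i=i]
 define ph' where "ph' x = frechet_derivative ph (at x) (axis i 1)" for x
 note T = T[folded ph'_def]
 have e: "\<bar>- 1 :: real\<bar> = 1" by simp
 have core: "Re (IN x. cor (ph' x) * g x) = - Re (IN x. cor (ph x) * h x)"
 if g: "g : L2" "integ g" and h: "h : L2" "integ h"
 and gh: "AE xi in lborel. ft (- 1) h xi = \<i> * cor (xi $ i) * ft (- 1) g xi" for g h
 proof -
 note [measurable] = L2_borel[OF g(1)] L2_borel[OF h(1)] L2_borel[OF T(2)] L2_borel[OF T(4)]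
 have par: "Re (IN x. cor (ps x) * k x) = Re (IN xi. ft (- 1) k xi * cnj (ft (- 1) (%x. cor (ps x)) xi))"
 if k: "k : L2" "integ k" and ps: "(%x. cor (ps x)) : L2" "integ (%x. cor (ps x))" for k ps
 proof -
 have "Re (IN x. cor (ps x) * k x) = ip (cls k) (cls (%x. cor (ps x)))"
 unfolding ip_cls[OF k(1) ps(1)] by (simp add: mult.commute)
 also have "... = ip (Fe (- 1) (cls k)) (Fe (- 1) (cls (%x. cor (ps x))))" by (rule ip_Fe_Fe[OF e, symmetric])
 also have "... = Re (IN xi. ft (- 1) k xi * cnj (ft (- 1) (%x. cor (ps x)) xi))"
 unfolding Fe_cls[OF e k] Fe_cls[OF e ps] by (rule ip_cls[OF ft_L2[OF e k] ft_L2[OF e ps]])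
 finally show ?thesis .
 qed
 have "(IN xi. ft (- 1) g xi * cnj (ft (- 1) (%x. cor (ph' x)) xi)) = (IN xi. - (ft (- 1) h xi * cnj (ft (- 1) (%x. cor (ph x)) xi)))"
 proof (rule integral_cong_AE)
 show "AE xi in lborel. ft (- 1) g xi * cnj (ft (- 1) (%x. cor (ph' x)) xi) = - (ft (- 1) h xi * cnj (ft (- 1) (%x. cor (ph x)) xi))"
 using gh by eventually_elim (simp add: T(5))
 show "(%xi. ft (- 1) g xi * cnj (ft (- 1) (%x. cor (ph' x)) xi)) : borel_measurable lborel" by measurable
 show "(%xi. - (ft (- 1) h xi * cnj (ft (- 1) (%x. cor (ph x)) xi))) : borel_measurable lborel" by measurable
 qed
 then show ?thesis unfolding par[OF g T(4,3)] par[OF h T(2,1)] by simp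
 qed
 have "AE xi in lborel. ft (- 1) (%x. \<i> * p x) xi = \<i> * cor (xi $ i) * ft (- 1) (%x. \<i> * f x) xi"
 using r by eventually_elim (simp add: ft_scale)
 then have "Re (IN x. cor (ph' x) * (\<i> * f x)) = - Re (IN x. cor (ph x) * (\<i> * p x))"
 by (intro core L2_scale integrable_mult_right f p)
 then have "Im (IN x. cor (ph' x) * f x) = - Im (IN x. cor (ph x) * p x)"
 unfolding mult.left_commute[of _ \<i>] integral_mult_right_zero by simp
 with core[OF f p r] show "(IN x. of_real (frechet_derivative ph (at x) (axis i 1)) * f x) = - (IN x. of_real (ph x) * p x)"
 unfolding ph'_def by (simp add: complex_eq_iff)
qed

text \<open>The fourth corner of a rectangle is a signed sum of the other three, which gives the product rule.\<close>

lemma CR_op_frequency: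
 assumes a: "CR_converges a b c xi" and c: "CR_converges (%x. \<i> * cor (x $ i) * a x) b c xi"
 "CR_converges a (%x. \<i> * cor (x $ i) * b x) c xi" "CR_converges a b (%x. \<i> * cor (x $ i) * c x) xi"
 shows "CR_op (%x. \<i> * cor (x $ i) * a x) b c xi + CR_op a (%x. \<i> * cor (x $ i) * b x) c xi
 + CR_op a b (%x. \<i> * cor (x $ i) * c x) xi = \<i> * cor (xi $ i) * CR_op a b c xi"
proof -
 have k: "CR_kernel (%x. \<i> * cor (x $ i) * a x) b c xi z + CR_kernel a (%x. \<i> * cor (x $ i) * b x) c xi z
 + CR_kernel a b (%x. \<i> * cor (x $ i) * c x) xi z = \<i> * cor (xi $ i) * CR_kernel a b c xi z" for z
 unfolding CR_kernel_def by (simp split: split_indicator) (simp add: algebra_simps)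
 show ?thesis
 unfolding CR_op_kernel[OF a] CR_op_kernel[OF c(1)] CR_op_kernel[OF c(2)] CR_op_kernel[OF c(3)]
 integral_mult_right_zero[symmetric] k[symmetric]
 using c unfolding CR_converges_def by simp
qed

lemma FT_ft: "f : L2 ==> integ f ==> AE xi in lborel. FT f xi = ft (- 1) f xi"
 by (intro FT_AE ft_L2) (simp_all add: Fe_cls)

lemma ft_CR_op:
 assumes f: "f : L2" "integ f" and g: "g : L2" "integ g" and h: "h : L2" "integ h"
 and T: "integ (CR_op f g h)"
 shows "AE xi in lborel. ft (- 1) (CR_op f g h) xi = CR_op (ft (- 1) f) (ft (- 1) g) (ft (- 1) h) xi"
proof -
 have e: "\<bar>- 1 :: real\<bar> = 1" by simp
 have "CR_op (FT f) (FT g) (FT h) = CR_op (ft (- 1) f) (ft (- 1) g) (ft (- 1) h)"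
 by (rule CR_op_cong_AE) (intro L2_borel FT_L2 ft_L2 e f g h FT_ft)+
 with FT_CR_op[OF f(1) g(1) h(1)] FT_ft[OF L2.CR_in[OF f(1) g(1) h(1)] T] show ?thesis
 by (auto elim: eventually_elim2)
qed

lemma CR_op_product_rule:
 fixes i :: 2
 assumes f: "f : L2" "integ f" "p : L2" "integ p" "AE xi in lborel. ft (- 1) p xi = \<i> * cor (xi $ i) * ft (- 1) f xi"
 and g: "g : L2" "integ g" "q : L2" "integ q" "AE xi in lborel. ft (- 1) q xi = \<i> * cor (xi $ i) * ft (- 1) g xi"
 and h: "h : L2" "integ h" "r : L2" "integ r" "AE xi in lborel. ft (- 1) r xi = \<i> * cor (xi $ i) * ft (- 1) h xi"
 and T: "integ (CR_op f g h)" "integ (CR_op p g h)" "integ (CR_op f q h)" "integ (CR_op f g r)"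
 shows "AE xi in lborel. ft (- 1) (%x. CR_op p g h x + CR_op f q h x + CR_op f g r x) xi = \<i> * cor (xi $ i) * ft (- 1) (CR_op f g h) xi"
proof -
 have e: "\<bar>- 1 :: real\<bar> = 1" by simp
 define m where "m k = (%x. \<i> * cor (x $ i) * k x)" for k :: plane_fun
 have mi: "m (ft (- 1) k) : L2 & (AE xi in lborel. ft (- 1) k' xi = m (ft (- 1) k) xi)"
 if k: "k : L2" "integ k" "k' : L2" "integ k'" and kk: "AE xi in lborel. ft (- 1) k' xi = \<i> * cor (xi $ i) * ft (- 1) k xi" for k k'
 proof
 note [measurable] = L2_borel[OF ft_L2[OF e k(1,2)]]
 have "m (ft (- 1) k) : bmf" unfolding m_def by measurable
 then show "m (ft (- 1) k) : L2" by (rule L2_cong[OF ft_L2[OF e k(3,4)]]) (use kk in \<open>simp add: m_def\<close>)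
 show "AE xi in lborel. ft (- 1) k' xi = m (ft (- 1) k) xi" using kk by (simp add: m_def)
 qed
 let ?a = "ft (- 1) f" and ?b = "ft (- 1) g" and ?c = "ft (- 1) h"
 have a: "?a : L2" and b: "?b : L2" and c: "?c : L2" and a': "ft (- 1) p : L2" and b': "ft (- 1) q : L2" and c': "ft (- 1) r : L2"
 by (intro ft_L2 e f g h)+
 note ma = mi[OF f] and mb = mi[OF g] and mc = mi[OF h]
 have 1: "CR_op (ft (- 1) p) ?b ?c = CR_op (m ?a) ?b ?c"
 by (rule CR_op_cong_AE) (use a b c a' ma in \<open>auto intro: L2_borel\<close>)
 have 2: "CR_op ?a (ft (- 1) q) ?c = CR_op ?a (m ?b) ?c"
 by (rule CR_op_cong_AE) (use a b c b' mb in \<open>auto intro: L2_borel\<close>)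
 have 3: "CR_op ?a ?b (ft (- 1) r) = CR_op ?a ?b (m ?c)"
 by (rule CR_op_cong_AE) (use a b c c' mc in \<open>auto intro: L2_borel\<close>)
 have s: "ft (- 1) (%x. CR_op p g h x + CR_op f q h x + CR_op f g r x) = (%xi. ft (- 1) (CR_op p g h) xi + ft (- 1) (CR_op f q h) xi + ft (- 1) (CR_op f g r) xi)"
 using T by (simp add: ft_add)
 have conv: "AE xi in lborel. CR_converges ?a ?b ?c xi" "AE xi in lborel. CR_converges (m ?a) ?b ?c xi"
 "AE xi in lborel. CR_converges ?a (m ?b) ?c xi" "AE xi in lborel. CR_converges ?a ?b (m ?c) xi"
 using ma mb mc by (intro CR_converges_L2 a b c; simp)+
 show ?thesis
 using ft_CR_op[OF f(1,2) g(1,2) h(1,2) T(1)] ft_CR_op[OF f(3,4) g(1,2) h(1,2) T(2)] ft_CR_op[OF f(1,2) g(3,4) h(1,2) T(3)] ft_CR_op[OF f(1,2) g(1,2) h(3,4) T(4)] conv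
 proof eventually_elim
 case (elim xi)
 show ?case
 unfolding s elim(1-4) 1 2 3 using CR_op_frequency[OF elim(5) elim(6-8)[unfolded m_def]] by (simp only: m_def)
 qed
qed

section \<open>The linearised equation\<close>

context bounded_trilinear
begin

definition tangent :: "'a \<times> 'a => 'a \<times> 'a => 'a \<times> 'a => 'a \<times> 'a" where
 "tangent z z' z'' = (F (fst z) (fst z') (fst z''),
 F (snd z) (fst z') (fst z'') + F (fst z) (snd z') (fst z'') + F (fst z) (fst z') (snd z''))"

lemma norm_fst_le': "norm (fst z) <= norm z" and norm_snd_le': "norm (snd z) <= norm z"
 using norm_fst_le[of "fst z" "snd z"] norm_snd_le[of "snd z" "fst z"] by simp_all

lemma bounded_trilinear_tangent: "bounded_trilinear tangent"
proof
 have "norm (tangent z z' z'') <= 4 * K * norm z * norm z' * norm z''" for z z' z''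
 proof -
 have b: "norm (F a b c) <= K * norm z * norm z' * norm z''" if "norm a <= norm z" "norm b <= norm z'" "norm c <= norm z''" for a b c
 by (rule order_trans[OF norm_le]) (intro mult_mono that mult_nonneg_nonneg K_nonneg norm_ge_zero order_refl)
 have "norm (tangent z z' z'') <= norm (fst (tangent z z' z'')) + norm (snd (tangent z z' z''))"
 using norm_Pair_le[of "fst (tangent z z' z'')" "snd (tangent z z' z'')"] by simp
 also have "... <= norm (F (fst z) (fst z') (fst z'')) + (norm (F (snd z) (fst z') (fst z'')) + norm (F (fst z) (snd z') (fst z'')) + norm (F (fst z) (fst z') (snd z'')))"
 unfolding tangent_def fst_conv snd_conv by (intro add_left_mono order_trans[OF norm_triangle_ineq] add_right_mono norm_triangle_ineq)
 also have "... <= K * norm z * norm z' * norm z'' + (K * norm z * norm z' * norm z'' + K * norm z * norm z' * norm z'' + K * norm z * norm z' * norm z'')"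
 by (intro add_mono b norm_fst_le' norm_snd_le')
 finally show ?thesis by (simp add: algebra_simps)
 qed
 then show "\<exists>C. \<forall>z z' z''. norm (tangent z z' z'') <= C * norm z * norm z' * norm z''" by blast
qed (auto simp: tangent_def add1 add2 add3 scale1 scale2 scale3 scaleR_add_right)

text \<open>The second component solves a linear equation whose coefficients the first one controls.\<close>

lemma a_priori_tangent:
 assumes ap: "a_priori_bounded F" shows "a_priori_bounded tangent"
 unfolding a_priori_bounded_def
proof (intro allI)
 interpret T: bounded_trilinear tangent by (rule bounded_trilinear_tangent)
 fix R T :: real
 obtain B where B: "!!v ta t. 0 <= ta ==> ta <= T ==> cubic_sol F {0..ta} v ==> norm (v 0) <= R ==> t : {0..ta} ==> norm (v t) <= B"
 using ap unfolding a_priori_bounded_def by meson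
 define C where "C = 4 * K * (max B 0)^2"
 have C: "0 <= C" using K_nonneg by (simp add: C_def)
 show "\<exists>B. \<forall>u ta. 0 <= ta --> ta <= T --> cubic_sol tangent {0..ta} u --> norm (u 0) <= R --> (\<forall>t\<in>{0..ta}. norm (u t) <= B)"
 proof (rule exI[of _ "exp (exp (C * T) * (1 + ln (1 + R)))"], intro allI impI ballI)
 fix u ta t assume h: "0 <= ta" "ta <= T" "cubic_sol tangent {0..ta} u" "norm (u 0) <= R" "t : {0..ta}"
 have f: "cubic_sol F {0..ta} (%t. fst (u t))"
 unfolding cubic_sol_def
 proof
 fix s assume "s : {0..ta}"
 from bounded_linear.has_vector_derivative[OF bounded_linear_fst cubic_solD[OF h(3) this]]
 show "((%t. fst (u t)) has_vector_derivative F (fst (u s)) (fst (u s)) (fst (u s))) (at s within {0..ta})"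
 by (simp add: tangent_def)
 qed
 have f0: "norm (fst (u 0)) <= R" using norm_fst_le'[of "u 0"] h(4) by linarith
 have "norm (u t) <= exp (exp (C * ta) * (1 + ln (1 + norm (u 0))))"
 proof (rule T.cubic_sol_log_growth[OF h(3) C _ h(5)])
 fix s assume s: "s : {0..ta}"
 let ?x = "fst (u s)" and ?y = "snd (u s)"
 have b: "norm ?x <= max B 0" using B[OF h(1,2) f f0 s] by simp
 have n: "norm (F a b c) <= K * (max B 0)^2 * norm (u s)"
 if "norm a * norm b * norm c <= (max B 0)^2 * norm (u s)" for a b c
 using order_trans[OF norm_le[of a b c]] mult_left_mono[OF that K_nonneg] by (simp add: mult.assoc)
 have sq: "norm ?x * norm ?x <= (max B 0)^2" unfolding power2_eq_square by (intro mult_mono b) auto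
 have p: "norm ?x * norm ?x * norm w <= (max B 0)^2 * norm (u s)" if "norm w <= norm (u s)" for w :: 'a
 by (intro mult_mono sq that) auto
 have 1: "norm (F ?x ?x ?x) <= K * (max B 0)^2 * norm (u s)" by (rule n) (use p[OF norm_fst_le'] in simp)
 have 2: "norm (F ?y ?x ?x) <= K * (max B 0)^2 * norm (u s)" "norm (F ?x ?y ?x) <= K * (max B 0)^2 * norm (u s)"
 "norm (F ?x ?x ?y) <= K * (max B 0)^2 * norm (u s)"
 by (rule n, use p[OF norm_snd_le'] in \<open>simp add: mult_ac\<close>)+
 have "norm (tangent (u s) (u s) (u s)) <= norm (F ?x ?x ?x) + norm (F ?y ?x ?x + F ?x ?y ?x + F ?x ?x ?y)"
 unfolding tangent_def by (rule norm_Pair_le)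
 also have "... <= norm (F ?x ?x ?x) + (norm (F ?y ?x ?x) + norm (F ?x ?y ?x) + norm (F ?x ?x ?y))"
 by (intro add_left_mono order_trans[OF norm_triangle_ineq] add_right_mono norm_triangle_ineq)
 also have "... <= C * norm (u s)" using 1 2 unfolding C_def by linarith
 also have "... <= C * ((1 + norm (u s)) * (1 + ln (1 + norm (u s))))"
 proof (rule mult_left_mono[OF _ C])
 have "0 <= ln (1 + norm (u s))" by simp
 then have "0 <= (1 + norm (u s)) * ln (1 + norm (u s))" by (intro mult_nonneg_nonneg) auto
 then show "norm (u s) <= (1 + norm (u s)) * (1 + ln (1 + norm (u s)))" by (simp add: distrib_left)
 qed
 finally show "norm (tangent (u s) (u s) (u s)) <= C * (1 + norm (u s)) * (1 + ln (1 + norm (u s)))" by (simp only: mult.assoc)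
 qed
 also have "... <= exp (exp (C * T) * (1 + ln (1 + R)))"
 proof -
 have "ln (1 + norm (u 0)) <= ln (1 + R)" using h(4) norm_ge_zero[of "u 0"] by (subst ln_le_cancel_iff) linarith+
 then show ?thesis using h(2) C by (simp, intro mult_mono) (auto intro: mult_left_mono)
 qed
 finally show "norm (u t) <= exp (exp (C * T) * (1 + ln (1 + R)))" .
 qed
qed

lemma tangent_flow:
 assumes ap: "a_priori_bounded F" "a_priori_bounded (%u v w. - F u v w)"
 and W: "closed W" "subspace W" "!!z. z : W ==> tangent z z z : W" and z0: "(U 0, q0) : W"
 and U: "cubic_sol F UNIV U"
 shows "\<exists>q. continuous_on UNIV q & (\<forall>t. (U t, q t) : W)"
proof -
 interpret T: bounded_trilinear tangent by (rule bounded_trilinear_tangent)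
 interpret m: bounded_trilinear "%u v w. - F u v w" by (rule uminus)
 have "m.tangent = (%u v w. - tangent u v w)" by (simp add: fun_eq_iff m.tangent_def tangent_def)
 then have apm: "a_priori_bounded (%u v w. - tangent u v w)" using m.a_priori_tangent[OF ap(2)] by simp
 obtain z where z: "cubic_sol tangent UNIV z" "z 0 = (U 0, q0)" "!!t. z t : W"
 using T.global_solution_in[OF a_priori_tangent[OF ap(1)] apm W z0] by blast
 have f: "cubic_sol F UNIV (%t. fst (z t))"
 unfolding cubic_sol_def
 proof
 fix s
 from bounded_linear.has_vector_derivative[OF bounded_linear_fst cubic_solD[OF z(1) UNIV_I]]
 show "((%t. fst (z t)) has_vector_derivative F (fst (z s)) (fst (z s)) (fst (z s))) (at s within UNIV)"
 by (simp add: tangent_def)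
 qed
 have eq: "fst (z t) = U t" for t
 by (rule cubic_sol_unique[OF cubic_sol_subset[OF f subset_UNIV] cubic_sol_subset[OF U subset_UNIV], of "- \<bar>t\<bar>" "\<bar>t\<bar>"])
 (use z(2) in auto)
 have "(U t, snd (z t)) : W" for t using z(3)[of t] eq[of t] by (metis prod.collapse)
 moreover have "continuous_on UNIV (%t. snd (z t))" by (intro continuous_intros cubic_sol_continuous[OF z(1)])
 ultimately show ?thesis by blast
qed

end

section \<open>Gradients\<close>

text \<open>The relation between the transforms of a function and of its derivative is closed because the transform at a point is a bounded functional. The tangent flow preserves it, and its first component is the flow.\<close>

lemma X_gradient_flow:
 assumes sg: "2 < sg" and g0: "g0 : fun_space (X_norm sg)" and p: "weak_gradient g0 p" "!!i. p i : fun_space (X_norm sg)"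
 shows "\<exists>g. CR_solution (X_norm sg) UNIV g0 g & cont_curve (X_norm sg) UNIV g \<and>
 (\<exists>q. (\<forall>t. weak_gradient (g t) (q t)) & (\<forall>i. cont_curve (X_norm sg) UNIV (%t. q t i)))"
proof -
 interpret X: CR_space "X_norm sg" "xcls sg" by (rule CR_space_X[OF sg])
 have ap: "a_priori_bounded X.F" "a_priori_bounded (%u v w. - X.F u v w)"
 using a_priori_X[OF sg, of 1] a_priori_X[OF sg, of "- 1"] by simp_all
 obtain U where U: "cubic_sol X.F UNIV U" "U 0 = xcls sg g0"
 using X.global_solution_in[OF ap, of UNIV "xcls sg g0"] by auto
 note int = X_integrable[OF sg] and l2 = X_in_L2[OF sg]
 define L where "L xi u = ft (- 1) (X.lift u) xi" for xi u
 have LJ: "L xi (xcls sg f) = ft (- 1) f xi" if f: "f : fun_space (X_norm sg)" for f xi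
 proof -
 have "AE x in lborel. X.lift (xcls sg f) x = f x" using X.J_eq[OF X.lift_in f, of "xcls sg f"] by simp
 then show ?thesis unfolding L_def using ft_cong_AE[of "X.lift (xcls sg f)" f "- 1"] fun_spaceD(1)[OF f] fun_spaceD(1)[OF X.lift_in] by simp
 qed
 have bl: "bounded_linear (L xi)" for xi
 proof -
 obtain c where c: "0 <= c" "!!f. f : bmf ==> L2w_norm (sg / 2) f <= en c * X_norm sg f & L2_norm f <= L2w_norm (sg / 2) f
 & (NN x. eabs f x) <= en c * L2w_norm (sg / 2) f" using X_norm_bounds[OF sg] by blast
 show ?thesis
 proof (rule bounded_linear_intro)
 fix u v :: "essentially_bounded fsp" and r :: real
 show "L xi (u + v) = L xi u + L xi v"
 using LJ[OF X.add_in[OF X.lift_in[of u] X.lift_in[of v]], of xi] X.J_add[OF X.lift_in[of u] X.lift_in[of v]]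
 by (simp add: L_def ft_add int)
 show "L xi (r *R u) = r *R L xi u"
 using LJ[OF X.scale_in[OF X.lift_in[of u]], of xi "cor r"] X.J_scale[OF X.lift_in[of u], of r]
 by (simp add: L_def ft_scale scaleR_conv_of_real)
 let ?f = "X.lift u"
 have b: "(NN x. eabs ?f x) <= en c * (en c * X_norm sg ?f)"
 using c(2)[OF fun_spaceD(1)[OF X.lift_in[of u]]] by (meson order_trans mult_left_mono zero_le)
 have "en (IN x. cmod (?f x)) = (NN x. eabs ?f x)"
 unfolding eabs_def by (rule nn_integral_eq_integral[symmetric]) (simp_all add: int)
 also have "... <= en (c * (c * norm u))"
 using b X.J_norm[OF X.lift_in[of u]] c(1) by (simp add: ennreal_mult)
 finally have "(IN x. cmod (?f x)) <= c * (c * norm u)" using c(1) by (subst (asm) ennreal_le_iff) auto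
 then have "(IN x. cmod (?f x)) / (2 * pi) <= c * (c * norm u) / (2 * pi)" by (intro divide_right_mono) auto
 then show "norm (L xi u) <= norm u * (c * c / (2 * pi))"
 using norm_ft_le[OF int[OF X.lift_in[of u]], of "- 1" xi] by (simp add: L_def mult_ac)
 qed
 qed
 have flow: "\<exists>q. continuous_on UNIV q & (\<forall>t. weak_partial i (X.lift (U t)) (X.lift (q t)))" for i
 proof -
 define W where "W = {z. AE xi in lborel. L xi (snd z) = \<i> * cor (xi $ i) * L xi (fst z)}"
 have W1: "closed W"
 unfolding closed_sequential_limits
 proof (intro allI impI, elim conjE)
 fix x l assume x: "\<forall>n. x n : W" and l: "x ----> l"
 have "AE xi in lborel. \<forall>n. L xi (snd (x n)) = \<i> * cor (xi $ i) * L xi (fst (x n))"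
 using x by (subst AE_all_countable) (simp add: W_def)
 then have "AE xi in lborel. L xi (snd l) = \<i> * cor (xi $ i) * L xi (fst l)"
 proof eventually_elim
 fix xi assume h: "\<forall>n. L xi (snd (x n)) = \<i> * cor (xi $ i) * L xi (fst (x n))"
 have 1: "(%n. L xi (snd (x n))) ----> L xi (snd l)" by (rule bounded_linear.tendsto[OF bl tendsto_snd[OF l]])
 have 2: "(%n. \<i> * cor (xi $ i) * L xi (fst (x n))) ----> \<i> * cor (xi $ i) * L xi (fst l)"
 by (rule tendsto_mult[OF tendsto_const bounded_linear.tendsto[OF bl tendsto_fst[OF l]]])
 show "L xi (snd l) = \<i> * cor (xi $ i) * L xi (fst l)" by (rule LIMSEQ_unique[OF 1]) (simp only: h 2)
 qed
 then show "l : W" by (simp add: W_def)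
 qed
 have lin: "L xi 0 = 0" "L xi (u + v) = L xi u + L xi v" "L xi (r *R u) = r *R L xi u" for xi u v r
 using bounded_linear.linear[OF bl[of xi]] by (auto simp: linear_0 linear_add linear_scale)
 have W2: "subspace W"
 unfolding subspace_def
 proof (intro conjI ballI allI)
 show "0 : W" by (simp add: W_def lin)
 show "x + y : W" if x: "x : W" and y: "y : W" for x y
 proof -
 have "AE xi in lborel. L xi (snd (x + y)) = \<i> * cor (xi $ i) * L xi (fst (x + y))"
 using x[unfolded W_def mem_Collect_eq] y[unfolded W_def mem_Collect_eq]
 by eventually_elim (simp add: lin distrib_left)
 then show ?thesis by (simp add: W_def)
 qed
 show "r *R x : W" if x: "x : W" for r x
 proof -
 have "AE xi in lborel. L xi (snd (r *R x)) = \<i> * cor (xi $ i) * L xi (fst (r *R x))"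
 using x[unfolded W_def mem_Collect_eq] by eventually_elim (simp add: lin)
 then show ?thesis by (simp add: W_def)
 qed
 qed
 have W3: "X.tangent z z z : W" if z: "z : W" for z
 proof -
 let ?f = "X.lift (fst z)" and ?k = "X.lift (snd z)"
 have f: "?f : fun_space (X_norm sg)" and k: "?k : fun_space (X_norm sg)" by simp_all
 have r: "AE xi in lborel. ft (- 1) ?k xi = \<i> * cor (xi $ i) * ft (- 1) ?f xi" using z by (simp add: W_def L_def)
 note T = X.CR_in[OF f f f] X.CR_in[OF k f f] X.CR_in[OF f k f] X.CR_in[OF f f k]
 have FJ: "X.F (xcls sg a) (xcls sg b) (xcls sg c) = xcls sg (%x. \<i> * CR_op a b c x)"
 if "a : fun_space (X_norm sg)" "b : fun_space (X_norm sg)" "c : fun_space (X_norm sg)" for a b c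
 using X.CR_op_J[OF that] X.times_i_J[OF X.CR_in[OF that]] by simp
 have 1: "fst (X.tangent z z z) = xcls sg (%x. \<i> * CR_op ?f ?f ?f x)"
 using FJ[OF f f f] by (simp add: X.tangent_def)
 have 2: "snd (X.tangent z z z) = xcls sg (%x. \<i> * CR_op ?k ?f ?f x) + xcls sg (%x. \<i> * CR_op ?f ?k ?f x) + xcls sg (%x. \<i> * CR_op ?f ?f ?k x)"
 using FJ[OF k f f] FJ[OF f k f] FJ[OF f f k] by (simp add: X.tangent_def)
 have "AE xi in lborel. ft (- 1) (%x. CR_op ?k ?f ?f x + CR_op ?f ?k ?f x + CR_op ?f ?f ?k x) xi = \<i> * cor (xi $ i) * ft (- 1) (CR_op ?f ?f ?f) xi"
 by (rule CR_op_product_rule) (intro l2 int f k r T)+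
 then have "AE xi in lborel. L xi (snd (X.tangent z z z)) = \<i> * cor (xi $ i) * L xi (fst (X.tangent z z z))"
 proof eventually_elim
 fix xi assume h: "ft (- 1) (%x. CR_op ?k ?f ?f x + CR_op ?f ?k ?f x + CR_op ?f ?f ?k x) xi = \<i> * cor (xi $ i) * ft (- 1) (CR_op ?f ?f ?f) xi"
 have "L xi (snd (X.tangent z z z)) = \<i> * (ft (- 1) (CR_op ?k ?f ?f) xi + ft (- 1) (CR_op ?f ?k ?f) xi + ft (- 1) (CR_op ?f ?f ?k) xi)"
 unfolding 2 lin LJ[OF X.scale_in[OF T(2)]] LJ[OF X.scale_in[OF T(3)]] LJ[OF X.scale_in[OF T(4)]] ft_scale by (simp add: distrib_left)
 also have "... = \<i> * ft (- 1) (%x. CR_op ?k ?f ?f x + CR_op ?f ?k ?f x + CR_op ?f ?f ?k x) xi"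
 using int[OF T(2)] int[OF T(3)] int[OF T(4)] by (simp add: ft_add)
 also have "... = \<i> * cor (xi $ i) * L xi (fst (X.tangent z z z))"
 unfolding h 1 LJ[OF X.scale_in[OF T(1)]] ft_scale by (simp only: mult_ac)
 finally show "L xi (snd (X.tangent z z z)) = \<i> * cor (xi $ i) * L xi (fst (X.tangent z z z))" .
 qed
 then show ?thesis by (simp add: W_def)
 qed
 have W0: "(U 0, xcls sg (p i)) : W"
 using ft_weak_partial[OF _ int[OF g0] int[OF p(2)[of i]]] p(1) by (simp add: W_def U(2) LJ[OF g0] LJ[OF p(2)] weak_gradient_def)
 obtain q where q: "continuous_on UNIV q" "!!t. (U t, q t) : W" using X.tangent_flow[OF ap W1 W2 W3 W0 U(1)] by blast
 have "weak_partial i (X.lift (U t)) (X.lift (q t))" for t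
 by (rule weak_partialI) (use q(2)[of t] in \<open>simp_all add: l2 int W_def L_def\<close>)
 then show ?thesis using q(1) by blast
 qed
 then have "\<exists>Q. \<forall>i. continuous_on UNIV (Q i) & (\<forall>t. weak_partial i (X.lift (U t)) (X.lift (Q i t)))" by (intro choice allI)
 then obtain Q where Q: "!!i. continuous_on UNIV (Q i)" "!!i t. weak_partial i (X.lift (U t)) (X.lift (Q i t))" by blast
 have c: "cont_curve (X_norm sg) UNIV (%t. X.lift (V t))" if "continuous_on UNIV V" for V
 by (rule X.cont_curveI) (use that in simp_all)
 show ?thesis
 proof (rule exI[of _ "%t. X.lift (U t)"], intro conjI)
 show "CR_solution (X_norm sg) UNIV g0 (%t. X.lift (U t))" by (rule X.CR_solution_lift[OF U(1) _ g0 U(2)]) simp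
 show "cont_curve (X_norm sg) UNIV (%t. X.lift (U t))" by (rule c[OF cubic_sol_continuous[OF U(1)]])
 show "\<exists>q. (\<forall>t. weak_gradient (X.lift (U t)) (q t)) & (\<forall>i. cont_curve (X_norm sg) UNIV (%t. q t i))"
 by (rule exI[of _ "%t i. X.lift (Q i t)"]) (use Q c in \<open>simp add: weak_gradient_def\<close>)
 qed
qed

lemma globally_well_posed_X: assumes sg: "2 < sg" shows "CR_globally_well_posed (X_norm sg)"
proof -
 interpret CR_space "X_norm sg" "xcls sg" by (rule CR_space_X[OF sg])
 show ?thesis by (rule globally_well_posed'[OF a_priori_X[OF sg]])
qed

theorem theorem2p8:
  shows
    "(CR_locally_well_posed Xdot1_norm \<and> CR_globally_well_posed L2_norm) \<and>
     (\<forall>s::real. 0 \<le> s \<longrightarrow>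
        CR_globally_well_posed (H_norm s) \<and> CR_globally_well_posed (L2w_norm s)) \<and>
     (\<forall>\<sigma>::real. 2 < \<sigma> \<longrightarrow>
        CR_globally_well_posed (X_norm \<sigma>) \<and>
        (\<forall>g0\<in>fun_space (X_norm \<sigma>).
           (\<exists>p. weak_gradient g0 p \<and> (\<forall>i. p i \<in> fun_space (X_norm \<sigma>))) \<longrightarrow>
           (\<exists>g. CR_solution (X_norm \<sigma>) UNIV g0 g \<and>
                cont_curve (X_norm \<sigma>) UNIV g \<and>
                (\<exists>q. (\<forall>t. weak_gradient (g t) (q t)) \<and>
                     (\<forall>i. cont_curve (X_norm \<sigma>) UNIV (\<lambda>t. q t i))))))"
proof (intro conjI allI impI ballI)
  show "CR_locally_well_posed Xdot1_norm" by (rule locally_well_posed_Xdot1)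
  show "CR_globally_well_posed L2_norm" by (rule L2.globally_well_posed'[OF a_priori_L2])
  fix s :: real assume "0 \<le> s"
  then show "CR_globally_well_posed (H_norm s)" "CR_globally_well_posed (L2w_norm s)"
    by (rule globally_well_posed_H, rule globally_well_posed_L2w)
next
  fix \<sigma> :: real assume \<sigma>: "2 < \<sigma>"
  show "CR_globally_well_posed (X_norm \<sigma>)" by (rule globally_well_posed_X[OF \<sigma>])
  fix g0 assume g0: "g0 \<in> fun_space (X_norm \<sigma>)" and "\<exists>p. weak_gradient g0 p \<and> (\<forall>i. p i \<in> fun_space (X_norm \<sigma>))"
  then obtain p where "weak_gradient g0 p" "\<And>i. p i \<in> fun_space (X_norm \<sigma>)" by blast
  then show "\<exists>g. CR_solution (X_norm \<sigma>) UNIV g0 g \<and> cont_curve (X_norm \<sigma>) UNIV g \<and>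
    (\<exists>q. (\<forall>t. weak_gradient (g t) (q t)) \<and> (\<forall>i. cont_curve (X_norm \<sigma>) UNIV (\<lambda>t. q t i)))"
    by (rule X_gradient_flow[OF \<sigma> g0])
qed


end
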